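(* Let $0<\alpha<1$ and let $\lambda\in\mathbb{R}$ be a constant. For every $a\in\mathbb{R}$ and $f\in{}^{-\alpha}H(0,T)$ there exists a unique solution $u$, $u-a\in L^2(0,T)$, to $$\partial_t^\alpha(u-a)=-\lambda u+f\quad\text{in }{}^{-\alpha}H(0,T),\qquad u-a\in L^2(0,T).$$ Moreover there is a constant $C>0$ such that $$\|u-a\|_{L^2(0,T)}\le C\big(|a|+\|f\|_{{}^{-\alpha}H(0,T)}\big)$$ for all $a\in\mathbb{R}$ and $f\in{}^{-\alpha}H(0,T)$.
   Context: Let $T>0$; the constant function with value $a$ is denoted by $a$. For $0<\alpha<1$, $H^\alpha(0,T)$ is the Sobolev–Slobodeckij space with norm $\|v\|_{H^\alpha(0,T)}=\big(\|v\|_{L^2}^2+\int_0^T\int_0^T\frac{|v(t)-v(s)|^2}{|t-s|^{1+2\alpha}}dtds\big)^{1/2}$. The space ${}^{\alpha}H(0,T)$ is: $H^\alpha(0,T)$ if $\alpha<\frac12$; $\{v\in H^{1/2}(0,T):\int_0^T\frac{|v(t)|^2}{T-t}dt<\infty\}$ if $\alpha=\frac12$; $\{v\in H^\alpha(0,T):v(T)=0\}$ if $\alpha>\frac12$. Its norm is that of $H^\alpha(0,T)$, except for $\alpha=\frac12$ where it is $(\|v\|_{H^{1/2}}^2+\int_0^T\frac{|v(t)|^2}{T-t}dt)^{1/2}$. ${}^{-\alpha}H(0,T):=({}^{\alpha}H(0,T))'$ is its dual, with $L^2(0,T)$ identified with its own dual, so that ${}^{\alpha}H(0,T)\subset L^2(0,T)\subset{}^{-\alpha}H(0,T)$.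 Let $(J_\alpha v)(t)=\frac1{\Gamma(\alpha)}\int_t^T(\xi-t)^{\alpha-1}v(\xi)d\xi$, which is an isomorphism $L^2(0,T)\to{}^{\alpha}H(0,T)$, and let $J_\alpha':{}^{-\alpha}H(0,T)\to L^2(0,T)$ be its dual operator, also an isomorphism: $(J_\alpha'f,\psi)_{L^2(0,T)}=\langle f,J_\alpha\psi\rangle$ for $\psi\in L^2(0,T)$. The fractional derivative is $\partial_t^\alpha:=(J_\alpha')^{-1}:L^2(0,T)\to{}^{-\alpha}H(0,T)$. *)

theory Defs
  imports "HOL-Analysis.Analysis"
begin

text \<open>
  Elements of function spaces over the interval from 0 to T are represented by total functions
  of type \<^typ>\<open>real \<Rightarrow> real\<close>; their values outside the open interval are irrelevant, and two
  representatives describe the same element iff they agree almost everywhere in \<open>leb0 T\<close>.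
\<close>

abbreviation leb0 :: "real \<Rightarrow> real measure" where
  "leb0 T \<equiv> lebesgue_on {0<..<T}"

definition L2 :: "real \<Rightarrow> (real \<Rightarrow> real) set" where
  "L2 T = {v \<in> borel_measurable (leb0 T).
             integrable (leb0 T) (\<lambda>t. (v t)\<^sup>2)}"

definition L2_inner :: "real \<Rightarrow> (real \<Rightarrow> real) \<Rightarrow> (real \<Rightarrow> real) \<Rightarrow> real" where
  "L2_inner T v w = (LINT t|leb0 T. v t * w t)"

definition L2_norm :: "real \<Rightarrow> (real \<Rightarrow> real) \<Rightarrow> real" where
  "L2_norm T v = sqrt (LINT t|leb0 T. (v t)\<^sup>2)"

definition L2_eq :: "real \<Rightarrow> (real \<Rightarrow> real) \<Rightarrow> (real \<Rightarrow> real) \<Rightarrow> bool" where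
  "L2_eq T v w \<longleftrightarrow> (AE t in leb0 T. v t = w t)"

text \<open>
  The difference quotient on the diagonal is \<open>0 / 0 = 0\<close>; the diagonal is a null set.
\<close>

definition slobodeckij_quotient :: "real \<Rightarrow> (real \<Rightarrow> real) \<Rightarrow> real \<times> real \<Rightarrow> real" where
  "slobodeckij_quotient \<alpha> v = (\<lambda>(t, s). \<bar>v t - v s\<bar>\<^sup>2 / \<bar>t - s\<bar> powr (1 + 2 * \<alpha>))"

definition sobolev_H :: "real \<Rightarrow> real \<Rightarrow> (real \<Rightarrow> real) set" where
  "sobolev_H \<alpha> T = {v \<in> L2 T.
     integrable (leb0 T \<Otimes>\<^sub>M leb0 T) (slobodeckij_quotient \<alpha> v)}"

definition sobolev_norm :: "real \<Rightarrow> real \<Rightarrow> (real \<Rightarrow> real) \<Rightarrow> real" where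
  "sobolev_norm \<alpha> T v = sqrt ((L2_norm T v)\<^sup>2 +
     (LINT p|(leb0 T \<Otimes>\<^sub>M leb0 T). slobodeckij_quotient \<alpha> v p))"

text \<open>
  For \<open>\<alpha> > 1/2\<close> the endpoint value \<open>v(T)\<close> is that of the continuous representative of \<open>v\<close> on the
  closed interval, not the value of an arbitrary representative.
\<close>

definition end_H :: "real \<Rightarrow> real \<Rightarrow> (real \<Rightarrow> real) set" where
  "end_H \<alpha> T =
     (if \<alpha> < 1/2 then sobolev_H \<alpha> T
      else if \<alpha> = 1/2 then
        {v \<in> sobolev_H \<alpha> T. integrable (leb0 T) (\<lambda>t. \<bar>v t\<bar>\<^sup>2 / (T - t))}
      else
        {v \<in> sobolev_H \<alpha> T. \<exists>w. continuous_on {0..T} w \<and> L2_eq T v w \<and> w T = 0})"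

definition end_H_norm :: "real \<Rightarrow> real \<Rightarrow> (real \<Rightarrow> real) \<Rightarrow> real" where
  "end_H_norm \<alpha> T v =
     (if \<alpha> = 1/2 then
        sqrt ((sobolev_norm \<alpha> T v)\<^sup>2 + (LINT t|leb0 T. \<bar>v t\<bar>\<^sup>2 / (T - t)))
      else sobolev_norm \<alpha> T v)"

text \<open>
  Bounded linear functionals on \<^term>\<open>end_H \<alpha> T\<close>. They are taken to be extensional, so that equality
  in the dual space is equality of functions; boundedness makes them invariant under changes of
  representative on null sets.
\<close>

definition dual_H :: "real \<Rightarrow> real \<Rightarrow> ((real \<Rightarrow> real) \<Rightarrow> real) set" where
  "dual_H \<alpha> T = {F \<in> extensional (end_H \<alpha> T).
     (\<forall>v\<in>end_H \<alpha> T. \<forall>w\<in>end_H \<alpha> T. F (\<lambda>t. v t + w t) = F v + F w) \<and>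
     (\<forall>c. \<forall>v\<in>end_H \<alpha> T. F (\<lambda>t. c * v t) = c * F v) \<and>
     (\<exists>K. \<forall>v\<in>end_H \<alpha> T. \<bar>F v\<bar> \<le> K * end_H_norm \<alpha> T v)}"

definition dual_norm :: "real \<Rightarrow> real \<Rightarrow> ((real \<Rightarrow> real) \<Rightarrow> real) \<Rightarrow> real" where
  "dual_norm \<alpha> T F = (SUP v\<in>{v \<in> end_H \<alpha> T. end_H_norm \<alpha> T v \<le> 1}. \<bar>F v\<bar>)"

text \<open>The embedding of the square integrable functions into the dual space.\<close>

definition L2_embed :: "real \<Rightarrow> real \<Rightarrow> (real \<Rightarrow> real) \<Rightarrow> (real \<Rightarrow> real) \<Rightarrow> real" where
  "L2_embed \<alpha> T u = (\<lambda>v\<in>end_H \<alpha> T. L2_inner T u v)"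

definition J_op :: "real \<Rightarrow> real \<Rightarrow> (real \<Rightarrow> real) \<Rightarrow> real \<Rightarrow> real" where
  "J_op \<alpha> T v t =
     1 / Gamma \<alpha> * (LINT \<xi>:{t<..<T}|lebesgue. (\<xi> - t) powr (\<alpha> - 1) * v \<xi>)"

text \<open>The defining property determines \<open>J_dual \<alpha> T F\<close> up to null sets only.\<close>

definition J_dual :: "real \<Rightarrow> real \<Rightarrow> ((real \<Rightarrow> real) \<Rightarrow> real) \<Rightarrow> real \<Rightarrow> real" where
  "J_dual \<alpha> T F = (SOME g. g \<in> L2 T \<and> (\<forall>\<psi>\<in>L2 T. L2_inner T g \<psi> = F (J_op \<alpha> T \<psi>)))"

text \<open>
  The inverse of \<^term>\<open>J_dual \<alpha> T\<close> as a map from the square integrable functions to the dual space.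
\<close>

definition frac_deriv :: "real \<Rightarrow> real \<Rightarrow> (real \<Rightarrow> real) \<Rightarrow> (real \<Rightarrow> real) \<Rightarrow> real" where
  "frac_deriv \<alpha> T w = (THE F. F \<in> dual_H \<alpha> T \<and> L2_eq T (J_dual \<alpha> T F) w)"

definition is_solution ::
  "real \<Rightarrow> real \<Rightarrow> real \<Rightarrow> real \<Rightarrow> ((real \<Rightarrow> real) \<Rightarrow> real) \<Rightarrow> (real \<Rightarrow> real) \<Rightarrow> bool" where
  "is_solution \<alpha> T lam a f u \<longleftrightarrow>
     (\<lambda>t. u t - a) \<in> L2 T \<and>
     frac_deriv \<alpha> T (\<lambda>t. u t - a) = (\<lambda>v\<in>end_H \<alpha> T. - lam * L2_embed \<alpha> T u v + f v)"

end

theory Submission imports Defs "HOL-Real_Asymp.Real_Asymp" begin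

text \<open>
  The equation is turned into a statement about inner products. The operator \<open>J = J_op \<alpha> T\<close> is an
  isomorphism of the square integrable functions onto \<open>end_H \<alpha> T\<close> (\<open>J_bounded\<close>, \<open>J_inj\<close>, \<open>J_onto\<close>). So a
  functional in the dual space is determined by its values on the functions \<open>J \<psi>\<close>, and the fractional
  derivative of \<open>w\<close> is the functional that takes the value \<open>(w, \<psi>)\<close> at \<open>J \<psi>\<close> (\<open>frac_deriv_eq_iff\<close>). Hence \<open>u\<close> is a
  solution iff \<open>w = u - a\<close> is square integrable and satisfies \<open>(w, \<psi> + lam J \<psi>) = f (J \<psi>) - lam a (1, J \<psi>)\<close> for all \<open>\<psi>\<close>. The Volterra
  equation \<open>\<psi> + lam J \<psi> = x\<close> is uniquely solvable with a bound for every real \<open>lam\<close>, because \<open>J\<close> has a small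
  norm with respect to the weight \<open>exp (2 \<mu> t)\<close> if \<open>\<mu>\<close> is large (\<open>JT_Volterra\<close>). Therefore the condition
  prescribes the inner product of \<open>w\<close> with every \<open>x\<close>, and the Riesz representation theorem gives
  existence, uniqueness and the estimate (\<open>solvability\<close>).

  That \<open>J\<close> is an isomorphism is the main part. For \<open>v\<close> extended by zero beyond \<open>T\<close> consider the energy
  \<open>N v\<close>, the integral of \<open>h powr (- 1 - 2 \<alpha>) (v t - v (t + h))\<^sup>2\<close> over \<open>h > 0\<close> and \<open>0 < t < T\<close>. The pairs with
  \<open>t + h < T\<close> contribute half of the Slobodeckij integral, the others the integral of
  \<open>(v t)\<^sup>2 (T - t) powr (- 2 \<alpha>) / (2 \<alpha>)\<close> (\<open>shift_energy_eq\<close>). For \<open>\<alpha> = 1/2\<close> the latter is part of the norm of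
  \<open>end_H\<close>; for the other orders a fractional Hardy inequality bounds it, where the boundary value zero
  enters if \<open>\<alpha> > 1/2\<close> (\<open>end_weight_bound\<close>). So the square of the norm is equivalent to \<open>N v\<close> plus the square
  of the norm of \<open>v\<close> as a square integrable function.

  The differences of \<open>v = Gamma \<alpha> J \<psi>\<close> are scaled averages of \<open>\<psi>\<close>: \<open>v t - v (t + h)\<close> is \<open>h powr \<alpha>\<close> times the integral
  of \<open>\<kappa> x \<psi> (t + h x)\<close> over \<open>x\<close>, with \<open>\<kappa> x = x\<^sub>+ powr (\<alpha> - 1) - (x - 1)\<^sub>+ powr (\<alpha> - 1)\<close>, a kernel of integral zero
  (\<open>back_int_difference\<close>, \<open>diff_ker_integral\<close>). An inner product of two such averages is a double integral
  of \<open>\<kappa> x \<kappa> y A (h \<bar>x - y\<bar>)\<close> or \<open>\<kappa> x \<kappa> y A (h \<bar>x + y\<bar>)\<close> with a correlation \<open>A\<close>, depending on whether the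
  averages look in the same or in opposite directions. When it is integrated against \<open>dh / h\<close>, the
  cancellation in \<open>\<kappa>\<close> leaves only logarithms (locale \<open>log_scale\<close>). In the first case this bounds \<open>N (J \<psi>)\<close> by
  the square of the norm of \<open>\<psi>\<close> (\<open>square_function_bound\<close>). In the second case it converges to \<open>c (\<psi>, \<phi>)\<close>, a
  reproducing formula of Calderon type (\<open>reproducing_limit\<close>), where \<open>c\<close> is minus the double integral of
  \<open>\<kappa> x \<kappa> y ln (x + y)\<close>. This constant is positive because it is also a limit of integrals of the squared
  Laplace transform of \<open>\<kappa>\<close> (\<open>repro_const_pos\<close>). The formula recovers \<open>\<psi>\<close> from the differences of \<open>J \<psi>\<close>, which is
  injectivity (\<open>JT_injective\<close>); read as the definition of a bounded functional for a given \<open>v\<close> of finite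
  energy, it provides a preimage of \<open>v\<close> with a bound (\<open>JT_surjective\<close>).
\<close>

section \<open>Square integrable functions on a measure space\<close>

definition sq_integrable :: "'a measure \<Rightarrow> ('a \<Rightarrow> real) \<Rightarrow> bool" where
  "sq_integrable M f \<longleftrightarrow> f \<in> borel_measurable M \<and> integrable M (\<lambda>x. (f x)\<^sup>2)"

definition norm2 :: "'a measure \<Rightarrow> ('a \<Rightarrow> real) \<Rightarrow> real" where
  "norm2 M f = sqrt (LINT x|M. (f x)\<^sup>2)"

lemma sq_integrable_measurable[measurable_dest]: "sq_integrable M f \<Longrightarrow> f \<in> borel_measurable M"
  by (auto simp: sq_integrable_def)

lemma norm2_nonneg[simp]: "0 \<le> norm2 M f"
  by (simp add: norm2_def)

lemma norm2_power2: "(norm2 M f)\<^sup>2 = (LINT x|M. (f x)\<^sup>2)"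
  by (simp add: norm2_def)

lemma sq_integrable_mult_integrable:
  assumes "sq_integrable M f" "sq_integrable M g"
  shows "integrable M (\<lambda>x. f x * g x)"
proof -
  have [measurable]: "f \<in> borel_measurable M" "g \<in> borel_measurable M"
    using assms by (auto simp: sq_integrable_def)
  show ?thesis
  proof (rule Bochner_Integration.integrable_bound)
    show "integrable M (\<lambda>x. (f x)\<^sup>2 + (g x)\<^sup>2)"
      using assms by (auto simp: sq_integrable_def)
    show "AE x in M. norm (f x * g x) \<le> norm ((f x)\<^sup>2 + (g x)\<^sup>2)"
    proof (rule AE_I2)
      fix x
      have "2 * \<bar>f x\<bar> * \<bar>g x\<bar> \<le> \<bar>f x\<bar>\<^sup>2 + \<bar>g x\<bar>\<^sup>2" by (rule sum_squares_bound)
      moreover have "0 \<le> \<bar>f x\<bar> * \<bar>g x\<bar>" by simp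
      ultimately have "\<bar>f x\<bar> * \<bar>g x\<bar> \<le> (f x)\<^sup>2 + (g x)\<^sup>2"
        unfolding power2_abs mult.assoc by linarith
      then show "norm (f x * g x) \<le> norm ((f x)\<^sup>2 + (g x)\<^sup>2)" by (simp add: abs_mult)
    qed
  qed measurable
qed

lemma sq_integrable_add: "sq_integrable M f \<Longrightarrow> sq_integrable M g \<Longrightarrow> sq_integrable M (\<lambda>x. f x + g x)"
  using sq_integrable_mult_integrable[of M f g]
  by (auto simp: sq_integrable_def power2_sum mult.assoc)

lemma sq_integrable_scale: "sq_integrable M f \<Longrightarrow> sq_integrable M (\<lambda>x. c * f x)"
  by (auto simp: sq_integrable_def power_mult_distrib)

lemma sq_integrable_diff: "sq_integrable M f \<Longrightarrow> sq_integrable M g \<Longrightarrow> sq_integrable M (\<lambda>x. f x - g x)"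
  using sq_integrable_add[of M f "\<lambda>x. (-1) * g x"] sq_integrable_scale[of M g "-1"] by simp

lemma sq_integrable_zero[simp]: "sq_integrable M (\<lambda>x. 0)"
  by (simp add: sq_integrable_def)

lemma norm2_scale: "norm2 M (\<lambda>x. c * f x) = \<bar>c\<bar> * norm2 M f"
  by (simp add: norm2_def power_mult_distrib real_sqrt_mult)

lemma norm2_eq_0_iff:
  assumes "sq_integrable M f" shows "norm2 M f = 0 \<longleftrightarrow> (AE x in M. f x = 0)"
  using integral_nonneg_eq_0_iff_AE[of M "\<lambda>x. (f x)\<^sup>2"] assms
  by (auto simp: norm2_def sq_integrable_def)

lemma norm2_cong_AE:
  assumes "f \<in> borel_measurable M" "g \<in> borel_measurable M" "AE x in M. f x = g x"
  shows "norm2 M f = norm2 M g"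
  unfolding norm2_def using assms by (intro arg_cong[of _ _ sqrt] integral_cong_AE) auto

lemma sq_integrable_cong_AE:
  assumes "sq_integrable M f" "g \<in> borel_measurable M" "AE x in M. f x = g x"
  shows "sq_integrable M g"
  unfolding sq_integrable_def
proof
  have "AE x in M. (f x)\<^sup>2 = (g x)\<^sup>2" using assms(3) by eventually_elim simp
  then show "integrable M (\<lambda>x. (g x)\<^sup>2)"
    using assms integrable_cong_AE[of "\<lambda>x. (f x)\<^sup>2" M "\<lambda>x. (g x)\<^sup>2"]
    by (auto simp: sq_integrable_def)
qed fact

lemma L2_Cauchy_Schwarz:
  assumes "sq_integrable M f" "sq_integrable M g"
  shows "\<bar>LINT x|M. f x * g x\<bar> \<le> norm2 M f * norm2 M g"
proof -
  have main: "(LINT x|M. f x * g x) \<le> norm2 M f * norm2 M g" if fg: "sq_integrable M f" "sq_integrable M g" for f g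
  proof (cases "norm2 M f = 0 \<or> norm2 M g = 0")
    case True
    then have "AE x in M. f x * g x = 0"
      using norm2_eq_0_iff[OF fg(1)] norm2_eq_0_iff[OF fg(2)] by auto
    then have "(LINT x|M. f x * g x) = 0"
      by (rule integral_eq_zero_AE)
    then show ?thesis by simp
  next
    case False
    define a b where "a = norm2 M f" and "b = norm2 M g"
    have pos: "a > 0" "b > 0"
      using False norm2_nonneg[of M f] norm2_nonneg[of M g] by (auto simp: a_def b_def less_le)
    have "0 \<le> (LINT x|M. (b * f x - a * g x)\<^sup>2)" by simp
    also have "\<dots> = (LINT x|M. b\<^sup>2 * (f x)\<^sup>2 + a\<^sup>2 * (g x)\<^sup>2 - (2 * a * b) * (f x * g x))"
      by (intro Bochner_Integration.integral_cong) (auto simp: power2_diff power_mult_distrib)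
    also have "\<dots> = b\<^sup>2 * a\<^sup>2 + a\<^sup>2 * b\<^sup>2 - (2 * a * b) * (LINT x|M. f x * g x)"
      using sq_integrable_mult_integrable[OF fg] fg unfolding a_def b_def norm2_power2
      by (simp add: sq_integrable_def)
    finally have "(2 * a * b) * (LINT x|M. f x * g x) \<le> (2 * a * b) * (a * b)"
      by (simp add: power2_eq_square algebra_simps)
    then show ?thesis using pos by (simp add: a_def b_def)
  qed
  have "(LINT x|M. (-1 * f x) * g x) \<le> norm2 M (\<lambda>x. -1 * f x) * norm2 M g"
    using assms by (intro main sq_integrable_scale)
  moreover have "norm2 M (\<lambda>x. -1 * f x) = norm2 M f"
    using norm2_scale[of M "-1" f] by simp
  ultimately show ?thesis using main[OF assms] by (simp add: abs_le_iff)
qed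

lemma norm2_triangle:
  assumes "sq_integrable M f" "sq_integrable M g"
  shows "norm2 M (\<lambda>x. f x + g x) \<le> norm2 M f + norm2 M g"
proof (rule power2_le_imp_le)
  have "(norm2 M (\<lambda>x. f x + g x))\<^sup>2 = (LINT x|M. (f x)\<^sup>2 + (g x)\<^sup>2 + 2 * (f x * g x))"
    unfolding norm2_power2
    by (intro Bochner_Integration.integral_cong) (auto simp: power2_sum)
  also have "\<dots> = (norm2 M f)\<^sup>2 + (norm2 M g)\<^sup>2 + 2 * (LINT x|M. f x * g x)"
    using sq_integrable_mult_integrable[OF assms] assms unfolding norm2_power2 by (simp add: sq_integrable_def)
  also have "\<dots> \<le> (norm2 M f)\<^sup>2 + (norm2 M g)\<^sup>2 + 2 * (norm2 M f * norm2 M g)"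
    using L2_Cauchy_Schwarz[OF assms] by linarith
  finally show "(norm2 M (\<lambda>x. f x + g x))\<^sup>2 \<le> (norm2 M f + norm2 M g)\<^sup>2"
    by (simp add: power2_sum)
qed simp

lemma norm2_triangle_diff:
  assumes "sq_integrable M f" "sq_integrable M g" "sq_integrable M h"
  shows "norm2 M (\<lambda>x. f x - h x) \<le> norm2 M (\<lambda>x. f x - g x) + norm2 M (\<lambda>x. g x - h x)"
  using norm2_triangle[of M "\<lambda>x. f x - g x" "\<lambda>x. g x - h x"] assms sq_integrable_diff by auto

lemma nn_integral_power2_sq_integrable:
  assumes "sq_integrable M f"
  shows "(\<integral>\<^sup>+x. ennreal ((f x)\<^sup>2) \<partial>M) = ennreal ((norm2 M f)\<^sup>2)"
  unfolding norm2_power2 using assms by (intro nn_integral_eq_integral) (auto simp: sq_integrable_def)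

lemma sq_integrable_if_nn_integral_le:
  assumes [measurable]: "f \<in> borel_measurable M"
    and le: "(\<integral>\<^sup>+x. ennreal ((f x)\<^sup>2) \<partial>M) \<le> ennreal (c\<^sup>2)" and c: "0 \<le> c"
  shows "sq_integrable M f" "norm2 M f \<le> c"
proof -
  have int: "integrable M (\<lambda>x. (f x)\<^sup>2)"
    using le by (intro integrableI_nonneg) (auto simp: less_top[symmetric] top_unique)
  then show s: "sq_integrable M f" by (simp add: sq_integrable_def)
  have "ennreal ((norm2 M f)\<^sup>2) \<le> ennreal (c\<^sup>2)"
    using le nn_integral_power2_sq_integrable[OF s] by simp
  then have "(norm2 M f)\<^sup>2 \<le> c\<^sup>2" by simp
  then show "norm2 M f \<le> c" using c by (rule power2_le_imp_le)
qed

lemma norm2_telescope: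
  fixes f :: "nat \<Rightarrow> 'a \<Rightarrow> real"
  assumes s: "\<And>n. sq_integrable M (f n)" and d: "\<And>n. norm2 M (\<lambda>x. f (Suc n) x - f n x) \<le> C / 2 ^ n" and C: "0 \<le> C"
  shows "norm2 M (\<lambda>x. f (n + m) x - f n x) \<le> 2 * C / 2 ^ n - 2 * C / 2 ^ (n + m)"
proof (induction m)
  case 0 show ?case by (simp add: norm2_def)
next
  case (Suc m)
  have "norm2 M (\<lambda>x. f (n + Suc m) x - f n x)
      \<le> norm2 M (\<lambda>x. f (n + Suc m) x - f (n + m) x) + norm2 M (\<lambda>x. f (n + m) x - f n x)"
    by (rule norm2_triangle_diff) (auto intro: s)
  also have "\<dots> \<le> C / 2 ^ (n + m) + (2 * C / 2 ^ n - 2 * C / 2 ^ (n + m))"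
    using d[of "n + m"] Suc by simp
  also have "\<dots> = 2 * C / 2 ^ n - 2 * C / 2 ^ (n + Suc m)"
    by (simp add: field_simps)
  finally show ?case .
qed

text \<open>
  The weights \<open>2 ^ n\<close> make the sum of \<open>2 ^ n * (f (Suc n) x - f n x)\<^sup>2\<close> integrable, and where this sum
  is finite the differences themselves are summable, so that the pointwise limit exists almost
  everywhere. Fatou's lemma then transfers the bounds of \<open>norm2_telescope\<close> to the limit.
\<close>

lemma L2_complete:
  fixes f :: "nat \<Rightarrow> 'a \<Rightarrow> real"
  assumes s: "\<And>n. sq_integrable M (f n)" and d: "\<And>n. norm2 M (\<lambda>x. f (Suc n) x - f n x) \<le> C / 2 ^ n"
  obtains g where "sq_integrable M g" "\<And>n. norm2 M (\<lambda>x. g x - f n x) \<le> 2 * C / 2 ^ n"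
proof -
  have "0 \<le> norm2 M (\<lambda>x. f (Suc 0) x - f 0 x)" by simp
  also have "\<dots> \<le> C" using d[of 0] by simp
  finally have C: "0 \<le> C" .
  have [measurable]: "f n \<in> borel_measurable M" for n using s by (auto simp: sq_integrable_def)
  let ?d = "\<lambda>n x. f (Suc n) x - f n x"
  have sd: "sq_integrable M (?d n)" for n by (intro sq_integrable_diff s)
  have bnd: "(\<integral>\<^sup>+x. ennreal (2 ^ n * (?d n x)\<^sup>2) \<partial>M) \<le> ennreal (C\<^sup>2 * (1/2) ^ n)" for n
  proof -
    have "(\<integral>\<^sup>+x. ennreal (2 ^ n * (?d n x)\<^sup>2) \<partial>M) = ennreal (2 ^ n) * (\<integral>\<^sup>+x. ennreal ((?d n x)\<^sup>2) \<partial>M)"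
      by (subst nn_integral_cmult[symmetric]) (auto simp: ennreal_mult)
    also have "\<dots> = ennreal (2 ^ n) * ennreal ((norm2 M (?d n))\<^sup>2)"
      by (simp add: nn_integral_power2_sq_integrable[OF sd])
    also have "\<dots> = ennreal (2 ^ n * (norm2 M (?d n))\<^sup>2)" by (simp add: ennreal_mult)
    also have "\<dots> \<le> ennreal (2 ^ n * (C / 2 ^ n)\<^sup>2)"
      using d[of n] by (intro ennreal_leI mult_left_mono power_mono) auto
    also have "2 ^ n * (C / 2 ^ n)\<^sup>2 = C\<^sup>2 * (1/2) ^ n"
      by (simp add: power2_eq_square field_simps)
    finally show ?thesis .
  qed
  have "(\<integral>\<^sup>+x. (\<Sum>n. ennreal (2 ^ n * (?d n x)\<^sup>2)) \<partial>M) = (\<Sum>n. \<integral>\<^sup>+x. ennreal (2 ^ n * (?d n x)\<^sup>2) \<partial>M)"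
    by (intro nn_integral_suminf) measurable
  also have "\<dots> \<le> (\<Sum>n. ennreal (C\<^sup>2 * (1/2) ^ n))"
    by (intro suminf_le bnd) auto
  also have "\<dots> = ennreal (\<Sum>n. C\<^sup>2 * (1/2) ^ n)"
    by (intro suminf_ennreal2) (auto intro!: summable_mult summable_geometric)
  finally have "(\<integral>\<^sup>+x. (\<Sum>n. ennreal (2 ^ n * (?d n x)\<^sup>2)) \<partial>M) \<noteq> \<infinity>"
    by (auto simp: top_unique)
  then have "AE x in M. (\<Sum>n. ennreal (2 ^ n * (?d n x)\<^sup>2)) \<noteq> \<infinity>"
    by (intro nn_integral_PInf_AE) auto
  then have conv: "AE x in M. convergent (\<lambda>n. f n x)"
  proof eventually_elim
    case (elim x)
    have weighted: "summable (\<lambda>n. 2 ^ n * (?d n x)\<^sup>2)"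
      using elim by (intro summable_suminf_not_top) auto
    have "summable (\<lambda>n. ?d n x)"
    proof (rule summable_comparison_test')
      show "summable (\<lambda>n. (1/2) ^ n + 2 ^ n * (?d n x)\<^sup>2)"
        using weighted by (intro summable_add summable_geometric) auto
      fix n :: nat
      \<comment> \<open>By the inequality of the means, \<open>2 * \<bar>d\<bar> \<le> 1 / p + p * d\<^sup>2\<close> for \<open>p = 2 ^ n\<close>.\<close>
      define p :: real where "p = 2 ^ n"
      have p: "p > 0" by (simp add: p_def)
      have "0 \<le> (1 - p * \<bar>?d n x\<bar>)\<^sup>2" by simp
      also have "\<dots> = p * (1 / p + p * (?d n x)\<^sup>2 - 2 * \<bar>?d n x\<bar>)"
        using p by (simp add: power2_diff power_mult_distrib) (simp add: power2_eq_square algebra_simps)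
      finally have "2 * \<bar>?d n x\<bar> \<le> 1 / p + p * (?d n x)\<^sup>2"
        using p by (simp add: zero_le_mult_iff)
      moreover have "\<bar>?d n x\<bar> \<le> 2 * \<bar>?d n x\<bar>" by simp
      ultimately have "\<bar>?d n x\<bar> \<le> 1 / p + p * (?d n x)\<^sup>2"
        by (rule order_trans[rotated])
      then have "\<bar>?d n x\<bar> \<le> (1/2) ^ n + 2 ^ n * (?d n x)\<^sup>2"
        by (simp add: p_def power_one_over)
      then show "norm (?d n x) \<le> (1/2) ^ n + 2 ^ n * (?d n x)\<^sup>2"
        by simp
    qed
    then have "convergent (\<lambda>n. \<Sum>i<n. ?d i x)"
      by (simp add: summable_iff_convergent)
    then have "convergent (\<lambda>n. f n x - f 0 x)"
      by (simp add: sum_lessThan_telescope[of "\<lambda>n. f n x"])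
    then show ?case using convergent_diff_const_right_iff[of "\<lambda>n. f n x" "f 0 x"] by simp
  qed
  define g where "g = (\<lambda>x. lim (\<lambda>n. f n x))"
  have [measurable]: "g \<in> borel_measurable M" unfolding g_def by measurable
  have nb: "(\<integral>\<^sup>+x. ennreal ((g x - f n x)\<^sup>2) \<partial>M) \<le> ennreal ((2 * C / 2 ^ n)\<^sup>2)" for n
  proof -
    have "(\<integral>\<^sup>+x. ennreal ((g x - f n x)\<^sup>2) \<partial>M)
        = (\<integral>\<^sup>+x. liminf (\<lambda>m. ennreal ((f (n + m) x - f n x)\<^sup>2)) \<partial>M)"
    proof (rule nn_integral_cong_AE)
      show "AE x in M. ennreal ((g x - f n x)\<^sup>2) = liminf (\<lambda>m. ennreal ((f (n + m) x - f n x)\<^sup>2))"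
        using conv
      proof eventually_elim
        case (elim x)
        then have "(\<lambda>m. f m x) \<longlonglongrightarrow> g x" by (simp add: g_def convergent_LIMSEQ_iff)
        then have "(\<lambda>m. f (n + m) x) \<longlonglongrightarrow> g x"
          using LIMSEQ_ignore_initial_segment[of "\<lambda>m. f m x" "g x" n] by (simp add: add.commute)
        then have "(\<lambda>m. ennreal ((f (n + m) x - f n x)\<^sup>2)) \<longlonglongrightarrow> ennreal ((g x - f n x)\<^sup>2)"
          by (intro tendsto_ennrealI tendsto_intros)
        then show ?case by (intro lim_imp_Liminf[symmetric]) simp_all
      qed
    qed
    also have "\<dots> \<le> liminf (\<lambda>m. \<integral>\<^sup>+x. ennreal ((f (n + m) x - f n x)\<^sup>2) \<partial>M)"
      by (rule nn_integral_liminf) measurable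
    also have "\<dots> \<le> liminf (\<lambda>m. ennreal ((2 * C / 2 ^ n)\<^sup>2))"
    proof (rule Liminf_mono, rule always_eventually, rule allI)
      fix m
      have "norm2 M (\<lambda>x. f (n + m) x - f n x) \<le> 2 * C / 2 ^ n - 2 * C / 2 ^ (n + m)"
        by (rule norm2_telescope[OF s d C])
      also have "\<dots> \<le> 2 * C / 2 ^ n" using C by simp
      finally have "(norm2 M (\<lambda>x. f (n + m) x - f n x))\<^sup>2 \<le> (2 * C / 2 ^ n)\<^sup>2"
        by (intro power_mono) auto
      then show "(\<integral>\<^sup>+x. ennreal ((f (n + m) x - f n x)\<^sup>2) \<partial>M) \<le> ennreal ((2 * C / 2 ^ n)\<^sup>2)"
        by (subst nn_integral_power2_sq_integrable) (auto intro!: sq_integrable_diff s ennreal_leI)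
    qed
    also have "\<dots> = ennreal ((2 * C / 2 ^ n)\<^sup>2)" by (simp add: Liminf_const)
    finally show ?thesis .
  qed
  have dn: "sq_integrable M (\<lambda>x. g x - f n x)" "norm2 M (\<lambda>x. g x - f n x) \<le> 2 * C / 2 ^ n" for n
    using sq_integrable_if_nn_integral_le[OF _ nb[of n]] C by auto
  have "sq_integrable M (\<lambda>x. (g x - f 0 x) + f 0 x)" by (intro sq_integrable_add dn s)
  then show ?thesis using that dn by auto
qed

text \<open>
  The representing function is the minimiser of \<open>Q f = (norm2 M f)\<^sup>2 / 2 - \<Lambda> f\<close>. By the parallelogram
  law a minimising sequence is a Cauchy sequence, and the variation of \<open>Q\<close> at its limit \<open>g\<close> in the
  direction of a function \<open>\<phi>\<close> is the difference of the inner product of \<open>g\<close> and \<open>\<phi>\<close> and \<open>\<Lambda> \<phi>\<close>.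
\<close>

lemma L2_Riesz:
  fixes \<Lambda> :: "('a \<Rightarrow> real) \<Rightarrow> real"
  assumes add: "\<And>f g. sq_integrable M f \<Longrightarrow> sq_integrable M g \<Longrightarrow> \<Lambda> (\<lambda>x. f x + g x) = \<Lambda> f + \<Lambda> g"
    and scale: "\<And>c f. sq_integrable M f \<Longrightarrow> \<Lambda> (\<lambda>x. c * f x) = c * \<Lambda> f"
    and bdd: "\<And>f. sq_integrable M f \<Longrightarrow> \<bar>\<Lambda> f\<bar> \<le> K * norm2 M f"
  obtains g where "sq_integrable M g" "\<And>f. sq_integrable M f \<Longrightarrow> (LINT x|M. g x * f x) = \<Lambda> f" "norm2 M g \<le> \<bar>K\<bar>"
proof -
  define Q where "Q f = (norm2 M f)\<^sup>2 / 2 - \<Lambda> f" for f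
  define I where "I = (INF f\<in>Collect (sq_integrable M). Q f)"
  have low: "- (K\<^sup>2 / 2) \<le> Q f" if "sq_integrable M f" for f
  proof -
    have "0 \<le> (norm2 M f - K)\<^sup>2" by simp
    then have "K * norm2 M f \<le> (norm2 M f)\<^sup>2 / 2 + K\<^sup>2 / 2"
      by (simp add: power2_diff mult.commute)
    then show ?thesis using bdd[OF that] by (simp add: Q_def)
  qed
  have bb: "bdd_below (Q ` Collect (sq_integrable M))"
    by (rule bdd_belowI2[of _ "- (K\<^sup>2 / 2)"]) (auto intro: low)
  have Ile: "I \<le> Q f" if "sq_integrable M f" for f
    unfolding I_def using that bb by (intro cINF_lower) auto
  \<comment> \<open>The rate \<open>(1/4) ^ n\<close> for the values gives the rate \<open>1 / 2 ^ n\<close> for the norms of the differences,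
    as required by \<open>L2_complete\<close>.\<close>
  have "\<exists>f. sq_integrable M f \<and> Q f < I + (1/4) ^ n" for n :: nat
  proof -
    have "(INF f\<in>Collect (sq_integrable M). Q f) < I + (1/4) ^ n" by (simp add: I_def)
    then show ?thesis using cINF_less_iff[OF _ bb] by (auto intro: sq_integrable_zero)
  qed
  then obtain f where f: "\<And>n. sq_integrable M (f n)" "\<And>n. Q (f n) < I + (1/4) ^ n"
    by metis
  have par: "(norm2 M (\<lambda>x. f x - g x))\<^sup>2 = 4 * (Q f + Q g - 2 * Q (\<lambda>x. (1/2) * (f x + g x)))"
    if fg: "sq_integrable M f" "sq_integrable M g" for f g
  proof -
    define h where "h = (\<lambda>x. (1/2) * (f x + g x))"
    have "\<Lambda> h = (\<Lambda> f + \<Lambda> g) / 2"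
      using scale[OF sq_integrable_add[OF fg], of "1/2"] add[OF fg] by (simp add: h_def)
    moreover have "(norm2 M h)\<^sup>2 = (norm2 M (\<lambda>x. f x + g x))\<^sup>2 / 4"
      unfolding h_def norm2_scale by (simp add: power_divide)
    moreover have "(norm2 M (\<lambda>x. f x - g x))\<^sup>2 = (norm2 M f)\<^sup>2 + (norm2 M g)\<^sup>2 - 2 * (LINT x|M. f x * g x)"
      unfolding norm2_power2 power2_diff using fg sq_integrable_mult_integrable[OF fg]
      by (simp add: sq_integrable_def mult.assoc)
    moreover have "(norm2 M (\<lambda>x. f x + g x))\<^sup>2 = (norm2 M f)\<^sup>2 + (norm2 M g)\<^sup>2 + 2 * (LINT x|M. f x * g x)"
      unfolding norm2_power2 power2_sum using fg sq_integrable_mult_integrable[OF fg]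
      by (simp add: sq_integrable_def mult.assoc)
    ultimately show ?thesis unfolding Q_def h_def[symmetric] by (simp add: field_simps)
  qed
  have "norm2 M (\<lambda>x. f (Suc n) x - f n x) \<le> 4 / 2 ^ n" for n
  proof (rule power2_le_imp_le)
    define q where "q = Q (\<lambda>x. (1/2) * (f (Suc n) x + f n x))"
    have "I \<le> q"
      unfolding q_def by (intro Ile sq_integrable_scale sq_integrable_add f)
    then have "Q (f (Suc n)) + Q (f n) - 2 * q \<le> (1/4) ^ Suc n + (1/4) ^ n"
      using f(2)[of n] f(2)[of "Suc n"] by linarith
    then have "(norm2 M (\<lambda>x. f (Suc n) x - f n x))\<^sup>2 \<le> 4 * ((1/4) ^ Suc n + (1/4) ^ n)"
      unfolding par[OF f(1) f(1)] q_def[symmetric] by (intro mult_left_mono) auto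
    also have "\<dots> \<le> 16 * (1/4) ^ n" by simp
    also have "\<dots> = (4 / 2 ^ n)\<^sup>2"
      by (simp add: power_divide power2_eq_square power_mult_distrib[symmetric])
    finally show "(norm2 M (\<lambda>x. f (Suc n) x - f n x))\<^sup>2 \<le> (4 / 2 ^ n)\<^sup>2" .
  qed simp
  from L2_complete[OF f(1) this] obtain g
    where g: "sq_integrable M g" "\<And>n. norm2 M (\<lambda>x. g x - f n x) \<le> 2 * 4 / 2 ^ n" by blast
  have lim0: "(\<lambda>n. norm2 M (\<lambda>x. g x - f n x)) \<longlonglongrightarrow> 0"
  proof (rule tendsto_sandwich[OF _ _ tendsto_const])
    show "(\<lambda>n. 2 * 4 / 2 ^ n) \<longlonglongrightarrow> (0::real)" by real_asymp
    show "\<forall>\<^sub>F n in sequentially. norm2 M (\<lambda>x. g x - f n x) \<le> 2 * 4 / 2 ^ n"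
      using g(2) by simp
  qed auto
  have Qg: "Q g \<le> I"
  proof -
    have bnd: "Q g \<le> I + (1/4) ^ n + \<bar>K\<bar> * norm2 M (\<lambda>x. g x - f n x)
                 + norm2 M (\<lambda>x. g x - f n x) * norm2 M g" for n
    proof -
      let ?d = "\<lambda>x. g x - f n x"
      have sd: "sq_integrable M ?d" by (intro sq_integrable_diff g f)
      have e: "(norm2 M (f n))\<^sup>2 = (norm2 M g)\<^sup>2 + (norm2 M ?d)\<^sup>2 - 2 * (LINT x|M. g x * ?d x)"
      proof -
        have "(norm2 M (f n))\<^sup>2 = (LINT x|M. (g x)\<^sup>2 + (?d x)\<^sup>2 - 2 * (g x * ?d x))"
          unfolding norm2_power2
          by (intro Bochner_Integration.integral_cong) (auto simp: power2_eq_square algebra_simps)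
        then show ?thesis using g sd sq_integrable_mult_integrable[OF g(1) sd]
          unfolding norm2_power2 by (simp add: sq_integrable_def)
      qed
      have "\<Lambda> g = \<Lambda> (f n) + \<Lambda> ?d" using add[OF f(1) sd, of n] by simp
      moreover have "\<bar>\<Lambda> ?d\<bar> \<le> \<bar>K\<bar> * norm2 M ?d"
        using bdd[OF sd] mult_right_mono[OF abs_ge_self[of K] norm2_nonneg[of M ?d]] by linarith
      moreover have "(LINT x|M. g x * ?d x) \<le> norm2 M ?d * norm2 M g"
        using L2_Cauchy_Schwarz[OF g(1) sd] by (simp add: mult.commute)
      ultimately show ?thesis using f(2)[of n] e zero_le_power2[of "norm2 M ?d"]
        unfolding Q_def by linarith
    qed
    have "(\<lambda>n. I + (1/4) ^ n + \<bar>K\<bar> * norm2 M (\<lambda>x. g x - f n x)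
                 + norm2 M (\<lambda>x. g x - f n x) * norm2 M g) \<longlonglongrightarrow> I + 0 + \<bar>K\<bar> * 0 + 0 * norm2 M g"
      by (intro tendsto_intros lim0 LIMSEQ_power_zero) auto
    then show ?thesis using bnd by (auto intro: LIMSEQ_le_const)
  qed
  have rep: "(LINT x|M. g x * \<phi> x) = \<Lambda> \<phi>" if ph: "sq_integrable M \<phi>" for \<phi>
  proof -
    define X where "X = (LINT x|M. g x * \<phi> x) - \<Lambda> \<phi>"
    define F where "F = (norm2 M \<phi>)\<^sup>2"
    have q: "0 \<le> s * X + s\<^sup>2 * F / 2" for s
    proof -
      have "Q g \<le> Q (\<lambda>x. g x + s * \<phi> x)"
        using Qg Ile[of "\<lambda>x. g x + s * \<phi> x"] ph g sq_integrable_add sq_integrable_scale by fastforce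
      moreover have "(norm2 M (\<lambda>x. g x + s * \<phi> x))\<^sup>2 = (norm2 M g)\<^sup>2 + s\<^sup>2 * F + 2 * s * (LINT x|M. g x * \<phi> x)"
      proof -
        have "(norm2 M (\<lambda>x. g x + s * \<phi> x))\<^sup>2 = (LINT x|M. (g x)\<^sup>2 + s\<^sup>2 * (\<phi> x)\<^sup>2 + (2 * s) * (g x * \<phi> x))"
          unfolding norm2_power2
          by (intro Bochner_Integration.integral_cong) (auto simp: power2_eq_square algebra_simps)
        then show ?thesis using g ph sq_integrable_mult_integrable[OF g(1) ph]
          unfolding norm2_power2 F_def by (simp add: sq_integrable_def)
      qed
      moreover have "\<Lambda> (\<lambda>x. g x + s * \<phi> x) = \<Lambda> g + s * \<Lambda> \<phi>"
        using add[OF g(1) sq_integrable_scale[OF ph]] scale[OF ph] by simp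
      ultimately show ?thesis unfolding Q_def X_def by (simp add: algebra_simps)
    qed
    have F: "0 \<le> F" by (simp add: F_def)
    \<comment> \<open>For this step the linear term of the variation exceeds the quadratic one.\<close>
    define s where "s = - X / (F + 1)"
    have "s * X + s\<^sup>2 * F / 2 = X\<^sup>2 * (F / 2 - (F + 1)) / (F + 1)\<^sup>2"
      using F unfolding s_def by (simp add: divide_simps) (simp add: power2_eq_square algebra_simps)
    with q[of s] have "0 \<le> X\<^sup>2 * (F / 2 - (F + 1)) / (F + 1)\<^sup>2" by simp
    then have "0 \<le> X\<^sup>2 * (F / 2 - (F + 1))"
      using F by (simp add: zero_le_divide_iff)
    then have "X\<^sup>2 \<le> 0"
      using F by (simp add: zero_le_mult_iff)
    then have "X = 0" by simp
    then show ?thesis by (simp add: X_def)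
  qed
  have "(norm2 M g)\<^sup>2 = (LINT x|M. g x * g x)" unfolding norm2_power2 by (simp add: power2_eq_square)
  also have "\<dots> = \<Lambda> g" using rep[OF g(1)] .
  finally have "(norm2 M g)\<^sup>2 \<le> \<bar>K\<bar> * norm2 M g"
    using bdd[OF g(1)] mult_right_mono[OF abs_ge_self[of K] norm2_nonneg[of M g]] by linarith
  then have "norm2 M g * norm2 M g \<le> \<bar>K\<bar> * norm2 M g" by (simp add: power2_eq_square)
  then have "norm2 M g \<le> \<bar>K\<bar>" using norm2_nonneg[of M g] by (cases "norm2 M g = 0") (auto simp: mult_le_cancel_right)
  then show ?thesis using that g(1) rep by blast
qed

section \<open>Averages over dilations\<close>

lemma integrable_product_mult:
  fixes f :: "'a \<Rightarrow> real" and g :: "'b \<Rightarrow> real"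
  assumes "sigma_finite_measure M1" "sigma_finite_measure M2"
    and f: "integrable M1 f" and g: "integrable M2 g"
  shows "integrable (M1 \<Otimes>\<^sub>M M2) (\<lambda>p. f (fst p) * g (snd p))"
proof -
  interpret pair_sigma_finite M1 M2 using assms by (simp add: pair_sigma_finite_def)
  have [measurable]: "f \<in> borel_measurable M1" "g \<in> borel_measurable M2" using f g by auto
  show ?thesis
  proof (rule Fubini_integrable)
    show "integrable M1 (\<lambda>x. \<integral>y. norm (f (fst (x, y)) * g (snd (x, y))) \<partial>M2)"
      using f g by (simp add: abs_mult)
    show "AE x in M1. integrable M2 (\<lambda>y. f (fst (x, y)) * g (snd (x, y)))"
      using g by simp
  qed measurable
qed

lemma integral_product_mult:
  fixes u v :: "real \<Rightarrow> real"
  assumes "integrable lborel u" "integrable lborel v"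
  shows "(LINT p|(lborel \<Otimes>\<^sub>M lborel). u (fst p) * v (snd p)) = (LINT x|lborel. u x) * (LINT y|lborel. v y)"
proof -
  have "integrable (lborel \<Otimes>\<^sub>M lborel) (\<lambda>(x, y). u x * v y)"
    using integrable_product_mult[OF _ _ assms] by (simp add: case_prod_beta' sigma_finite_lborel)
  from lborel_pair.integral_fst[OF this] show ?thesis by (simp add: case_prod_beta')
qed

text \<open>
  The oriented interval integral keeps \<open>log_int_add\<close> valid for end points in any order, which matters
  because a dilation may move an end point to either side.
\<close>

definition log_int :: "(real \<Rightarrow> real) \<Rightarrow> real \<Rightarrow> real \<Rightarrow> real" where
  "log_int A x y = (LBINT s=ereal x..ereal y. A s / s)"

lemma log_int_integrable:
  assumes [measurable]: "A \<in> borel_measurable borel" and B: "\<And>s. \<bar>A s\<bar> \<le> B" and x: "0 < x" "0 < y"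
  shows "interval_lebesgue_integrable lborel (ereal x) (ereal y) (\<lambda>s. A s / s)"
proof -
  have *: "set_integrable lborel {x<..<y} (\<lambda>s. A s / s)" if x: "0 < x" for x y
    unfolding set_integrable_def
  proof (rule Bochner_Integration.integrable_bound)
    show "integrable lborel (\<lambda>s. B / x * indicator {x<..<y} s)"
      by (intro integrable_mult_right integrable_real_indicator) (cases "x \<le> y"; simp)+
    show "AE s in lborel. norm (indicator {x<..<y} s *\<^sub>R (A s / s)) \<le> norm (B / x * indicator {x<..<y} s)"
    proof (rule AE_I2)
      fix s
      have "\<bar>A s\<bar> / \<bar>s\<bar> \<le> B / x" if "x < s"
        using that x B[of s] by (intro frac_le) auto
      moreover have "0 \<le> B" using B[of 0] by linarith
      ultimately show "norm (indicator {x<..<y} s *\<^sub>R (A s / s)) \<le> norm (B / x * indicator {x<..<y} s)"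
        using x by (auto simp: indicator_def)
    qed
  qed measurable
  show ?thesis
    using *[OF x(1), of y] *[OF x(2), of x] by (auto simp: interval_lebesgue_integrable_def)
qed

lemma log_int_add:
  assumes [measurable]: "A \<in> borel_measurable borel" and B: "\<And>s. \<bar>A s\<bar> \<le> B"
    and "0 < x" "0 < y" "0 < z"
  shows "log_int A x y + log_int A y z = log_int A x z"
  unfolding log_int_def
proof (rule interval_integral_sum)
  have "interval_lebesgue_integrable lborel (ereal (min x (min y z))) (ereal (max x (max y z))) (\<lambda>s. A s / s)"
    using assms by (intro log_int_integrable[OF _ B]) auto
  then show "interval_lebesgue_integrable lborel (min (ereal x) (min (ereal y) (ereal z)))
     (max (ereal x) (max (ereal y) (ereal z))) (\<lambda>s. A s / s)" by simp
qed

lemma log_int_const: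
  assumes "0 < x" "0 < y"
  shows "log_int (\<lambda>_. a) x y = a * (ln y - ln x)"
proof -
  have "(LBINT s=ereal x..ereal y. a / s) = a * ln y - a * ln x"
  proof (rule interval_integral_FTC_finite)
    show "continuous_on {min x y..max x y} (\<lambda>s. a / s)"
      using assms by (intro continuous_intros) auto
    fix s assume "min x y \<le> s" "s \<le> max x y"
    then have "s > 0" using assms by auto
    then show "((\<lambda>s. a * ln s) has_vector_derivative a / s) (at s within {min x y..max x y})"
      by (auto intro!: derivative_eq_intros simp: has_real_derivative_iff_has_vector_derivative[symmetric])
  qed
  then show ?thesis by (simp add: log_int_def right_diff_distrib)
qed

text \<open>
  The measure \<open>ds / s\<close> gives the interval from \<open>x\<close> to \<open>y\<close> the length \<open>\<bar>ln y - ln x\<bar>\<close>. The case \<open>a = 0\<close>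
  with \<open>e\<close> a bound of \<open>A\<close> is the crude estimate, small \<open>e\<close> gives limits at the ends of the half-line.
\<close>

lemma log_int_close:
  assumes A[measurable]: "A \<in> borel_measurable borel" and B: "\<And>s. \<bar>A s\<bar> \<le> B"
    and xy: "0 < x" "0 < y" and e: "\<And>s. min x y < s \<Longrightarrow> s < max x y \<Longrightarrow> \<bar>A s - a\<bar> \<le> e"
  shows "\<bar>log_int A x y - a * (ln y - ln x)\<bar> \<le> e * \<bar>ln y - ln x\<bar>"
proof -
  have *: "\<bar>log_int A x y - a * (ln y - ln x)\<bar> \<le> e * (ln y - ln x)"
    if xy: "0 < x" "x \<le> y" and e: "\<And>s. x < s \<Longrightarrow> s < y \<Longrightarrow> \<bar>A s - a\<bar> \<le> e" for x y
  proof -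
    have y: "0 < y" using xy by linarith
    have i1: "interval_lebesgue_integrable lborel (ereal x) (ereal y) (\<lambda>s. A s / s)"
      using xy y by (intro log_int_integrable[OF A B])
    have i2: "interval_lebesgue_integrable lborel (ereal x) (ereal y) (\<lambda>s. a / s)" for a
      using xy y by (intro log_int_integrable[of "\<lambda>_. a" "\<bar>a\<bar>"]) auto
    have "log_int A x y - a * (ln y - ln x) = (LBINT s=ereal x..ereal y. A s / s - a / s)"
      using log_int_const[OF xy(1) y, of a] i1 i2[of a]
      by (simp add: log_int_def interval_lebesgue_integral_diff)
    also have "\<bar>\<dots>\<bar> \<le> (LBINT s=ereal x..ereal y. norm (A s / s - a / s))"
      using interval_integral_norm[of "ereal x" "ereal y" "\<lambda>s. A s / s - a / s"] i1 i2[of a] xy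
      by (auto simp: interval_lebesgue_integral_diff)
    also have "\<dots> \<le> (LBINT s=ereal x..ereal y. e / s)"
    proof -
      have "interval_lebesgue_integrable lborel (ereal x) (ereal y) (\<lambda>s. A s / s - a / s)"
        using i1 i2[of a] by (rule interval_lebesgue_integral_diff)
      then have s1: "set_integrable lborel {x<..<y} (\<lambda>s. norm (A s / s - a / s))"
        using xy by (auto simp: interval_lebesgue_integrable_def intro: set_integrable_abs)
      have s2: "set_integrable lborel {x<..<y} (\<lambda>s. e / s)"
        using xy i2[of e] by (auto simp: interval_lebesgue_integrable_def)
      have "(LBINT s:{x<..<y}. norm (A s / s - a / s)) \<le> (LBINT s:{x<..<y}. e / s)"
      proof (rule set_integral_mono[OF s1 s2])
        fix s assume "s \<in> {x<..<y}"
        then have "s > 0" "\<bar>A s - a\<bar> \<le> e" using e xy by auto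
        then show "norm (A s / s - a / s) \<le> e / s"
          by (simp add: diff_divide_distrib[symmetric] divide_right_mono)
      qed
      then show ?thesis using xy by (simp add: interval_lebesgue_integral_def)
    qed
    also have "\<dots> = e * (ln y - ln x)"
      using log_int_const[OF xy(1) y, of e] by (simp add: log_int_def)
    finally show ?thesis .
  qed
  show ?thesis
  proof (cases "x \<le> y")
    case True
    then show ?thesis using *[of x y] xy e by (auto simp: ln_le_cancel_iff)
  next
    case False
    have "log_int A x y = - log_int A y x"
      unfolding log_int_def by (rule interval_integral_endpoints_reverse)
    moreover have "\<bar>log_int A y x - a * (ln x - ln y)\<bar> \<le> e * (ln x - ln y)"
      using False xy e by (intro *) auto
    moreover have "\<bar>ln y - ln x\<bar> = ln x - ln y" using False xy by simp
    ultimately show ?thesis by (simp add: algebra_simps)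
  qed
qed

lemma log_int_scale:
  assumes "0 < q" "a < b"
  shows "(LINT h|lborel. indicator {a<..<b} h / h * A (h * q)) = log_int A (a * q) (b * q)"
proof -
  have "log_int A (a * q) (b * q) = (LINT s|lborel. indicator {a * q<..<b * q} s * (A s / s))"
    using assms by (simp add: log_int_def interval_lebesgue_integral_def set_lebesgue_integral_def)
  also have "\<dots> = \<bar>q\<bar> *\<^sub>R (LINT h|lborel. indicator {a * q<..<b * q} (0 + q * h) * (A (0 + q * h) / (0 + q * h)))"
    using assms by (intro lborel_integral_real_affine) auto
  also have "\<dots> = (LINT h|lborel. q * (indicator {a * q<..<b * q} (q * h) * (A (q * h) / (q * h))))"
    using assms by (simp only: real_scaleR_def abs_of_pos add_0 integral_mult_right_zero)
  also have "\<dots> = (LINT h|lborel. indicator {a<..<b} h / h * A (h * q))"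
    using assms by (intro Bochner_Integration.integral_cong)
       (auto simp: indicator_def mult.commute field_simps)
  finally show ?thesis ..
qed

text \<open>
  A weight \<open>g\<close> with integral zero is averaged against the dilated values \<open>A (h * q w)\<close> of a bounded
  function \<open>A\<close>, and the result is integrated against \<open>dh / h\<close> over an interval, which gives \<open>scale_int\<close>.
  The measure \<open>dh / h\<close> is invariant under dilations, so without the cancellation in \<open>g\<close> every value of
  \<open>q\<close> would contribute the same divergent amount; with it, only the logarithm of \<open>q\<close> survives as the
  interval exhausts the half-line.
\<close>

locale log_scale =
  fixes M :: "'a measure" and g q :: "'a \<Rightarrow> real"
  assumes sfin: "sigma_finite_measure M"
    and g_int: "integrable M g" and g0: "(LINT w|M. g w) = 0"
    and q_meas[measurable]: "q \<in> borel_measurable M" and q_pos: "AE w in M. 0 < q w"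
    and gq_int: "integrable M (\<lambda>w. g w * ln (q w))"
begin

lemma g_meas[measurable]: "g \<in> borel_measurable M"
  using g_int by auto

definition scale_int :: "(real \<Rightarrow> real) \<Rightarrow> real \<Rightarrow> real \<Rightarrow> real" where
  "scale_int A a b = (LINT h|lborel. indicator {a<..<b} h / h * (LINT w|M. g w * A (h * q w)))"

definition incr :: "(real \<Rightarrow> real) \<Rightarrow> real \<Rightarrow> real \<Rightarrow> 'a \<Rightarrow> real" where
  "incr A a b w = (LINT h|lborel. indicator {a<..<b} h / h * A (h * q w)) - log_int A a b"

lemma incr_measurable[measurable (raw)]:
  assumes [measurable]: "A \<in> borel_measurable borel"
  shows "incr A a b \<in> borel_measurable M"
  unfolding incr_def by (intro borel_measurable_diff borel_measurable_const) measurable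

lemma incr_eq:
  assumes A: "A \<in> borel_measurable borel" "\<And>s. \<bar>A s\<bar> \<le> B" and "0 < a" "a < b" "0 < q w"
  shows "incr A a b w = log_int A b (b * q w) - log_int A a (a * q w)"
proof -
  have "log_int A a (a * q w) + log_int A (a * q w) (b * q w) = log_int A a (b * q w)"
       "log_int A a b + log_int A b (b * q w) = log_int A a (b * q w)"
    using assms by (auto intro!: log_int_add[OF A])
  then show ?thesis unfolding incr_def log_int_scale[OF assms(5,4)] by linarith
qed

lemma incr_bound:
  assumes A: "A \<in> borel_measurable borel" "\<And>s. \<bar>A s\<bar> \<le> B" and ab: "0 < a" "a < b" and q: "0 < q w"
  shows "\<bar>incr A a b w\<bar> \<le> 2 * B * \<bar>ln (q w)\<bar>"
proof -
  have "\<bar>log_int A x (x * q w)\<bar> \<le> B * \<bar>ln (q w)\<bar>" if "0 < x" for x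
    using log_int_close[OF A, of x "x * q w" 0 B] that q A(2) by (simp add: ln_mult)
  from this[of a] this[of b] ab show ?thesis
    unfolding incr_eq[OF A ab q] by linarith
qed

lemma g_incr_integrable:
  assumes A[measurable]: "A \<in> borel_measurable borel" and B: "\<And>s. \<bar>A s\<bar> \<le> B" and ab: "0 < a" "a < b"
  shows "integrable M (\<lambda>w. g w * incr A a b w)"
proof (rule Bochner_Integration.integrable_bound)
  show "integrable M (\<lambda>w. 2 * B * (g w * ln (q w)))" using gq_int by simp
  have B0: "0 \<le> B" using B[of 0] by linarith
  show "AE w in M. norm (g w * incr A a b w) \<le> norm (2 * B * (g w * ln (q w)))"
    using q_pos
  proof eventually_elim
    case (elim w)
    then show ?case using incr_bound[OF A B ab elim] B0
      by (simp add: abs_mult) (metis ab_semigroup_mult_class.mult_ac(1) abs_ge_zero mult.left_commute mult_left_mono)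
  qed
qed measurable

text \<open>
  The integral of \<open>g\<close> vanishes, hence the part \<open>log_int A a b\<close>, which does not depend on \<open>w\<close>, may be
  subtracted from the inner integral. What remains is \<open>incr\<close>, the contribution of two boundary
  intervals by which the dilated interval differs from the original one.
\<close>

lemma scale_int_eq:
  assumes A[measurable]: "A \<in> borel_measurable borel" and B: "\<And>s. \<bar>A s\<bar> \<le> B" and ab: "0 < a" "a < b"
  shows "scale_int A a b = (LINT w|M. g w * incr A a b w)"
proof -
  interpret M: sigma_finite_measure M by (rule sfin)
  interpret P: pair_sigma_finite lborel M by (intro pair_sigma_finite.intro) unfold_locales
  have ih: "integrable lborel (\<lambda>h. indicator {a<..<b} h / h)"
  proof -
    have "interval_lebesgue_integrable lborel (ereal a) (ereal b) (\<lambda>s. 1 / s)"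
      using ab by (intro log_int_integrable[of "\<lambda>_. 1" 1]) auto
    then show ?thesis using ab
      by (simp add: interval_lebesgue_integrable_def set_integrable_def divide_inverse)
  qed
  have "integrable (lborel \<Otimes>\<^sub>M M) (\<lambda>p. B * ((indicator {a<..<b} (fst p) / fst p) * g (snd p)))"
    by (intro integrable_mult_right integrable_product_mult ih g_int sfin) unfold_locales
  then have I: "integrable (lborel \<Otimes>\<^sub>M M) (\<lambda>p. indicator {a<..<b} (fst p) / fst p * (g (snd p) * A (fst p * q (snd p))))"
  proof (rule Bochner_Integration.integrable_bound)
    show "AE p in lborel \<Otimes>\<^sub>M M. norm (indicator {a<..<b} (fst p) / fst p * (g (snd p) * A (fst p * q (snd p))))
        \<le> norm (B * ((indicator {a<..<b} (fst p) / fst p) * g (snd p)))"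
    proof (rule AE_I2)
      fix p :: "real \<times> 'a"
      define z where "z = \<bar>indicator {a<..<b} (fst p) / fst p * g (snd p)\<bar>"
      have "z * \<bar>A (fst p * q (snd p))\<bar> \<le> z * B" by (intro mult_left_mono B) (simp add: z_def)
      moreover have "0 \<le> B" using B[of 0] by linarith
      ultimately show "norm (indicator {a<..<b} (fst p) / fst p * (g (snd p) * A (fst p * q (snd p))))
        \<le> norm (B * ((indicator {a<..<b} (fst p) / fst p) * g (snd p)))"
        by (simp add: z_def abs_mult mult_ac)
    qed
  qed measurable
  have "scale_int A a b = (LINT h|lborel. LINT w|M. indicator {a<..<b} h / h * (g w * A (h * q w)))"
    unfolding scale_int_def by simp
  also have "\<dots> = (LINT w|M. LINT h|lborel. indicator {a<..<b} h / h * (g w * A (h * q w)))"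
    using I by (intro P.Fubini_integral[symmetric]) (simp add: case_prod_beta')
  also have "\<dots> = (LINT w|M. g w * (incr A a b w + log_int A a b))"
  proof (intro Bochner_Integration.integral_cong refl)
    fix w
    have "(LINT h|lborel. indicator {a<..<b} h / h * (g w * A (h * q w)))
        = (LINT h|lborel. g w * (indicator {a<..<b} h / h * A (h * q w)))"
      by (simp add: mult_ac)
    also have "\<dots> = g w * (LINT h|lborel. indicator {a<..<b} h / h * A (h * q w))"
      by (rule integral_mult_right_zero)
    finally show "(LINT h|lborel. indicator {a<..<b} h / h * (g w * A (h * q w)))
        = g w * (incr A a b w + log_int A a b)" by (simp add: incr_def)
  qed
  also have "\<dots> = (LINT w|M. g w * incr A a b w + log_int A a b * g w)"
    by (simp add: algebra_simps)
  also have "\<dots> = (LINT w|M. g w * incr A a b w)"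
    using g_incr_integrable[OF A B ab] g_int g0 by simp
  finally show ?thesis .
qed

text \<open>
  Both boundary intervals have length \<open>\<bar>ln (q w)\<bar>\<close> with respect to \<open>ds / s\<close>, whatever \<open>a\<close> and \<open>b\<close> are.
\<close>

lemma scale_int_bound:
  assumes A[measurable]: "A \<in> borel_measurable borel" and B: "\<And>s. \<bar>A s\<bar> \<le> B" and ab: "0 < a" "a < b"
  shows "\<bar>scale_int A a b\<bar> \<le> 2 * B * (LINT w|M. \<bar>g w * ln (q w)\<bar>)"
proof -
  have "\<bar>scale_int A a b\<bar> \<le> (LINT w|M. \<bar>g w * incr A a b w\<bar>)"
    unfolding scale_int_eq[OF A B ab] by (rule integral_abs_bound)
  also have "\<dots> \<le> (LINT w|M. 2 * B * \<bar>g w * ln (q w)\<bar>)"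
  proof (rule integral_mono_AE)
    show "AE w in M. \<bar>g w * incr A a b w\<bar> \<le> 2 * B * \<bar>g w * ln (q w)\<bar>"
      using q_pos
    proof eventually_elim
      case (elim w)
      then have "\<bar>g w\<bar> * \<bar>incr A a b w\<bar> \<le> \<bar>g w\<bar> * (2 * B * \<bar>ln (q w)\<bar>)"
        by (intro mult_left_mono incr_bound[OF A B ab]) auto
      then show ?case by (simp add: abs_mult mult_ac)
    qed
  qed (use g_incr_integrable[OF A B ab] gq_int in auto)
  finally show ?thesis by simp
qed

text \<open>
  The boundary interval near infinity contributes nothing in the limit, the one near zero contributes
  \<open>a0 * ln (q w)\<close>; the bound of \<open>incr_bound\<close> permits dominated convergence.
\<close>

lemma scale_int_limit:
  assumes A[measurable]: "A \<in> borel_measurable borel" and B: "\<And>s. \<bar>A s\<bar> \<le> B"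
    and lim0: "(A \<longlongrightarrow> a0) (at_right 0)" and limi: "(A \<longlongrightarrow> 0) at_top"
  shows "(\<lambda>n. scale_int A (1 / real (n + 2)) (real (n + 2))) \<longlonglongrightarrow> - a0 * (LINT w|M. g w * ln (q w))"
proof -
  let ?a = "\<lambda>n. 1 / real (n + 2)" and ?b = "\<lambda>n. real (n + 2)"
  have ab: "0 < ?a n" "?a n < ?b n" for n
    using less_1_mult[of "2 + real n" "2 + real n"] by (auto simp: divide_less_eq add.commute)
  have "(\<lambda>n. LINT w|M. g w * incr A (?a n) (?b n) w) \<longlonglongrightarrow> (LINT w|M. - a0 * (g w * ln (q w)))"
  proof (rule integral_dominated_convergence)
    show "integrable M (\<lambda>w. 2 * B * \<bar>g w * ln (q w)\<bar>)" using gq_int by simp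
    show "AE w in M. norm (g w * incr A (?a n) (?b n) w) \<le> 2 * B * \<bar>g w * ln (q w)\<bar>" for n
      using q_pos
    proof eventually_elim
      case (elim w)
      then have "\<bar>g w\<bar> * \<bar>incr A (?a n) (?b n) w\<bar> \<le> \<bar>g w\<bar> * (2 * B * \<bar>ln (q w)\<bar>)"
        by (intro mult_left_mono incr_bound[OF A B ab]) auto
      then show ?case by (simp add: abs_mult mult_ac)
    qed
    show "AE w in M. (\<lambda>n. g w * incr A (?a n) (?b n) w) \<longlonglongrightarrow> - a0 * (g w * ln (q w))"
      using q_pos
    proof eventually_elim
      case (elim w)
      define Q where "Q = q w"
      have Q: "0 < Q" using elim by (simp add: Q_def)
      define m where "m = min 1 Q"
      have m: "0 < m" "m \<le> 1" "m \<le> Q" using Q by (auto simp: m_def)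
      have L1: "(\<lambda>n. log_int A (?b n) (?b n * Q)) \<longlonglongrightarrow> 0"
      proof (rule tendstoI)
        fix e :: real assume e: "e > 0"
        define e' where "e' = e / (\<bar>ln Q\<bar> + 1)"
        have e': "e' > 0" using e by (simp add: e'_def)
        have "\<forall>\<^sub>F s in at_top. dist (A s) 0 < e'" using limi e' by (rule tendstoD)
        then obtain K where K: "\<And>s. K \<le> s \<Longrightarrow> \<bar>A s\<bar> < e'" by (auto simp: eventually_at_top_linorder)
        have "\<forall>\<^sub>F n in sequentially. ?b n * m \<ge> K" using m by real_asymp
        then show "\<forall>\<^sub>F n in sequentially. dist (log_int A (?b n) (?b n * Q)) 0 < e"
        proof eventually_elim
          case (elim n)
          have "\<bar>log_int A (?b n) (?b n * Q) - 0 * (ln (?b n * Q) - ln (?b n))\<bar>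
              \<le> e' * \<bar>ln (?b n * Q) - ln (?b n)\<bar>"
          proof (rule log_int_close[OF A B])
            fix s assume s: "min (?b n) (?b n * Q) < s"
            have "?b n * m \<le> ?b n" "?b n * m \<le> ?b n * Q"
              using m mult_left_mono[of m 1 "?b n"] mult_left_mono[of m Q "?b n"] by auto
            then have "K \<le> s" using s elim by linarith
            then show "\<bar>A s - 0\<bar> \<le> e'" using K[of s] by simp
          qed (use Q in auto)
          also have "ln (?b n * Q) - ln (?b n) = ln Q" using Q by (simp add: ln_mult)
          also have "e' * \<bar>ln Q\<bar> < e' * (\<bar>ln Q\<bar> + 1)" using e' by simp
          also have "\<dots> = e" by (simp add: e'_def)
          finally show ?case by simp
        qed
      qed
      have L2: "(\<lambda>n. log_int A (?a n) (?a n * Q)) \<longlonglongrightarrow> a0 * ln Q"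
      proof (rule tendstoI)
        fix e :: real assume e: "e > 0"
        define e' where "e' = e / (\<bar>ln Q\<bar> + 1)"
        have e': "e' > 0" using e by (simp add: e'_def)
        have "\<forall>\<^sub>F s in at_right 0. dist (A s) a0 < e'" using lim0 e' by (rule tendstoD)
        then obtain K where K: "K > 0" "\<And>s. 0 < s \<Longrightarrow> s < K \<Longrightarrow> \<bar>A s - a0\<bar> < e'"
          by (auto simp: eventually_at_right_field dist_real_def)
        have "\<forall>\<^sub>F n in sequentially. ?a n * max 1 Q < K" using K Q by real_asymp
        then show "\<forall>\<^sub>F n in sequentially. dist (log_int A (?a n) (?a n * Q)) (a0 * ln Q) < e"
        proof eventually_elim
          case (elim n)
          have a: "0 < ?a n" by simp
          have eq: "ln (?a n * Q) - ln (?a n) = ln Q" using Q a by (subst ln_mult) auto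
          have "\<bar>log_int A (?a n) (?a n * Q) - a0 * (ln (?a n * Q) - ln (?a n))\<bar>
              \<le> e' * \<bar>ln (?a n * Q) - ln (?a n)\<bar>"
          proof (rule log_int_close[OF A B])
            fix s assume s: "min (?a n) (?a n * Q) < s" "s < max (?a n) (?a n * Q)"
            have "?a n \<le> ?a n * max 1 Q" "?a n * Q \<le> ?a n * max 1 Q"
              using a mult_left_mono[of 1 "max 1 Q" "?a n"] mult_left_mono[of Q "max 1 Q" "?a n"] by auto
            then have "s < K" using s elim by linarith
            moreover have "0 < s" using s(1) a mult_pos_pos[OF a Q] by linarith
            ultimately show "\<bar>A s - a0\<bar> \<le> e'" using K(2)[of s] by simp
          qed (use Q a mult_pos_pos[OF a Q] in auto)
          also have "e' * \<bar>ln (?a n * Q) - ln (?a n)\<bar> < e' * (\<bar>ln Q\<bar> + 1)" unfolding eq using e' by simp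
          also have "\<dots> = e" by (simp add: e'_def)
          finally show ?case unfolding eq by (simp add: dist_real_def)
        qed
      qed
      have "(\<lambda>n. g w * (log_int A (?b n) (?b n * Q) - log_int A (?a n) (?a n * Q)))
          \<longlonglongrightarrow> g w * (0 - a0 * ln Q)"
        by (intro tendsto_intros L1 L2)
      moreover have "incr A (?a n) (?b n) w = log_int A (?b n) (?b n * Q) - log_int A (?a n) (?a n * Q)" for n
        unfolding Q_def by (rule incr_eq[OF A B ab elim])
      ultimately show ?case by (simp add: Q_def mult_ac)
    qed
  qed measurable
  then show ?thesis using scale_int_eq[OF A B ab] by simp
qed

end

section \<open>The kernel of the differences of a fractional integral\<close>

lemma nn_integral_powr_from_0:
  fixes c e :: real
  assumes "-1 < e" "0 \<le> c"
  shows "(\<integral>\<^sup>+x. ennreal (indicator {0..c} x * x powr e) \<partial>lborel) = ennreal (c powr (e + 1) / (e + 1))"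
  using nn_integral_has_integral_lebesgue[OF _ has_integral_powr_from_0[OF assms]] by simp

lemma nn_integral_powr_to_inf:
  fixes c e :: real
  assumes "e < -1" "0 < c"
  shows "(\<integral>\<^sup>+x. ennreal (indicator {c..} x * x powr e) \<partial>lborel) = ennreal (- (c powr (e + 1)) / (e + 1))"
  using nn_integral_has_integral_lebesgue[OF _ has_integral_powr_to_inf[OF assms]] by simp

lemma powr_from_0_lborel:
  fixes c e :: real
  assumes "-1 < e" "0 \<le> c"
  shows "integrable lborel (\<lambda>x. indicator {0..c} x * x powr e)"
    and "(LINT x|lborel. indicator {0..c} x * x powr e) = c powr (e + 1) / (e + 1)"
proof -
  note nn = nn_integral_powr_from_0[OF assms]
  show "integrable lborel (\<lambda>x. indicator {0..c} x * x powr e)"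
    by (rule integrableI_nonneg) (use nn in auto)
  show "(LINT x|lborel. indicator {0..c} x * x powr e) = c powr (e + 1) / (e + 1)"
    by (subst integral_eq_nn_integral) (use nn assms in auto)
qed

lemma powr_to_inf_lborel:
  fixes c e :: real
  assumes "e < -1" "0 < c"
  shows "integrable lborel (\<lambda>x. indicator {c..} x * x powr e)"
  by (rule integrableI_nonneg) (use nn_integral_powr_to_inf[OF assms] in auto)

locale frac_order =
  fixes \<alpha> :: real
  assumes alpha: "0 < \<alpha>" "\<alpha> < 1"
begin

definition pow_ker :: "real \<Rightarrow> real" where
  "pow_ker x = (if 0 < x then x powr (\<alpha> - 1) else 0)"

text \<open>
  The kernel of the difference over the step one of a convolution with \<open>pow_ker\<close>. Since \<open>pow_ker\<close> is
  homogeneous, its dilations represent the differences over all other steps, see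
  \<open>back_int_difference\<close>. Unlike \<open>pow_ker\<close> it is integrable, and its integral is zero.
\<close>

definition diff_ker :: "real \<Rightarrow> real" where
  "diff_ker x = pow_ker x - pow_ker (x - 1)"

lemma pow_ker_measurable[measurable]: "pow_ker \<in> borel_measurable borel"
  unfolding pow_ker_def[abs_def] by measurable

lemma diff_ker_measurable[measurable]: "diff_ker \<in> borel_measurable borel"
  unfolding diff_ker_def[abs_def] by measurable

lemma pow_ker_nonneg: "0 \<le> pow_ker x"
  by (simp add: pow_ker_def)

lemma pow_ker_eq_0: "x \<le> 0 \<Longrightarrow> pow_ker x = 0"
  by (simp add: pow_ker_def)

lemma diff_ker_eq_0: "x \<le> 0 \<Longrightarrow> diff_ker x = 0"
  by (simp add: diff_ker_def pow_ker_def)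

lemma diff_ker_pos: "0 < x \<Longrightarrow> x \<le> 1 \<Longrightarrow> 0 < diff_ker x"
  by (simp add: diff_ker_def pow_ker_def)

lemma pow_ker_antimono: "0 < x \<Longrightarrow> x \<le> y \<Longrightarrow> pow_ker y \<le> pow_ker x"
  using alpha by (auto simp: pow_ker_def intro!: powr_mono2')

lemma diff_ker_nonpos: "1 < x \<Longrightarrow> diff_ker x \<le> 0"
  using pow_ker_antimono[of "x - 1" x] by (simp add: diff_ker_def)

lemma diff_ker_far: 
  assumes x: "2 \<le> x" shows "\<bar>diff_ker x\<bar> \<le> 2 powr (2 - \<alpha>) * x powr (\<alpha> - 2)"
proof -
  have "\<exists>z>x - 1. z < x \<and> (x powr (\<alpha> - 1)) - ((x - 1) powr (\<alpha> - 1)) = (x - (x - 1)) * ((\<alpha> - 1) * z powr (\<alpha> - 2))"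
    using x by (intro MVT2) (auto intro!: derivative_eq_intros simp: algebra_simps)
  then obtain z where z: "x - 1 < z" "z < x" and e: "x powr (\<alpha> - 1) - (x - 1) powr (\<alpha> - 1) = (\<alpha> - 1) * z powr (\<alpha> - 2)"
    by auto
  have "\<bar>diff_ker x\<bar> = (1 - \<alpha>) * z powr (\<alpha> - 2)"
    using x e alpha by (simp add: diff_ker_def pow_ker_def abs_mult)
  also have "\<dots> \<le> 1 * (x / 2) powr (\<alpha> - 2)"
    using alpha z x by (intro mult_mono powr_mono2') auto
  also have "\<dots> = 2 powr (2 - \<alpha>) * x powr (\<alpha> - 2)"
  proof -
    have "(x / 2) powr (\<alpha> - 2) = x powr (\<alpha> - 2) / 2 powr (\<alpha> - 2)"
      by (rule powr_divide)
    moreover have "2 powr (2 - \<alpha>) = inverse (2 powr (\<alpha> - 2))"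
      by (metis minus_diff_eq powr_minus)
    ultimately show ?thesis by (simp only: divide_inverse mult.commute mult_1)
  qed
  finally show ?thesis .
qed

text \<open>
  The kernel is of the order of \<open>x powr (\<alpha> - 1)\<close> at \<open>0\<close>, of \<open>(x - 1) powr (\<alpha> - 1)\<close> to the right of \<open>1\<close>, and
  of \<open>x powr (\<alpha> - 2)\<close> at infinity by the mean value theorem. The conditions on \<open>p\<close> and \<open>d\<close> are the
  integrability conditions for the three powers.
\<close>

lemma diff_ker_weighted_power_integrable:
  assumes d: "0 \<le> d" and p: "0 < p" "-1 < p * (\<alpha> - 1)" "d + p * (\<alpha> - 2) < -1"
  shows "integrable lborel (\<lambda>x. \<bar>x\<bar> powr d * \<bar>diff_ker x\<bar> powr p)"
proof -
  let ?e = "p * (\<alpha> - 1)" and ?f = "d + p * (\<alpha> - 2)"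
  let ?C = "2 powr ((2 - \<alpha>) * p)"
  let ?D = "\<lambda>x. indicator {0..1} x * x powr ?e + 2 powr d * (indicator {0..1} (x - 1) * (x - 1) powr ?e)
       + ?C * (indicator {2..} x * x powr ?f)"
  show ?thesis
  proof (rule Bochner_Integration.integrable_bound)
    have "integrable lborel (\<lambda>x::real. indicator {0..1} (-1 + 1 * x) * (-1 + 1 * x) powr ?e)"
      using lborel_integrable_real_affine[OF powr_from_0_lborel(1)[OF p(2), of 1], of 1 "-1"] by simp
    then show "integrable lborel ?D"
      using powr_from_0_lborel(1)[OF p(2), of 1] powr_to_inf_lborel[OF p(3), of 2]
      by (intro Bochner_Integration.integrable_add integrable_mult_right) simp_all
    show "AE x in lborel. norm (\<bar>x\<bar> powr d * \<bar>diff_ker x\<bar> powr p) \<le> norm (?D x)"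
    proof (rule AE_I2)
      fix x :: real
      have nn: "0 \<le> indicator {0..1} x * x powr ?e" "0 \<le> 2 powr d * (indicator {0..1} (x - 1) * (x - 1) powr ?e)"
        "0 \<le> ?C * (indicator {2..} x * x powr ?f)" by auto
      have "\<bar>x\<bar> powr d * \<bar>diff_ker x\<bar> powr p \<le> ?D x"
      proof -
        consider "x \<le> 0" | "0 < x" "x \<le> 1" | "1 < x" "x \<le> 2" | "2 < x" by linarith
        then show ?thesis
        proof cases
          case 1 then show ?thesis using nn by (simp add: diff_ker_eq_0)
        next
          case 2
          have "\<bar>x\<bar> powr d * \<bar>diff_ker x\<bar> powr p \<le> 1 * (x powr (\<alpha> - 1)) powr p"
            using 2 d p by (intro mult_mono) (auto simp: diff_ker_def pow_ker_def powr_le1)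
          also have "\<dots> = indicator {0..1} x * x powr ?e" using 2 by (simp add: powr_powr mult.commute)
          finally show ?thesis using nn by linarith
        next
          case 3
          have "\<bar>diff_ker x\<bar> \<le> (x - 1) powr (\<alpha> - 1)"
            using diff_ker_nonpos[of x] 3 by (simp add: diff_ker_def pow_ker_def)
          then have "\<bar>diff_ker x\<bar> powr p \<le> ((x - 1) powr (\<alpha> - 1)) powr p" using p by (intro powr_mono2) auto
          then have "\<bar>x\<bar> powr d * \<bar>diff_ker x\<bar> powr p \<le> 2 powr d * ((x - 1) powr (\<alpha> - 1)) powr p"
            using 3 d p powr_mono2[of d "\<bar>x\<bar>" 2] by (intro mult_mono) auto
          also have "\<dots> = 2 powr d * (indicator {0..1} (x - 1) * (x - 1) powr ?e)"
            using 3 by (simp add: powr_powr mult.commute)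
          finally show ?thesis using nn by linarith
        next
          case 4
          have "\<bar>diff_ker x\<bar> powr p \<le> (2 powr (2 - \<alpha>) * x powr (\<alpha> - 2)) powr p"
            using p 4 by (intro powr_mono2 diff_ker_far) auto
          then have "\<bar>x\<bar> powr d * \<bar>diff_ker x\<bar> powr p \<le> x powr d * (2 powr (2 - \<alpha>) * x powr (\<alpha> - 2)) powr p"
            using 4 by (intro mult_mono) auto
          also have "\<dots> = ?C * (x powr d * x powr (p * (\<alpha> - 2)))"
            using 4 by (simp add: powr_mult powr_powr mult.commute mult.left_commute)
          also have "\<dots> = ?C * (indicator {2..} x * x powr ?f)"
            using 4 by (simp add: powr_add)
          finally show ?thesis using nn by linarith
        qed
      qed
      then show "norm (\<bar>x\<bar> powr d * \<bar>diff_ker x\<bar> powr p) \<le> norm (?D x)"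
        by simp
    qed
  qed measurable
qed

lemma diff_ker_integrable: "integrable lborel diff_ker"
proof -
  have "integrable lborel (\<lambda>x. \<bar>x\<bar> powr 0 * \<bar>diff_ker x\<bar> powr 1)"
    using alpha by (intro diff_ker_weighted_power_integrable) auto
  then show ?thesis
  proof (rule Bochner_Integration.integrable_bound)
    show "AE x in lborel. norm (diff_ker x) \<le> norm (\<bar>x\<bar> powr 0 * \<bar>diff_ker x\<bar> powr 1)"
      by (rule AE_I2) (auto simp: diff_ker_eq_0)
  qed measurable
qed

lemma pow_ker_truncated:
  assumes "0 \<le> c"
  shows "integrable lborel (\<lambda>x. indicator {..c} x * pow_ker x)" "(LINT x|lborel. indicator {..c} x * pow_ker x) = c powr \<alpha> / \<alpha>"
proof -
  have "(\<lambda>x. indicator {..c} x * pow_ker x) = (\<lambda>x. indicator {0..c} x * x powr (\<alpha> - 1))"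
    by (auto simp: fun_eq_iff indicator_def pow_ker_def)
  then show "integrable lborel (\<lambda>x. indicator {..c} x * pow_ker x)" "(LINT x|lborel. indicator {..c} x * pow_ker x) = c powr \<alpha> / \<alpha>"
    using powr_from_0_lborel[of "\<alpha> - 1" c] assms alpha by simp_all
qed

text \<open>
  The integral over \<open>{..n + 1}\<close> is \<open>((n + 1) powr \<alpha> - n powr \<alpha>) / \<alpha>\<close>, which tends to zero because \<open>\<alpha> < 1\<close>.
\<close>

lemma diff_ker_integral: "(LINT x|lborel. diff_ker x) = 0"
proof -
  have eq: "(LINT x|lborel. indicator {..real (n + 1)} x * diff_ker x) = real (n + 1) powr \<alpha> / \<alpha> - real n powr \<alpha> / \<alpha>" for n
  proof -
    have sh: "indicator {..real n} (-1 + 1 * x) * pow_ker (-1 + 1 * x) = indicator {..real (n + 1)} x * pow_ker (x - 1)" for x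
      by (auto simp: indicator_def)
    have "integrable lborel (\<lambda>x. indicator {..real n} (-1 + 1 * x) * pow_ker (-1 + 1 * x))"
      by (rule lborel_integrable_real_affine[OF pow_ker_truncated(1)]) auto
    moreover have "(LINT x|lborel. indicator {..real n} (-1 + 1 * x) * pow_ker (-1 + 1 * x)) = real n powr \<alpha> / \<alpha>"
      using lborel_integral_real_affine[of 1 "\<lambda>x. indicator {..real n} x * pow_ker x" "-1"] pow_ker_truncated(2)[of "real n"] by simp
    ultimately show ?thesis
      unfolding sh diff_ker_def right_diff_distrib using pow_ker_truncated[of "real (n + 1)"] by simp
  qed
  have "(\<lambda>n. LINT x|lborel. indicator {..real (n + 1)} x * diff_ker x) \<longlonglongrightarrow> (LINT x|lborel. diff_ker x)"
  proof (rule integral_dominated_convergence)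
    show "integrable lborel (\<lambda>x. \<bar>diff_ker x\<bar>)" using diff_ker_integrable by simp
    show "AE x in lborel. (\<lambda>n. indicator {..real (n + 1)} x * diff_ker x) \<longlonglongrightarrow> diff_ker x"
    proof (rule AE_I2)
      fix x
      obtain N where N: "x \<le> real N" using real_arch_simple by blast
      have "\<forall>\<^sub>F n in sequentially. indicator {..real (n + 1)} x * diff_ker x = diff_ker x"
        using eventually_ge_at_top[of N] by eventually_elim (use N in auto)
      then show "(\<lambda>n. indicator {..real (n + 1)} x * diff_ker x) \<longlonglongrightarrow> diff_ker x"
        by (rule tendsto_eventually)
    qed
  qed (auto simp: indicator_def)
  moreover have "(\<lambda>n. real (n + 1) powr \<alpha> / \<alpha> - real n powr \<alpha> / \<alpha>) \<longlonglongrightarrow> 0"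
    using alpha by real_asymp
  ultimately show ?thesis unfolding eq by (rule LIMSEQ_unique)
qed

text \<open>
  Where \<open>z = \<bar>x - s * y\<bar>\<close> is at least \<open>1\<close>, the logarithm is bounded by a small power of \<open>\<bar>x\<bar>\<close> and \<open>\<bar>y\<bar>\<close>,
  against which the kernel is integrable. Where \<open>z < 1\<close>, the product of \<open>a = \<bar>diff_ker y\<bar>\<close> and the
  logarithm \<open>l\<close> is split as in Young's inequality, \<open>a * l \<le> a powr (1 + \<alpha>) + l powr (1 + 1 / \<alpha>)\<close>: the
  power \<open>1 + \<alpha>\<close> of the kernel is still integrable, and every power of the logarithm is integrable near
  zero, so that the second term is a convolution of integrable functions.
\<close>

lemma diff_ker_product_log_integrable:
  assumes s: "\<bar>s\<bar> = 1"
  shows "integrable (lborel \<Otimes>\<^sub>M lborel) (\<lambda>p. diff_ker (fst p) * diff_ker (snd p) * ln \<bar>fst p - s * snd p\<bar>)"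
proof -
  \<comment> \<open>Half of the critical exponent: \<open>\<bar>x\<bar> powr d * \<bar>diff_ker x\<bar>\<close> is integrable at infinity iff \<open>d < 1 - \<alpha>\<close>.\<close>
  define d where "d = (1 - \<alpha>) / 2"
  have d: "0 < d" "d \<le> 1" using alpha by (auto simp: d_def)
  \<comment> \<open>Chosen such that \<open>d' * e = 1/2\<close>; then \<open>\<bar>ln z\<bar> powr e\<close> is at most a multiple of \<open>z powr (-1/2)\<close>.\<close>
  define d' where "d' = \<alpha> / (2 * (1 + \<alpha>))"
  have d': "0 < d'" using alpha by (auto simp: d'_def)
  define e where "e = 1 + 1 / \<alpha>"
  have "e = (1 + \<alpha>) / \<alpha>" using alpha by (simp add: e_def field_simps)
  then have d'e: "d' * e = 1 / 2" using alpha by (simp add: d'_def)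
  define K where "K = (1 / d') powr e"
  let ?k = "\<lambda>z::real. indicator {-1..1} z * \<bar>z\<bar> powr (-1/2)"
  let ?D = "\<lambda>p. \<bar>diff_ker (fst p)\<bar> * \<bar>diff_ker (snd p)\<bar> powr (1 + \<alpha>) + K * (\<bar>diff_ker (fst p)\<bar> * ?k (fst p - s * snd p))
      + 2 / d * ((\<bar>fst p\<bar> powr d * \<bar>diff_ker (fst p)\<bar>) * \<bar>diff_ker (snd p)\<bar>) + 2 / d * (\<bar>diff_ker (fst p)\<bar> * (\<bar>snd p\<bar> powr d * \<bar>diff_ker (snd p)\<bar>))"
  have pos_k: "integrable lborel (\<lambda>z::real. indicator {0..1} z * z powr (-1/2))"
    by (rule powr_from_0_lborel) auto
  have k_int: "integrable lborel ?k"
  proof (rule Bochner_Integration.integrable_bound)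
    show "integrable lborel (\<lambda>z::real. indicator {0..1} z * z powr (-1/2) + indicator {0..1} (0 + (-1) * z) * (0 + (-1) * z) powr (-1/2))"
      using pos_k lborel_integrable_real_affine[OF pos_k, of "-1" 0] by (intro Bochner_Integration.integrable_add) auto
  qed (auto simp: indicator_def)
  have abs_int: "integrable lborel (\<lambda>x. \<bar>diff_ker x\<bar>)" using diff_ker_integrable by simp
  have pow_int: "integrable lborel (\<lambda>x. \<bar>diff_ker x\<bar> powr (1 + \<alpha>))"
  proof -
    have "0 < \<alpha> * \<alpha>" "\<alpha> * \<alpha> < 1"
      using alpha mult_strict_mono[of \<alpha> 1 \<alpha> 1] by auto
    then have "integrable lborel (\<lambda>x. \<bar>x\<bar> powr 0 * \<bar>diff_ker x\<bar> powr (1 + \<alpha>))"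
      using alpha by (intro diff_ker_weighted_power_integrable) (auto simp: algebra_simps)
    then show ?thesis
    proof (rule Bochner_Integration.integrable_bound)
      show "AE x in lborel. norm (\<bar>diff_ker x\<bar> powr (1 + \<alpha>)) \<le> norm (\<bar>x\<bar> powr 0 * \<bar>diff_ker x\<bar> powr (1 + \<alpha>))"
        by (rule AE_I2) (auto simp: diff_ker_eq_0)
    qed measurable
  qed
  have mom_int: "integrable lborel (\<lambda>x. \<bar>x\<bar> powr d * \<bar>diff_ker x\<bar>)"
    using diff_ker_weighted_power_integrable[of d 1] alpha d by (simp add: d_def field_simps)
  have conv_int: "integrable (lborel \<Otimes>\<^sub>M lborel) (\<lambda>p. \<bar>diff_ker (fst p)\<bar> * ?k (fst p - s * snd p))"
  proof (rule lborel_pair.Fubini_integrable)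
    have eq: "(LINT y|lborel. norm (\<bar>diff_ker x\<bar> * ?k (x - s * y))) = (LINT z|lborel. ?k z) * \<bar>diff_ker x\<bar>" for x
      using lborel_integral_real_affine[of "-s" "\<lambda>z. ?k z" x] s by (simp add: abs_mult mult.commute)
    show "integrable lborel (\<lambda>x. LINT y|lborel. norm (\<bar>diff_ker (fst (x, y))\<bar> * ?k (fst (x, y) - s * snd (x, y))))"
      using abs_int by (simp only: fst_conv snd_conv eq) (rule integrable_mult_right)
    show "AE x in lborel. integrable lborel (\<lambda>y. \<bar>diff_ker (fst (x, y))\<bar> * ?k (fst (x, y) - s * snd (x, y)))"
    proof (rule AE_I2)
      fix x :: real
      have "integrable lborel (\<lambda>y. ?k (x + (-s) * y))"
        by (rule lborel_integrable_real_affine[OF k_int]) (use s in auto)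
      then show "integrable lborel (\<lambda>y. \<bar>diff_ker (fst (x, y))\<bar> * ?k (fst (x, y) - s * snd (x, y)))"
        by simp
    qed
  qed measurable
  show ?thesis
  proof (rule Bochner_Integration.integrable_bound)
    show "integrable (lborel \<Otimes>\<^sub>M lborel) ?D"
      by (intro Bochner_Integration.integrable_add integrable_mult_right conv_int
          integrable_product_mult[of lborel lborel "\<lambda>x. \<bar>diff_ker x\<bar>" "\<lambda>y. \<bar>diff_ker y\<bar> powr (1 + \<alpha>)"]
          integrable_product_mult[of lborel lborel "\<lambda>x. \<bar>diff_ker x\<bar>" "\<lambda>x. \<bar>x\<bar> powr d * \<bar>diff_ker x\<bar>"]
          integrable_product_mult[of lborel lborel "\<lambda>x. \<bar>x\<bar> powr d * \<bar>diff_ker x\<bar>" "\<lambda>x. \<bar>diff_ker x\<bar>"]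
          abs_int pow_int mom_int) unfold_locales
    show "AE p in lborel \<Otimes>\<^sub>M lborel. norm (diff_ker (fst p) * diff_ker (snd p) * ln \<bar>fst p - s * snd p\<bar>) \<le> norm (?D p)"
    proof (rule AE_I2)
      fix p :: "real \<times> real"
      define x y where "x = fst p" and "y = snd p"
      define a b where "a = \<bar>diff_ker y\<bar>" and "b = \<bar>diff_ker x\<bar>"
      define z where "z = \<bar>x - s * y\<bar>"
      have nn: "0 \<le> a" "0 \<le> b" "0 \<le> z" "0 \<le> K" by (auto simp: a_def b_def z_def K_def)
      have "a * \<bar>ln z\<bar> \<le> a powr (1 + \<alpha>) + K * ?k (x - s * y) + 2 / d * (a * (\<bar>x\<bar> powr d + \<bar>y\<bar> powr d))"
      proof (cases "z < 1")
        case True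
        show ?thesis
        proof (cases "z = 0")
          case True
          then show ?thesis using nn d by simp
        next
          case False
          then have z: "0 < z" "z < 1" using True nn by auto
          define l where "l = \<bar>ln z\<bar>"
          have l0: "0 \<le> l" by (simp add: l_def)
          have "ln (1 / z) \<le> (1 / z) powr d' / d'"
            using z d' by (intro ln_powr_bound) auto
          then have l: "l \<le> 1 / d' * z powr (- d')"
            using z by (simp add: l_def ln_div powr_divide powr_minus field_simps)
          have "l powr e \<le> (1 / d' * z powr (- d')) powr e"
            using l l0 alpha by (intro powr_mono2) (auto simp: e_def)
          also have "\<dots> = K * z powr (- (d' * e))"
            using d' z by (simp add: K_def powr_mult powr_powr powr_divide)
          also have "- (d' * e) = -1/2" using d'e by simp
          finally have le: "l powr e \<le> K * ?k (x - s * y)"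
            using z by (auto simp: indicator_def z_def)
          have "a * l \<le> a powr (1 + \<alpha>) + l powr e"
          \<comment> \<open>Whichever of \<open>l\<close> and \<open>a powr \<alpha>\<close> is larger, its power dominates the product.\<close>
          proof (cases "l \<le> a powr \<alpha>")
            case True
            then have "a * l \<le> a * a powr \<alpha>" using nn by (intro mult_left_mono) auto
            also have "\<dots> = a powr (1 + \<alpha>)" using nn by (simp add: powr_add powr_one)
            finally show ?thesis by (smt (verit) powr_ge_zero)
          next
            case False
            then have "(a powr \<alpha>) powr (1 / \<alpha>) \<le> l powr (1 / \<alpha>)"
              using alpha by (intro powr_mono2) auto
            then have "a \<le> l powr (1 / \<alpha>)" using alpha nn by (simp add: powr_powr)
            then have "a * l \<le> l powr (1 / \<alpha>) * l" using l0 by (intro mult_right_mono) auto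
            also have "\<dots> = l powr e" using l0 by (simp add: e_def powr_add powr_one)
            finally show ?thesis by (smt (verit) powr_ge_zero)
          qed
          then have "a * l \<le> a powr (1 + \<alpha>) + K * ?k (x - s * y)" using le by linarith
          moreover have "0 \<le> 2 / d * (a * (\<bar>x\<bar> powr d + \<bar>y\<bar> powr d))" using nn d by simp
          ultimately show ?thesis by (simp add: l_def)
        qed
      next
        case False
        have m: "z \<le> 2 * max \<bar>x\<bar> \<bar>y\<bar>" using s by (auto simp: z_def abs_if max_def split: if_splits)
        have "\<bar>ln z\<bar> = ln z" using False by simp
        also have "\<dots> \<le> z powr d / d" using False d by (intro ln_powr_bound) auto
        also have "\<dots> \<le> (2 * max \<bar>x\<bar> \<bar>y\<bar>) powr d / d" using m d False by (intro divide_right_mono powr_mono2) auto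
        also have "\<dots> \<le> 2 * (\<bar>x\<bar> powr d + \<bar>y\<bar> powr d) / d"
        proof (intro divide_right_mono)
          have "2 powr d \<le> 2 powr 1" using d by (intro powr_mono) auto
          then have "2 powr d \<le> (2::real)" by simp
          then have "2 powr d * (max \<bar>x\<bar> \<bar>y\<bar>) powr d \<le> 2 * (\<bar>x\<bar> powr d + \<bar>y\<bar> powr d)"
            by (intro mult_mono) (auto simp: max_def)
          then show "(2 * max \<bar>x\<bar> \<bar>y\<bar>) powr d \<le> 2 * (\<bar>x\<bar> powr d + \<bar>y\<bar> powr d)"
            by (simp add: powr_mult)
        qed (use d in auto)
        finally have "a * \<bar>ln z\<bar> \<le> a * (2 * (\<bar>x\<bar> powr d + \<bar>y\<bar> powr d) / d)"
          using nn by (intro mult_left_mono)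
        moreover have "0 \<le> a powr (1 + \<alpha>)" "0 \<le> K * ?k (x - s * y)" using nn by auto
        moreover have "a * (2 * (\<bar>x\<bar> powr d + \<bar>y\<bar> powr d) / d) = 2 / d * (a * (\<bar>x\<bar> powr d + \<bar>y\<bar> powr d))"
          by simp
        ultimately show ?thesis by linarith
      qed
      then have "b * (a * \<bar>ln z\<bar>) \<le> b * (a powr (1 + \<alpha>) + K * ?k (x - s * y) + 2 / d * (a * (\<bar>x\<bar> powr d + \<bar>y\<bar> powr d)))"
        using nn by (intro mult_left_mono)
      also have "\<dots> = ?D p"
        by (simp add: x_def[symmetric] y_def[symmetric] a_def[symmetric] b_def[symmetric] algebra_simps)
      finally have "b * (a * \<bar>ln z\<bar>) \<le> ?D p" .
      moreover have "norm (diff_ker (fst p) * diff_ker (snd p) * ln \<bar>fst p - s * snd p\<bar>) = b * (a * \<bar>ln z\<bar>)"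
        by (simp add: x_def y_def a_def b_def z_def abs_mult mult.assoc)
      ultimately have "norm (diff_ker (fst p) * diff_ker (snd p) * ln \<bar>fst p - s * snd p\<bar>) \<le> ?D p"
        by (simp only:)
      then show "norm (diff_ker (fst p) * diff_ker (snd p) * ln \<bar>fst p - s * snd p\<bar>) \<le> norm (?D p)"
        by (rule order_trans) (simp only: real_norm_def abs_ge_self)
    qed
  qed measurable
qed

lemma log_scale_diff_ker:
  assumes s: "\<bar>s\<bar> = 1"
  shows "log_scale (lborel \<Otimes>\<^sub>M lborel) (\<lambda>p. diff_ker (fst p) * diff_ker (snd p)) (\<lambda>p. \<bar>fst p - s * snd p\<bar>)"
proof (rule log_scale.intro)
  show "sigma_finite_measure (lborel \<Otimes>\<^sub>M lborel :: (real \<times> real) measure)" by unfold_locales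
  show "integrable (lborel \<Otimes>\<^sub>M lborel) (\<lambda>p. diff_ker (fst p) * diff_ker (snd p))"
    by (intro integrable_product_mult diff_ker_integrable) unfold_locales
  show "(LINT p|(lborel \<Otimes>\<^sub>M lborel). diff_ker (fst p) * diff_ker (snd p)) = 0"
    by (simp add: integral_product_mult diff_ker_integrable diff_ker_integral)
  show "AE p in lborel \<Otimes>\<^sub>M lborel. 0 < \<bar>fst p - s * snd p\<bar>"
  proof (rule lborel_pair.AE_pair_measure)
    show "AE x in lborel. AE y in lborel. 0 < \<bar>fst (x, y) - s * snd (x, y)\<bar>"
    proof (rule AE_I2)
      fix x :: real
      show "AE y in lborel. 0 < \<bar>fst (x, y) - s * snd (x, y)\<bar>"
        using AE_lborel_singleton[of "x / s"] by eventually_elim (use s in auto)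
    qed
  qed measurable
  show "integrable (lborel \<Otimes>\<^sub>M lborel) (\<lambda>p. diff_ker (fst p) * diff_ker (snd p) * ln \<bar>fst p - s * snd p\<bar>)"
    by (rule diff_ker_product_log_integrable[OF s])
qed measurable

text \<open>
  The first instance belongs to averages in the same direction, the second one to averages in
  opposite directions, see \<open>diff_avg_inner\<close>. The factors \<open>1\<close> and \<open>-1\<close> are kept so that both are literal
  instances of \<open>log_scale_diff_ker\<close>.
\<close>

sublocale diff_scale: log_scale "lborel \<Otimes>\<^sub>M lborel" "\<lambda>p. diff_ker (fst p) * diff_ker (snd p)" "\<lambda>p. \<bar>fst p - 1 * snd p\<bar>"
  by (rule log_scale_diff_ker) simp

sublocale sum_scale: log_scale "lborel \<Otimes>\<^sub>M lborel" "\<lambda>p. diff_ker (fst p) * diff_ker (snd p)" "\<lambda>p. \<bar>fst p - (-1) * snd p\<bar>"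
  by (rule log_scale_diff_ker) simp

definition repro_const :: real where
  "repro_const = - (LINT p|(lborel \<Otimes>\<^sub>M lborel). diff_ker (fst p) * diff_ker (snd p) * ln \<bar>fst p - (-1) * snd p\<bar>)"

definition diff_ker_laplace :: "real \<Rightarrow> real" where
  "diff_ker_laplace h = (LINT x|lborel. diff_ker x * exp (- h * \<bar>x\<bar>))"

lemma diff_ker_exp_integrable: "0 \<le> h \<Longrightarrow> integrable lborel (\<lambda>x. diff_ker x * exp (- h * \<bar>x\<bar>))"
proof (rule Bochner_Integration.integrable_bound[OF diff_ker_integrable])
  assume h: "0 \<le> h"
  show "AE x in lborel. norm (diff_ker x * exp (- h * \<bar>x\<bar>)) \<le> norm (diff_ker x)"
    using h by (intro AE_I2) (auto simp: abs_mult intro!: mult_left_le)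
qed measurable

text \<open>
  Since the integral of the kernel is zero, a multiple of it may be subtracted so that the remaining
  weight \<open>exp (- h * x) - exp (- h)\<close> changes its sign at \<open>1\<close>, exactly where the kernel changes its sign.
\<close>

lemma diff_ker_laplace_pos:
  assumes h: "0 < h" shows "0 < diff_ker_laplace h"
proof -
  let ?f = "\<lambda>x. diff_ker x * exp (- h * \<bar>x\<bar>) - exp (- h) * diff_ker x"
  have i: "integrable lborel ?f" using diff_ker_exp_integrable[of h] diff_ker_integrable h by simp
  have e: "diff_ker_laplace h = (LINT x|lborel. ?f x)"
    using diff_ker_exp_integrable[of h] diff_ker_integrable h by (simp add: diff_ker_laplace_def diff_ker_integral)
  have f: "?f x = diff_ker x * (exp (- h * \<bar>x\<bar>) - exp (- h))" for x by (simp add: algebra_simps)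
  have nn: "0 \<le> ?f x" for x
  proof -
    consider "x \<le> 0" | "0 < x" "x \<le> 1" | "1 < x" by linarith
    then show ?thesis
    proof cases
      case 2 then show ?thesis unfolding f using diff_ker_pos[of x] h by (intro mult_nonneg_nonneg) auto
    next
      case 3 then show ?thesis unfolding f using diff_ker_nonpos[of x] h by (intro mult_nonpos_nonpos) auto
    qed (simp add: diff_ker_eq_0)
  qed
  have "diff_ker_laplace h \<noteq> 0"
  proof
    assume "diff_ker_laplace h = 0"
    then have "AE x in lborel. ?f x = 0"
      using integral_nonneg_eq_0_iff_AE[OF i] nn e by auto
    then have "AE x in lborel. x \<notin> {0<..<1::real}"
    proof eventually_elim
      case (elim x)
      have "0 < ?f x" if "0 < x" "x < 1"
        unfolding f using diff_ker_pos[of x] that h by (intro mult_pos_pos) auto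
      then show ?case using elim by force
    qed
    then have "{0<..<1::real} \<in> null_sets lborel" by (subst AE_iff_null_sets) auto
    then show False by (auto dest!: null_setsD1)
  qed
  moreover have "0 \<le> diff_ker_laplace h" unfolding e using nn by (intro integral_nonneg_AE) auto
  ultimately show ?thesis by simp
qed

text \<open>
  The constant is the limit in \<open>scale_int_limit\<close> for \<open>A z = exp (- \<bar>z\<bar>)\<close>. For this function the double
  integral with \<open>fst p + snd p\<close> factorises into the square of \<open>diff_ker_laplace\<close>, so that the truncated
  integrals are positive and increase with the interval.
\<close>

lemma repro_const_pos: "0 < repro_const"
proof -
  define A where "A = (\<lambda>z::real. exp (- \<bar>z\<bar>))"
  have A[measurable]: "A \<in> borel_measurable borel" unfolding A_def by measurable
  have B: "\<bar>A s\<bar> \<le> 1" for s by (simp add: A_def)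
  have inner: "(LINT p|(lborel \<Otimes>\<^sub>M lborel). diff_ker (fst p) * diff_ker (snd p) * A (h * \<bar>fst p - (-1) * snd p\<bar>)) = (diff_ker_laplace h)\<^sup>2"
    if "0 < h" for h
  proof -
    have "diff_ker (fst p) * diff_ker (snd p) * A (h * \<bar>fst p - (-1) * snd p\<bar>)
        = (diff_ker (fst p) * exp (- h * \<bar>fst p\<bar>)) * (diff_ker (snd p) * exp (- h * \<bar>snd p\<bar>))" for p
    proof (cases "fst p \<le> 0 \<or> snd p \<le> 0")
      case True then show ?thesis using diff_ker_eq_0[of "fst p"] diff_ker_eq_0[of "snd p"] by auto
    next
      case False
      then have "A (h * \<bar>fst p - (-1) * snd p\<bar>) = exp (- h * \<bar>fst p\<bar>) * exp (- h * \<bar>snd p\<bar>)"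
        using that by (simp add: A_def exp_add[symmetric] abs_mult algebra_simps)
      then show ?thesis by (simp add: mult_ac)
    qed
    then have "(LINT p|(lborel \<Otimes>\<^sub>M lborel). diff_ker (fst p) * diff_ker (snd p) * A (h * \<bar>fst p - (-1) * snd p\<bar>))
        = (LINT p|(lborel \<Otimes>\<^sub>M lborel). (diff_ker (fst p) * exp (- h * \<bar>fst p\<bar>)) * (diff_ker (snd p) * exp (- h * \<bar>snd p\<bar>)))"
      by (simp only:)
    also have "\<dots> = diff_ker_laplace h * diff_ker_laplace h"
      unfolding diff_ker_laplace_def by (intro integral_product_mult diff_ker_exp_integrable) (use that in auto)
    finally show ?thesis by (simp add: power2_eq_square)
  qed
  have si: "sum_scale.scale_int A a b = (LINT h|lborel. indicator {a<..<b} h / h * (diff_ker_laplace h)\<^sup>2)" if "0 < a" for a b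
    unfolding sum_scale.scale_int_def
    by (intro Bochner_Integration.integral_cong refl) (use inner that in \<open>auto simp: indicator_def\<close>)
  have diff_ker_laplace_le: "\<bar>diff_ker_laplace h\<bar> \<le> (LINT x|lborel. \<bar>diff_ker x\<bar>)" if "0 < h" for h
  proof -
    have "\<bar>diff_ker_laplace h\<bar> \<le> (LINT x|lborel. \<bar>diff_ker x * exp (- h * \<bar>x\<bar>)\<bar>)"
      unfolding diff_ker_laplace_def by (rule integral_abs_bound)
    also have "\<dots> \<le> (LINT x|lborel. \<bar>diff_ker x\<bar>)"
      using diff_ker_integrable that
      by (intro integral_mono integrable_abs[OF diff_ker_exp_integrable]) (auto simp: abs_mult intro!: mult_left_le)
    finally show ?thesis .
  qed
  have diff_ker_laplace_meas[measurable]: "diff_ker_laplace \<in> borel_measurable borel" unfolding diff_ker_laplace_def[abs_def] by measurable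
  have ii: "integrable lborel (\<lambda>h. indicator {a<..<b} h / h * (diff_ker_laplace h)\<^sup>2)" if "0 < a" "a < b" for a b
  proof (rule Bochner_Integration.integrable_bound)
    show "integrable lborel (\<lambda>h. (1 / a * (LINT x|lborel. \<bar>diff_ker x\<bar>)\<^sup>2) * indicator {a<..<b} h)"
      using that by (intro integrable_mult_right) simp
    show "AE h in lborel. norm (indicator {a<..<b} h / h * (diff_ker_laplace h)\<^sup>2)
        \<le> norm ((1 / a * (LINT x|lborel. \<bar>diff_ker x\<bar>)\<^sup>2) * indicator {a<..<b} h)"
    proof (rule AE_I2)
      fix h
      have "1 / h * (diff_ker_laplace h)\<^sup>2 \<le> 1 / a * (LINT x|lborel. \<bar>diff_ker x\<bar>)\<^sup>2" if "a < h" "h < b"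
        using that \<open>0 < a\<close> power_mono[OF diff_ker_laplace_le[of h], of 2]
        by (intro mult_mono divide_left_mono) auto
      then show "norm (indicator {a<..<b} h / h * (diff_ker_laplace h)\<^sup>2)
        \<le> norm ((1 / a * (LINT x|lborel. \<bar>diff_ker x\<bar>)\<^sup>2) * indicator {a<..<b} h)"
        using that by (auto simp: indicator_def)
    qed
  qed measurable
  define m where "m = sum_scale.scale_int A 1 2"
  have m0: "0 \<le> m" unfolding m_def by (subst si) (auto intro!: integral_nonneg_AE simp: indicator_def)
  have "m \<noteq> 0"
  proof
    assume "m = 0"
    then have "AE h in lborel. indicator {1<..<2} h / h * (diff_ker_laplace h)\<^sup>2 = 0"
      using integral_nonneg_eq_0_iff_AE[OF ii[of 1 2]] si[of 1 2]
      by (auto simp: m_def indicator_def)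
    then have "AE h in lborel. h \<notin> {1<..<2::real}"
    proof eventually_elim
      case (elim h)
      then show ?case using diff_ker_laplace_pos[of h] by (auto simp: indicator_def)
    qed
    then have "{1<..<2::real} \<in> null_sets lborel" by (subst AE_iff_null_sets) auto
    then show False by (auto dest!: null_setsD1)
  qed
  then have m: "0 < m" using m0 by simp
  have lim: "(\<lambda>n. sum_scale.scale_int A (1 / real (n + 2)) (real (n + 2))) \<longlonglongrightarrow> - 1 * (LINT p|(lborel \<Otimes>\<^sub>M lborel). diff_ker (fst p) * diff_ker (snd p) * ln \<bar>fst p - (-1) * snd p\<bar>)"
  proof (rule sum_scale.scale_int_limit[OF A B])
    show "(A \<longlongrightarrow> 1) (at_right 0)"
      unfolding A_def by real_asymp
    show "(A \<longlongrightarrow> 0) at_top"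
      unfolding A_def by real_asymp
  qed
  have "m \<le> sum_scale.scale_int A (1 / real (n + 2)) (real (n + 2))" for n
  proof -
    have ab: "0 < 1 / real (n + 2)" "1 / real (n + 2) < real (n + 2)" "1 / real (n + 2) < 1" "real (n + 2) \<ge> 2"
      using less_1_mult[of "2 + real n" "2 + real n"] by (auto simp: divide_less_eq add.commute)
    have "m = (LINT h|lborel. indicator {1<..<2} h / h * (diff_ker_laplace h)\<^sup>2)" unfolding m_def by (rule si) simp
    also have "\<dots> \<le> (LINT h|lborel. indicator {1 / real (n + 2)<..<real (n + 2)} h / h * (diff_ker_laplace h)\<^sup>2)"
    proof (rule integral_mono[OF ii ii])
      fix h
      show "indicator {1<..<2} h / h * (diff_ker_laplace h)\<^sup>2 \<le> indicator {1 / real (n + 2)<..<real (n + 2)} h / h * (diff_ker_laplace h)\<^sup>2"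
      proof (intro mult_right_mono)
        have "indicator {1<..<2} h / h \<le> indicator {c<..<d} h / h" if "0 < c" "c < 1" "2 \<le> d" for c d :: real
          using that by (auto simp: indicator_def)
        then show "indicator {1<..<2} h / h \<le> indicator {1 / real (n + 2)<..<real (n + 2)} h / h"
          using ab by blast
      qed simp
    qed (use ab in auto)
    also have "\<dots> = sum_scale.scale_int A (1 / real (n + 2)) (real (n + 2))" by (rule si[symmetric]) (use ab in auto)
    finally show ?thesis .
  qed
  then have "m \<le> repro_const"
    using LIMSEQ_le_const[OF lim, of m] by (auto simp: repro_const_def)
  then show ?thesis using m by simp
qed

end

section \<open>Convolutions and correlations on the line\<close>

abbreviation sqR :: "(real \<Rightarrow> real) \<Rightarrow> bool" where "sqR \<equiv> sq_integrable lborel"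
abbreviation norm2R :: "(real \<Rightarrow> real) \<Rightarrow> real" where "norm2R \<equiv> norm2 lborel"

lemma sqR_borel[measurable_dest]: "sqR f \<Longrightarrow> f \<in> borel_measurable borel"
  by (simp add: sq_integrable_def)

lemma sqR_shift:
  assumes "sqR f" shows "sqR (\<lambda>t. f (t + z))" "norm2R (\<lambda>t. f (t + z)) = norm2R f"
proof -
  have [measurable]: "f \<in> borel_measurable borel" using assms by (rule sqR_borel)
  have i: "integrable lborel (\<lambda>t. (f t)\<^sup>2)" using assms by (simp add: sq_integrable_def)
  show "sqR (\<lambda>t. f (t + z))"
    using lborel_integrable_real_affine[OF i, of 1 z] by (simp add: sq_integrable_def add.commute)
  show "norm2R (\<lambda>t. f (t + z)) = norm2R f"
    using lborel_integral_real_affine[of 1 "\<lambda>t. (f t)\<^sup>2" z] by (simp add: norm2_def add.commute)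
qed

text \<open>
  Young's inequality for the convolution of an integrable with a square integrable function: the
  Cauchy-Schwarz inequality with respect to the measure \<open>\<bar>k x\<bar> dx\<close>, then Tonelli's theorem and the
  translation invariance of the norm. The parameter \<open>c\<close> covers both directions and all scales of the
  translation.
\<close>

lemma Young_L2:
  fixes k f :: "real \<Rightarrow> real"
  assumes k: "integrable lborel k" and f: "sqR f"
  shows "AE t in lborel. integrable lborel (\<lambda>x. k x * f (t + c * x))"
    and "sqR (\<lambda>t. LINT x|lborel. k x * f (t + c * x))"
    and "norm2R (\<lambda>t. LINT x|lborel. k x * f (t + c * x)) \<le> (LINT x|lborel. \<bar>k x\<bar>) * norm2R f"
proof -
  have [measurable]: "f \<in> borel_measurable borel" "k \<in> borel_measurable borel"
    using f k by (auto simp: sq_integrable_def)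
  define K where "K = (LINT x|lborel. \<bar>k x\<bar>)"
  have K0: "0 \<le> K" by (simp add: K_def)
  have nnK: "(\<integral>\<^sup>+x. ennreal \<bar>k x\<bar> \<partial>lborel) = ennreal K"
    unfolding K_def using k by (intro nn_integral_eq_integral) auto
  define G where "G t = (\<integral>\<^sup>+x. ennreal \<bar>k x * f (t + c * x)\<bar> \<partial>lborel)" for t
  have [measurable]: "G \<in> borel_measurable borel" unfolding G_def[abs_def] by measurable
  have sqr: "(ennreal (sqrt \<bar>k x\<bar>))\<^sup>2 = ennreal \<bar>k x\<bar>" for x
    by (simp add: ennreal_power)
  have "(G t)\<^sup>2 \<le> ennreal K * (\<integral>\<^sup>+x. ennreal \<bar>k x\<bar> * ennreal ((f (t + c * x))\<^sup>2) \<partial>lborel)" for t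
  proof -
    have "G t = (\<integral>\<^sup>+x. ennreal (sqrt \<bar>k x\<bar>) * (ennreal (sqrt \<bar>k x\<bar>) * ennreal \<bar>f (t + c * x)\<bar>) \<partial>lborel)"
      unfolding G_def by (intro nn_integral_cong)
        (simp add: abs_mult ennreal_mult[symmetric] mult.assoc[symmetric])
    also have "\<dots>\<^sup>2 \<le> (\<integral>\<^sup>+x. (ennreal (sqrt \<bar>k x\<bar>))\<^sup>2 \<partial>lborel) *
        (\<integral>\<^sup>+x. (ennreal (sqrt \<bar>k x\<bar>) * ennreal \<bar>f (t + c * x)\<bar>)\<^sup>2 \<partial>lborel)"
      by (rule Cauchy_Schwarz_nn_integral) measurable
    also have "\<dots> = ennreal K * (\<integral>\<^sup>+x. ennreal \<bar>k x\<bar> * ennreal ((f (t + c * x))\<^sup>2) \<partial>lborel)"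
      by (simp only: power_mult_distrib sqr nnK) (simp add: ennreal_power)
    finally show ?thesis .
  qed
  then have "(\<integral>\<^sup>+t. (G t)\<^sup>2 \<partial>lborel)
      \<le> (\<integral>\<^sup>+t. ennreal K * (\<integral>\<^sup>+x. ennreal \<bar>k x\<bar> * ennreal ((f (t + c * x))\<^sup>2) \<partial>lborel) \<partial>lborel)"
    by (intro nn_integral_mono)
  also have "\<dots> = ennreal K * (\<integral>\<^sup>+t. \<integral>\<^sup>+x. ennreal \<bar>k x\<bar> * ennreal ((f (t + c * x))\<^sup>2) \<partial>lborel \<partial>lborel)"
    by (rule nn_integral_cmult) measurable
  also have "(\<integral>\<^sup>+t. \<integral>\<^sup>+x. ennreal \<bar>k x\<bar> * ennreal ((f (t + c * x))\<^sup>2) \<partial>lborel \<partial>lborel)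
      = (\<integral>\<^sup>+x. \<integral>\<^sup>+t. ennreal \<bar>k x\<bar> * ennreal ((f (t + c * x))\<^sup>2) \<partial>lborel \<partial>lborel)"
    by (rule lborel_pair.Fubini'[symmetric]) measurable
  also have "\<dots> = (\<integral>\<^sup>+x. ennreal \<bar>k x\<bar> * ennreal ((norm2R f)\<^sup>2) \<partial>lborel)"
  proof (intro nn_integral_cong)
    fix x
    have "(\<integral>\<^sup>+t. ennreal ((f (t + c * x))\<^sup>2) \<partial>lborel) = ennreal ((norm2R f)\<^sup>2)"
      using nn_integral_power2_sq_integrable[OF sqR_shift(1)[OF f], of "c * x"] sqR_shift(2)[OF f, of "c * x"] by simp
    then show "(\<integral>\<^sup>+t. ennreal \<bar>k x\<bar> * ennreal ((f (t + c * x))\<^sup>2) \<partial>lborel) = ennreal \<bar>k x\<bar> * ennreal ((norm2R f)\<^sup>2)"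
      by (subst nn_integral_cmult) auto
  qed
  also have "\<dots> = ennreal K * ennreal ((norm2R f)\<^sup>2)"
    by (subst nn_integral_multc) (auto simp: nnK)
  finally have main: "(\<integral>\<^sup>+t. (G t)\<^sup>2 \<partial>lborel) \<le> ennreal ((K * norm2R f)\<^sup>2)"
    using K0 by (simp add: ennreal_mult[symmetric] power2_eq_square mult_ac)
  then have "(\<integral>\<^sup>+t. (G t)\<^sup>2 \<partial>lborel) \<noteq> \<infinity>" by (auto simp: top_unique)
  then have "AE t in lborel. (G t)\<^sup>2 \<noteq> \<infinity>" by (intro nn_integral_PInf_AE) auto
  then have fin: "AE t in lborel. G t < \<infinity>"
    by eventually_elim (auto simp: less_top power2_eq_square ennreal_mult_eq_top_iff)
  show "AE t in lborel. integrable lborel (\<lambda>x. k x * f (t + c * x))"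
    using fin by eventually_elim (auto intro!: integrableI_bounded simp: G_def)
  have "(\<integral>\<^sup>+t. ennreal ((LINT x|lborel. k x * f (t + c * x))\<^sup>2) \<partial>lborel) \<le> (\<integral>\<^sup>+t. (G t)\<^sup>2 \<partial>lborel)"
  proof (rule nn_integral_mono)
    fix t
    have "ennreal \<bar>LINT x|lborel. k x * f (t + c * x)\<bar> \<le> G t"
    proof (cases "integrable lborel (\<lambda>x. k x * f (t + c * x))")
      case True
      have "ennreal \<bar>LINT x|lborel. k x * f (t + c * x)\<bar> \<le> ennreal (LINT x|lborel. \<bar>k x * f (t + c * x)\<bar>)"
        by (intro ennreal_leI integral_abs_bound)
      also have "\<dots> = G t" unfolding G_def
        using True by (intro nn_integral_eq_integral[symmetric]) auto
      finally show ?thesis .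
    qed (simp add: not_integrable_integral_eq)
    then have "(ennreal \<bar>LINT x|lborel. k x * f (t + c * x)\<bar>)\<^sup>2 \<le> (G t)\<^sup>2"
      by (rule power_mono) simp
    then show "ennreal ((LINT x|lborel. k x * f (t + c * x))\<^sup>2) \<le> (G t)\<^sup>2"
      by (simp add: ennreal_power)
  qed
  also note main
  finally have *: "(\<integral>\<^sup>+t. ennreal ((LINT x|lborel. k x * f (t + c * x))\<^sup>2) \<partial>lborel) \<le> ennreal ((K * norm2R f)\<^sup>2)" .
  have m: "(\<lambda>t. LINT x|lborel. k x * f (t + c * x)) \<in> borel_measurable lborel" by measurable
  show "sqR (\<lambda>t. LINT x|lborel. k x * f (t + c * x))"
    "norm2R (\<lambda>t. LINT x|lborel. k x * f (t + c * x)) \<le> (LINT x|lborel. \<bar>k x\<bar>) * norm2R f"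
    using sq_integrable_if_nn_integral_le[OF m *] K0 by (auto simp: K_def)
qed

definition corr :: "(real \<Rightarrow> real) \<Rightarrow> (real \<Rightarrow> real) \<Rightarrow> real \<Rightarrow> real" where
  "corr f g z = (LINT t|lborel. f (t + z) * g t)"

lemma corr_measurable[measurable (raw)]:
  assumes [measurable]: "f \<in> borel_measurable borel" "g \<in> borel_measurable borel"
  shows "corr f g \<in> borel_measurable borel"
  unfolding corr_def[abs_def] by measurable

lemma corr_bound: "sqR f \<Longrightarrow> sqR g \<Longrightarrow> \<bar>corr f g z\<bar> \<le> norm2R f * norm2R g"
  unfolding corr_def using L2_Cauchy_Schwarz[OF sqR_shift(1), of f g z] sqR_shift(2)[of f z] by simp

lemma corr_shift: "(LINT t|lborel. f (t + u) * g (t + w)) = corr f g (u - w)"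
  unfolding corr_def
  using lborel_integral_real_affine[of 1 "\<lambda>t. f (t + (u - w)) * g t" w] by (simp add: add.commute)

lemma corr_uminus: "corr f f (- z) = corr f f z"
  using corr_shift[of f 0 f z] by (simp add: corr_def mult.commute)

section \<open>The square function of the difference kernel\<close>

context frac_order
begin

definition diff_avg :: "real \<Rightarrow> (real \<Rightarrow> real) \<Rightarrow> real \<Rightarrow> real" where
  "diff_avg c f t = (LINT x|lborel. diff_ker x * f (t + c * x))"

definition diff_ker_L1 :: real where "diff_ker_L1 = (LINT x|lborel. \<bar>diff_ker x\<bar>)"

lemma diff_avg_measurable[measurable (raw)]:
  assumes [measurable]: "f \<in> borel_measurable borel" "u \<in> borel_measurable M" "w \<in> borel_measurable M"
  shows "(\<lambda>p. diff_avg (u p) f (w p)) \<in> borel_measurable M"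
  unfolding diff_avg_def by measurable

lemma diff_avg_AE: "sqR f \<Longrightarrow> AE t in lborel. integrable lborel (\<lambda>x. diff_ker x * f (t + c * x))"
  by (rule Young_L2(1)[OF diff_ker_integrable])

lemma diff_avg_sqR: "sqR f \<Longrightarrow> sqR (diff_avg c f)"
  unfolding diff_avg_def[abs_def] by (rule Young_L2(2)[OF diff_ker_integrable])

text \<open>
  By Fubini's theorem the inner product of two averages is a double integral of the two kernels
  against a function of one variable, the correlation, at the difference of the two translations. With
  equal scales the difference is a multiple of \<open>fst p - snd p\<close>, with opposite scales of
  \<open>fst p + snd p\<close>, which puts both cases into the form of \<open>scale_int\<close>.
\<close>

lemma diff_avg_inner:
  assumes f: "sqR f" and g: "sqR g"
  shows "(LINT t|lborel. diff_avg a f t * diff_avg b g t) =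
    (LINT p|(lborel \<Otimes>\<^sub>M lborel). diff_ker (fst p) * diff_ker (snd p) * corr f g (a * fst p - b * snd p))"
proof -
  have [measurable]: "f \<in> borel_measurable borel" "g \<in> borel_measurable borel" using f g by (auto simp: sq_integrable_def)
  interpret P: pair_sigma_finite "lborel :: real measure" "lborel \<Otimes>\<^sub>M lborel :: (real \<times> real) measure"
    by (rule pair_sigma_finite.intro) (auto intro: diff_scale.sfin sigma_finite_lborel)
  interpret Q: pair_sigma_finite "lborel \<Otimes>\<^sub>M lborel :: (real \<times> real) measure" "lborel :: real measure"
    by (rule pair_sigma_finite.intro) (auto intro: diff_scale.sfin sigma_finite_lborel)
  let ?F = "\<lambda>t p. (diff_ker (fst p) * f (t + a * fst p)) * (diff_ker (snd p) * g (t + b * snd p))"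
  have ti: "integrable lborel (\<lambda>t. f (t + u) * g (t + w))" for u w
    by (intro sq_integrable_mult_integrable sqR_shift f g)
  have tb: "(LINT t|lborel. \<bar>f (t + u) * g (t + w)\<bar>) \<le> norm2R f * norm2R g" for u w
  proof -
    have s: "sqR (\<lambda>t. \<bar>f t\<bar>)" "sqR (\<lambda>t. \<bar>g t\<bar>)" "norm2R (\<lambda>t. \<bar>f t\<bar>) = norm2R f" "norm2R (\<lambda>t. \<bar>g t\<bar>) = norm2R g"
      using f g by (auto simp: sq_integrable_def norm2_def)
    have "(LINT t|lborel. \<bar>f (t + u) * g (t + w)\<bar>) = corr (\<lambda>t. \<bar>f t\<bar>) (\<lambda>t. \<bar>g t\<bar>) (u - w)"
      using corr_shift[of "\<lambda>t. \<bar>f t\<bar>" u "\<lambda>t. \<bar>g t\<bar>" w] by (simp add: abs_mult)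
    also have "\<dots> \<le> norm2R f * norm2R g" using corr_bound[OF s(1,2), of "u - w"] s(3,4) by simp
    finally show ?thesis .
  qed
  have I: "integrable ((lborel \<Otimes>\<^sub>M lborel) \<Otimes>\<^sub>M lborel) (\<lambda>q. ?F (snd q) (fst q))"
  proof (rule Q.Fubini_integrable)
    have eq: "(LINT t|lborel. norm (?F t p)) = \<bar>diff_ker (fst p) * diff_ker (snd p)\<bar> * (LINT t|lborel. \<bar>f (t + a * fst p) * g (t + b * snd p)\<bar>)" for p
      by (subst integral_mult_right_zero[symmetric]) (simp add: abs_mult mult_ac)
    show "integrable (lborel \<Otimes>\<^sub>M lborel) (\<lambda>p. LINT t|lborel. norm (?F (snd (p, t)) (fst (p, t))))"
    proof (rule Bochner_Integration.integrable_bound)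
      show "integrable (lborel \<Otimes>\<^sub>M lborel) (\<lambda>p. (norm2R f * norm2R g) * (diff_ker (fst p) * diff_ker (snd p)))"
        using diff_scale.g_int by (rule integrable_mult_right)
      show "AE p in lborel \<Otimes>\<^sub>M lborel. norm (LINT t|lborel. norm (?F (snd (p, t)) (fst (p, t))))
          \<le> norm ((norm2R f * norm2R g) * (diff_ker (fst p) * diff_ker (snd p)))"
      proof (rule AE_I2)
        fix p :: "real \<times> real"
        have "\<bar>diff_ker (fst p) * diff_ker (snd p)\<bar> * (LINT t|lborel. \<bar>f (t + a * fst p) * g (t + b * snd p)\<bar>)
            \<le> \<bar>diff_ker (fst p) * diff_ker (snd p)\<bar> * (norm2R f * norm2R g)"
          by (intro mult_left_mono tb) auto
        then show "norm (LINT t|lborel. norm (?F (snd (p, t)) (fst (p, t))))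
          \<le> norm ((norm2R f * norm2R g) * (diff_ker (fst p) * diff_ker (snd p)))"
          unfolding fst_conv snd_conv eq by (simp add: abs_mult mult_ac)
      qed
    qed measurable
    show "AE p in lborel \<Otimes>\<^sub>M lborel. integrable lborel (\<lambda>t. ?F (snd (p, t)) (fst (p, t)))"
    proof (rule AE_I2)
      fix p :: "real \<times> real"
      have "integrable lborel (\<lambda>t. (diff_ker (fst p) * diff_ker (snd p)) * (f (t + a * fst p) * g (t + b * snd p)))"
        by (intro integrable_mult_right ti)
      then show "integrable lborel (\<lambda>t. ?F (snd (p, t)) (fst (p, t)))" by (simp add: mult_ac)
    qed
  qed measurable
  have "(LINT t|lborel. diff_avg a f t * diff_avg b g t) = (LINT t|lborel. LINT p|(lborel \<Otimes>\<^sub>M lborel). ?F t p)"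
  proof (rule integral_cong_AE)
    show "AE t in lborel. diff_avg a f t * diff_avg b g t = (LINT p|(lborel \<Otimes>\<^sub>M lborel). ?F t p)"
      using diff_avg_AE[OF f, of a] diff_avg_AE[OF g, of b]
    proof eventually_elim
      case (elim t)
      show ?case unfolding diff_avg_def by (rule integral_product_mult[symmetric]) fact+
    qed
  qed measurable
  also have "\<dots> = (LINT p|(lborel \<Otimes>\<^sub>M lborel). LINT t|lborel. ?F t p)"
    by (rule Q.Fubini_integral) (use I in \<open>simp add: case_prod_beta'\<close>)
  also have "\<dots> = (LINT p|(lborel \<Otimes>\<^sub>M lborel). diff_ker (fst p) * diff_ker (snd p) * corr f g (a * fst p - b * snd p))"
  proof (intro Bochner_Integration.integral_cong refl)
    fix p :: "real \<times> real"
    have "(LINT t|lborel. ?F t p) = (LINT t|lborel. (diff_ker (fst p) * diff_ker (snd p)) * (f (t + a * fst p) * g (t + b * snd p)))"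
      by (simp add: mult_ac)
    also have "\<dots> = diff_ker (fst p) * diff_ker (snd p) * (LINT t|lborel. f (t + a * fst p) * g (t + b * snd p))"
      by (rule integral_mult_right_zero)
    finally show "(LINT t|lborel. ?F t p) = diff_ker (fst p) * diff_ker (snd p) * corr f g (a * fst p - b * snd p)"
      by (simp only: corr_shift)
  qed
  finally show ?thesis .
qed

definition square_const :: real where
  "square_const = 2 * (LINT p|(lborel \<Otimes>\<^sub>M lborel). \<bar>diff_ker (fst p) * diff_ker (snd p) * ln \<bar>fst p - 1 * snd p\<bar>\<bar>)"

lemma square_const_nonneg: "0 \<le> square_const" by (simp add: square_const_def)

text \<open>
  The norm of the average at scale \<open>h\<close> is the double integral of the autocorrelation of \<open>f\<close>, an even
  function bounded by \<open>(norm2R f)\<^sup>2\<close>. So \<open>scale_int_bound\<close> applies on every bounded interval of scales,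
  with a constant independent of the interval.
\<close>

lemma square_function_bound:
  assumes f: "sqR f"
  shows "(\<integral>\<^sup>+h. ennreal (indicator {0<..} h / h) * (\<integral>\<^sup>+t. ennreal ((diff_avg h f t)\<^sup>2) \<partial>lborel) \<partial>lborel)
    \<le> ennreal (square_const * (norm2R f)\<^sup>2)"
proof -
  have [measurable]: "f \<in> borel_measurable borel" using f by (simp add: sq_integrable_def)
  define A where "A = corr f f"
  have A[measurable]: "A \<in> borel_measurable borel" unfolding A_def by measurable
  have B: "\<bar>A s\<bar> \<le> (norm2R f)\<^sup>2" for s using corr_bound[OF f f] by (simp add: A_def power2_eq_square)
  have n: "(norm2R (diff_avg h f))\<^sup>2 = (LINT p|(lborel \<Otimes>\<^sub>M lborel). diff_ker (fst p) * diff_ker (snd p) * A (h * \<bar>fst p - 1 * snd p\<bar>))"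
    if "0 < h" for h
  proof -
    have "A (h * \<bar>x - 1 * y\<bar>) = corr f f (h * x - h * y)" for x y
      using corr_uminus[of f "h * (x - y)"] by (auto simp: A_def abs_if algebra_simps)
    then show ?thesis
      using diff_avg_inner[OF f f, of h h] unfolding norm2_power2 by (simp add: power2_eq_square)
  qed
  let ?g = "\<lambda>h. (norm2R (diff_avg h f))\<^sup>2"
  have gm[measurable]: "?g \<in> borel_measurable borel" unfolding norm2_power2 by measurable
  have gb: "?g h \<le> (diff_ker_L1 * norm2R f)\<^sup>2" for h
    using Young_L2(3)[OF diff_ker_integrable f, of h]
    unfolding diff_avg_def[abs_def] diff_ker_L1_def by (intro power_mono) auto
  let ?a = "\<lambda>n. 1 / real (n + 2)" and ?b = "\<lambda>n. real (n + 2)"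
  have bd: "(\<integral>\<^sup>+h. ennreal (indicator {?a n<..<?b n} h / h * ?g h) \<partial>lborel) \<le> ennreal (square_const * (norm2R f)\<^sup>2)" for n
  proof -
    have ab: "0 < ?a n" "?a n < ?b n"
      using less_1_mult[of "2 + real n" "2 + real n"] by (auto simp: divide_less_eq add.commute)
    have "integrable lborel (\<lambda>h. indicator {?a n<..<?b n} h / h * ?g h)"
    proof (rule Bochner_Integration.integrable_bound)
      show "integrable lborel (\<lambda>h. (?b n * (diff_ker_L1 * norm2R f)\<^sup>2) * indicator {?a n<..<?b n} h)"
        using ab by (intro integrable_mult_right) simp
      show "AE h in lborel. norm (indicator {?a n<..<?b n} h / h * ?g h) \<le> norm ((?b n * (diff_ker_L1 * norm2R f)\<^sup>2) * indicator {?a n<..<?b n} h)"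
      proof (rule AE_I2)
        fix h
        have "1 / h * ?g h \<le> ?b n * (diff_ker_L1 * norm2R f)\<^sup>2" if "?a n < h"
        proof (rule mult_mono)
          have "0 < h" using that ab(1) by linarith
          have "1 / h \<le> 1 / ?a n" using that ab(1) \<open>0 < h\<close> by (intro divide_left_mono) auto
          then show "1 / h \<le> ?b n" by simp
        qed (use gb in auto)
        moreover have "\<bar>h\<bar> = h" if "?a n < h" using that ab(1) by linarith
        ultimately show "norm (indicator {?a n<..<?b n} h / h * ?g h) \<le> norm ((?b n * (diff_ker_L1 * norm2R f)\<^sup>2) * indicator {?a n<..<?b n} h)"
          using ab(1) by (cases "h \<in> {?a n<..<?b n}") auto
      qed
    qed measurable
    then have "(\<integral>\<^sup>+h. ennreal (indicator {?a n<..<?b n} h / h * ?g h) \<partial>lborel)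
        = ennreal (LINT h|lborel. indicator {?a n<..<?b n} h / h * ?g h)"
    proof (rule nn_integral_eq_integral)
      show "AE h in lborel. 0 \<le> indicator {?a n<..<?b n} h / h * ?g h"
      proof (rule AE_I2)
        fix h
        have "0 \<le> h" if "?a n < h" using that ab(1) by linarith
        then show "0 \<le> indicator {?a n<..<?b n} h / h * ?g h"
          by (cases "h \<in> {?a n<..<?b n}") auto
      qed
    qed
    also have "(LINT h|lborel. indicator {?a n<..<?b n} h / h * ?g h) = diff_scale.scale_int A (?a n) (?b n)"
      unfolding diff_scale.scale_int_def
    proof (intro Bochner_Integration.integral_cong refl)
      fix h
      show "indicator {?a n<..<?b n} h / h * ?g h = indicator {?a n<..<?b n} h / h *
         (LINT p|(lborel \<Otimes>\<^sub>M lborel). diff_ker (fst p) * diff_ker (snd p) * A (h * \<bar>fst p - 1 * snd p\<bar>))"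
      proof (cases "?a n < h")
        case True
        then have "0 < h" using ab(1) by linarith
        then show ?thesis by (simp only: n)
      qed simp
    qed
    also have "ennreal (diff_scale.scale_int A (?a n) (?b n)) \<le> ennreal (square_const * (norm2R f)\<^sup>2)"
      using diff_scale.scale_int_bound[OF A B ab] by (intro ennreal_leI) (simp add: square_const_def mult_ac)
    finally show ?thesis .
  qed
  have "(\<integral>\<^sup>+h. ennreal (indicator {0<..} h / h) * (\<integral>\<^sup>+t. ennreal ((diff_avg h f t)\<^sup>2) \<partial>lborel) \<partial>lborel)
      = (\<integral>\<^sup>+h. liminf (\<lambda>n. ennreal (indicator {?a n<..<?b n} h / h * ?g h)) \<partial>lborel)"
  proof (intro nn_integral_cong)
    fix h :: real
    have "(\<lambda>n. ennreal (indicator {?a n<..<?b n} h / h * ?g h)) \<longlonglongrightarrow> ennreal (indicator {0<..} h / h * ?g h)"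
    proof (rule tendsto_eventually)
      show "\<forall>\<^sub>F n in sequentially. ennreal (indicator {?a n<..<?b n} h / h * ?g h) = ennreal (indicator {0<..} h / h * ?g h)"
      proof (cases "0 < h")
        case True
        have "\<forall>\<^sub>F n in sequentially. ?a n < h" "\<forall>\<^sub>F n in sequentially. h < ?b n"
          using True by real_asymp+
        then show ?thesis by eventually_elim (use True in auto)
      next
        case False
        have "h \<notin> {?a n<..<?b n}" for n using False less_trans[of 0 "?a n" h] by auto
        then show ?thesis using False by simp
      qed
    qed
    then have "liminf (\<lambda>n. ennreal (indicator {?a n<..<?b n} h / h * ?g h)) = ennreal (indicator {0<..} h / h * ?g h)"
      by (intro lim_imp_Liminf) simp_all
    moreover have "ennreal (indicator {0<..} h / h) * ennreal (?g h) = ennreal (indicator {0<..} h / h * ?g h)"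
      by (intro ennreal_mult[symmetric]) (auto simp: indicator_def)
    ultimately show "ennreal (indicator {0<..} h / h) * (\<integral>\<^sup>+t. ennreal ((diff_avg h f t)\<^sup>2) \<partial>lborel)
        = liminf (\<lambda>n. ennreal (indicator {?a n<..<?b n} h / h * ?g h))"
      using nn_integral_power2_sq_integrable[OF diff_avg_sqR[OF f], of h] by simp
  qed
  also have "\<dots> \<le> liminf (\<lambda>n. \<integral>\<^sup>+h. ennreal (indicator {?a n<..<?b n} h / h * ?g h) \<partial>lborel)"
    by (rule nn_integral_liminf) measurable
  also have "\<dots> \<le> liminf (\<lambda>n::nat. ennreal (square_const * (norm2R f)\<^sup>2))"
    by (rule Liminf_mono) (use bd in auto)
  also have "\<dots> = ennreal (square_const * (norm2R f)\<^sup>2)" by (simp add: Liminf_const)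
  finally show ?thesis .
qed

text \<open>
  The kernel vanishes on the negative half-line, so the absolute value on the right-hand side is
  harmless; it is what the locale instance \<open>sum_scale\<close> requires.
\<close>

lemma diff_avg_cross:
  assumes f: "sqR f" and g: "sqR g" and h: "0 < h"
  shows "(LINT t|lborel. diff_avg h f t * diff_avg (- h) g t) =
    (LINT p|(lborel \<Otimes>\<^sub>M lborel). diff_ker (fst p) * diff_ker (snd p) * corr f g (h * \<bar>fst p - (-1) * snd p\<bar>))"
  unfolding diff_avg_inner[OF f g]
proof (intro Bochner_Integration.integral_cong refl)
  fix p :: "real \<times> real"
  show "diff_ker (fst p) * diff_ker (snd p) * corr f g (h * fst p - - h * snd p)
      = diff_ker (fst p) * diff_ker (snd p) * corr f g (h * \<bar>fst p - - 1 * snd p\<bar>)"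
  proof (cases "fst p \<le> 0 \<or> snd p \<le> 0")
    case False
    then have "h * fst p - - h * snd p = h * \<bar>fst p - - 1 * snd p\<bar>" by (simp add: algebra_simps)
    then show ?thesis by simp
  qed (auto simp: diff_ker_eq_0)
qed

text \<open>
  Up to the factor \<open>1 / Gamma \<alpha>\<close> the fractional integral from \<open>t\<close> to infinity.
\<close>

definition back_int :: "(real \<Rightarrow> real) \<Rightarrow> real \<Rightarrow> real" where
  "back_int f t = (LINT x|lborel. pow_ker x * f (t + x))"

lemma back_int_measurable[measurable (raw)]:
  assumes [measurable]: "f \<in> borel_measurable borel"
  shows "back_int f \<in> borel_measurable borel"
  unfolding back_int_def[abs_def] by measurable

lemma pow_ker_scale: "0 < h \<Longrightarrow> pow_ker (h * x) = h powr (\<alpha> - 1) * pow_ker x"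
  by (auto simp: pow_ker_def powr_mult zero_less_mult_iff)

text \<open>
  Substituting \<open>h * x\<close> for the variable of integration extracts \<open>h powr \<alpha>\<close> from both integrals, and the
  step \<open>h\<close> becomes the shift by one of the kernel.
\<close>

lemma back_int_difference:
  assumes h: "0 < h" and i1: "integrable lborel (\<lambda>x. pow_ker x * f (t + x))"
    and i2: "integrable lborel (\<lambda>x. pow_ker x * f (t + h + x))"
  shows "back_int f t - back_int f (t + h) = h powr \<alpha> * diff_avg h f t"
proof -
  have sc: "integrable lborel (\<lambda>x. pow_ker x * f (s + h * x))"
    "back_int f s = h powr \<alpha> * (LINT x|lborel. pow_ker x * f (s + h * x))"
    if i: "integrable lborel (\<lambda>x. pow_ker x * f (s + x))" for s
  proof -
    have "integrable lborel (\<lambda>x. pow_ker (0 + h * x) * f (s + (0 + h * x)))"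
      by (rule lborel_integrable_real_affine[OF i]) (use h in auto)
    then have "integrable lborel (\<lambda>x. h powr (\<alpha> - 1) * (pow_ker x * f (s + h * x)))"
      using h by (simp add: pow_ker_scale mult.assoc)
    from integrable_mult_right[OF this, of "inverse (h powr (\<alpha> - 1))"]
    show "integrable lborel (\<lambda>x. pow_ker x * f (s + h * x))"
      using h by (simp add: field_simps)
    have "back_int f s = h * (LINT x|lborel. pow_ker (0 + h * x) * f (s + (0 + h * x)))"
      unfolding back_int_def using lborel_integral_real_affine[of h "\<lambda>x. pow_ker x * f (s + x)" 0] h by simp
    also have "\<dots> = h * (LINT x|lborel. h powr (\<alpha> - 1) * (pow_ker x * f (s + h * x)))"
      using h by (simp add: pow_ker_scale mult.assoc)
    also have "\<dots> = h * h powr (\<alpha> - 1) * (LINT x|lborel. pow_ker x * f (s + h * x))"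
      by (simp only: integral_mult_right_zero mult.assoc)
    also have "h * h powr (\<alpha> - 1) = h powr \<alpha>" using h by (simp add: powr_mult_base)
    finally show "back_int f s = h powr \<alpha> * (LINT x|lborel. pow_ker x * f (s + h * x))" .
  qed
  have j2: "integrable lborel (\<lambda>x. pow_ker (x - 1) * f (t + h * x))"
    "(LINT x|lborel. pow_ker (x - 1) * f (t + h * x)) = (LINT x|lborel. pow_ker x * f (t + h + h * x))"
    using lborel_integrable_real_affine[OF sc(1)[OF i2], of 1 "-1"]
      lborel_integral_real_affine[of 1 "\<lambda>x. pow_ker x * f (t + h + h * x)" "-1"]
    by (simp_all add: algebra_simps)
  have "diff_avg h f t = (LINT x|lborel. pow_ker x * f (t + h * x)) - (LINT x|lborel. pow_ker (x - 1) * f (t + h * x))"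
    unfolding diff_avg_def diff_ker_def left_diff_distrib
    by (rule Bochner_Integration.integral_diff[OF sc(1)[OF i1] j2(1)])
  then show ?thesis unfolding sc(2)[OF i1] sc(2)[OF i2] j2(2) by (simp only: right_diff_distrib)
qed

end

lemma corr_comp_measurable[measurable (raw)]:
  assumes [measurable]: "f \<in> borel_measurable borel" "g \<in> borel_measurable borel" "u \<in> borel_measurable M"
  shows "(\<lambda>x. corr f g (u x)) \<in> borel_measurable M"
  unfolding corr_def by measurable

lemma Young_adjoint:
  fixes k f g :: "real \<Rightarrow> real"
  assumes k: "integrable lborel k" and f: "sqR f" and g: "sqR g"
  shows "(LINT t|lborel. g t * (LINT x|lborel. k x * f (t + c * x))) = (LINT x|lborel. k x * corr f g (c * x))"
proof -
  have [measurable]: "f \<in> borel_measurable borel" "g \<in> borel_measurable borel" "k \<in> borel_measurable borel"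
    using f g k by (auto simp: sq_integrable_def)
  have s: "sqR (\<lambda>t. \<bar>f t\<bar>)" "sqR (\<lambda>t. \<bar>g t\<bar>)" using f g by (auto simp: sq_integrable_def)
  have I: "integrable (lborel \<Otimes>\<^sub>M lborel) (\<lambda>p. k (fst p) * (f (snd p + c * fst p) * g (snd p)))"
  proof (rule lborel_pair.Fubini_integrable)
    have eq: "(LINT t|lborel. norm (k x * (f (t + c * x) * g t))) = \<bar>k x\<bar> * corr (\<lambda>t. \<bar>f t\<bar>) (\<lambda>t. \<bar>g t\<bar>) (c * x)" for x
      unfolding corr_def by (subst integral_mult_right_zero[symmetric]) (simp add: abs_mult mult_ac)
    show "integrable lborel (\<lambda>x. LINT t|lborel. norm (k (fst (x, t)) * (f (snd (x, t) + c * fst (x, t)) * g (snd (x, t)))))"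
      unfolding fst_conv snd_conv eq
    proof (rule Bochner_Integration.integrable_bound)
      let ?B = "norm2R (\<lambda>t. \<bar>f t\<bar>) * norm2R (\<lambda>t. \<bar>g t\<bar>)"
      show "integrable lborel (\<lambda>x. ?B * k x)" using k by (rule integrable_mult_right)
      show "AE x in lborel. norm (\<bar>k x\<bar> * corr (\<lambda>t. \<bar>f t\<bar>) (\<lambda>t. \<bar>g t\<bar>) (c * x)) \<le> norm (?B * k x)"
      proof (rule AE_I2)
        fix x
        have "\<bar>k x\<bar> * \<bar>corr (\<lambda>t. \<bar>f t\<bar>) (\<lambda>t. \<bar>g t\<bar>) (c * x)\<bar> \<le> \<bar>k x\<bar> * ?B"
          by (intro mult_left_mono corr_bound s) auto
        then show "norm (\<bar>k x\<bar> * corr (\<lambda>t. \<bar>f t\<bar>) (\<lambda>t. \<bar>g t\<bar>) (c * x)) \<le> norm (?B * k x)"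
          by (simp add: abs_mult mult_ac)
      qed
    qed measurable
    show "AE x in lborel. integrable lborel (\<lambda>t. k (fst (x, t)) * (f (snd (x, t) + c * fst (x, t)) * g (snd (x, t))))"
      unfolding fst_conv snd_conv
      by (intro AE_I2 integrable_mult_right sq_integrable_mult_integrable sqR_shift f g)
  qed measurable
  have "(LINT t|lborel. g t * (LINT x|lborel. k x * f (t + c * x)))
      = (LINT t|lborel. LINT x|lborel. k x * (f (t + c * x) * g t))"
    by (subst integral_mult_right_zero[symmetric]) (simp add: mult_ac)
  also have "\<dots> = (LINT x|lborel. LINT t|lborel. k x * (f (t + c * x) * g t))"
    by (rule lborel_pair.Fubini_integral) (use I in \<open>simp add: case_prod_beta'\<close>)
  finally show ?thesis unfolding corr_def by (simp only: integral_mult_right_zero)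
qed

lemma corr_swap: "corr g f (- z) = corr f g z"
  using corr_shift[of g 0 f z] by (simp add: corr_def mult.commute)

lemma AE_shift:
  fixes P :: "real \<Rightarrow> bool"
  assumes "Measurable.pred borel P" "AE t in lborel. P t"
  shows "AE t in lborel. P (t + z)"
  using AE_borel_affine[of 1 P z] assms by (simp add: add.commute)

context frac_order
begin

text \<open>
  The formal adjoint of \<open>back_int\<close>, which looks to the left.
\<close>

definition forw_int :: "(real \<Rightarrow> real) \<Rightarrow> real \<Rightarrow> real" where
  "forw_int f t = (LINT x|lborel. pow_ker x * f (t - x))"

lemma forw_int_measurable[measurable (raw)]:
  assumes [measurable]: "f \<in> borel_measurable borel"
  shows "forw_int f \<in> borel_measurable borel"
  unfolding forw_int_def[abs_def] by measurable

lemma forw_int_difference: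
  assumes "0 < h" "integrable lborel (\<lambda>x. pow_ker x * f (t - x))" "integrable lborel (\<lambda>x. pow_ker x * f (t - h - x))"
  shows "forw_int f t - forw_int f (t - h) = h powr \<alpha> * diff_avg (- h) f t"
  using back_int_difference[of h "\<lambda>u. f (- u)" "- t"] assms
  by (simp add: back_int_def forw_int_def diff_avg_def algebra_simps)

lemma diff_avg_adjoint:
  assumes f: "sqR f" and g: "sqR g"
  shows "(LINT t|lborel. g t * diff_avg c f t) = (LINT t|lborel. f t * diff_avg (- c) g t)"
  unfolding diff_avg_def Young_adjoint[OF diff_ker_integrable f g] Young_adjoint[OF diff_ker_integrable g f]
  using corr_swap[of g f] by simp

lemma square_function_bound_backward:
  assumes f: "sqR f"
  shows "(\<integral>\<^sup>+h. ennreal (indicator {0<..} h / h) * (\<integral>\<^sup>+t. ennreal ((diff_avg (- h) f t)\<^sup>2) \<partial>lborel) \<partial>lborel)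
    \<le> ennreal (square_const * (norm2R f)\<^sup>2)"
proof -
  have [measurable]: "f \<in> borel_measurable borel" using f by (simp add: sq_integrable_def)
  let ?r = "\<lambda>u. f (- u)"
  have i: "integrable lborel (\<lambda>t. (f t)\<^sup>2)" using f by (simp add: sq_integrable_def)
  have r: "sqR ?r" using lborel_integrable_real_affine[OF i, of "-1" 0] by (simp add: sq_integrable_def)
  have n: "norm2R ?r = norm2R f"
    using lborel_integral_real_affine[of "-1" "\<lambda>t. (f t)\<^sup>2" 0] by (simp add: norm2_def)
  have e: "diff_avg (- h) f t = diff_avg h ?r (- t)" for h t
    by (simp add: diff_avg_def algebra_simps)
  have "(\<integral>\<^sup>+t. ennreal ((diff_avg (- h) f t)\<^sup>2) \<partial>lborel) = (\<integral>\<^sup>+t. ennreal ((diff_avg h ?r t)\<^sup>2) \<partial>lborel)" for h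
    unfolding e using nn_integral_real_affine[of "\<lambda>t. ennreal ((diff_avg h ?r t)\<^sup>2)" "-1" 0] by simp
  then show ?thesis using square_function_bound[OF r] n by simp
qed

end

section \<open>Fractional integrals on an interval\<close>

locale frac_interval = frac_order +
  fixes T :: real
  assumes T: "0 < T"
begin

text \<open>
  The representatives of the square integrable functions on the interval that are used below: Borel
  functions on the line that vanish outside of the interval. Translations and dilations then need no
  case distinctions, and equality almost everywhere refers to the line.
\<close>

definition S :: "(real \<Rightarrow> real) \<Rightarrow> bool" where
  "S f \<longleftrightarrow> sqR f \<and> (\<forall>t. t \<notin> {0<..<T} \<longrightarrow> f t = 0)"

definition cut :: "(real \<Rightarrow> real) \<Rightarrow> real \<Rightarrow> real" where
  "cut f t = indicator {0<..<T} t * f t"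

lemma cut_measurable[measurable (raw)]:
  assumes [measurable]: "f \<in> borel_measurable borel"
  shows "cut f \<in> borel_measurable borel"
  unfolding cut_def[abs_def] by measurable

lemma S_sqR: "S f \<Longrightarrow> sqR f" and S_zero: "S f \<Longrightarrow> t \<notin> {0<..<T} \<Longrightarrow> f t = 0"
  by (auto simp: S_def)

lemma S_borel[measurable_dest]: "S f \<Longrightarrow> f \<in> borel_measurable borel"
  by (simp add: S_def sq_integrable_def)

lemma cut_S: "sqR f \<Longrightarrow> S (cut f)" and cut_le: "sqR f \<Longrightarrow> norm2R (cut f) \<le> norm2R f"
proof -
  assume f: "sqR f"
  then have [measurable]: "f \<in> borel_measurable borel" by (rule sqR_borel)
  have i: "integrable lborel (\<lambda>t. (f t)\<^sup>2)" using f by (simp add: sq_integrable_def)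
  have j: "integrable lborel (\<lambda>t. (cut f t)\<^sup>2)"
    by (rule Bochner_Integration.integrable_bound[OF i]) (auto simp: cut_def indicator_def)
  then show "S (cut f)" by (auto simp: S_def sq_integrable_def cut_def)
  show "norm2R (cut f) \<le> norm2R f" unfolding norm2_def
    by (intro real_sqrt_le_mono integral_mono j i) (auto simp: cut_def indicator_def)
qed

lemma S_add: "S f \<Longrightarrow> S g \<Longrightarrow> S (\<lambda>x. f x + g x)"
  and S_scale: "S f \<Longrightarrow> S (\<lambda>x. c * f x)"
  and S_diff: "S f \<Longrightarrow> S g \<Longrightarrow> S (\<lambda>x. f x - g x)"
  by (auto simp: S_def intro: sq_integrable_add sq_integrable_scale sq_integrable_diff)

lemma S_ind: assumes "b \<le> T" shows "S (indicator {0<..<b})"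
proof -
  have "integrable lborel (indicator {0<..<b} :: real \<Rightarrow> real)"
    by (rule integrable_real_indicator) (cases "0 \<le> b"; simp)+
  moreover have "(\<lambda>x. (indicator {0<..<b} x :: real)\<^sup>2) = indicator {0<..<b}"
    by (auto simp: indicator_def)
  ultimately have "sqR (indicator {0<..<b})" by (simp only: sq_integrable_def) simp
  then show ?thesis using assms by (auto simp: S_def)
qed

lemma S_integrable: assumes "S f" shows "integrable lborel f"
proof -
  have "integrable lborel (\<lambda>t. f t * indicator {0<..<T} t)"
    by (intro sq_integrable_mult_integrable S_sqR assms S_ind) simp
  moreover have "f t * indicator {0<..<T} t = f t" for t using S_zero[OF assms, of t] by (auto simp: indicator_def)
  ultimately show ?thesis by simp
qed

lemma trunc_pow_ker_integrable: "integrable lborel (\<lambda>x. indicator {..T} x * pow_ker x)"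
  using pow_ker_truncated(1)[of T] T by simp

lemma trunc_pow_ker_mult: "S f \<Longrightarrow> 0 \<le> t \<Longrightarrow> (indicator {..T} x * pow_ker x) * f (t + 1 * x) = pow_ker x * f (t + x)"
  using S_zero[of f "t + x"] by (auto simp: indicator_def)

lemma back_int_trunc: "S f \<Longrightarrow> 0 \<le> t \<Longrightarrow> back_int f t = (LINT x|lborel. (indicator {..T} x * pow_ker x) * f (t + 1 * x))"
  unfolding back_int_def by (simp only: trunc_pow_ker_mult)

lemma back_int_AE:
  assumes "S f" shows "AE t in lborel. 0 < t \<longrightarrow> integrable lborel (\<lambda>x. pow_ker x * f (t + x))"
  using Young_L2(1)[OF trunc_pow_ker_integrable S_sqR[OF assms], of 1]
proof eventually_elim
  case (elim t)
  show ?case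
  proof
    assume "0 < t"
    then have "(\<lambda>x. (indicator {..T} x * pow_ker x) * f (t + 1 * x)) = (\<lambda>x. pow_ker x * f (t + x))"
      by (intro ext trunc_pow_ker_mult[OF assms]) simp
    then show "integrable lborel (\<lambda>x. pow_ker x * f (t + x))" using elim by (simp only:)
  qed
qed

lemma back_int_AE_shift:
  assumes f: "S f" and h: "0 < h"
  shows "AE t in lborel. 0 < t \<longrightarrow> integrable lborel (\<lambda>x. pow_ker x * f (t + h + x))"
proof -
  have "AE t in lborel. integrable lborel (\<lambda>x. (indicator {..T} x * pow_ker x) * f (t + 1 * x + h))"
    using Young_L2(1)[OF trunc_pow_ker_integrable sqR_shift(1)[OF S_sqR[OF f], of h], of 1] .
  then show ?thesis
  proof eventually_elim
    case (elim t)
    show ?case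
    proof
      assume "0 < t"
      then have "(\<lambda>x. (indicator {..T} x * pow_ker x) * f (t + h + 1 * x)) = (\<lambda>x. pow_ker x * f (t + h + x))"
        using h by (intro ext trunc_pow_ker_mult[OF f]) simp
      moreover have "t + 1 * x + h = t + h + 1 * x" for x by simp
      ultimately show "integrable lborel (\<lambda>x. pow_ker x * f (t + h + x))"
        using elim by (simp only:)
    qed
  qed
qed

text \<open>
  Up to the factor \<open>1 / Gamma \<alpha>\<close> the operator \<open>J_op \<alpha> T\<close> on the representatives in \<open>S\<close>. Beyond \<open>T\<close> the
  integral vanishes by itself, but for negative arguments it does not.
\<close>

definition JT :: "(real \<Rightarrow> real) \<Rightarrow> real \<Rightarrow> real" where
  "JT f = cut (back_int f)"

lemma JT_eq: "S f \<Longrightarrow> JT f = cut (\<lambda>t. LINT x|lborel. (indicator {..T} x * pow_ker x) * f (t + 1 * x))"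
  unfolding JT_def cut_def by (auto simp: fun_eq_iff indicator_def back_int_trunc simp del: mult_1)

lemma JT_S: "S f \<Longrightarrow> S (JT f)"
  unfolding JT_eq by (intro cut_S Young_L2(2)[OF trunc_pow_ker_integrable] S_sqR)

lemma JT_bound: assumes f: "S f" shows "norm2R (JT f) \<le> (LINT x|lborel. \<bar>indicator {..T} x * pow_ker x\<bar>) * norm2R f"
  unfolding JT_eq[OF f]
  using cut_le[OF Young_L2(2)[OF trunc_pow_ker_integrable S_sqR[OF f], of 1]]
    Young_L2(3)[OF trunc_pow_ker_integrable S_sqR[OF f], of 1] by linarith

lemma JT_scale: "JT (\<lambda>x. c * f x) t = c * JT f t"
proof -
  have "(LINT x|lborel. pow_ker x * (c * f (t + x))) = (LINT x|lborel. c * (pow_ker x * f (t + x)))"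
    by (simp add: mult_ac)
  then show ?thesis unfolding JT_def cut_def back_int_def by simp
qed

lemma JT_add:
  assumes f: "S f" and g: "S g"
  shows "AE t in lborel. JT (\<lambda>x. f x + g x) t = JT f t + JT g t"
  using back_int_AE[OF f] back_int_AE[OF g]
proof eventually_elim
  case (elim t)
  show ?case
  proof (cases "0 < t")
    case True
    then have "back_int (\<lambda>x. f x + g x) t = back_int f t + back_int g t"
      using elim unfolding back_int_def distrib_left by (intro Bochner_Integration.integral_add) auto
    then show ?thesis by (simp add: JT_def cut_def distrib_left)
  qed (simp add: JT_def cut_def)
qed

lemma back_int_zero: "S f \<Longrightarrow> T \<le> t \<Longrightarrow> back_int f t = 0"
proof -
  assume f: "S f" and t: "T \<le> t"
  have "pow_ker x * f (t + x) = 0" for x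
    using S_zero[OF f, of "t + x"] t by (cases "0 < x") (auto simp: pow_ker_eq_0)
  then show ?thesis by (simp only: back_int_def integral_zero)
qed

lemma JT_pos: "S f \<Longrightarrow> 0 < t \<Longrightarrow> JT f t = back_int f t"
  using back_int_zero[of f t] by (auto simp: JT_def cut_def indicator_def)

lemma JT_difference:
  assumes f: "S f" and h: "0 < h"
  shows "AE t in lborel. 0 < t \<longrightarrow> JT f t - JT f (t + h) = h powr \<alpha> * diff_avg h f t"
  using back_int_AE[OF f] back_int_AE_shift[OF f h]
  by eventually_elim (use JT_pos[OF f] back_int_difference[OF h] h in auto)

text \<open>
  The square of the seminorm of fractional smoothness, written with translations. The argument \<open>t + h\<close>
  may exceed \<open>T\<close>, so for functions in \<open>S\<close> the jump to the value zero beyond \<open>T\<close> is part of the energy,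
  see \<open>shift_energy_eq\<close>.
\<close>

definition shift_energy :: "(real \<Rightarrow> real) \<Rightarrow> ennreal" where
  "shift_energy v = (\<integral>\<^sup>+h. \<integral>\<^sup>+t. ennreal (indicator {0<..} h * h powr (- 1 - 2 * \<alpha>))
     * ennreal (indicator {0<..<T} t * (v t - v (t + h))\<^sup>2) \<partial>lborel \<partial>lborel)"

text \<open>
  By \<open>JT_difference\<close> the factor \<open>h powr (- 1 - 2 * \<alpha>)\<close> becomes \<open>1 / h\<close>, and the energy is at most the
  square function of \<open>f\<close>.
\<close>

lemma shift_energy_JT:
  assumes f: "S f" shows "shift_energy (JT f) \<le> ennreal (square_const * (norm2R f)\<^sup>2)"
proof -
  have [measurable]: "f \<in> borel_measurable borel" using f by (rule S_borel)
  have "shift_energy (JT f) \<le> (\<integral>\<^sup>+h. ennreal (indicator {0<..} h / h) * (\<integral>\<^sup>+t. ennreal ((diff_avg h f t)\<^sup>2) \<partial>lborel) \<partial>lborel)"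
    unfolding shift_energy_def
  proof (rule nn_integral_mono)
    fix h :: real
    show "(\<integral>\<^sup>+t. ennreal (indicator {0<..} h * h powr (- 1 - 2 * \<alpha>))
       * ennreal (indicator {0<..<T} t * (JT f t - JT f (t + h))\<^sup>2) \<partial>lborel)
       \<le> ennreal (indicator {0<..} h / h) * (\<integral>\<^sup>+t. ennreal ((diff_avg h f t)\<^sup>2) \<partial>lborel)"
    proof (cases "0 < h")
      case True
      have "(\<integral>\<^sup>+t. ennreal (indicator {0<..} h * h powr (- 1 - 2 * \<alpha>))
         * ennreal (indicator {0<..<T} t * (JT f t - JT f (t + h))\<^sup>2) \<partial>lborel)
         \<le> (\<integral>\<^sup>+t. ennreal (indicator {0<..} h / h) * ennreal ((diff_avg h f t)\<^sup>2) \<partial>lborel)"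
      proof (rule nn_integral_mono_AE)
        show "AE t in lborel. ennreal (indicator {0<..} h * h powr (- 1 - 2 * \<alpha>))
          * ennreal (indicator {0<..<T} t * (JT f t - JT f (t + h))\<^sup>2)
          \<le> ennreal (indicator {0<..} h / h) * ennreal ((diff_avg h f t)\<^sup>2)"
          using JT_difference[OF f True]
        proof eventually_elim
          case (elim t)
          show ?case
          proof (cases "t \<in> {0<..<T}")
            case t: True
            have "h powr (- 1 - 2 * \<alpha>) * (h powr \<alpha> * diff_avg h f t)\<^sup>2
                = (h powr (- 1 - 2 * \<alpha>) * (h powr \<alpha> * h powr \<alpha>)) * (diff_avg h f t)\<^sup>2"
              by (simp add: power2_eq_square mult_ac)
            also have "h powr (- 1 - 2 * \<alpha>) * (h powr \<alpha> * h powr \<alpha>) = h powr (- 1)"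
              by (simp add: powr_add[symmetric])
            also have "h powr (- 1) = 1 / h" using True by (simp add: powr_minus divide_inverse)
            finally show ?thesis using t elim True by (simp add: ennreal_mult[symmetric])
          qed simp
        qed
      qed
      also have "\<dots> = ennreal (indicator {0<..} h / h) * (\<integral>\<^sup>+t. ennreal ((diff_avg h f t)\<^sup>2) \<partial>lborel)"
        by (rule nn_integral_cmult) measurable
      finally show ?thesis .
    qed simp
  qed
  also note square_function_bound[OF S_sqR[OF f]]
  finally show ?thesis .
qed

text \<open>
  The integrals of \<open>f\<close> over all half-lines vanish, hence the measures whose densities are the positive
  and the negative part of \<open>f\<close> agree on half-lines and are equal.
\<close>

lemma zero_if_initial_integrals_zero:
  assumes f: "S f" and z: "\<And>b. 0 < b \<Longrightarrow> b \<le> T \<Longrightarrow> (LINT t|lborel. f t * indicator {0<..<b} t) = 0"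
  shows "AE t in lborel. f t = 0"
proof -
  have [measurable]: "f \<in> borel_measurable borel" using f by (rule S_borel)
  have fi: "integrable lborel f" using f by (rule S_integrable)
  have z': "(LINT t|lborel. f t * indicator {x<..} t) = 0" for x
  proof -
    have "(LINT t|lborel. f t * indicator {0<..<T} t) = 0" using z[of T] T by simp
    moreover have "f t * indicator {0<..<T} t = f t" for t using S_zero[OF f, of t] by (auto simp: indicator_def)
    ultimately have f0: "(LINT t|lborel. f t) = 0" by simp
    define b where "b = min x T"
    have b: "(LINT t|lborel. f t * indicator {0<..<b} t) = 0"
      using z[of b] T by (cases "0 < b") (auto simp: b_def)
    have "(LINT t|lborel. f t * indicator {x<..} t) = (LINT t|lborel. f t - f t * indicator {0<..<b} t)"
    proof (rule integral_cong_AE)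
      show "AE t in lborel. f t * indicator {x<..} t = f t - f t * indicator {0<..<b} t"
        using AE_lborel_singleton[of x]
        by eventually_elim (use S_zero[OF f] in \<open>auto simp: indicator_def b_def min_def split: if_splits\<close>)
    qed measurable
    also have "\<dots> = 0"
    proof -
      have "integrable lborel (\<lambda>t. f t * indicator {0<..<b} t)"
        using fi by (rule Bochner_Integration.integrable_bound) (auto simp: indicator_def)
      then show ?thesis using fi f0 b by simp
    qed
    finally show ?thesis .
  qed
  define P N where "P t = max (f t) 0" and "N t = max (- f t) 0" for t
  have [measurable]: "P \<in> borel_measurable borel" "N \<in> borel_measurable borel"
    unfolding P_def[abs_def] N_def[abs_def] by measurable
  have PN: "f t = P t - N t" "0 \<le> P t" "0 \<le> N t" for t by (auto simp: P_def N_def)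
  have Pi: "integrable lborel P" "integrable lborel N"
    by (rule Bochner_Integration.integrable_bound[OF fi]; auto simp: P_def N_def)+
  have ind: "integrable lborel (\<lambda>t. u t * indicator {x<..} t)" if u: "integrable lborel u" for u :: "real \<Rightarrow> real" and x
  proof (rule Bochner_Integration.integrable_bound[OF u])
    have [measurable]: "u \<in> borel_measurable borel" using u by auto
    show "(\<lambda>t. u t * indicator {x<..} t) \<in> borel_measurable lborel" by measurable
  qed (auto simp: indicator_def)
  have em: "emeasure (density lborel (\<lambda>t. ennreal (u t))) {x<..} = ennreal (LINT t|lborel. u t * indicator {x<..} t)"
    if u: "integrable lborel u" "\<And>t. 0 \<le> u t" for u :: "real \<Rightarrow> real" and x
  proof -
    have [measurable]: "u \<in> borel_measurable borel" using u(1) by auto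
    have "emeasure (density lborel (\<lambda>t. ennreal (u t))) {x<..} = (\<integral>\<^sup>+t. ennreal (u t) * indicator {x<..} t \<partial>lborel)"
      by (rule emeasure_density) auto
    also have "\<dots> = (\<integral>\<^sup>+t. ennreal (u t * indicator {x<..} t) \<partial>lborel)"
      by (intro nn_integral_cong) (auto simp: indicator_def)
    also have "\<dots> = ennreal (LINT t|lborel. u t * indicator {x<..} t)"
      by (rule nn_integral_eq_integral[OF ind[OF u(1)]]) (use u(2) in auto)
    finally show ?thesis .
  qed
  have "density lborel (\<lambda>t. ennreal (P t)) = density lborel (\<lambda>t. ennreal (N t))"
  proof (rule measure_eqI_lessThan)
    fix x
    have "(LINT t|lborel. P t * indicator {x<..} t) - (LINT t|lborel. N t * indicator {x<..} t)
        = (LINT t|lborel. P t * indicator {x<..} t - N t * indicator {x<..} t)"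
      by (rule Bochner_Integration.integral_diff[symmetric]) (intro ind Pi)+
    also have "\<dots> = (LINT t|lborel. f t * indicator {x<..} t)" by (simp add: PN(1) left_diff_distrib)
    finally show "emeasure (density lborel (\<lambda>t. ennreal (P t))) {x<..} = emeasure (density lborel (\<lambda>t. ennreal (N t))) {x<..}"
      using z'[of x] em[OF Pi(1) PN(2)] em[OF Pi(2) PN(3)] by simp
    show "emeasure (density lborel (\<lambda>t. ennreal (P t))) {x<..} < \<infinity>" using em[OF Pi(1) PN(2)] by simp
  qed auto
  then have "AE t in lborel. ennreal (P t) = ennreal (N t)"
    by (intro sigma_finite_measure.density_unique[OF sigma_finite_lborel]) auto
  then show ?thesis by eventually_elim (use PN in \<open>auto simp: ennreal_inj\<close>)
qed

text \<open>
  For an indicator function as second factor, continuity of the correlation at zero is dominated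
  convergence, and for a shift beyond the length of the interval the correlation vanishes.
\<close>

lemma corr_ind_limits:
  assumes f: "S f" and b: "0 < b" "b \<le> T"
  shows "(corr f (indicator {0<..<b}) \<longlongrightarrow> (LINT t|lborel. f t * indicator {0<..<b} t)) (at_right 0)"
    and "(corr f (indicator {0<..<b}) \<longlongrightarrow> 0) at_top"
proof -
  have [measurable]: "f \<in> borel_measurable borel" using f by (rule S_borel)
  have fi: "integrable lborel f" using f by (rule S_integrable)
  let ?g = "indicator {0<..<b} :: real \<Rightarrow> real"
  have c: "corr f ?g z = (LINT t|lborel. f t * ?g (t - z))" for z
    using corr_shift[of f 0 ?g "- z"] by simp
  show "(corr f ?g \<longlongrightarrow> (LINT t|lborel. f t * ?g t)) (at_right 0)"
  proof (rule tendsto_at_right_sequentially[of 0 1])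
    fix X :: "nat \<Rightarrow> real" assume X: "X \<longlonglongrightarrow> 0"
    show "(\<lambda>n. corr f ?g (X n)) \<longlonglongrightarrow> (LINT t|lborel. f t * ?g t)"
      unfolding c
    proof (rule integral_dominated_convergence)
      show "integrable lborel (\<lambda>t. \<bar>f t\<bar>)" using fi by simp
      show "AE t in lborel. (\<lambda>n. f t * ?g (t - X n)) \<longlonglongrightarrow> f t * ?g t"
        using AE_lborel_singleton[of 0] AE_lborel_singleton[of b]
      proof eventually_elim
        case (elim t)
        have l: "(\<lambda>n. t - X n) \<longlonglongrightarrow> t" using tendsto_diff[OF tendsto_const X, of t] by simp
        have "\<forall>\<^sub>F n in sequentially. ?g (t - X n) = ?g t"
        proof -
          consider "t < 0" | "0 < t" "t < b" | "b < t" using elim by linarith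
          then show ?thesis
          proof cases
            case 1
            show ?thesis using order_tendstoD(2)[OF l 1] by eventually_elim (use 1 in \<open>auto simp: indicator_def\<close>)
          next
            case 2
            show ?thesis using order_tendstoD(1)[OF l 2(1)] order_tendstoD(2)[OF l 2(2)]
              by eventually_elim (use 2 in \<open>auto simp: indicator_def\<close>)
          next
            case 3
            show ?thesis using order_tendstoD(1)[OF l 3] by eventually_elim (use 3 in \<open>auto simp: indicator_def\<close>)
          qed
        qed
        then have "\<forall>\<^sub>F n in sequentially. f t * ?g (t - X n) = f t * ?g t" by eventually_elim simp
        then show ?case by (rule tendsto_eventually)
      qed
      show "AE t in lborel. norm (f t * ?g (t - X n)) \<le> \<bar>f t\<bar>" for n
        by (auto simp: indicator_def)
    qed measurable
  qed simp
  show "(corr f ?g \<longlongrightarrow> 0) at_top"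
  proof (rule tendsto_eventually)
    show "\<forall>\<^sub>F z in at_top. corr f ?g z = 0"
      using eventually_ge_at_top[of T]
    proof eventually_elim
      case (elim z)
      have "f t * ?g (t - z) = 0" for t
        using S_zero[OF f, of t] elim by (auto simp: indicator_def)
      then show ?case by (simp only: c integral_zero)
    qed
  qed
qed

text \<open>
  A reproducing formula of Calderon type: pairing the averages of \<open>f\<close> that look to the right with the
  averages of the second function that look to the left, and integrating against \<open>dh / h\<close>, restores a
  multiple of the inner product of the two functions. By \<open>diff_avg_cross\<close> it is \<open>scale_int_limit\<close> applied to
  the correlation, and \<open>repro_const\<close> is positive by \<open>repro_const_pos\<close>.
\<close>

lemma reproducing_limit:
  assumes f: "S f" and b: "0 < b" "b \<le> T"
  shows "(\<lambda>n. LINT h|lborel. indicator {1 / real (n + 2)<..<real (n + 2)} h / h *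
      (LINT t|lborel. diff_avg h f t * diff_avg (- h) (indicator {0<..<b}) t))
    \<longlonglongrightarrow> repro_const * (LINT t|lborel. f t * indicator {0<..<b} t)"
proof -
  let ?g = "indicator {0<..<b} :: real \<Rightarrow> real"
  have g: "S ?g" using b by (intro S_ind)
  have [measurable]: "f \<in> borel_measurable borel" using f by (rule S_borel)
  have "(\<lambda>n. sum_scale.scale_int (corr f ?g) (1 / real (n + 2)) (real (n + 2)))
      \<longlonglongrightarrow> - (LINT t|lborel. f t * ?g t) * (LINT p|(lborel \<Otimes>\<^sub>M lborel). diff_ker (fst p) * diff_ker (snd p) * ln \<bar>fst p - (-1) * snd p\<bar>)"
    by (rule sum_scale.scale_int_limit[OF _ corr_bound corr_ind_limits[OF f b]])
       (use f g in \<open>auto intro: S_sqR\<close>)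
  moreover have "sum_scale.scale_int (corr f ?g) (1 / real (n + 2)) (real (n + 2))
    = (LINT h|lborel. indicator {1 / real (n + 2)<..<real (n + 2)} h / h * (LINT t|lborel. diff_avg h f t * diff_avg (- h) ?g t))" for n
    unfolding sum_scale.scale_int_def
  proof (intro Bochner_Integration.integral_cong refl)
    fix h
    have a: "0 < 1 / real (n + 2)" by simp
    show "indicator {1 / real (n + 2)<..<real (n + 2)} h / h * (LINT p|(lborel \<Otimes>\<^sub>M lborel). diff_ker (fst p) * diff_ker (snd p) * corr f ?g (h * \<bar>fst p - - 1 * snd p\<bar>))
       = indicator {1 / real (n + 2)<..<real (n + 2)} h / h * (LINT t|lborel. diff_avg h f t * diff_avg (- h) ?g t)"
    proof (cases "1 / real (n + 2) < h")
      case True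
      then have "0 < h" using a by linarith
      then show ?thesis using diff_avg_cross[OF S_sqR[OF f] S_sqR[OF g]] by simp
    qed simp
  qed
  ultimately show ?thesis by (simp add: repro_const_def mult.commute)
qed

lemma diff_avg_zero_left: "S f \<Longrightarrow> 0 < h \<Longrightarrow> t \<le> 0 \<Longrightarrow> diff_avg (- h) f t = 0"
proof -
  assume f: "S f" and h: "0 < h" and t: "t \<le> 0"
  have "diff_ker x * f (t + - h * x) = 0" for x
  proof (cases "0 < x")
    case True
    then have "0 < h * x" using h by simp
    then have "t + - h * x \<notin> {0<..<T}" using t by simp
    then show ?thesis using S_zero[OF f] by simp
  qed (simp add: diff_ker_eq_0)
  then show ?thesis by (simp only: diff_avg_def integral_zero)
qed

text \<open>
  If \<open>JT f\<close> vanishes then so do its differences, that is, the averages of \<open>f\<close> that look to the right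
  vanish on the positive half-line. On the negative half-line the averages of the indicator function
  that look to the left vanish. Hence every pairing in \<open>reproducing_limit\<close> is zero.
\<close>

lemma JT_injective:
  assumes f: "S f" and z: "AE t in lborel. JT f t = 0"
  shows "AE t in lborel. f t = 0"
proof (rule zero_if_initial_integrals_zero[OF f])
  fix b assume b: "0 < b" "b \<le> T"
  have [measurable]: "f \<in> borel_measurable borel" using f by (rule S_borel)
  have [measurable]: "JT f \<in> borel_measurable borel" using JT_S[OF f] by (rule S_borel)
  let ?g = "indicator {0<..<b} :: real \<Rightarrow> real"
  have g: "S ?g" using b by (intro S_ind)
  have "(LINT t|lborel. diff_avg h f t * diff_avg (- h) ?g t) = 0" if h: "0 < h" for h
  proof (rule integral_eq_zero_AE)
    have "AE t in lborel. JT f (t + h) = 0" by (rule AE_shift[OF _ z]) measurable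
    then show "AE t in lborel. diff_avg h f t * diff_avg (- h) ?g t = 0"
      using z JT_difference[OF f h]
    proof eventually_elim
      case (elim t)
      then show ?case using h diff_avg_zero_left[OF g h, of t] by (cases "0 < t") auto
    qed
  qed
  then have "indicator {1 / real (n + 2)<..<real (n + 2)} h / h * (LINT t|lborel. diff_avg h f t * diff_avg (- h) ?g t) = 0" for n h
  proof (cases "1 / real (n + 2) < h")
    case True
    moreover have "0 < 1 / real (n + 2)" by simp
    ultimately have "0 < h" by linarith
    then show ?thesis using \<open>\<And>h. 0 < h \<Longrightarrow> (LINT t|lborel. diff_avg h f t * diff_avg (- h) ?g t) = 0\<close> by simp
  qed simp
  then have "(\<lambda>n. 0) \<longlonglongrightarrow> repro_const * (LINT t|lborel. f t * ?g t)"
    using reproducing_limit[OF f b] by (simp only: integral_zero)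
  then have "repro_const * (LINT t|lborel. f t * ?g t) = 0"
    using LIMSEQ_unique tendsto_const by blast
  then show "(LINT t|lborel. f t * ?g t) = 0" using repro_const_pos by simp
qed

section \<open>Inversion of the fractional integral\<close>

lemma initial_indicator_pow_ker_integrable:
  "integrable lborel (\<lambda>x. pow_ker x * indicator {0<..<b} (s - x))"
proof (rule Bochner_Integration.integrable_bound)
  show "integrable lborel (\<lambda>x. indicator {..max s 0} x * pow_ker x)" by (rule pow_ker_truncated) simp
qed (auto simp: indicator_def)

text \<open>
  A translation is moved to the other factor. The indicator may be dropped, since the average
  vanishes for \<open>t \<le> 0\<close> and the difference of \<open>v\<close> for \<open>t \<ge> T\<close>.
\<close>

lemma difference_adjoint:
  assumes v: "S v" and \<phi>: "S \<phi>" and h: "0 < h"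
  shows "(LINT t|lborel. indicator {0<..<T} t * (v t - v (t + h)) * diff_avg (- h) \<phi> t)
    = (LINT t|lborel. v t * (diff_avg (- h) \<phi> t - diff_avg (- h) \<phi> (t - h)))"
proof -
  let ?w = "diff_avg (- h) \<phi>"
  have w: "sqR ?w" by (intro diff_avg_sqR S_sqR \<phi>)
  have "indicator {0<..<T} t * (v t - v (t + h)) * ?w t = v t * ?w t - v (t + h) * ?w t" for t
  proof -
    consider "t \<le> 0" | "t \<in> {0<..<T}" | "T \<le> t" by force
    then show ?thesis
    proof cases
      case 1 then show ?thesis using diff_avg_zero_left[OF \<phi> h] by simp
    next
      case 3 then show ?thesis using S_zero[OF v, of t] S_zero[OF v, of "t + h"] h by simp
    qed (simp add: left_diff_distrib)
  qed
  then have "(LINT t|lborel. indicator {0<..<T} t * (v t - v (t + h)) * ?w t)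
      = (LINT t|lborel. v t * ?w t - v (t + h) * ?w t)" by (simp only:)
  also have "\<dots> = (LINT t|lborel. v t * ?w t) - (LINT t|lborel. v (t + h) * ?w t)"
    by (intro Bochner_Integration.integral_diff sq_integrable_mult_integrable sqR_shift S_sqR v w)
  also have "(LINT t|lborel. v (t + h) * ?w t) = (LINT t|lborel. v t * ?w (t - h))"
    using corr_shift[of v h ?w 0] corr_shift[of v 0 ?w "- h"] by simp
  also have "(LINT t|lborel. v t * ?w t) - (LINT t|lborel. v t * ?w (t - h))
      = (LINT t|lborel. v t * ?w t - v t * ?w (t - h))"
    using sqR_shift(1)[OF w, of "- h"] w S_sqR[OF v]
    by (intro Bochner_Integration.integral_diff[symmetric] sq_integrable_mult_integrable) simp_all
  finally show ?thesis by (simp only: right_diff_distrib)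
qed

text \<open>
  The differences of \<open>forw_int\<close> over the step \<open>h\<close> are averages. To the left of \<open>T\<close> the cut function agrees
  with the uncut one, because \<open>forw_int\<close> of the indicator vanishes on the negative half-line, and the
  average on both sides looks to the left only.
\<close>

lemma diff_avg_cut_forw_int_difference:
  assumes b: "0 < b" "b \<le> T" and h: "0 < h" and \<phi>: "S (cut (forw_int (indicator {0<..<b})))"
  defines "\<phi> \<equiv> cut (forw_int (indicator {0<..<b}))"
  shows "AE t in lborel. t < T \<longrightarrow> diff_avg (- h) \<phi> t - diff_avg (- h) \<phi> (t - h)
    = h powr \<alpha> * diff_avg (- h) (diff_avg (- h) (indicator {0<..<b})) t"
proof -
  let ?g = "indicator {0<..<b} :: real \<Rightarrow> real"
  have forw0: "forw_int ?g s = 0" if "s \<le> 0" for s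
  proof -
    have "pow_ker x * ?g (s - x) = 0" for x using that by (cases "0 < x") (auto simp: pow_ker_eq_0)
    then show ?thesis by (simp only: forw_int_def integral_zero)
  qed
  have eq: "diff_ker x * \<phi> (s + - h * x) = diff_ker x * forw_int ?g (s + - h * x)" if "s < T" for s x
  proof (cases "0 < x")
    case True
    then have "0 < h * x" using h by simp
    then have "s + - h * x < T" using that by simp
    then show ?thesis using forw0[of "s + - h * x"] by (auto simp: \<phi>_def cut_def indicator_def)
  qed (simp add: diff_ker_eq_0)
  have i1: "AE t in lborel. integrable lborel (\<lambda>x. diff_ker x * \<phi> (t + - h * x))"
    by (rule diff_avg_AE) (use \<phi> in \<open>auto simp: \<phi>_def intro: S_sqR\<close>)
  have i2: "AE t in lborel. integrable lborel (\<lambda>x. diff_ker x * \<phi> (t + - h * x + - h))"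
    by (rule diff_avg_AE, rule sqR_shift(1)) (use \<phi> in \<open>auto simp: \<phi>_def intro: S_sqR\<close>)
  show ?thesis
    using i1 i2
  proof eventually_elim
    case (elim t)
    show ?case
    proof
      assume t: "t < T"
      have e1: "(\<lambda>x. diff_ker x * \<phi> (t + - h * x)) = (\<lambda>x. diff_ker x * forw_int ?g (t + - h * x))"
        using eq[OF t] by (intro ext)
      have e2: "(\<lambda>x. diff_ker x * \<phi> (t + - h * x + - h)) = (\<lambda>x. diff_ker x * forw_int ?g (t - h + - h * x))"
        using eq[of "t - h"] t h by (intro ext) (simp add: algebra_simps)
      have th: "t - h < T" using t h by simp
      have "diff_avg (- h) \<phi> t - diff_avg (- h) \<phi> (t - h)
          = (LINT x|lborel. diff_ker x * forw_int ?g (t + - h * x)) - (LINT x|lborel. diff_ker x * forw_int ?g (t - h + - h * x))"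
        unfolding diff_avg_def by (simp only: eq[OF t] eq[OF th])
      also have "\<dots> = (LINT x|lborel. diff_ker x * forw_int ?g (t + - h * x) - diff_ker x * forw_int ?g (t - h + - h * x))"
        using elim unfolding e1 e2 by (rule Bochner_Integration.integral_diff[symmetric])
      also have "\<dots> = (LINT x|lborel. h powr \<alpha> * (diff_ker x * diff_avg (- h) ?g (t + - h * x)))"
      proof (intro Bochner_Integration.integral_cong refl)
        fix x
        have "forw_int ?g (t + - h * x) - forw_int ?g (t + - h * x - h) = h powr \<alpha> * diff_avg (- h) ?g (t + - h * x)"
          by (intro forw_int_difference h initial_indicator_pow_ker_integrable)
        then show "diff_ker x * forw_int ?g (t + - h * x) - diff_ker x * forw_int ?g (t - h + - h * x)
            = h powr \<alpha> * (diff_ker x * diff_avg (- h) ?g (t + - h * x))"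
          by (simp add: right_diff_distrib[symmetric] algebra_simps)
      qed
      also have "\<dots> = h powr \<alpha> * diff_avg (- h) (diff_avg (- h) ?g) t"
        by (simp only: diff_avg_def integral_mult_right_zero)
      finally show "diff_avg (- h) \<phi> t - diff_avg (- h) \<phi> (t - h) = h powr \<alpha> * diff_avg (- h) (diff_avg (- h) ?g) t" .
    qed
  qed
qed

text \<open>
  For \<open>v = JT f\<close> the differences are averages of \<open>f\<close>. For an arbitrary \<open>v\<close> there is no such \<open>f\<close> yet; moving
  the difference onto the test function \<open>cut (forw_int ...)\<close> produces two averages, and moving one of
  them back leaves averages of \<open>v\<close> itself.
\<close>

lemma difference_pairing:
  assumes v: "S v" and b: "0 < b" "b \<le> T" and h: "0 < h" and \<phi>: "S (cut (forw_int (indicator {0<..<b})))"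
  shows "(LINT t|lborel. indicator {0<..<T} t * (v t - v (t + h)) * diff_avg (- h) (cut (forw_int (indicator {0<..<b}))) t)
    = h powr \<alpha> * (LINT t|lborel. diff_avg h v t * diff_avg (- h) (indicator {0<..<b}) t)"
proof -
  let ?g = "indicator {0<..<b} :: real \<Rightarrow> real"
  let ?w = "diff_avg (- h) (cut (forw_int ?g))"
  have g: "sqR ?g" using S_ind[OF b(2)] by (rule S_sqR)
  have [measurable]: "v \<in> borel_measurable borel" using v by (rule S_borel)
  have "(LINT t|lborel. indicator {0<..<T} t * (v t - v (t + h)) * ?w t)
      = (LINT t|lborel. v t * (?w t - ?w (t - h)))"
    by (rule difference_adjoint[OF v \<phi> h])
  also have "\<dots> = (LINT t|lborel. h powr \<alpha> * (v t * diff_avg (- h) (diff_avg (- h) ?g) t))"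
  proof (rule integral_cong_AE)
    show "AE t in lborel. v t * (?w t - ?w (t - h)) = h powr \<alpha> * (v t * diff_avg (- h) (diff_avg (- h) ?g) t)"
      using diff_avg_cut_forw_int_difference[OF b h \<phi>]
    proof eventually_elim
      case (elim t)
      then show ?case using S_zero[OF v, of t] by (cases "t < T") (auto simp: mult_ac)
    qed
  qed measurable
  also have "\<dots> = h powr \<alpha> * (LINT t|lborel. v t * diff_avg (- h) (diff_avg (- h) ?g) t)"
    by (rule integral_mult_right_zero)
  also have "(LINT t|lborel. v t * diff_avg (- h) (diff_avg (- h) ?g) t) = (LINT t|lborel. diff_avg (- h) ?g t * diff_avg h v t)"
    using diff_avg_adjoint[OF diff_avg_sqR[OF g] S_sqR[OF v], of "- h" "- h"] by simp
  finally show ?thesis by (simp add: mult.commute)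
qed

text \<open>
  The measure and the powers of \<open>h\<close> in \<open>shift_pairing\<close> amount to \<open>h powr (- 1 - \<alpha>)\<close>; they are distributed
  such that the square of the norm of this factor is \<open>shift_energy v\<close>, and that of the other one, \<open>avg_quot\<close>,
  the square function.
\<close>

definition shift_quot :: "(real \<Rightarrow> real) \<Rightarrow> real \<times> real \<Rightarrow> real" where
  "shift_quot v p = indicator {0<..} (fst p) * (indicator {0<..<T} (snd p) *
     (fst p powr (- 1/2 - \<alpha>) * (v (snd p) - v (snd p + fst p))))"

definition avg_quot :: "(real \<Rightarrow> real) \<Rightarrow> real \<times> real \<Rightarrow> real" where
  "avg_quot \<phi> p = indicator {0<..} (fst p) * (fst p powr (- 1/2) * diff_avg (- fst p) (cut \<phi>) (snd p))"

lemma shift_quot_measurable[measurable (raw)]: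
  assumes [measurable]: "v \<in> borel_measurable borel"
  shows "shift_quot v \<in> borel_measurable (lborel \<Otimes>\<^sub>M lborel)"
  unfolding shift_quot_def[abs_def] by measurable

lemma avg_quot_measurable[measurable (raw)]:
  assumes [measurable]: "\<phi> \<in> borel_measurable borel"
  shows "avg_quot \<phi> \<in> borel_measurable (lborel \<Otimes>\<^sub>M lborel)"
  unfolding avg_quot_def[abs_def] by measurable

lemma shift_quot_sq_integrable:
  assumes v: "S v" and N: "shift_energy v \<le> ennreal (N\<^sup>2)" "0 \<le> N"
  shows "sq_integrable (lborel \<Otimes>\<^sub>M lborel) (shift_quot v)" "norm2 (lborel \<Otimes>\<^sub>M lborel) (shift_quot v) \<le> N"
proof -
  have [measurable]: "v \<in> borel_measurable borel" using v by (rule S_borel)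
  have pt: "ennreal ((shift_quot v (h, t))\<^sup>2) = ennreal (indicator {0<..} h * h powr (- 1 - 2 * \<alpha>))
     * ennreal (indicator {0<..<T} t * (v t - v (t + h))\<^sup>2)" for h t
  proof -
    have "(h powr (- 1/2 - \<alpha>))\<^sup>2 = h powr (- 1 - 2 * \<alpha>)"
      by (simp add: power2_eq_square powr_add[symmetric])
    then have "(shift_quot v (h, t))\<^sup>2 = (indicator {0<..} h * h powr (- 1 - 2 * \<alpha>)) * (indicator {0<..<T} t * (v t - v (t + h))\<^sup>2)"
      by (simp add: shift_quot_def power_mult_distrib indicator_def)
    then show ?thesis by (simp add: ennreal_mult[symmetric])
  qed
  have "(\<integral>\<^sup>+p. ennreal ((shift_quot v p)\<^sup>2) \<partial>(lborel \<Otimes>\<^sub>M lborel)) = (\<integral>\<^sup>+h. \<integral>\<^sup>+t. ennreal ((shift_quot v (h, t))\<^sup>2) \<partial>lborel \<partial>lborel)"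
    by (rule lborel.nn_integral_fst[symmetric]) measurable
  also have "\<dots> = shift_energy v" unfolding shift_energy_def pt ..
  also have "\<dots> \<le> ennreal (N\<^sup>2)" by (rule N)
  finally have *: "(\<integral>\<^sup>+p. ennreal ((shift_quot v p)\<^sup>2) \<partial>(lborel \<Otimes>\<^sub>M lborel)) \<le> ennreal (N\<^sup>2)" .
  show "sq_integrable (lborel \<Otimes>\<^sub>M lborel) (shift_quot v)" "norm2 (lborel \<Otimes>\<^sub>M lborel) (shift_quot v) \<le> N"
    using sq_integrable_if_nn_integral_le[OF _ * N(2)] by auto
qed

lemma avg_quot_sq_integrable:
  assumes \<phi>: "sqR \<phi>"
  shows "sq_integrable (lborel \<Otimes>\<^sub>M lborel) (avg_quot \<phi>)" "norm2 (lborel \<Otimes>\<^sub>M lborel) (avg_quot \<phi>) \<le> sqrt square_const * norm2R \<phi>"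
proof -
  have [measurable]: "\<phi> \<in> borel_measurable borel" using \<phi> by (rule sqR_borel)
  have c: "sqR (cut \<phi>)" using cut_S[OF \<phi>] by (rule S_sqR)
  have pt: "ennreal ((avg_quot \<phi> (h, t))\<^sup>2) = ennreal (indicator {0<..} h / h) * ennreal ((diff_avg (- h) (cut \<phi>) t)\<^sup>2)" for h t
  proof (cases "0 < h")
    case True
    have "(h powr (- 1/2))\<^sup>2 = h powr (- 1)" by (simp add: power2_eq_square powr_add[symmetric])
    also have "h powr (- 1) = 1 / h" using True by (simp add: powr_minus divide_inverse)
    finally have "(avg_quot \<phi> (h, t))\<^sup>2 = (indicator {0<..} h / h) * ((diff_avg (- h) (cut \<phi>) t)\<^sup>2)"
      using True by (simp add: avg_quot_def power_mult_distrib)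
    then show ?thesis using True by (simp add: ennreal_mult[symmetric])
  qed (simp add: avg_quot_def)
  have "(\<integral>\<^sup>+p. ennreal ((avg_quot \<phi> p)\<^sup>2) \<partial>(lborel \<Otimes>\<^sub>M lborel)) = (\<integral>\<^sup>+h. \<integral>\<^sup>+t. ennreal ((avg_quot \<phi> (h, t))\<^sup>2) \<partial>lborel \<partial>lborel)"
    by (rule lborel.nn_integral_fst[symmetric]) measurable
  also have "\<dots> = (\<integral>\<^sup>+h. ennreal (indicator {0<..} h / h) * (\<integral>\<^sup>+t. ennreal ((diff_avg (- h) (cut \<phi>) t)\<^sup>2) \<partial>lborel) \<partial>lborel)"
    unfolding pt by (intro nn_integral_cong nn_integral_cmult) measurable
  also have "\<dots> \<le> ennreal (square_const * (norm2R (cut \<phi>))\<^sup>2)" by (rule square_function_bound_backward[OF c])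
  also have "\<dots> \<le> ennreal ((sqrt square_const * norm2R \<phi>)\<^sup>2)"
    using cut_le[OF \<phi>] square_const_nonneg by (intro ennreal_leI) (simp add: power_mult_distrib mult_left_mono power_mono)
  finally have *: "(\<integral>\<^sup>+p. ennreal ((avg_quot \<phi> p)\<^sup>2) \<partial>(lborel \<Otimes>\<^sub>M lborel)) \<le> ennreal ((sqrt square_const * norm2R \<phi>)\<^sup>2)" .
  show "sq_integrable (lborel \<Otimes>\<^sub>M lborel) (avg_quot \<phi>)" "norm2 (lborel \<Otimes>\<^sub>M lborel) (avg_quot \<phi>) \<le> sqrt square_const * norm2R \<phi>"
    using sq_integrable_if_nn_integral_le[OF _ *] square_const_nonneg by auto
qed

text \<open>
  If \<open>v = JT f\<close> then, by the reproducing formula, this is formally \<open>repro_const\<close> times the inner product of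
  \<open>f\<close> and \<open>\<phi>\<close>. It is meaningful for every \<open>v\<close> of finite energy and bounded in \<open>\<phi>\<close>, so it serves to define
  the function \<open>f\<close>.
\<close>

definition shift_pairing :: "(real \<Rightarrow> real) \<Rightarrow> (real \<Rightarrow> real) \<Rightarrow> real" where
  "shift_pairing v \<phi> = (LINT p|(lborel \<Otimes>\<^sub>M lborel). shift_quot v p * avg_quot \<phi> p)"

lemma shift_pairing_add:
  assumes v: "S v" and N: "shift_energy v \<le> ennreal (N\<^sup>2)" "0 \<le> N" and f: "sqR f" and g: "sqR g"
  shows "shift_pairing v (\<lambda>x. f x + g x) = shift_pairing v f + shift_pairing v g"
proof -
  have [measurable]: "v \<in> borel_measurable borel" "f \<in> borel_measurable borel" "g \<in> borel_measurable borel"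
    using v f g by (auto simp: S_def sq_integrable_def)
  have "AE p in lborel \<Otimes>\<^sub>M lborel. avg_quot (\<lambda>x. f x + g x) p = avg_quot f p + avg_quot g p"
  proof (rule lborel_pair.AE_pair_measure)
    show "{p \<in> space (lborel \<Otimes>\<^sub>M lborel). avg_quot (\<lambda>x. f x + g x) p = avg_quot f p + avg_quot g p} \<in> sets (lborel \<Otimes>\<^sub>M lborel)"
      by measurable
    show "AE h in lborel. AE t in lborel. avg_quot (\<lambda>x. f x + g x) (h, t) = avg_quot f (h, t) + avg_quot g (h, t)"
    proof (rule AE_I2)
      fix h
      show "AE t in lborel. avg_quot (\<lambda>x. f x + g x) (h, t) = avg_quot f (h, t) + avg_quot g (h, t)"
        using diff_avg_AE[OF S_sqR[OF cut_S[OF f]], of "- h"] diff_avg_AE[OF S_sqR[OF cut_S[OF g]], of "- h"]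
      proof eventually_elim
        case (elim t)
        have "cut (\<lambda>x. f x + g x) = (\<lambda>x. cut f x + cut g x)" by (auto simp: cut_def distrib_left)
        then have "diff_avg (- h) (cut (\<lambda>x. f x + g x)) t = diff_avg (- h) (cut f) t + diff_avg (- h) (cut g) t"
          using elim unfolding diff_avg_def by (simp add: distrib_left)
        then show ?case by (simp add: avg_quot_def distrib_left)
      qed
    qed
  qed
  then have "AE p in lborel \<Otimes>\<^sub>M lborel. shift_quot v p * avg_quot (\<lambda>x. f x + g x) p = shift_quot v p * avg_quot f p + shift_quot v p * avg_quot g p"
    by eventually_elim (simp add: distrib_left)
  then have "shift_pairing v (\<lambda>x. f x + g x) = (LINT p|(lborel \<Otimes>\<^sub>M lborel). shift_quot v p * avg_quot f p + shift_quot v p * avg_quot g p)"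
    unfolding shift_pairing_def by (intro integral_cong_AE) measurable
  also have "\<dots> = shift_pairing v f + shift_pairing v g" unfolding shift_pairing_def
    by (intro Bochner_Integration.integral_add sq_integrable_mult_integrable shift_quot_sq_integrable[OF v N] avg_quot_sq_integrable f g)
  finally show ?thesis .
qed

lemma shift_pairing_scale: "shift_pairing v (\<lambda>x. c * f x) = c * shift_pairing v f"
proof -
  have "diff_avg (- h) (cut (\<lambda>x. c * f x)) t = c * diff_avg (- h) (cut f) t" for h t
  proof -
    have "diff_avg (- h) (cut (\<lambda>x. c * f x)) t = (LINT x|lborel. c * (diff_ker x * cut f (t + - h * x)))"
      unfolding diff_avg_def by (simp add: cut_def mult_ac)
    then show ?thesis by (simp only: diff_avg_def integral_mult_right_zero)
  qed
  then have "shift_quot v p * avg_quot (\<lambda>x. c * f x) p = c * (shift_quot v p * avg_quot f p)" for p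
    by (simp add: avg_quot_def mult_ac)
  then show ?thesis by (simp only: shift_pairing_def integral_mult_right_zero)
qed

lemma shift_pairing_bound:
  assumes v: "S v" and N: "shift_energy v \<le> ennreal (N\<^sup>2)" "0 \<le> N" and f: "sqR f"
  shows "\<bar>shift_pairing v f\<bar> \<le> (N * sqrt square_const) * norm2R f"
proof -
  have "\<bar>shift_pairing v f\<bar> \<le> norm2 (lborel \<Otimes>\<^sub>M lborel) (shift_quot v) * norm2 (lborel \<Otimes>\<^sub>M lborel) (avg_quot f)"
    unfolding shift_pairing_def by (intro L2_Cauchy_Schwarz shift_quot_sq_integrable[OF v N] avg_quot_sq_integrable f)
  also have "\<dots> \<le> N * (sqrt square_const * norm2R f)"
    by (intro mult_mono shift_quot_sq_integrable[OF v N] avg_quot_sq_integrable f N) simp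
  finally show ?thesis by (simp add: mult.assoc)
qed

text \<open>
  Truncating \<open>pow_ker\<close> does not change the integral on the interval and makes the kernel integrable, as
  required by \<open>Young_L2\<close> and \<open>Young_adjoint\<close>.
\<close>

lemma cut_forw_int_indicator:
  "b \<le> T \<Longrightarrow> cut (forw_int (indicator {0<..<b})) = cut (\<lambda>s. LINT x|lborel. (indicator {..T} x * pow_ker x) * indicator {0<..<b} (s + (-1) * x))"
proof (rule ext)
  fix s assume b: "b \<le> T"
  show "cut (forw_int (indicator {0<..<b})) s = cut (\<lambda>s. LINT x|lborel. (indicator {..T} x * pow_ker x) * indicator {0<..<b} (s + (-1) * x)) s"
  proof (cases "s \<in> {0<..<T}")
    case True
    have "pow_ker x * indicator {0<..<b} (s - x) = (indicator {..T} x * pow_ker x) * indicator {0<..<b} (s + (-1) * x)" for x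
      using True by (auto simp: indicator_def)
    then have "forw_int (indicator {0<..<b}) s = (LINT x|lborel. (indicator {..T} x * pow_ker x) * indicator {0<..<b} (s + (-1) * x))"
      by (simp only: forw_int_def)
    then show ?thesis by (simp only: cut_def)
  qed (simp add: cut_def)
qed

text \<open>
  The functions \<open>cut (forw_int ...)\<close> are the images of the indicator functions under the adjoint of \<open>JT\<close>,
  so this identity is the weak form of \<open>JT f = v\<close> for the function \<open>f\<close> that represents the functional
  \<open>shift_pairing v / repro_const\<close>. On a bounded range of scales it is \<open>difference_pairing\<close>; the limit is
  \<open>reproducing_limit\<close>, now applied to \<open>v\<close>.
\<close>

lemma shift_pairing_cut_forw_int:
  assumes v: "S v" and N: "shift_energy v \<le> ennreal (N\<^sup>2)" "0 \<le> N" and b: "0 < b" "b \<le> T"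
  shows "shift_pairing v (cut (forw_int (indicator {0<..<b}))) = repro_const * (LINT t|lborel. v t * indicator {0<..<b} t)"
proof -
  let ?g = "indicator {0<..<b} :: real \<Rightarrow> real"
  let ?\<phi> = "cut (forw_int ?g)"
  have [measurable]: "v \<in> borel_measurable borel" using v by (rule S_borel)
  have g: "S ?g" using S_ind[OF b(2)] .
  have \<phi>: "S ?\<phi>"
    unfolding cut_forw_int_indicator[OF b(2)] by (intro cut_S Young_L2(2)[OF trunc_pow_ker_integrable] S_sqR g)
  have cc: "cut ?\<phi> = ?\<phi>" by (auto simp: cut_def indicator_def)
  let ?M = "lborel \<Otimes>\<^sub>M lborel :: (real \<times> real) measure"
  let ?F = "\<lambda>p. shift_quot v p * avg_quot ?\<phi> p"
  let ?I = "\<lambda>n h. indicator {1 / real (n + 2)<..<real (n + 2)} h :: real"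
  have Fi: "integrable ?M ?F" by (intro sq_integrable_mult_integrable shift_quot_sq_integrable[OF v N] avg_quot_sq_integrable S_sqR \<phi>)
  have Fni: "integrable ?M (\<lambda>p. ?I n (fst p) * ?F p)" for n
    by (rule Bochner_Integration.integrable_bound[OF Fi]) (auto simp: indicator_def)
  have lim: "(\<lambda>n. LINT p|?M. ?I n (fst p) * ?F p) \<longlonglongrightarrow> (LINT p|?M. ?F p)"
  proof (rule integral_dominated_convergence)
    show "integrable ?M (\<lambda>p. \<bar>?F p\<bar>)" using Fi by simp
    show "AE p in ?M. (\<lambda>n. ?I n (fst p) * ?F p) \<longlonglongrightarrow> ?F p"
    proof (rule AE_I2)
      fix p :: "real \<times> real"
      show "(\<lambda>n. ?I n (fst p) * ?F p) \<longlonglongrightarrow> ?F p"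
      proof (cases "0 < fst p")
        case True
        have "\<forall>\<^sub>F n in sequentially. 1 / real (n + 2) < fst p" "\<forall>\<^sub>F n in sequentially. fst p < real (n + 2)"
          using True by real_asymp+
        then have "\<forall>\<^sub>F n in sequentially. ?I n (fst p) * ?F p = ?F p" by eventually_elim simp
        then show ?thesis by (rule tendsto_eventually)
      qed (simp add: shift_quot_def)
    qed
  qed (auto simp: indicator_def)
  have eq: "(LINT p|?M. ?I n (fst p) * ?F p) = (LINT h|lborel. ?I n h / h * (LINT t|lborel. diff_avg h v t * diff_avg (- h) ?g t))" for n
  proof -
    have "(LINT p|?M. ?I n (fst p) * ?F p) = (LINT h|lborel. LINT t|lborel. ?I n h * ?F (h, t))"
      using lborel_pair.integral_fst'[OF Fni[of n]] by simp
    also have "\<dots> = (LINT h|lborel. ?I n h / h * (LINT t|lborel. diff_avg h v t * diff_avg (- h) ?g t))"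
    proof (intro Bochner_Integration.integral_cong refl)
      fix h
      show "(LINT t|lborel. ?I n h * ?F (h, t)) = ?I n h / h * (LINT t|lborel. diff_avg h v t * diff_avg (- h) ?g t)"
      proof (cases "1 / real (n + 2) < h")
        case True
        moreover have "0 < 1 / real (n + 2)" by simp
        ultimately have h: "0 < h" by linarith
        have hp: "h powr (- 1/2 - \<alpha>) * h powr (- 1/2) = h powr (- 1 - \<alpha>)"
          by (simp add: powr_add[symmetric])
        have "?F (h, t) = h powr (- 1/2 - \<alpha>) * h powr (- 1/2) * (indicator {0<..<T} t * (v t - v (t + h)) * diff_avg (- h) ?\<phi> t)" for t
          using h by (simp add: shift_quot_def avg_quot_def cc mult_ac)
        then have "(LINT t|lborel. ?I n h * ?F (h, t)) = (LINT t|lborel. (?I n h * h powr (- 1 - \<alpha>)) *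
            (indicator {0<..<T} t * (v t - v (t + h)) * diff_avg (- h) ?\<phi> t))"
          by (simp only: hp mult.assoc)
        also have "\<dots> = (?I n h * h powr (- 1 - \<alpha>)) * (LINT t|lborel. indicator {0<..<T} t * (v t - v (t + h)) * diff_avg (- h) ?\<phi> t)"
          by (rule integral_mult_right_zero)
        also have "\<dots> = ?I n h * (h powr (- 1 - \<alpha>) * h powr \<alpha>) * (LINT t|lborel. diff_avg h v t * diff_avg (- h) ?g t)"
          unfolding difference_pairing[OF v b h \<phi>] by (simp only: mult.assoc)
        also have "h powr (- 1 - \<alpha>) * h powr \<alpha> = h powr (- 1)" by (simp add: powr_add[symmetric])
        also have "h powr (- 1) = 1 / h" using h by (simp add: powr_minus divide_inverse)
        finally show ?thesis by simp
      qed simp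
    qed
    finally show ?thesis .
  qed
  have "(\<lambda>n. LINT p|?M. ?I n (fst p) * ?F p) \<longlonglongrightarrow> repro_const * (LINT t|lborel. v t * ?g t)"
    unfolding eq by (rule reproducing_limit[OF v b])
  with lim show ?thesis unfolding shift_pairing_def by (rule LIMSEQ_unique)
qed

text \<open>
  A function of finite energy is in the range of \<open>JT\<close>: \<open>L2_Riesz\<close> represents \<open>shift_pairing v\<close> by a function
  \<open>\<psi>0\<close>, and by \<open>shift_pairing_cut_forw_int\<close> the integrals of \<open>JT \<psi>0\<close> and \<open>repro_const * v\<close> over initial intervals
  agree. The norm of the functional bounds the preimage.
\<close>

lemma JT_surjective:
  assumes v: "S v" and N: "shift_energy v \<le> ennreal (N\<^sup>2)" "0 \<le> N"
  obtains \<psi> where "S \<psi>" "AE t in lborel. JT \<psi> t = v t" "norm2R \<psi> \<le> N * sqrt square_const / repro_const"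
proof -
  obtain \<psi>0 where p0: "sqR \<psi>0" and rep: "\<And>f. sqR f \<Longrightarrow> (LINT x|lborel. \<psi>0 x * f x) = shift_pairing v f"
    and pb: "norm2R \<psi>0 \<le> \<bar>N * sqrt square_const\<bar>"
    by (rule L2_Riesz[of lborel "shift_pairing v" "N * sqrt square_const"])
       (auto intro: shift_pairing_add[OF v N] shift_pairing_scale shift_pairing_bound[OF v N])
  define \<psi>1 where "\<psi>1 = cut \<psi>0"
  have p1: "S \<psi>1" unfolding \<psi>1_def by (rule cut_S[OF p0])
  define d where "d = (\<lambda>t. JT \<psi>1 t - repro_const * v t)"
  have Sd: "S d" unfolding d_def by (intro S_diff S_scale JT_S p1 v)
  have "AE t in lborel. d t = 0"
  proof (rule zero_if_initial_integrals_zero[OF Sd])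
    fix b assume b: "0 < b" "b \<le> T"
    let ?g = "indicator {0<..<b} :: real \<Rightarrow> real"
    let ?\<phi> = "cut (forw_int ?g)"
    let ?k = "\<lambda>x. indicator {..T} x * pow_ker x"
    have g: "S ?g" using S_ind[OF b(2)] .
    have \<phi>: "S ?\<phi>"
      unfolding cut_forw_int_indicator[OF b(2)] by (intro cut_S Young_L2(2)[OF trunc_pow_ker_integrable] S_sqR g)
    have "JT \<psi>1 t * ?g t = ?g t * (LINT x|lborel. ?k x * \<psi>1 (t + 1 * x))" for t
    proof (cases "t \<in> {0<..<b}")
      case True
      then have "JT \<psi>1 t = (LINT x|lborel. ?k x * \<psi>1 (t + 1 * x))"
        using JT_pos[OF p1, of t] back_int_trunc[OF p1, of t] by (auto simp del: mult_1)
      then show ?thesis by (simp only: mult.commute)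
    qed simp
    then have "(LINT t|lborel. JT \<psi>1 t * ?g t) = (LINT t|lborel. ?g t * (LINT x|lborel. ?k x * \<psi>1 (t + 1 * x)))"
      by (simp only:)
    also have "\<dots> = (LINT x|lborel. ?k x * corr \<psi>1 ?g (1 * x))"
      by (rule Young_adjoint[OF trunc_pow_ker_integrable S_sqR[OF p1] S_sqR[OF g]])
    also have "\<dots> = (LINT x|lborel. ?k x * corr ?g \<psi>1 ((-1) * x))"
      using corr_swap[of ?g \<psi>1] by simp
    also have "\<dots> = (LINT s|lborel. \<psi>1 s * (LINT x|lborel. ?k x * ?g (s + (-1) * x)))"
      by (rule Young_adjoint[OF trunc_pow_ker_integrable S_sqR[OF g] S_sqR[OF p1], symmetric])
    also have "\<dots> = (LINT s|lborel. \<psi>0 s * ?\<phi> s)"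
      unfolding cut_forw_int_indicator[OF b(2)] \<psi>1_def cut_def by (simp only: mult_ac)
    also have "\<dots> = shift_pairing v ?\<phi>" by (rule rep[OF S_sqR[OF \<phi>]])
    also have "\<dots> = repro_const * (LINT t|lborel. v t * ?g t)" by (rule shift_pairing_cut_forw_int[OF v N b])
    finally have e: "(LINT t|lborel. JT \<psi>1 t * ?g t) = repro_const * (LINT t|lborel. v t * ?g t)" .
    have i: "integrable lborel (\<lambda>t. JT \<psi>1 t * ?g t)" "integrable lborel (\<lambda>t. v t * ?g t)"
      by (intro sq_integrable_mult_integrable S_sqR JT_S p1 v g)+
    have "(LINT t|lborel. d t * ?g t) = (LINT t|lborel. JT \<psi>1 t * ?g t - repro_const * (v t * ?g t))"
      by (simp add: d_def left_diff_distrib mult.assoc)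
    also have "\<dots> = 0" using i e by simp
    finally show "(LINT t|lborel. d t * ?g t) = 0" .
  qed
  moreover have "JT (\<lambda>x. (1 / repro_const) * \<psi>1 x) t = (1 / repro_const) * JT \<psi>1 t" for t by (rule JT_scale)
  ultimately have "AE t in lborel. JT (\<lambda>x. (1 / repro_const) * \<psi>1 x) t = v t"
    using repro_const_pos by (auto simp: d_def)
  moreover have "S (\<lambda>x. (1 / repro_const) * \<psi>1 x)" by (intro S_scale p1)
  moreover have "norm2R (\<lambda>x. (1 / repro_const) * \<psi>1 x) \<le> N * sqrt square_const / repro_const"
  proof -
    have "norm2R \<psi>1 \<le> N * sqrt square_const" using cut_le[OF p0] pb N square_const_nonneg unfolding \<psi>1_def by simp
    then show ?thesis unfolding norm2_scale using repro_const_pos by (simp add: divide_right_mono)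
  qed
  ultimately show ?thesis using that by blast
qed

end

section \<open>A fractional Hardy inequality\<close>

text \<open>
  Telescoping gives \<open>u s\<close> as the sum of \<open>u (\<mu> ^ k * s) - u (\<mu> ^ (k + 1) * s)\<close>. The Cauchy-Schwarz inequality
  with the weights \<open>r ^ k\<close> costs the factor \<open>1 / (1 - r)\<close> and the factors \<open>(1 / r) ^ k\<close>; the substitution
  \<open>\<mu> ^ k * s\<close> gains \<open>(\<mu> powr (e - 1)) ^ k \<le> (r\<^sup>2) ^ k\<close>, so a geometric series with ratio \<open>r\<close> is left.
\<close>

lemma hardy_dilation:
  fixes u :: "real \<Rightarrow> real"
  assumes [measurable]: "u \<in> borel_measurable borel"
    and \<mu>: "0 < \<mu>" and r: "0 < r" "r < 1" "\<mu> powr (e - 1) \<le> r\<^sup>2"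
    and lim: "\<And>s. 0 < s \<Longrightarrow> (\<lambda>n. u (\<mu> ^ n * s)) \<longlonglongrightarrow> 0"
  shows "(\<integral>\<^sup>+s. ennreal (indicator {0<..} s * (u s)\<^sup>2 * s powr (- e)) \<partial>lborel)
    \<le> ennreal (1 / (1 - r)\<^sup>2) * (\<integral>\<^sup>+s. ennreal (indicator {0<..} s * (u s - u (\<mu> * s))\<^sup>2 * s powr (- e)) \<partial>lborel)"
proof -
  define d where "d s = u s - u (\<mu> * s)" for s
  have [measurable]: "d \<in> borel_measurable borel" unfolding d_def[abs_def] by measurable
  define D where "D = (\<integral>\<^sup>+s. ennreal (indicator {0<..} s * (d s)\<^sup>2 * s powr (- e)) \<partial>lborel)"
  let ?c = "1 / (1 - r)"
  have pt: "ennreal (indicator {0<..} s * (u s)\<^sup>2 * s powr (- e))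
      \<le> (\<Sum>k. ennreal (?c * (1 / r) ^ k) * ennreal (indicator {0<..} s * (d (\<mu> ^ k * s))\<^sup>2 * s powr (- e)))" for s
  proof (cases "0 < s")
    case True
    let ?R = "\<Sum>k. ennreal (?c * (1 / r) ^ k) * ennreal ((d (\<mu> ^ k * s))\<^sup>2 * s powr (- e))"
    have fin: "ennreal ((u s - u (\<mu> ^ n * s))\<^sup>2 * s powr (- e)) \<le> ?R" for n
    proof -
      have tel: "u s - u (\<mu> ^ n * s) = (\<Sum>k<n. d (\<mu> ^ k * s))"
        by (induction n) (auto simp: d_def mult_ac)
      have "(\<Sum>k<n. d (\<mu> ^ k * s))\<^sup>2 = (\<Sum>k<n. sqrt (r ^ k) * (d (\<mu> ^ k * s) / sqrt (r ^ k)))\<^sup>2"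
        using r by simp
      also have "\<dots> \<le> (\<Sum>k<n. (sqrt (r ^ k))\<^sup>2) * (\<Sum>k<n. (d (\<mu> ^ k * s) / sqrt (r ^ k))\<^sup>2)"
        by (rule Cauchy_Schwarz_ineq_sum)
      also have "\<dots> = (\<Sum>k<n. r ^ k) * (\<Sum>k<n. (1 / r) ^ k * (d (\<mu> ^ k * s))\<^sup>2)"
        using r by (simp add: power_divide)
      also have "\<dots> \<le> ?c * (\<Sum>k<n. (1 / r) ^ k * (d (\<mu> ^ k * s))\<^sup>2)"
      proof (rule mult_right_mono)
        show "(\<Sum>k<n. r ^ k) \<le> ?c"
          using r sum_le_suminf[of "\<lambda>k. r ^ k" "{..<n}"] by (simp add: summable_geometric suminf_geometric)
        show "0 \<le> (\<Sum>k<n. (1 / r) ^ k * (d (\<mu> ^ k * s))\<^sup>2)" using r by (intro sum_nonneg) auto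
      qed
      finally have "(u s - u (\<mu> ^ n * s))\<^sup>2 * s powr (- e)
          \<le> ?c * (\<Sum>k<n. (1 / r) ^ k * (d (\<mu> ^ k * s))\<^sup>2) * s powr (- e)"
        unfolding tel by (rule mult_right_mono) simp
      also have "\<dots> = (\<Sum>k<n. ?c * (1 / r) ^ k * ((d (\<mu> ^ k * s))\<^sup>2 * s powr (- e)))"
        by (simp add: sum_distrib_left sum_distrib_right mult_ac)
      finally have "ennreal ((u s - u (\<mu> ^ n * s))\<^sup>2 * s powr (- e))
          \<le> ennreal (\<Sum>k<n. ?c * (1 / r) ^ k * ((d (\<mu> ^ k * s))\<^sup>2 * s powr (- e)))"
        by (rule ennreal_leI)
      also have "\<dots> = (\<Sum>k<n. ennreal (?c * (1 / r) ^ k) * ennreal ((d (\<mu> ^ k * s))\<^sup>2 * s powr (- e)))"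
      proof -
        have "(\<Sum>k<n. ennreal (?c * (1 / r) ^ k) * ennreal ((d (\<mu> ^ k * s))\<^sup>2 * s powr (- e)))
            = (\<Sum>k<n. ennreal (?c * (1 / r) ^ k * ((d (\<mu> ^ k * s))\<^sup>2 * s powr (- e))))"
          by (intro sum.cong refl ennreal_mult[symmetric]) (use r in auto)
        also have "\<dots> = ennreal (\<Sum>k<n. ?c * (1 / r) ^ k * ((d (\<mu> ^ k * s))\<^sup>2 * s powr (- e)))"
          by (intro sum_ennreal mult_nonneg_nonneg) (use r in auto)
        finally show ?thesis ..
      qed
      also have "\<dots> \<le> ?R" by (intro sum_le_suminf) auto
      finally show ?thesis .
    qed
    have "(\<lambda>n. ennreal ((u s - u (\<mu> ^ n * s))\<^sup>2 * s powr (- e))) \<longlonglongrightarrow> ennreal ((u s - 0)\<^sup>2 * s powr (- e))"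
      by (intro tendsto_ennrealI tendsto_intros lim True)
    then have "ennreal ((u s)\<^sup>2 * s powr (- e)) \<le> ?R"
      using fin by (auto intro!: LIMSEQ_le_const2)
    then show ?thesis using True by simp
  qed simp
  have sc: "(\<integral>\<^sup>+s. ennreal (indicator {0<..} s * (d (\<mu> ^ k * s))\<^sup>2 * s powr (- e)) \<partial>lborel) \<le> ennreal ((r\<^sup>2) ^ k) * D" for k
  proof -
    define m where "m = \<mu> ^ k"
    have m: "0 < m" using \<mu> by (simp add: m_def)
    have "ennreal m * (\<integral>\<^sup>+s. ennreal (indicator {0<..} s * (d (m * s))\<^sup>2 * s powr (- e)) \<partial>lborel)
        = (\<integral>\<^sup>+s. ennreal m * ennreal (indicator {0<..} s * (d (m * s))\<^sup>2 * s powr (- e)) \<partial>lborel)"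
      by (rule nn_integral_cmult[symmetric]) measurable
    have "D = ennreal m * (\<integral>\<^sup>+s. ennreal (indicator {0<..} (0 + m * s) * (d (0 + m * s))\<^sup>2 * (0 + m * s) powr (- e)) \<partial>lborel)"
      unfolding D_def using m by (subst nn_integral_real_affine[of _ m 0]) auto
    also have "(\<integral>\<^sup>+s. ennreal (indicator {0<..} (0 + m * s) * (d (0 + m * s))\<^sup>2 * (0 + m * s) powr (- e)) \<partial>lborel)
        = (\<integral>\<^sup>+s. ennreal (m powr (- e)) * ennreal (indicator {0<..} s * (d (m * s))\<^sup>2 * s powr (- e)) \<partial>lborel)"
      using m by (intro nn_integral_cong)
        (auto simp: ennreal_mult[symmetric] powr_mult indicator_def zero_less_mult_iff mult_ac)
    also have "\<dots> = ennreal (m powr (- e)) * (\<integral>\<^sup>+s. ennreal (indicator {0<..} s * (d (m * s))\<^sup>2 * s powr (- e)) \<partial>lborel)"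
      by (rule nn_integral_cmult) measurable
    finally have "ennreal (m powr (e - 1)) * D = (ennreal (m powr (e - 1)) * (ennreal m * ennreal (m powr (- e)))) *
        (\<integral>\<^sup>+s. ennreal (indicator {0<..} s * (d (m * s))\<^sup>2 * s powr (- e)) \<partial>lborel)"
      by (simp add: mult.assoc)
    also have "ennreal (m powr (e - 1)) * (ennreal m * ennreal (m powr (- e))) = ennreal (m powr (e - 1) * (m powr 1 * m powr (- e)))"
      using m by (simp add: ennreal_mult)
    also have "m powr (e - 1) * (m powr 1 * m powr (- e)) = m powr ((e - 1) + (1 + (- e)))"
      by (simp only: powr_add)
    also have "\<dots> = 1" using m by simp
    finally have eq: "(\<integral>\<^sup>+s. ennreal (indicator {0<..} s * (d (m * s))\<^sup>2 * s powr (- e)) \<partial>lborel) = ennreal (m powr (e - 1)) * D"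
      by simp
    have "m powr (e - 1) = (\<mu> powr (e - 1)) ^ k"
      unfolding m_def using \<mu> by (simp add: powr_realpow[symmetric] powr_powr mult.commute)
    also have "\<dots> \<le> (r\<^sup>2) ^ k" by (intro power_mono r) simp
    finally have "ennreal (m powr (e - 1)) * D \<le> ennreal ((r\<^sup>2) ^ k) * D"
      by (intro mult_right_mono ennreal_leI) auto
    then show ?thesis unfolding eq[unfolded m_def] m_def .
  qed
  have "(\<integral>\<^sup>+s. ennreal (indicator {0<..} s * (u s)\<^sup>2 * s powr (- e)) \<partial>lborel)
      \<le> (\<integral>\<^sup>+s. (\<Sum>k. ennreal (?c * (1 / r) ^ k) * ennreal (indicator {0<..} s * (d (\<mu> ^ k * s))\<^sup>2 * s powr (- e))) \<partial>lborel)"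
    by (intro nn_integral_mono pt)
  also have "\<dots> = (\<Sum>k. \<integral>\<^sup>+s. ennreal (?c * (1 / r) ^ k) * ennreal (indicator {0<..} s * (d (\<mu> ^ k * s))\<^sup>2 * s powr (- e)) \<partial>lborel)"
    by (rule nn_integral_suminf) measurable
  also have "\<dots> \<le> (\<Sum>k. ennreal (?c * r ^ k) * D)"
  proof (intro suminf_le)
    fix k
    have "(\<integral>\<^sup>+s. ennreal (?c * (1 / r) ^ k) * ennreal (indicator {0<..} s * (d (\<mu> ^ k * s))\<^sup>2 * s powr (- e)) \<partial>lborel)
        = ennreal (?c * (1 / r) ^ k) * (\<integral>\<^sup>+s. ennreal (indicator {0<..} s * (d (\<mu> ^ k * s))\<^sup>2 * s powr (- e)) \<partial>lborel)"
      by (rule nn_integral_cmult) measurable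
    also have "\<dots> \<le> ennreal (?c * (1 / r) ^ k) * (ennreal ((r\<^sup>2) ^ k) * D)"
      by (intro mult_left_mono sc) simp
    also have "\<dots> = ennreal (?c * (1 / r) ^ k * (r\<^sup>2) ^ k) * D"
    proof -
      have "ennreal (?c * (1 / r) ^ k * (r\<^sup>2) ^ k) = ennreal (?c * (1 / r) ^ k) * ennreal ((r\<^sup>2) ^ k)"
        by (rule ennreal_mult) (use r in auto)
      then show ?thesis by (simp only: mult.assoc)
    qed
    also have "?c * (1 / r) ^ k * (r\<^sup>2) ^ k = ?c * r ^ k"
      using r by (simp add: power_mult_distrib[symmetric] power2_eq_square)
    finally show "(\<integral>\<^sup>+s. ennreal (?c * (1 / r) ^ k) * ennreal (indicator {0<..} s * (d (\<mu> ^ k * s))\<^sup>2 * s powr (- e)) \<partial>lborel)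
       \<le> ennreal (?c * r ^ k) * D" .
  qed auto
  also have "\<dots> = (\<Sum>k. ennreal (?c * r ^ k)) * D" by (rule ennreal_suminf_multc)
  also have "(\<Sum>k. ennreal (?c * r ^ k)) = ennreal (1 / (1 - r)\<^sup>2)"
  proof -
    have "(\<Sum>k. ennreal (?c * r ^ k)) = ennreal (\<Sum>k. ?c * r ^ k)"
      using r by (intro suminf_ennreal2) (auto intro!: summable_mult summable_geometric)
    also have "(\<Sum>k. ?c * r ^ k) = 1 / (1 - r)\<^sup>2"
      using r by (subst suminf_mult) (auto simp: summable_geometric suminf_geometric power2_eq_square)
    finally show ?thesis .
  qed
  finally show ?thesis unfolding D_def d_def .
qed

context frac_interval
begin

definition slob :: "(real \<Rightarrow> real) \<Rightarrow> ennreal" where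
  "slob v = (\<integral>\<^sup>+t. \<integral>\<^sup>+s. ennreal (indicator {0<..<T} t * indicator {0<..<T} s *
      ((v t - v s)\<^sup>2 / \<bar>t - s\<bar> powr (1 + 2 * \<alpha>))) \<partial>lborel \<partial>lborel)"

definition half_slob :: "(real \<Rightarrow> real) \<Rightarrow> ennreal" where
  "half_slob v = (\<integral>\<^sup>+t. \<integral>\<^sup>+s. ennreal (indicator {0<..<T} t * indicator {0<..<T} s * indicator {t<..} s *
      ((v t - v s)\<^sup>2 / \<bar>t - s\<bar> powr (1 + 2 * \<alpha>))) \<partial>lborel \<partial>lborel)"

text \<open>
  For \<open>\<alpha> = 1/2\<close> this is the additional term in the square of the norm of \<open>end_H\<close>.
\<close>

definition end_weight :: "(real \<Rightarrow> real) \<Rightarrow> ennreal" where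
  "end_weight v = (\<integral>\<^sup>+t. ennreal (indicator {0<..<T} t * (v t)\<^sup>2 * (T - t) powr (- (2 * \<alpha>))) \<partial>lborel)"

lemma indicator_greaterThan_measurable[measurable (raw)]:
  fixes f g :: "'m \<Rightarrow> real"
  assumes [measurable]: "f \<in> borel_measurable M" "g \<in> borel_measurable M"
  shows "(\<lambda>x. indicator {f x<..} (g x) :: real) \<in> borel_measurable M"
proof -
  have eq: "(\<lambda>x. indicator {f x<..} (g x) :: real) = (\<lambda>x. if f x < g x then 1 else 0)"
    by (auto simp: fun_eq_iff)
  show ?thesis unfolding eq by measurable
qed

text \<open>
  The integrand is symmetric, and the diagonal does not contribute.
\<close>

lemma slob_half:
  assumes [measurable]: "v \<in> borel_measurable borel"
  shows "slob v = 2 * half_slob v"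
proof -
  let ?K = "\<lambda>t s. indicator {0<..<T} t * indicator {0<..<T} s * indicator {t<..} s *
      ((v t - v s)\<^sup>2 / \<bar>t - s\<bar> powr (1 + 2 * \<alpha>))"
  have "slob v = (\<integral>\<^sup>+t. \<integral>\<^sup>+s. ennreal (?K t s) + ennreal (?K s t) \<partial>lborel \<partial>lborel)"
    unfolding slob_def
  proof (intro nn_integral_cong)
    fix t s :: real
    have "indicator {0<..<T} t * indicator {0<..<T} s * ((v t - v s)\<^sup>2 / \<bar>t - s\<bar> powr (1 + 2 * \<alpha>)) = ?K t s + ?K s t"
      by (cases t s rule: linorder_cases) (auto simp: power2_commute abs_minus_commute)
    then show "ennreal (indicator {0<..<T} t * indicator {0<..<T} s * ((v t - v s)\<^sup>2 / \<bar>t - s\<bar> powr (1 + 2 * \<alpha>)))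
        = ennreal (?K t s) + ennreal (?K s t)" by (simp add: ennreal_plus)
  qed
  also have "\<dots> = (\<integral>\<^sup>+t. (\<integral>\<^sup>+s. ennreal (?K t s) \<partial>lborel) + (\<integral>\<^sup>+s. ennreal (?K s t) \<partial>lborel) \<partial>lborel)"
    by (intro nn_integral_cong nn_integral_add) measurable
  also have "\<dots> = (\<integral>\<^sup>+t. \<integral>\<^sup>+s. ennreal (?K t s) \<partial>lborel \<partial>lborel) + (\<integral>\<^sup>+t. \<integral>\<^sup>+s. ennreal (?K s t) \<partial>lborel \<partial>lborel)"
    by (intro nn_integral_add) measurable
  also have "(\<integral>\<^sup>+t. \<integral>\<^sup>+s. ennreal (?K s t) \<partial>lborel \<partial>lborel) = (\<integral>\<^sup>+s. \<integral>\<^sup>+t. ennreal (?K s t) \<partial>lborel \<partial>lborel)"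
    by (rule lborel_pair.Fubini') measurable
  finally show ?thesis by (simp only: half_slob_def mult_2)
qed

text \<open>
  For fixed \<open>t\<close> the steps \<open>h < T - t\<close> reach the points \<open>t + h\<close> of the interval and give the half of the
  double integral above the diagonal. For the other steps \<open>v (t + h) = 0\<close>, and the integral of
  \<open>h powr (- 1 - 2 * \<alpha>)\<close> over \<open>h \<ge> T - t\<close> produces the weight.
\<close>

lemma shift_energy_eq:
  assumes v: "S v"
  shows "shift_energy v = half_slob v + ennreal (1 / (2 * \<alpha>)) * end_weight v"
proof -
  have [measurable]: "v \<in> borel_measurable borel" using v by (rule S_borel)
  let ?K = "\<lambda>t s. indicator {0<..<T} t * indicator {0<..<T} s * indicator {t<..} s *
      ((v t - v s)\<^sup>2 / \<bar>t - s\<bar> powr (1 + 2 * \<alpha>))"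
  let ?W = "\<lambda>t. indicator {0<..<T} t * (v t)\<^sup>2 * (T - t) powr (- (2 * \<alpha>))"
  have inner: "(\<integral>\<^sup>+h. ennreal (indicator {0<..} h * h powr (- 1 - 2 * \<alpha>)) * ennreal (indicator {0<..<T} t * (v t - v (t + h))\<^sup>2) \<partial>lborel)
      = (\<integral>\<^sup>+s. ennreal (?K t s) \<partial>lborel) + ennreal (1 / (2 * \<alpha>)) * ennreal (?W t)" for t
  proof (cases "t \<in> {0<..<T}")
    case True
    let ?f = "\<lambda>h. ennreal (indicator {0<..} h * h powr (- 1 - 2 * \<alpha>)) * ennreal (indicator {0<..<T} t * (v t - v (t + h))\<^sup>2)"
    have "(\<integral>\<^sup>+h. ?f h \<partial>lborel) = (\<integral>\<^sup>+s. ?f (- t + 1 * s) \<partial>lborel)"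
      using nn_integral_real_affine[of ?f 1 "- t"] by simp
    also have "\<dots> = (\<integral>\<^sup>+s. ennreal (?K t s) + ennreal ((v t)\<^sup>2) * ennreal (indicator {T - t..} (- t + 1 * s) * (- t + 1 * s) powr (- 1 - 2 * \<alpha>)) \<partial>lborel)"
    proof (intro nn_integral_cong)
      fix s :: real
      consider "s \<le> t" | "t < s" "s < T" | "T \<le> s" by linarith
      then show "?f (- t + 1 * s) = ennreal (?K t s) + ennreal ((v t)\<^sup>2) * ennreal (indicator {T - t..} (- t + 1 * s) * (- t + 1 * s) powr (- 1 - 2 * \<alpha>))"
      proof cases
        case 1 then show ?thesis using True by auto
      next
        case 2
        have "(s - t) powr (- 1 - 2 * \<alpha>) = 1 / (s - t) powr (1 + 2 * \<alpha>)"
          using powr_minus[of "s - t" "1 + 2 * \<alpha>"] by (simp add: divide_inverse)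
        then show ?thesis using 2 True by (simp add: ennreal_mult[symmetric] divide_inverse mult.commute)
      next
        case 3 then show ?thesis using True S_zero[OF v, of s] by (simp add: mult.commute)
      qed
    qed
    also have "\<dots> = (\<integral>\<^sup>+s. ennreal (?K t s) \<partial>lborel) + ennreal ((v t)\<^sup>2) *
        (\<integral>\<^sup>+s. ennreal (indicator {T - t..} (- t + 1 * s) * (- t + 1 * s) powr (- 1 - 2 * \<alpha>)) \<partial>lborel)"
      by (subst nn_integral_add) (auto simp: nn_integral_cmult)
    also have "(\<integral>\<^sup>+s. ennreal (indicator {T - t..} (- t + 1 * s) * (- t + 1 * s) powr (- 1 - 2 * \<alpha>)) \<partial>lborel)
        = (\<integral>\<^sup>+x. ennreal (indicator {T - t..} x * x powr (- 1 - 2 * \<alpha>)) \<partial>lborel)"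
      using nn_integral_real_affine[of "\<lambda>x. ennreal (indicator {T - t..} x * x powr (- 1 - 2 * \<alpha>))" 1 "- t"] by simp
    also have "\<dots> = ennreal (1 / (2 * \<alpha>) * (T - t) powr (- (2 * \<alpha>)))"
      using True alpha by (subst nn_integral_powr_to_inf) auto
    finally show ?thesis using True alpha by (simp add: ennreal_mult[symmetric] mult_ac)
  qed simp
  have "shift_energy v = (\<integral>\<^sup>+t. \<integral>\<^sup>+h. ennreal (indicator {0<..} h * h powr (- 1 - 2 * \<alpha>)) * ennreal (indicator {0<..<T} t * (v t - v (t + h))\<^sup>2) \<partial>lborel \<partial>lborel)"
    unfolding shift_energy_def by (rule lborel_pair.Fubini'[symmetric]) measurable
  also have "\<dots> = (\<integral>\<^sup>+t. (\<integral>\<^sup>+s. ennreal (?K t s) \<partial>lborel) + ennreal (1 / (2 * \<alpha>)) * ennreal (?W t) \<partial>lborel)"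
    unfolding inner ..
  also have "\<dots> = half_slob v + ennreal (1 / (2 * \<alpha>)) * end_weight v"
    unfolding half_slob_def end_weight_def by (subst nn_integral_add) (auto simp: nn_integral_cmult)
  finally show ?thesis .
qed

text \<open>
  The bound \<open>H\<close>, valid for each dilation factor, is integrated over the factors. With \<open>\<rho> = \<mu> * s\<close> as new
  variable the right-hand side becomes a double integral of \<open>(u s - u \<rho>)\<^sup>2 * s powr (- 1 - 2 * \<alpha>)\<close>, and
  \<open>\<bar>s - \<rho>\<bar> \<le> 2 * s\<close> because the factors are at most \<open>3\<close>. If one of the two points lies beyond \<open>T\<close> then \<open>u\<close>
  vanishes there; in that case \<open>s\<close> is at least \<open>T / 3\<close>, and the point beyond \<open>T\<close> is at most \<open>3 * T\<close> if
  the other one is inside, so the norm of \<open>u\<close> suffices.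
\<close>

lemma hardy_averaged:
  assumes u: "S u" and ab: "0 < a" "a < b" "1 / 3 \<le> a" "b \<le> 3" and C0: "0 \<le> C0"
    and H: "\<And>\<mu>. a \<le> \<mu> \<Longrightarrow> \<mu> \<le> b \<Longrightarrow> W \<le> ennreal C0 *
       (\<integral>\<^sup>+s. ennreal (indicator {0<..} s * (u s - u (\<mu> * s))\<^sup>2 * s powr (- (2 * \<alpha>))) \<partial>lborel)"
  shows "ennreal (b - a) * W \<le> ennreal C0 * (ennreal (2 powr (1 + 2 * \<alpha>)) * slob u
     + ennreal (2 * (3 * T) * (T / 3) powr (- 1 - 2 * \<alpha>)) * (\<integral>\<^sup>+s. ennreal ((u s)\<^sup>2) \<partial>lborel))"
proof -
  have [measurable]: "u \<in> borel_measurable borel" using u by (rule S_borel)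
  let ?c = "(T / 3) powr (- 1 - 2 * \<alpha>)"
  have "ennreal (b - a) * W = (\<integral>\<^sup>+\<mu>. W * indicator {a..b} \<mu> \<partial>lborel)"
    using ab by (simp add: nn_integral_cmult_indicator mult.commute)
  also have "\<dots> \<le> (\<integral>\<^sup>+\<mu>. ennreal C0 * (\<integral>\<^sup>+s. ennreal (indicator {a..b} \<mu>) *
       ennreal (indicator {0<..} s * (u s - u (\<mu> * s))\<^sup>2 * s powr (- (2 * \<alpha>))) \<partial>lborel) \<partial>lborel)"
    by (intro nn_integral_mono) (use H in \<open>auto simp: indicator_def\<close>)
  also have "\<dots> = ennreal C0 * (\<integral>\<^sup>+\<mu>. \<integral>\<^sup>+s. ennreal (indicator {a..b} \<mu>) *
       ennreal (indicator {0<..} s * (u s - u (\<mu> * s))\<^sup>2 * s powr (- (2 * \<alpha>))) \<partial>lborel \<partial>lborel)"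
    by (rule nn_integral_cmult) measurable
  also have "(\<integral>\<^sup>+\<mu>. \<integral>\<^sup>+s. ennreal (indicator {a..b} \<mu>) *
       ennreal (indicator {0<..} s * (u s - u (\<mu> * s))\<^sup>2 * s powr (- (2 * \<alpha>))) \<partial>lborel \<partial>lborel)
     = (\<integral>\<^sup>+s. \<integral>\<^sup>+\<mu>. ennreal (indicator {a..b} \<mu>) *
       ennreal (indicator {0<..} s * (u s - u (\<mu> * s))\<^sup>2 * s powr (- (2 * \<alpha>))) \<partial>lborel \<partial>lborel)"
    by (rule lborel_pair.Fubini'[symmetric]) measurable
  also have "\<dots> = (\<integral>\<^sup>+s. \<integral>\<^sup>+\<rho>. ennreal (indicator {0<..} s * indicator {a..b} (\<rho> / s) * ((u s - u \<rho>)\<^sup>2 * s powr (- 1 - 2 * \<alpha>))) \<partial>lborel \<partial>lborel)"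
  proof (rule nn_integral_cong)
    fix s :: real
    show "(\<integral>\<^sup>+\<mu>. ennreal (indicator {a..b} \<mu>) * ennreal (indicator {0<..} s * (u s - u (\<mu> * s))\<^sup>2 * s powr (- (2 * \<alpha>))) \<partial>lborel)
       = (\<integral>\<^sup>+\<rho>. ennreal (indicator {0<..} s * indicator {a..b} (\<rho> / s) * ((u s - u \<rho>)\<^sup>2 * s powr (- 1 - 2 * \<alpha>))) \<partial>lborel)"
    proof (cases "0 < s")
      case True
      let ?f = "\<lambda>\<rho>. ennreal (indicator {0<..} s * indicator {a..b} (\<rho> / s) * ((u s - u \<rho>)\<^sup>2 * s powr (- 1 - 2 * \<alpha>)))"
      have sp: "s * s powr (- 1 - 2 * \<alpha>) = s powr (- (2 * \<alpha>))"
        using True by (simp add: powr_mult_base)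
      have "(\<integral>\<^sup>+\<rho>. ?f \<rho> \<partial>lborel) = ennreal s * (\<integral>\<^sup>+\<mu>. ?f (0 + s * \<mu>) \<partial>lborel)"
        using True nn_integral_real_affine[of ?f s 0] by simp
      also have "\<dots> = (\<integral>\<^sup>+\<mu>. ennreal s * ?f (0 + s * \<mu>) \<partial>lborel)"
        by (rule nn_integral_cmult[symmetric]) measurable
      also have "\<dots> = (\<integral>\<^sup>+\<mu>. ennreal (indicator {a..b} \<mu>) * ennreal (indicator {0<..} s * (u s - u (\<mu> * s))\<^sup>2 * s powr (- (2 * \<alpha>))) \<partial>lborel)"
      proof (intro nn_integral_cong)
        fix \<mu> :: real
        have "s * (indicator {a..b} \<mu> * ((u s - u (s * \<mu>))\<^sup>2 * s powr (- 1 - 2 * \<alpha>)))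
            = indicator {a..b} \<mu> * ((u s - u (s * \<mu>))\<^sup>2 * (s * s powr (- 1 - 2 * \<alpha>)))" by (simp only: mult_ac)
        then show "ennreal s * ?f (0 + s * \<mu>) = ennreal (indicator {a..b} \<mu>) * ennreal (indicator {0<..} s * (u s - u (\<mu> * s))\<^sup>2 * s powr (- (2 * \<alpha>)))"
          using True unfolding sp by (simp add: ennreal_mult[symmetric] mult.commute[of \<mu> s])
      qed
      finally show ?thesis ..
    qed simp
  qed
  also have "\<dots> \<le> (\<integral>\<^sup>+s. \<integral>\<^sup>+\<rho>. ennreal (2 powr (1 + 2 * \<alpha>)) * ennreal (indicator {0<..<T} s * indicator {0<..<T} \<rho> *
        ((u s - u \<rho>)\<^sup>2 / \<bar>s - \<rho>\<bar> powr (1 + 2 * \<alpha>)))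
      + (ennreal (?c * (u s)\<^sup>2) * indicator {0..3 * T} \<rho> + ennreal (?c * (u \<rho>)\<^sup>2) * indicator {0..3 * T} s) \<partial>lborel \<partial>lborel)"
  proof (intro nn_integral_mono)
    fix s \<rho> :: real
    let ?L = "indicator {0<..} s * indicator {a..b} (\<rho> / s) * ((u s - u \<rho>)\<^sup>2 * s powr (- 1 - 2 * \<alpha>))"
    let ?A = "2 powr (1 + 2 * \<alpha>) * (indicator {0<..<T} s * indicator {0<..<T} \<rho> *
        ((u s - u \<rho>)\<^sup>2 / \<bar>s - \<rho>\<bar> powr (1 + 2 * \<alpha>)))"
    let ?B = "?c * (u s)\<^sup>2 * indicator {0..3 * T} \<rho>" and ?C = "?c * (u \<rho>)\<^sup>2 * indicator {0..3 * T} s"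
    have nn: "0 \<le> ?A" "0 \<le> ?B" "0 \<le> ?C" by auto
    have "?L \<le> ?A + (?B + ?C)"
    proof (cases "0 < s \<and> \<rho> / s \<in> {a..b}")
      case True
      then have s: "0 < s" by simp
      have "a * s \<le> \<rho>" "\<rho> \<le> b * s" using True by (auto simp: field_simps)
      moreover have "1 / 3 * s \<le> a * s" "b * s \<le> 3 * s" using ab s by (auto intro: mult_right_mono)
      ultimately have \<rho>: "s \<le> 3 * \<rho>" "\<rho> \<le> 3 * s" by linarith+
      have L: "?L = (u s - u \<rho>)\<^sup>2 * s powr (- 1 - 2 * \<alpha>)" using True by simp
      have big: "s powr (- 1 - 2 * \<alpha>) \<le> ?c" if "T / 3 \<le> s"
        using that T alpha by (intro powr_mono2') auto
      show ?thesis
      proof (cases "s < T")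
        case sT: True
        show ?thesis
        proof (cases "\<rho> < T")
          case True
          have "?L \<le> ?A"
          proof (cases "s = \<rho>")
            case False
            have ge: "0 < \<bar>s - \<rho>\<bar> / 2" "\<bar>s - \<rho>\<bar> / 2 \<le> s" using False \<rho> s by auto
            have "s powr (- 1 - 2 * \<alpha>) \<le> (\<bar>s - \<rho>\<bar> / 2) powr (- 1 - 2 * \<alpha>)"
              using ge alpha by (intro powr_mono2') auto
            also have "\<dots> = 2 powr (1 + 2 * \<alpha>) / \<bar>s - \<rho>\<bar> powr (1 + 2 * \<alpha>)"
            proof -
              have "(\<bar>s - \<rho>\<bar> / 2) powr (- (1 + 2 * \<alpha>)) = inverse ((\<bar>s - \<rho>\<bar> / 2) powr (1 + 2 * \<alpha>))"
                by (rule powr_minus)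
              then show ?thesis by (simp add: powr_divide)
            qed
            finally have "(u s - u \<rho>)\<^sup>2 * s powr (- 1 - 2 * \<alpha>) \<le> (u s - u \<rho>)\<^sup>2 * (2 powr (1 + 2 * \<alpha>) / \<bar>s - \<rho>\<bar> powr (1 + 2 * \<alpha>))"
              by (intro mult_left_mono) auto
            moreover have "0 < \<rho>" using \<rho> s by linarith
            ultimately show ?thesis unfolding L using s sT True by (simp add: mult_ac)
          qed (use nn in simp)
          then show ?thesis using nn by linarith
        next
          case False
          then have "u \<rho> = 0" using S_zero[OF u, of \<rho>] by auto
          then have "?L = (u s)\<^sup>2 * s powr (- 1 - 2 * \<alpha>)" unfolding L by simp
          also have "\<dots> \<le> (u s)\<^sup>2 * ?c" using False \<rho> by (intro mult_left_mono big) auto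
          also have "\<dots> = ?B" using False \<rho> sT s by (auto simp: indicator_def)
          finally show ?thesis using nn by linarith
        qed
      next
        case False
        then have us: "u s = 0" using S_zero[OF u, of s] by auto
        show ?thesis
        proof (cases "\<rho> < T")
          case True
          have "?L = (u \<rho>)\<^sup>2 * s powr (- 1 - 2 * \<alpha>)" unfolding L by (simp add: us)
          also have "\<dots> \<le> (u \<rho>)\<^sup>2 * ?c" using False T by (intro mult_left_mono big) auto
          also have "\<dots> = ?C" using False \<rho> True s by (auto simp: indicator_def)
          finally show ?thesis using nn by linarith
        next
          case False
          then have "u \<rho> = 0" using S_zero[OF u, of \<rho>] by auto
          then have "?L = 0" unfolding L by (simp add: us)
          then show ?thesis using nn by linarith
        qed
      qed
    next
      case False
      then have "?L = 0" by auto
      then show ?thesis using nn by linarith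
    qed
    then have "ennreal ?L \<le> ennreal (?A + (?B + ?C))" by (rule ennreal_leI)
    also have "\<dots> = ennreal ?A + (ennreal ?B + ennreal ?C)" using nn by simp
    also have "ennreal ?A = ennreal (2 powr (1 + 2 * \<alpha>)) * ennreal (indicator {0<..<T} s * indicator {0<..<T} \<rho> *
        ((u s - u \<rho>)\<^sup>2 / \<bar>s - \<rho>\<bar> powr (1 + 2 * \<alpha>)))" by (rule ennreal_mult) auto
    also have "ennreal ?B = ennreal (?c * (u s)\<^sup>2) * indicator {0..3 * T} \<rho>" by (simp add: indicator_def)
    also have "ennreal ?C = ennreal (?c * (u \<rho>)\<^sup>2) * indicator {0..3 * T} s" by (simp add: indicator_def)
    finally show "ennreal ?L \<le> ennreal (2 powr (1 + 2 * \<alpha>)) * ennreal (indicator {0<..<T} s * indicator {0<..<T} \<rho> *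
        ((u s - u \<rho>)\<^sup>2 / \<bar>s - \<rho>\<bar> powr (1 + 2 * \<alpha>)))
      + (ennreal (?c * (u s)\<^sup>2) * indicator {0..3 * T} \<rho> + ennreal (?c * (u \<rho>)\<^sup>2) * indicator {0..3 * T} s)" .
  qed
  also have "\<dots> = ennreal (2 powr (1 + 2 * \<alpha>)) * slob u + (ennreal (3 * T * ?c) * (\<integral>\<^sup>+s. ennreal ((u s)\<^sup>2) \<partial>lborel)
      + ennreal (3 * T * ?c) * (\<integral>\<^sup>+s. ennreal ((u s)\<^sup>2) \<partial>lborel))"
  proof -
    have e1: "(\<integral>\<^sup>+s. \<integral>\<^sup>+\<rho>. ennreal (?c * (u s)\<^sup>2) * indicator {0..3 * T} \<rho> \<partial>lborel \<partial>lborel) = ennreal (3 * T * ?c) * (\<integral>\<^sup>+s. ennreal ((u s)\<^sup>2) \<partial>lborel)"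
    proof -
      have "(\<integral>\<^sup>+\<rho>. ennreal (?c * (u s)\<^sup>2) * indicator {0..3 * T} \<rho> \<partial>lborel) = ennreal (3 * T * ?c) * ennreal ((u s)\<^sup>2)" for s
      proof -
        have "(\<integral>\<^sup>+\<rho>. ennreal (?c * (u s)\<^sup>2) * indicator {0..3 * T} \<rho> \<partial>lborel) = ennreal (?c * (u s)\<^sup>2) * emeasure lborel {0..3 * T}"
          by (rule nn_integral_cmult_indicator) simp
        also have "emeasure lborel {0..3 * T} = ennreal (3 * T)" using T by simp
        also have "ennreal (?c * (u s)\<^sup>2) * ennreal (3 * T) = ennreal (3 * T * ?c) * ennreal ((u s)\<^sup>2)"
          using T by (simp add: ennreal_mult[symmetric] mult_ac)
        finally show ?thesis .
      qed
      then have "(\<integral>\<^sup>+s. \<integral>\<^sup>+\<rho>. ennreal (?c * (u s)\<^sup>2) * indicator {0..3 * T} \<rho> \<partial>lborel \<partial>lborel)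
          = (\<integral>\<^sup>+s. ennreal (3 * T * ?c) * ennreal ((u s)\<^sup>2) \<partial>lborel)" by (simp only:)
      also have "\<dots> = ennreal (3 * T * ?c) * (\<integral>\<^sup>+s. ennreal ((u s)\<^sup>2) \<partial>lborel)"
        by (rule nn_integral_cmult) measurable
      finally show ?thesis .
    qed
    have e2: "(\<integral>\<^sup>+s. \<integral>\<^sup>+\<rho>. ennreal (?c * (u \<rho>)\<^sup>2) * indicator {0..3 * T} s \<partial>lborel \<partial>lborel) = ennreal (3 * T * ?c) * (\<integral>\<^sup>+s. ennreal ((u s)\<^sup>2) \<partial>lborel)"
      by (rule trans[OF lborel_pair.Fubini' e1]) measurable
    let ?X = "\<lambda>s \<rho>. ennreal (indicator {0<..<T} s * indicator {0<..<T} \<rho> * ((u s - u \<rho>)\<^sup>2 / \<bar>s - \<rho>\<bar> powr (1 + 2 * \<alpha>)))"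
    let ?Y = "\<lambda>s \<rho>. ennreal (?c * (u s)\<^sup>2) * indicator {0..3 * T} \<rho>"
    let ?Z = "\<lambda>s \<rho>. ennreal (?c * (u \<rho>)\<^sup>2) * indicator {0..3 * T} s"
    have "(\<integral>\<^sup>+s. \<integral>\<^sup>+\<rho>. ennreal (2 powr (1 + 2 * \<alpha>)) * ?X s \<rho> + (?Y s \<rho> + ?Z s \<rho>) \<partial>lborel \<partial>lborel)
        = (\<integral>\<^sup>+s. (\<integral>\<^sup>+\<rho>. ennreal (2 powr (1 + 2 * \<alpha>)) * ?X s \<rho> \<partial>lborel) + (\<integral>\<^sup>+\<rho>. ?Y s \<rho> + ?Z s \<rho> \<partial>lborel) \<partial>lborel)"
      by (rule nn_integral_cong, rule nn_integral_add) measurable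
    also have "\<dots> = (\<integral>\<^sup>+s. \<integral>\<^sup>+\<rho>. ennreal (2 powr (1 + 2 * \<alpha>)) * ?X s \<rho> \<partial>lborel \<partial>lborel) + (\<integral>\<^sup>+s. \<integral>\<^sup>+\<rho>. ?Y s \<rho> + ?Z s \<rho> \<partial>lborel \<partial>lborel)"
      by (rule nn_integral_add) measurable
    also have "(\<integral>\<^sup>+s. \<integral>\<^sup>+\<rho>. ?Y s \<rho> + ?Z s \<rho> \<partial>lborel \<partial>lborel)
        = (\<integral>\<^sup>+s. (\<integral>\<^sup>+\<rho>. ?Y s \<rho> \<partial>lborel) + (\<integral>\<^sup>+\<rho>. ?Z s \<rho> \<partial>lborel) \<partial>lborel)"
      by (rule nn_integral_cong, rule nn_integral_add) measurable
    also have "\<dots> = (\<integral>\<^sup>+s. \<integral>\<^sup>+\<rho>. ?Y s \<rho> \<partial>lborel \<partial>lborel) + (\<integral>\<^sup>+s. \<integral>\<^sup>+\<rho>. ?Z s \<rho> \<partial>lborel \<partial>lborel)"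
      by (rule nn_integral_add) measurable
    also have "(\<integral>\<^sup>+s. \<integral>\<^sup>+\<rho>. ennreal (2 powr (1 + 2 * \<alpha>)) * ?X s \<rho> \<partial>lborel \<partial>lborel)
        = (\<integral>\<^sup>+s. ennreal (2 powr (1 + 2 * \<alpha>)) * (\<integral>\<^sup>+\<rho>. ?X s \<rho> \<partial>lborel) \<partial>lborel)"
      by (rule nn_integral_cong, rule nn_integral_cmult) measurable
    also have "\<dots> = ennreal (2 powr (1 + 2 * \<alpha>)) * slob u"
      unfolding slob_def by (rule nn_integral_cmult) measurable
    finally show ?thesis by (simp only: e1 e2)
  qed
  also have "ennreal (3 * T * ?c) * (\<integral>\<^sup>+s. ennreal ((u s)\<^sup>2) \<partial>lborel) + ennreal (3 * T * ?c) * (\<integral>\<^sup>+s. ennreal ((u s)\<^sup>2) \<partial>lborel)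
      = ennreal (2 * (3 * T) * ?c) * (\<integral>\<^sup>+s. ennreal ((u s)\<^sup>2) \<partial>lborel)"
  proof -
    have "ennreal (2 * (3 * T) * ?c) = ennreal (3 * T * ?c) + ennreal (3 * T * ?c)"
      using T by (subst ennreal_plus[symmetric]) (auto simp: mult_ac)
    then show ?thesis by (simp add: distrib_right)
  qed
  finally show ?thesis by (simp add: mult_left_mono)
qed

text \<open>
  A range of dilation factors is needed for which \<open>\<mu> powr (2 * \<alpha> - 1)\<close> stays below \<open>1\<close>. For \<open>\<alpha> < 1/2\<close> these are
  factors above \<open>1\<close>, and the telescoping ends because \<open>u\<close> vanishes beyond \<open>T\<close>; for \<open>\<alpha> > 1/2\<close> these are
  factors below \<open>1\<close>, and the boundary value zero at the origin is used. For \<open>\<alpha> = 1/2\<close> no factor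
  qualifies, and the inequality fails.
\<close>

lemma hardy_from_left:
  assumes "\<alpha> \<noteq> 1/2"
  obtains C where "0 \<le> C" "\<And>u. S u \<Longrightarrow> (1/2 < \<alpha> \<Longrightarrow> (u \<longlongrightarrow> 0) (at_right 0)) \<Longrightarrow>
    (\<integral>\<^sup>+s. ennreal (indicator {0<..} s * (u s)\<^sup>2 * s powr (- (2 * \<alpha>))) \<partial>lborel)
      \<le> ennreal C * (slob u + (\<integral>\<^sup>+s. ennreal ((u s)\<^sup>2) \<partial>lborel))"
proof -
  define a b where "a = (if \<alpha> < 1/2 then 2 else 1/3 :: real)" and "b = (if \<alpha> < 1/2 then 3 else 1/2 :: real)"
  have ab: "0 < a" "a < b" "1/3 \<le> a" "b \<le> 3" by (auto simp: a_def b_def)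
  \<comment> \<open>On both ranges of factors \<open>\<mu> powr (2 * \<alpha> - 1) \<le> r\<^sup>2\<close>.\<close>
  define r where "r = sqrt (2 powr (- \<bar>2 * \<alpha> - 1\<bar>))"
  have r2: "r\<^sup>2 = 2 powr (- \<bar>2 * \<alpha> - 1\<bar>)" by (simp add: r_def)
  have r: "0 < r" "r < 1"
  proof -
    show "0 < r" by (simp add: r_def)
    have "2 powr (- \<bar>2 * \<alpha> - 1\<bar>) < (2::real) powr 0" using assms by (intro powr_less_mono) auto
    then show "r < 1" by (simp add: r_def)
  qed
  define C0 where "C0 = 1 / (1 - r)\<^sup>2"
  have C0: "0 \<le> C0" by (simp add: C0_def)
  define K where "K = max (2 powr (1 + 2 * \<alpha>)) (2 * (3 * T) * (T / 3) powr (- 1 - 2 * \<alpha>))"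
  have K: "0 \<le> K" by (simp add: K_def le_max_iff_disj)
  have main: "(\<integral>\<^sup>+s. ennreal (indicator {0<..} s * (u s)\<^sup>2 * s powr (- (2 * \<alpha>))) \<partial>lborel)
      \<le> ennreal (C0 * K / (b - a)) * (slob u + (\<integral>\<^sup>+s. ennreal ((u s)\<^sup>2) \<partial>lborel))"
    if u: "S u" and l: "1/2 < \<alpha> \<Longrightarrow> (u \<longlongrightarrow> 0) (at_right 0)" for u
  proof -
    have [measurable]: "u \<in> borel_measurable borel" using u by (rule S_borel)
    let ?W = "(\<integral>\<^sup>+s. ennreal (indicator {0<..} s * (u s)\<^sup>2 * s powr (- (2 * \<alpha>))) \<partial>lborel)"
    let ?R = "slob u + (\<integral>\<^sup>+s. ennreal ((u s)\<^sup>2) \<partial>lborel)"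
    have "ennreal (b - a) * ?W \<le> ennreal C0 * (ennreal (2 powr (1 + 2 * \<alpha>)) * slob u
     + ennreal (2 * (3 * T) * (T / 3) powr (- 1 - 2 * \<alpha>)) * (\<integral>\<^sup>+s. ennreal ((u s)\<^sup>2) \<partial>lborel))"
    proof (rule hardy_averaged[OF u ab C0])
      fix \<mu> assume \<mu>: "a \<le> \<mu>" "\<mu> \<le> b"
      show "?W \<le> ennreal C0 * (\<integral>\<^sup>+s. ennreal (indicator {0<..} s * (u s - u (\<mu> * s))\<^sup>2 * s powr (- (2 * \<alpha>))) \<partial>lborel)"
        unfolding C0_def
      proof (rule hardy_dilation)
        show "0 < \<mu>" using \<mu> ab by linarith
        show "\<mu> powr (2 * \<alpha> - 1) \<le> r\<^sup>2"
        proof (cases "\<alpha> < 1/2")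
          case True
          then have "\<mu> powr (2 * \<alpha> - 1) \<le> 2 powr (2 * \<alpha> - 1)"
            using \<mu> by (intro powr_mono2') (auto simp: a_def)
          then show ?thesis using True by (simp add: r2)
        next
          case False
          then have "\<mu> powr (2 * \<alpha> - 1) \<le> (1 / 2) powr (2 * \<alpha> - 1)"
            using \<mu> ab by (intro powr_mono2) (auto simp: a_def b_def)
          also have "\<dots> = 2 powr (- (2 * \<alpha> - 1))"
            by (simp only: powr_minus powr_divide) (simp add: divide_inverse)
          finally show ?thesis using False by (simp add: r2)
        qed
        fix s :: real assume s: "0 < s"
        show "(\<lambda>n. u (\<mu> ^ n * s)) \<longlonglongrightarrow> 0"
        proof (cases "\<alpha> < 1/2")
          case True
          then have "1 < \<mu>" using \<mu> by (simp add: a_def)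
          then obtain N where N: "T / s < \<mu> ^ N" using real_arch_pow by blast
          have "\<forall>\<^sub>F n in sequentially. u (\<mu> ^ n * s) = 0"
            using eventually_ge_at_top[of N]
          proof eventually_elim
            case (elim n)
            then have "\<mu> ^ N \<le> \<mu> ^ n" using \<open>1 < \<mu>\<close> by (intro power_increasing) auto
            then have "T / s < \<mu> ^ n" using N by linarith
            then have "T < \<mu> ^ n * s" using s by (simp add: field_simps)
            then show ?case using S_zero[OF u] by simp
          qed
          then show ?thesis by (rule tendsto_eventually)
        next
          case False
          then have m: "0 < \<mu>" "\<mu> < 1" "1/2 < \<alpha>" using \<mu> assms by (auto simp: a_def b_def)
          have F: "filterlim (\<lambda>n. \<mu> ^ n * s) (at_right 0) sequentially"
          proof (rule tendsto_imp_filterlim_at_right)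
            show "(\<lambda>n. \<mu> ^ n * s) \<longlonglongrightarrow> 0"
              using tendsto_mult_right[OF LIMSEQ_power_zero[of \<mu>], of s] m by simp
            show "\<forall>\<^sub>F n in sequentially. 0 < \<mu> ^ n * s" using m s by simp
          qed
          show ?thesis by (rule filterlim_compose[OF l[OF m(3)] F])
        qed
      qed (use r in auto)
    qed
    also have "\<dots> \<le> ennreal C0 * (ennreal K * slob u + ennreal K * (\<integral>\<^sup>+s. ennreal ((u s)\<^sup>2) \<partial>lborel))"
      by (intro mult_left_mono add_mono mult_right_mono ennreal_leI) (auto simp: K_def)
    also have "\<dots> = ennreal (C0 * K) * ?R"
      using C0 K by (simp add: ennreal_mult distrib_left mult.assoc)
    finally have "ennreal (1 / (b - a)) * (ennreal (b - a) * ?W) \<le> ennreal (1 / (b - a)) * (ennreal (C0 * K) * ?R)"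
      by (rule mult_left_mono) simp
    moreover have "ennreal (1 / (b - a)) * ennreal (b - a) = 1"
      using ab by (simp add: ennreal_mult[symmetric])
    moreover have "ennreal (1 / (b - a)) * ennreal (C0 * K) = ennreal (C0 * K / (b - a))"
      using ab C0 K by (simp add: ennreal_mult[symmetric])
    ultimately show ?thesis by (simp add: mult.assoc[symmetric])
  qed
  have "0 \<le> C0 * K / (b - a)" using C0 K ab by simp
  then show ?thesis using that main by blast
qed

text \<open>
  The reflection of the interval turns \<open>hardy_from_left\<close> into an inequality for the weight at \<open>T\<close>.
\<close>

lemma end_weight_bound:
  assumes "\<alpha> \<noteq> 1/2"
  obtains C where "0 \<le> C" "\<And>v. S v \<Longrightarrow> (1/2 < \<alpha> \<Longrightarrow> (v \<longlongrightarrow> 0) (at_left T)) \<Longrightarrow>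
    end_weight v \<le> ennreal C * (slob v + (\<integral>\<^sup>+s. ennreal ((v s)\<^sup>2) \<partial>lborel))"
proof -
  obtain C where C: "0 \<le> C" and H: "\<And>u. S u \<Longrightarrow> (1/2 < \<alpha> \<Longrightarrow> (u \<longlongrightarrow> 0) (at_right 0)) \<Longrightarrow>
    (\<integral>\<^sup>+s. ennreal (indicator {0<..} s * (u s)\<^sup>2 * s powr (- (2 * \<alpha>))) \<partial>lborel)
      \<le> ennreal C * (slob u + (\<integral>\<^sup>+s. ennreal ((u s)\<^sup>2) \<partial>lborel))"
    using hardy_from_left[OF assms] by blast
  have "end_weight v \<le> ennreal C * (slob v + (\<integral>\<^sup>+s. ennreal ((v s)\<^sup>2) \<partial>lborel))"
    if v: "S v" and l: "1/2 < \<alpha> \<Longrightarrow> (v \<longlongrightarrow> 0) (at_left T)" for v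
  proof -
    have [measurable]: "v \<in> borel_measurable borel" using v by (rule S_borel)
    define u where "u s = v (T + (-1) * s)" for s
    have [measurable]: "u \<in> borel_measurable borel" unfolding u_def[abs_def] by measurable
    have i: "integrable lborel (\<lambda>t. (v t)\<^sup>2)" using v by (simp add: S_def sq_integrable_def)
    have u: "S u"
      using lborel_integrable_real_affine[OF i, of "-1" T] S_zero[OF v]
      by (auto simp: S_def sq_integrable_def u_def)
    have flip: "(\<integral>\<^sup>+s. f (T + (-1) * s) \<partial>lborel) = (\<integral>\<^sup>+s. f s \<partial>lborel)"
      if "f \<in> borel_measurable borel" for f :: "real \<Rightarrow> ennreal"
      using nn_integral_real_affine[OF that, of "-1" T] by simp
    have e1: "(\<integral>\<^sup>+s. ennreal ((u s)\<^sup>2) \<partial>lborel) = (\<integral>\<^sup>+s. ennreal ((v s)\<^sup>2) \<partial>lborel)"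
      unfolding u_def by (rule flip) measurable
    have e2: "end_weight v = (\<integral>\<^sup>+s. ennreal (indicator {0<..} s * (u s)\<^sup>2 * s powr (- (2 * \<alpha>))) \<partial>lborel)"
    proof -
      have "end_weight v = (\<integral>\<^sup>+s. ennreal (indicator {0<..<T} (T + (-1) * s) * (v (T + (-1) * s))\<^sup>2 * (T - (T + (-1) * s)) powr (- (2 * \<alpha>))) \<partial>lborel)"
        unfolding end_weight_def by (rule flip[symmetric]) measurable
      also have "\<dots> = (\<integral>\<^sup>+s. ennreal (indicator {0<..} s * (u s)\<^sup>2 * s powr (- (2 * \<alpha>))) \<partial>lborel)"
      proof (rule nn_integral_cong)
        fix s
        show "ennreal (indicator {0<..<T} (T + (-1) * s) * (v (T + (-1) * s))\<^sup>2 * (T - (T + (-1) * s)) powr (- (2 * \<alpha>)))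
          = ennreal (indicator {0<..} s * (u s)\<^sup>2 * s powr (- (2 * \<alpha>)))"
          using S_zero[OF v, of "T + (-1) * s"] by (auto simp: u_def indicator_def)
      qed
      finally show ?thesis .
    qed
    have e3: "slob u = slob v"
    proof -
      let ?K = "\<lambda>t s. ennreal (indicator {0<..<T} t * indicator {0<..<T} s * ((v t - v s)\<^sup>2 / \<bar>t - s\<bar> powr (1 + 2 * \<alpha>)))"
      have "slob u = (\<integral>\<^sup>+t. \<integral>\<^sup>+s. ?K (T + (-1) * t) (T + (-1) * s) \<partial>lborel \<partial>lborel)"
        unfolding slob_def
      proof (intro nn_integral_cong)
        fix t s :: real
        have "indicator {0<..<T} (T + (-1) * t) = (indicator {0<..<T} t :: real)"
          "indicator {0<..<T} (T + (-1) * s) = (indicator {0<..<T} s :: real)"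
          by (auto simp: indicator_def)
        moreover have "\<bar>(T + (-1) * t) - (T + (-1) * s)\<bar> = \<bar>t - s\<bar>" by simp
        ultimately show "ennreal (indicator {0<..<T} t * indicator {0<..<T} s * ((u t - u s)\<^sup>2 / \<bar>t - s\<bar> powr (1 + 2 * \<alpha>)))
          = ?K (T + (-1) * t) (T + (-1) * s)"
          unfolding u_def by simp
      qed
      also have "\<dots> = (\<integral>\<^sup>+t. \<integral>\<^sup>+s. ?K (T + (-1) * t) s \<partial>lborel \<partial>lborel)"
        by (rule nn_integral_cong, rule flip) measurable
      also have "\<dots> = (\<integral>\<^sup>+t. \<integral>\<^sup>+s. ?K t s \<partial>lborel \<partial>lborel)"
        by (rule flip) measurable
      finally show ?thesis by (simp only: slob_def)
    qed
    have "(u \<longlongrightarrow> 0) (at_right 0)" if "1/2 < \<alpha>"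
    proof -
      have "filterlim (\<lambda>s. T + (-1) * s) (at_left T) (at_right 0)"
      proof (rule tendsto_imp_filterlim_at_left)
        have "((\<lambda>s. T + (-1) * s) \<longlongrightarrow> T + (-1) * 0) (at_right 0)" by (intro tendsto_intros)
        then show "((\<lambda>s. T + (-1) * s) \<longlongrightarrow> T) (at_right 0)" by simp
        show "\<forall>\<^sub>F x in at_right 0. T + - 1 * x < T"
          using eventually_at_right_less[of "0::real"] by eventually_elim simp
      qed
      then show ?thesis unfolding u_def by (rule filterlim_compose[OF l[OF that]])
    qed
    from H[OF u this] show ?thesis by (simp only: e1 e2 e3)
  qed
  then show ?thesis using that C by blast
qed

section \<open>Hoelder continuity and Volterra equations\<close>

text \<open>
  For \<open>\<alpha> > 1/2\<close> the kernel \<open>diff_ker\<close> is square integrable, and the Cauchy-Schwarz inequality bounds the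
  average pointwise; the dilation by \<open>h\<close> costs \<open>h powr (- 1/2)\<close>.
\<close>

lemma back_int_Hoelder:
  assumes a: "1/2 < \<alpha>"
  obtains K where "\<And>f t h. S f \<Longrightarrow> 0 \<le> t \<Longrightarrow> 0 < h \<Longrightarrow> \<bar>back_int f t - back_int f (t + h)\<bar> \<le> K * norm2R f * h powr (\<alpha> - 1/2)"
proof -
  have "integrable lborel (\<lambda>x. \<bar>x\<bar> powr 0 * \<bar>diff_ker x\<bar> powr 2)"
    using a alpha by (intro diff_ker_weighted_power_integrable) auto
  then have "integrable lborel (\<lambda>x. (diff_ker x)\<^sup>2)"
  proof (rule Bochner_Integration.integrable_bound)
    show "AE x in lborel. norm ((diff_ker x)\<^sup>2) \<le> norm (\<bar>x\<bar> powr 0 * \<bar>diff_ker x\<bar> powr 2)"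
    proof (rule AE_I2)
      fix x show "norm ((diff_ker x)\<^sup>2) \<le> norm (\<bar>x\<bar> powr 0 * \<bar>diff_ker x\<bar> powr 2)"
        by (cases "diff_ker x = 0") (auto simp: diff_ker_eq_0 powr_numeral)
    qed
  qed measurable
  then have k2: "sqR diff_ker" by (simp add: sq_integrable_def)
  have "integrable lborel (\<lambda>x. indicator {0..T} x * x powr (2 * (\<alpha> - 1)))"
    using a T by (intro powr_from_0_lborel) auto
  then have "integrable lborel (\<lambda>x. (indicator {..T} x * pow_ker x)\<^sup>2)"
  proof (rule Bochner_Integration.integrable_bound)
    show "AE x in lborel. norm ((indicator {..T} x * pow_ker x)\<^sup>2) \<le> norm (indicator {0..T} x * x powr (2 * (\<alpha> - 1)))"
    proof (rule AE_I2)
      fix x :: real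
      have "(x powr (\<alpha> - 1))\<^sup>2 = x powr (2 * (\<alpha> - 1))"
        by (simp add: power2_eq_square powr_add[symmetric])
      then show "norm ((indicator {..T} x * pow_ker x)\<^sup>2) \<le> norm (indicator {0..T} x * x powr (2 * (\<alpha> - 1)))"
        by (auto simp: indicator_def pow_ker_def)
    qed
  qed measurable
  then have p2: "sqR (\<lambda>x. indicator {..T} x * pow_ker x)" by (simp add: sq_integrable_def)
  have main: "\<bar>back_int f t - back_int f (t + h)\<bar> \<le> norm2R diff_ker * norm2R f * h powr (\<alpha> - 1/2)"
    if f: "S f" and t: "0 \<le> t" and h: "0 < h" for f t h
  proof -
    have [measurable]: "f \<in> borel_measurable borel" using f by (rule S_borel)
    have int: "integrable lborel (\<lambda>x. pow_ker x * f (t + x))" if "0 \<le> t" for t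
    proof -
      have "integrable lborel (\<lambda>x. (indicator {..T} x * pow_ker x) * f (x + t))"
        by (intro sq_integrable_mult_integrable p2 sqR_shift S_sqR f)
      moreover have "(\<lambda>x. (indicator {..T} x * pow_ker x) * f (x + t)) = (\<lambda>x. pow_ker x * f (t + x))"
      proof (rule ext)
        fix x show "(indicator {..T} x * pow_ker x) * f (x + t) = pow_ker x * f (t + x)"
          using trunc_pow_ker_mult[OF f that, of x] by (simp only: mult_1 add.commute)
      qed
      ultimately show ?thesis by (simp only:)
    qed
    have i: "integrable lborel (\<lambda>t. (f t)\<^sup>2)" using f by (simp add: S_def sq_integrable_def)
    have s: "sqR (\<lambda>x. f (t + h * x))"
      using lborel_integrable_real_affine[OF i, of h t] h by (simp add: sq_integrable_def)
    have "(norm2R (\<lambda>x. f (t + h * x)))\<^sup>2 = (norm2R f)\<^sup>2 / h"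
      unfolding norm2_power2 using lborel_integral_real_affine[of h "\<lambda>t. (f t)\<^sup>2" t] h by simp
    then have "norm2R (\<lambda>x. f (t + h * x)) = norm2R f / sqrt h"
      using real_sqrt_unique[of "norm2R (\<lambda>x. f (t + h * x))" "(norm2R f)\<^sup>2 / h"] h
      by (simp add: real_sqrt_divide)
    moreover have "\<bar>diff_avg h f t\<bar> \<le> norm2R diff_ker * norm2R (\<lambda>x. f (t + h * x))"
      unfolding diff_avg_def by (rule L2_Cauchy_Schwarz[OF k2 s])
    ultimately have "\<bar>diff_avg h f t\<bar> \<le> norm2R diff_ker * (norm2R f / sqrt h)" by simp
    then have "h powr \<alpha> * \<bar>diff_avg h f t\<bar> \<le> h powr \<alpha> * (norm2R diff_ker * (norm2R f / sqrt h))"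
      by (intro mult_left_mono) auto
    also have "\<dots> = norm2R diff_ker * norm2R f * (h powr \<alpha> / h powr (1/2))"
      using h by (simp add: powr_half_sqrt)
    also have "h powr \<alpha> / h powr (1/2) = h powr (\<alpha> - 1/2)" by (rule powr_diff[symmetric])
    finally have "h powr \<alpha> * \<bar>diff_avg h f t\<bar> \<le> norm2R diff_ker * norm2R f * h powr (\<alpha> - 1/2)" .
    moreover have "back_int f t - back_int f (t + h) = h powr \<alpha> * diff_avg h f t"
      by (rule back_int_difference[OF h int[OF t] int]) (use t h in simp)
    ultimately show ?thesis by (simp add: abs_mult)
  qed
  then show ?thesis using that by blast
qed

lemma back_int_continuous:
  assumes a: "1/2 < \<alpha>" and f: "S f"
  shows "continuous_on {0..T} (back_int f)"
proof -
  obtain K where K: "\<And>f t h. S f \<Longrightarrow> 0 \<le> t \<Longrightarrow> 0 < h \<Longrightarrow> \<bar>back_int f t - back_int f (t + h)\<bar> \<le> K * norm2R f * h powr (\<alpha> - 1/2)"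
    using back_int_Hoelder[OF a] by blast
  have bd: "\<bar>back_int f s - back_int f t\<bar> \<le> \<bar>K * norm2R f\<bar> * \<bar>s - t\<bar> powr (\<alpha> - 1/2)" if "0 \<le> t" "0 \<le> s" for s t
  proof -
    have *: "\<bar>back_int f t - back_int f s\<bar> \<le> \<bar>K * norm2R f\<bar> * \<bar>s - t\<bar> powr (\<alpha> - 1/2)" if "0 \<le> t" "t < s" for s t
    proof -
      have "\<bar>back_int f t - back_int f s\<bar> \<le> K * norm2R f * (s - t) powr (\<alpha> - 1/2)"
        using K[OF f that(1), of "s - t"] that by simp
      also have "\<dots> \<le> \<bar>K * norm2R f\<bar> * (s - t) powr (\<alpha> - 1/2)" by (intro mult_right_mono) auto
      finally show ?thesis using that by simp
    qed
    show ?thesis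
      using *[of t s] *[of s t] that by (cases t s rule: linorder_cases) (auto simp: abs_minus_commute)
  qed
  show ?thesis
    unfolding continuous_on_def
  proof
    fix t assume t: "t \<in> {0..T}"
    have "((\<lambda>s. \<bar>s - t\<bar> powr (\<alpha> - 1/2)) \<longlongrightarrow> 0) (at t within {0..T})"
    proof -
      have "((\<lambda>s. \<bar>s - t\<bar> powr (\<alpha> - 1/2)) \<longlongrightarrow> \<bar>t - t\<bar> powr (\<alpha> - 1/2)) (at t within {0..T})"
        using a by (intro tendsto_powr2 tendsto_intros) auto
      then show ?thesis by simp
    qed
    then have l: "((\<lambda>s. \<bar>K * norm2R f\<bar> * \<bar>s - t\<bar> powr (\<alpha> - 1/2)) \<longlongrightarrow> 0) (at t within {0..T})"
      using tendsto_mult_right_zero by blast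
    have "((\<lambda>s. back_int f s - back_int f t) \<longlongrightarrow> 0) (at t within {0..T})"
    proof (rule Lim_null_comparison[OF _ l])
      show "\<forall>\<^sub>F s in at t within {0..T}. norm (back_int f s - back_int f t) \<le> \<bar>K * norm2R f\<bar> * \<bar>s - t\<bar> powr (\<alpha> - 1/2)"
        using bd t by (auto simp: eventually_at_filter)
    qed
    then show "(back_int f \<longlongrightarrow> back_int f t) (at t within {0..T})" by (simp add: LIM_zero_iff)
  qed
qed

definition exp_weight :: "real \<Rightarrow> (real \<Rightarrow> real) \<Rightarrow> real \<Rightarrow> real" where
  "exp_weight \<mu> f t = exp (\<mu> * t) * f t"

lemma exp_weight_bounds:
  assumes f: "S f" and \<mu>: "0 \<le> \<mu>"
  shows "S (exp_weight \<mu> f)" "norm2R f \<le> norm2R (exp_weight \<mu> f)" "norm2R (exp_weight \<mu> f) \<le> exp (\<mu> * T) * norm2R f"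
proof -
  have [measurable]: "f \<in> borel_measurable borel" using f by (rule S_borel)
  have i: "integrable lborel (\<lambda>t. (f t)\<^sup>2)" using f by (simp add: S_def sq_integrable_def)
  have b: "(f t)\<^sup>2 \<le> (exp_weight \<mu> f t)\<^sup>2" "(exp_weight \<mu> f t)\<^sup>2 \<le> (exp (\<mu> * T))\<^sup>2 * (f t)\<^sup>2" for t
  proof -
    have "1 \<le> exp (\<mu> * t) \<and> exp (\<mu> * t) \<le> exp (\<mu> * T)" if "t \<in> {0<..<T}"
      using that \<mu> by (auto intro: mult_left_mono)
    moreover have "f t = 0" if "t \<notin> {0<..<T}" using S_zero[OF f that] .
    ultimately have *: "f t = 0 \<or> (1 \<le> (exp (\<mu> * t))\<^sup>2 \<and> (exp (\<mu> * t))\<^sup>2 \<le> (exp (\<mu> * T))\<^sup>2)"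
      by (metis exp_ge_zero one_le_power power_mono)
    then show "(f t)\<^sup>2 \<le> (exp_weight \<mu> f t)\<^sup>2" "(exp_weight \<mu> f t)\<^sup>2 \<le> (exp (\<mu> * T))\<^sup>2 * (f t)\<^sup>2"
      unfolding exp_weight_def power_mult_distrib
      by (auto intro: mult_right_mono) (metis mult.commute mult.right_neutral mult_left_mono zero_le_power2)
  qed
  have j: "integrable lborel (\<lambda>t. (exp_weight \<mu> f t)\<^sup>2)"
  proof (rule Bochner_Integration.integrable_bound)
    show "integrable lborel (\<lambda>t. (exp (\<mu> * T))\<^sup>2 * (f t)\<^sup>2)" using i by (rule integrable_mult_right)
    show "(\<lambda>t. (exp_weight \<mu> f t)\<^sup>2) \<in> borel_measurable lborel" unfolding exp_weight_def by measurable
  qed (use b(2) in auto)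
  have "exp_weight \<mu> f \<in> borel_measurable borel" unfolding exp_weight_def[abs_def] by measurable
  then show "S (exp_weight \<mu> f)" using j S_zero[OF f] unfolding S_def sq_integrable_def by (auto simp: exp_weight_def)
  show "norm2R f \<le> norm2R (exp_weight \<mu> f)" unfolding norm2_def
    by (intro real_sqrt_le_mono integral_mono i j b)
  have "(norm2R (exp_weight \<mu> f))\<^sup>2 \<le> (LINT t|lborel. (exp (\<mu> * T))\<^sup>2 * (f t)\<^sup>2)"
    unfolding norm2_power2 by (intro integral_mono j integrable_mult_right i b)
  also have "\<dots> = (exp (\<mu> * T) * norm2R f)\<^sup>2" by (simp add: power_mult_distrib norm2_power2)
  finally show "norm2R (exp_weight \<mu> f) \<le> exp (\<mu> * T) * norm2R f" by (rule power2_le_imp_le) simp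
qed

text \<open>
  As \<open>JT\<close> looks to the right, the growing weight turns its kernel into \<open>pow_ker x * exp (- \<mu> * x)\<close>, whose
  integral tends to zero as \<open>\<mu>\<close> grows.
\<close>

lemma JT_small_weighted:
  assumes e: "0 < e"
  obtains \<mu> where "0 \<le> \<mu>" "\<And>f. S f \<Longrightarrow> norm2R (exp_weight \<mu> (JT f)) \<le> e * norm2R (exp_weight \<mu> f)"
proof -
  let ?k = "\<lambda>\<mu> x. (indicator {..T} x * pow_ker x) * exp (- \<mu> * x)"
  have dom: "\<bar>?k \<mu> x\<bar> \<le> indicator {..T} x * pow_ker x" if "0 \<le> \<mu>" for \<mu> x
  proof (cases "0 < x")
    case True
    then have "exp (- \<mu> * x) \<le> 1" using that by simp
    then show ?thesis using pow_ker_nonneg[of x] by (auto simp: indicator_def abs_mult intro: mult_left_le)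
  qed (simp add: pow_ker_eq_0)
  have ki: "integrable lborel (?k \<mu>)" if "0 \<le> \<mu>" for \<mu>
  proof (rule Bochner_Integration.integrable_bound[OF trunc_pow_ker_integrable])
    show "AE x in lborel. norm (?k \<mu> x) \<le> norm (indicator {..T} x * pow_ker x)"
    proof (rule AE_I2)
      fix x show "norm (?k \<mu> x) \<le> norm (indicator {..T} x * pow_ker x)"
        using order_trans[OF dom[OF that, of x] abs_ge_self] by (simp only: real_norm_def)
    qed
  qed measurable
  have "(\<lambda>n. LINT x|lborel. \<bar>?k (real n) x\<bar>) \<longlonglongrightarrow> (LINT x::real|lborel. 0)"
  proof (rule integral_dominated_convergence)
    show "integrable lborel (\<lambda>x. indicator {..T} x * pow_ker x)" by (rule trunc_pow_ker_integrable)
    show "AE x in lborel. (\<lambda>n. \<bar>?k (real n) x\<bar>) \<longlonglongrightarrow> 0"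
    proof (rule AE_I2)
      fix x :: real
      show "(\<lambda>n. \<bar>?k (real n) x\<bar>) \<longlonglongrightarrow> 0"
      proof (cases "0 < x")
        case True
        have "(\<lambda>n. exp (- real n * x)) \<longlonglongrightarrow> 0" using True by real_asymp
        from tendsto_mult_right_zero[OF this, of "\<bar>indicator {..T} x * pow_ker x\<bar>"] show ?thesis
          by (simp add: abs_mult)
      qed (simp add: pow_ker_eq_0)
    qed
    show "AE x in lborel. norm \<bar>?k (real n) x\<bar> \<le> indicator {..T} x * pow_ker x" for n
      using dom[of "real n"] by (intro AE_I2) simp
  qed measurable
  then have "\<forall>\<^sub>F n in sequentially. (LINT x|lborel. \<bar>?k (real n) x\<bar>) < e"
    using e by (auto dest: order_tendstoD(2))
  then obtain n where n: "(LINT x|lborel. \<bar>?k (real n) x\<bar>) < e"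
    by (auto simp: eventually_sequentially)
  define \<mu> where "\<mu> = real n"
  have \<mu>: "0 \<le> \<mu>" by (simp add: \<mu>_def)
  have "norm2R (exp_weight \<mu> (JT f)) \<le> e * norm2R (exp_weight \<mu> f)" if f: "S f" for f
  proof -
    let ?w = "exp_weight \<mu> f"
    have w: "S ?w" by (rule exp_weight_bounds(1)[OF f \<mu>])
    have "exp_weight \<mu> (JT f) t = cut (\<lambda>t. LINT x|lborel. ?k \<mu> x * ?w (t + 1 * x)) t" for t
    proof (cases "t \<in> {0<..<T}")
      case True
      have "exp (\<mu> * t) * ((indicator {..T} x * pow_ker x) * f (t + 1 * x)) = ?k \<mu> x * ?w (t + 1 * x)" for x
      proof -
        have "exp (- \<mu> * x) * exp (\<mu> * (t + 1 * x)) = exp (\<mu> * t)"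
          by (simp add: exp_add[symmetric] algebra_simps)
        then have "?k \<mu> x * ?w (t + 1 * x) = (indicator {..T} x * pow_ker x) * (exp (\<mu> * t) * f (t + 1 * x))"
          by (simp only: exp_weight_def mult.assoc[symmetric]) (simp only: mult.assoc)
        then show ?thesis by (simp only: mult.left_commute)
      qed
      then have "(LINT x|lborel. ?k \<mu> x * ?w (t + 1 * x)) = exp (\<mu> * t) * (LINT x|lborel. (indicator {..T} x * pow_ker x) * f (t + 1 * x))"
        by (simp only: integral_mult_right_zero[symmetric])
      then show ?thesis using True by (simp only: JT_eq[OF f] exp_weight_def cut_def) simp
    qed (simp add: exp_weight_def JT_def cut_def)
    then have "exp_weight \<mu> (JT f) = cut (\<lambda>t. LINT x|lborel. ?k \<mu> x * ?w (t + 1 * x))" by (rule ext)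
    then have "norm2R (exp_weight \<mu> (JT f)) \<le> norm2R (\<lambda>t. LINT x|lborel. ?k \<mu> x * ?w (t + 1 * x))"
      using cut_le[OF Young_L2(2)[OF ki[OF \<mu>] S_sqR[OF w]], of 1] by simp
    also have "\<dots> \<le> (LINT x|lborel. \<bar>?k \<mu> x\<bar>) * norm2R ?w"
      by (rule Young_L2(3)[OF ki[OF \<mu>] S_sqR[OF w]])
    also have "\<dots> \<le> e * norm2R ?w" using n by (intro mult_right_mono) (auto simp: \<mu>_def)
    finally show ?thesis .
  qed
  then show ?thesis using that \<mu> by blast
qed

text \<open>
  In a weighted norm the operator \<open>l * JT\<close> is a contraction, whatever the size and the sign of \<open>l\<close>. This
  gives the bound by the triangle inequality and the solution by iteration.
\<close>

lemma JT_Volterra: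
  obtains C where "0 \<le> C"
    "\<And>\<eta>. S \<eta> \<Longrightarrow> \<exists>\<psi>. S \<psi> \<and> (AE t in lborel. \<psi> t + l * JT \<psi> t = \<eta> t)"
    "\<And>\<eta> \<psi>. S \<eta> \<Longrightarrow> S \<psi> \<Longrightarrow> (AE t in lborel. \<psi> t + l * JT \<psi> t = \<eta> t) \<Longrightarrow> norm2R \<psi> \<le> C * norm2R \<eta>"
proof -
  \<comment> \<open>The contraction factor is then at most \<open>1/2\<close>, the rate required by \<open>L2_complete\<close>.\<close>
  define e where "e = 1 / (2 * (\<bar>l\<bar> + 1))"
  have e: "0 < e" by (simp add: e_def)
  have le: "\<bar>l\<bar> * e \<le> 1/2" by (simp add: e_def field_simps)
  obtain \<mu> where \<mu>: "0 \<le> \<mu>" and J: "\<And>f. S f \<Longrightarrow> norm2R (exp_weight \<mu> (JT f)) \<le> e * norm2R (exp_weight \<mu> f)"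
    using JT_small_weighted[OF e] by blast
  let ?w = "\<lambda>f. norm2R (exp_weight \<mu> f)"
  have lJ: "?w (\<lambda>t. l * JT f t) \<le> 1/2 * ?w f" if "S f" for f
  proof -
    have "exp_weight \<mu> (\<lambda>t. l * JT f t) = (\<lambda>t. l * exp_weight \<mu> (JT f) t)" by (auto simp: exp_weight_def)
    then have "?w (\<lambda>t. l * JT f t) = \<bar>l\<bar> * ?w (JT f)" by (simp add: norm2_scale)
    also have "\<dots> \<le> \<bar>l\<bar> * (e * ?w f)" by (intro mult_left_mono J that) simp
    also have "\<dots> \<le> 1/2 * ?w f" using mult_right_mono[OF le, of "?w f"] by (simp add: mult.assoc)
    finally show ?thesis .
  qed
  have bound: "norm2R \<psi> \<le> (2 * exp (\<mu> * T)) * norm2R \<eta>"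
    if \<eta>: "S \<eta>" and \<psi>: "S \<psi>" and eq: "AE t in lborel. \<psi> t + l * JT \<psi> t = \<eta> t" for \<eta> \<psi>
  proof -
    have [measurable]: "\<eta> \<in> borel_measurable borel" "\<psi> \<in> borel_measurable borel" using \<eta> \<psi> by (auto intro: S_borel)
    have m: "exp_weight \<mu> f \<in> borel_measurable lborel" if "f \<in> borel_measurable borel" for f
      using that unfolding exp_weight_def[abs_def] by measurable
    have lS: "S (\<lambda>t. - l * JT \<psi> t)" by (intro S_scale JT_S \<psi>)
    have "?w \<psi> = norm2R (\<lambda>t. exp_weight \<mu> \<eta> t + exp_weight \<mu> (\<lambda>t. - l * JT \<psi> t) t)"
    proof (rule norm2_cong_AE)
      show "AE t in lborel. exp_weight \<mu> \<psi> t = exp_weight \<mu> \<eta> t + exp_weight \<mu> (\<lambda>t. - l * JT \<psi> t) t"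
        using eq
      proof eventually_elim
        case (elim t)
        show ?case unfolding exp_weight_def elim[symmetric] by (simp add: algebra_simps)
      qed
      show "(\<lambda>t. exp_weight \<mu> \<eta> t + exp_weight \<mu> (\<lambda>t. - l * JT \<psi> t) t) \<in> borel_measurable lborel"
        using m[of \<eta>] m[OF S_borel[OF lS]] by measurable
    qed (use m in simp)
    also have "\<dots> \<le> ?w \<eta> + ?w (\<lambda>t. - l * JT \<psi> t)"
      by (intro norm2_triangle S_sqR exp_weight_bounds(1)[OF _ \<mu>] \<eta> lS)
    also have "?w (\<lambda>t. - l * JT \<psi> t) = ?w (\<lambda>t. l * JT \<psi> t)"
      by (simp add: norm2_def exp_weight_def power_mult_distrib)
    also have "?w \<eta> + \<dots> \<le> ?w \<eta> + 1/2 * ?w \<psi>" using lJ[OF \<psi>] by simp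
    finally have "?w \<psi> \<le> 2 * ?w \<eta>" by simp
    also have "\<dots> \<le> 2 * (exp (\<mu> * T) * norm2R \<eta>)" using exp_weight_bounds(3)[OF \<eta> \<mu>] by simp
    finally show ?thesis using exp_weight_bounds(2)[OF \<psi> \<mu>] by simp
  qed
  have ex: "\<exists>\<psi>. S \<psi> \<and> (AE t in lborel. \<psi> t + l * JT \<psi> t = \<eta> t)" if \<eta>: "S \<eta>" for \<eta>
  proof -
    define \<psi> where "\<psi> = rec_nat (\<lambda>t. 0) (\<lambda>_ f t. \<eta> t - l * JT f t)"
    have \<psi>0: "\<psi> 0 = (\<lambda>t. 0)" and \<psi>S: "\<psi> (Suc n) = (\<lambda>t. \<eta> t - l * JT (\<psi> n) t)" for n
      by (simp_all add: \<psi>_def)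
    have S\<psi>: "S (\<psi> n)" for n
    proof (induction n)
      case 0 show ?case unfolding \<psi>0 by (simp add: S_def)
    next
      case (Suc n) then show ?case unfolding \<psi>S by (intro S_diff \<eta> S_scale JT_S)
    qed
    have JTd: "AE t in lborel. JT (\<lambda>x. f x - g x) t = JT f t - JT g t" if "S f" "S g" for f g
      using JT_add[OF that(1) S_scale[OF that(2), of "-1"]] by (simp only: JT_scale) simp
    let ?d = "\<lambda>n t. \<psi> (Suc n) t - \<psi> n t"
    have Sd: "S (?d n)" for n by (intro S_diff S\<psi>)
    have wd: "?w (?d n) \<le> ?w \<eta> / 2 ^ n" for n
    proof (induction n)
      case 0
      have "JT (\<lambda>t. 0) t = 0" for t using JT_scale[of 0 "\<lambda>t. 0" t] by simp
      then have "?d 0 = \<eta>" by (simp add: \<psi>0 \<psi>S)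
      then show ?case by simp
    next
      case (Suc n)
      have "?w (?d (Suc n)) = ?w (\<lambda>t. l * JT (?d n) t)"
        unfolding norm2_def
      proof (intro arg_cong[of _ _ sqrt] integral_cong_AE)
        have a: "S (\<lambda>t. l * JT (?d n) t)" by (intro S_scale JT_S Sd)
        show "(\<lambda>t. (exp_weight \<mu> (?d (Suc n)) t)\<^sup>2) \<in> borel_measurable lborel"
          "(\<lambda>t. (exp_weight \<mu> (\<lambda>t. l * JT (?d n) t) t)\<^sup>2) \<in> borel_measurable lborel"
          using S_borel[OF exp_weight_bounds(1)[OF Sd \<mu>, of "Suc n"]] S_borel[OF exp_weight_bounds(1)[OF a \<mu>]] by measurable
        show "AE t in lborel. (exp_weight \<mu> (?d (Suc n)) t)\<^sup>2 = (exp_weight \<mu> (\<lambda>t. l * JT (?d n) t) t)\<^sup>2"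
          using JTd[OF S\<psi> S\<psi>, of "Suc n" n]
        proof eventually_elim
          case (elim t)
          have "?d (Suc n) t = - (l * JT (?d n) t)"
            unfolding elim unfolding \<psi>S[of "Suc n"] by (simp add: \<psi>S[of n] algebra_simps)
          then show ?case by (simp add: exp_weight_def power_mult_distrib)
        qed
      qed
      also have "\<dots> \<le> 1/2 * ?w (?d n)" by (rule lJ[OF Sd])
      also have "\<dots> \<le> ?w \<eta> / 2 ^ Suc n" using Suc by simp
      finally show ?case .
    qed
    have d2: "norm2R (?d n) \<le> ?w \<eta> / 2 ^ n" for n
      using exp_weight_bounds(2)[OF Sd \<mu>, of n] wd[of n] by linarith
    obtain g where g: "sqR g" and gl: "\<And>n. norm2R (\<lambda>x. g x - \<psi> n x) \<le> 2 * ?w \<eta> / 2 ^ n"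
      using L2_complete[OF S_sqR[OF S\<psi>] d2] by blast
    define p where "p = cut g"
    have Sp: "S p" unfolding p_def by (rule cut_S[OF g])
    have pl: "norm2R (\<lambda>x. p x - \<psi> n x) \<le> 2 * ?w \<eta> / 2 ^ n" for n
    proof -
      have "(\<lambda>x. p x - \<psi> n x) = cut (\<lambda>x. g x - \<psi> n x)"
        using S_zero[OF S\<psi>[of n]] by (auto simp: p_def cut_def indicator_def fun_eq_iff)
      then show ?thesis using cut_le[OF sq_integrable_diff[OF g S_sqR[OF S\<psi>[of n]]]] gl[of n] by simp
    qed
    let ?k = "LINT x|lborel. \<bar>indicator {..T} x * pow_ker x\<bar>"
    let ?r = "\<lambda>t. p t + l * JT p t - \<eta> t"
    have Sr: "S ?r" by (intro S_diff S_add S_scale JT_S Sp \<eta>)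
    have rb: "norm2R ?r \<le> (1 + \<bar>l\<bar> * ?k) * (2 * ?w \<eta> / 2 ^ n)" for n
    proof -
      have a: "S (\<lambda>t. p t - \<psi> (Suc n) t)" "S (\<lambda>t. p t - \<psi> n t)" by (intro S_diff Sp S\<psi>)+
      have b: "S (\<lambda>t. l * JT (\<lambda>t. p t - \<psi> n t) t)" by (intro S_scale JT_S a)
      have "norm2R ?r = norm2R (\<lambda>t. (p t - \<psi> (Suc n) t) + l * JT (\<lambda>t. p t - \<psi> n t) t)"
      proof (rule norm2_cong_AE)
        show "AE t in lborel. ?r t = (p t - \<psi> (Suc n) t) + l * JT (\<lambda>t. p t - \<psi> n t) t"
          using JTd[OF Sp S\<psi>[of n]]
        proof eventually_elim
          case (elim t)
          show ?case unfolding elim by (simp add: \<psi>S algebra_simps)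
        qed
        show "?r \<in> borel_measurable lborel" using S_borel[OF Sr] by simp
        show "(\<lambda>t. (p t - \<psi> (Suc n) t) + l * JT (\<lambda>t. p t - \<psi> n t) t) \<in> borel_measurable lborel"
          using S_borel[OF a(1)] S_borel[OF b] by measurable
      qed
      also have "\<dots> \<le> norm2R (\<lambda>t. p t - \<psi> (Suc n) t) + norm2R (\<lambda>t. l * JT (\<lambda>t. p t - \<psi> n t) t)"
        by (intro norm2_triangle S_sqR a b)
      also have "norm2R (\<lambda>t. p t - \<psi> (Suc n) t) \<le> 2 * ?w \<eta> / 2 ^ n"
      proof -
        have "2 * ?w \<eta> / 2 ^ Suc n \<le> 2 * ?w \<eta> / 2 ^ n" by (intro divide_left_mono) auto
        then show ?thesis using pl[of "Suc n"] by linarith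
      qed
      also have "norm2R (\<lambda>t. l * JT (\<lambda>t. p t - \<psi> n t) t) \<le> \<bar>l\<bar> * (?k * (2 * ?w \<eta> / 2 ^ n))"
      proof -
        have "norm2R (JT (\<lambda>t. p t - \<psi> n t)) \<le> ?k * (2 * ?w \<eta> / 2 ^ n)"
          using JT_bound[OF a(2)] mult_left_mono[OF pl[of n], of ?k] by simp
        then show ?thesis unfolding norm2_scale by (intro mult_left_mono) auto
      qed
      finally show ?thesis by (simp only: distrib_right mult_1 mult.assoc)
    qed
    have "(\<lambda>n. c * (b / 2 ^ n)) \<longlonglongrightarrow> 0" for b c :: real by real_asymp
    then have "(\<lambda>n. (1 + \<bar>l\<bar> * ?k) * (2 * ?w \<eta> / 2 ^ n)) \<longlonglongrightarrow> 0" .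
    then have "norm2R ?r \<le> 0" using rb by (auto intro: LIMSEQ_le_const)
    then have "norm2R ?r = 0" using norm2_nonneg[of lborel ?r] by linarith
    then have "AE t in lborel. ?r t = 0" using norm2_eq_0_iff[OF S_sqR[OF Sr]] by simp
    then have "AE t in lborel. p t + l * JT p t = \<eta> t" by eventually_elim simp
    then show ?thesis using Sp by blast
  qed
  show ?thesis using that[of "2 * exp (\<mu> * T)"] ex bound by auto
qed

end

section \<open>The spaces of fractional order\<close>

lemma nonneg_integrable_iff:
  fixes f :: "'a \<Rightarrow> real"
  assumes "f \<in> borel_measurable M" "\<And>x. x \<in> space M \<Longrightarrow> 0 \<le> f x"
  shows "integrable M f \<longleftrightarrow> (\<integral>\<^sup>+x. ennreal (f x) \<partial>M) < \<infinity>"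
    and "(LINT x|M. f x) = enn2real (\<integral>\<^sup>+x. ennreal (f x) \<partial>M)"
proof -
  have "(\<integral>\<^sup>+x. ennreal (norm (f x)) \<partial>M) = (\<integral>\<^sup>+x. ennreal (f x) \<partial>M)"
    by (intro nn_integral_cong) (use assms(2) in simp)
  then show "integrable M f \<longleftrightarrow> (\<integral>\<^sup>+x. ennreal (f x) \<partial>M) < \<infinity>"
    using assms(1) by (simp add: integrable_iff_bounded)
  show "(LINT x|M. f x) = enn2real (\<integral>\<^sup>+x. ennreal (f x) \<partial>M)"
    using assms by (intro integral_eq_nn_integral AE_I2) auto
qed

context frac_interval
begin

abbreviation I where "I \<equiv> leb0 T"

lemma space_I: "space I = {0<..<T}"
  by (simp add: space_restrict_space)

lemma AE_I: "AE t in lborel. t \<in> {0<..<T} \<longrightarrow> P t \<Longrightarrow> AE t in I. P t"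
  by (subst AE_restrict_space_iff) (auto intro: AE_completion)

lemma AE_I_lborel: "AE t in I. P t \<Longrightarrow> AE t in lborel. t \<in> {0<..<T} \<longrightarrow> P t"
  by (subst (asm) AE_restrict_space_iff) (auto simp: AE_completion_iff)

lemma borel_I: "f \<in> borel_measurable borel \<Longrightarrow> f \<in> borel_measurable I"
  by (intro measurable_restrict_space1 measurable_completion) simp

lemma nn_integral_I:
  "f \<in> borel_measurable borel \<Longrightarrow> (\<integral>\<^sup>+t. f t \<partial>I) = (\<integral>\<^sup>+t. f t * indicator {0<..<T} t \<partial>lborel)"
  by (subst nn_integral_restrict_space) (auto simp: nn_integral_completion)

lemma I_sigma_finite: "sigma_finite_measure I"
proof -
  have "finite_measure I" by (rule finite_measure_lebesgue_on) auto
  then show ?thesis by (rule finite_measure.axioms)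
qed

lemma L2_sq_integrable: "v \<in> L2 T \<longleftrightarrow> sq_integrable I v"
  by (auto simp: L2_def sq_integrable_def)

lemma L2_norm_norm2: "L2_norm T v = norm2 I v"
  by (simp add: L2_norm_def norm2_def)

lemma S_I:
  assumes "S v" shows "sq_integrable I v" "norm2 I v = norm2R v"
proof -
  have [measurable]: "v \<in> borel_measurable borel" using assms by (rule S_borel)
  have m: "v \<in> borel_measurable I" by (rule borel_I) measurable
  have "(\<integral>\<^sup>+t. ennreal ((v t)\<^sup>2) \<partial>I) = (\<integral>\<^sup>+t. ennreal ((v t)\<^sup>2) * indicator {0<..<T} t \<partial>lborel)"
    by (rule nn_integral_I) measurable
  also have "\<dots> = (\<integral>\<^sup>+t. ennreal ((v t)\<^sup>2) \<partial>lborel)"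
    by (intro nn_integral_cong) (use S_zero[OF assms] in \<open>auto simp: indicator_def\<close>)
  finally have e: "(\<integral>\<^sup>+t. ennreal ((v t)\<^sup>2) \<partial>I) = (\<integral>\<^sup>+t. ennreal ((v t)\<^sup>2) \<partial>lborel)" .
  have mm: "(\<lambda>t. (v t)\<^sup>2) \<in> borel_measurable I" using m by measurable
  have mb: "(\<lambda>t. (v t)\<^sup>2) \<in> borel_measurable lborel" by measurable
  have "integrable lborel (\<lambda>t. (v t)\<^sup>2)" using assms by (simp add: S_def sq_integrable_def)
  then show "sq_integrable I v"
    using m e nonneg_integrable_iff(1)[OF mm] nonneg_integrable_iff(1)[OF mb] by (simp add: sq_integrable_def)
  show "norm2 I v = norm2R v"
    using e nonneg_integrable_iff(2)[OF mm] nonneg_integrable_iff(2)[OF mb] by (simp add: norm2_def)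
qed

text \<open>
  A Lebesgue measurable function agrees almost everywhere with a Borel function.
\<close>

lemma borel_rep:
  fixes v :: "real \<Rightarrow> real"
  assumes "v \<in> borel_measurable I"
  obtains v' where "v' \<in> borel_measurable borel" "\<And>t. t \<notin> {0<..<T} \<Longrightarrow> v' t = 0" "AE t in I. v t = v' t"
proof -
  have "(\<lambda>t. indicator {0<..<T} t *\<^sub>R v t) \<in> borel_measurable (completion lborel)"
    using assms by (subst (asm) borel_measurable_restrict_space_iff) auto
  then obtain g where g: "g \<in> borel_measurable lborel" "AE t in lborel. indicator {0<..<T} t *\<^sub>R v t = g t"
    using completion_ex_borel_measurable_real by blast
  have "cut g \<in> borel_measurable borel" using g(1) by measurable
  moreover have "AE t in I. v t = cut g t"
    by (rule AE_I) (use g(2) in \<open>auto simp: cut_def\<close>)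
  ultimately show ?thesis using that[of "cut g"] by (auto simp: cut_def)
qed

lemma L2_rep:
  assumes "sq_integrable I v"
  obtains v' where "S v'" "AE t in I. v t = v' t" "norm2 I v = norm2R v'"
proof -
  have m: "v \<in> borel_measurable I" using assms by (simp add: sq_integrable_def)
  obtain v' where v': "v' \<in> borel_measurable borel" "\<And>t. t \<notin> {0<..<T} \<Longrightarrow> v' t = 0" "AE t in I. v t = v' t"
    using borel_rep[OF m] by blast
  note [measurable] = v'(1)
  have "sq_integrable I v'" using sq_integrable_cong_AE[OF assms borel_I[OF v'(1)] v'(3)] .
  then have "(\<integral>\<^sup>+t. ennreal ((v' t)\<^sup>2) \<partial>I) < \<infinity>"
    using nn_integral_power2_sq_integrable[of I v'] by simp
  moreover have "(\<integral>\<^sup>+t. ennreal ((v' t)\<^sup>2) \<partial>I) = (\<integral>\<^sup>+t. ennreal ((v' t)\<^sup>2) \<partial>lborel)"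
    by (subst nn_integral_I, measurable, intro nn_integral_cong) (use v'(2) in \<open>auto simp: indicator_def\<close>)
  ultimately have "integrable lborel (\<lambda>t. (v' t)\<^sup>2)" by (intro integrableI_nonneg) auto
  then have S: "S v'" using v' by (auto simp: S_def sq_integrable_def)
  have "norm2 I v = norm2R v'" using norm2_cong_AE[OF m borel_I[OF v'(1)] v'(3)] S_I(2)[OF S] by simp
  then show ?thesis using that S v'(3) by blast
qed

lemma J_op_JT:
  assumes \<psi>': "S \<psi>'" and eq: "AE t in I. \<psi> t = \<psi>' t" and m: "\<psi> \<in> borel_measurable I" and t: "t \<in> {0<..<T}"
  shows "J_op \<alpha> T \<psi> t = 1 / Gamma \<alpha> * JT \<psi>' t"
proof -
  have [measurable]: "\<psi>' \<in> borel_measurable borel" using \<psi>' by (rule S_borel)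
  let ?f = "\<lambda>\<phi> \<xi>. indicator {t<..<T} \<xi> * ((\<xi> - t) powr (\<alpha> - 1) * \<phi> \<xi>) :: real"
  have "(LINT \<xi>:{t<..<T}|lebesgue. (\<xi> - t) powr (\<alpha> - 1) * \<psi> \<xi>) = (LINT \<xi>|lebesgue. ?f \<psi> \<xi>)"
    by (simp add: set_lebesgue_integral_def)
  also have "\<dots> = (LINT \<xi>|lebesgue. ?f \<psi>' \<xi>)"
  proof (rule integral_cong_AE)
    have b: "(\<lambda>\<xi>. indicator {0<..<T} \<xi> * \<psi> \<xi>) \<in> borel_measurable lebesgue"
      using m by (subst (asm) borel_measurable_restrict_space_iff) auto
    have c: "(\<lambda>\<xi>. indicator {t<..<T} \<xi> * (\<xi> - t) powr (\<alpha> - 1)) \<in> borel_measurable lebesgue"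
      by (rule measurable_completion) measurable
    have "?f \<psi> = (\<lambda>\<xi>. (indicator {t<..<T} \<xi> * (\<xi> - t) powr (\<alpha> - 1)) * (indicator {0<..<T} \<xi> * \<psi> \<xi>))"
      using t by (auto simp: fun_eq_iff indicator_def)
    then show "?f \<psi> \<in> borel_measurable lebesgue" using b c by simp
    show "?f \<psi>' \<in> borel_measurable lebesgue" by (rule measurable_completion) measurable
    have "AE \<xi> in lebesgue. \<xi> \<in> {0<..<T} \<longrightarrow> \<psi> \<xi> = \<psi>' \<xi>"
      using eq by (subst (asm) AE_restrict_space_iff) auto
    then show "AE \<xi> in lebesgue. ?f \<psi> \<xi> = ?f \<psi>' \<xi>"
      by eventually_elim (use t in \<open>auto simp: indicator_def\<close>)
  qed
  also have "\<dots> = (LINT \<xi>|lborel. ?f \<psi>' \<xi>)" by (rule integral_completion) measurable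
  also have "\<dots> = (LINT x|lborel. ?f \<psi>' (t + 1 * x))"
    using lborel_integral_real_affine[of 1 "?f \<psi>'" t] by simp
  also have "\<dots> = back_int \<psi>' t"
    unfolding back_int_def
  proof (rule Bochner_Integration.integral_cong[OF refl])
    fix x
    show "?f \<psi>' (t + 1 * x) = pow_ker x * \<psi>' (t + x)"
      using S_zero[OF \<psi>', of "t + x"] t by (auto simp: indicator_def pow_ker_def)
  qed
  also have "\<dots> = JT \<psi>' t" using JT_pos[OF \<psi>', of t] t by simp
  finally show ?thesis by (simp add: J_op_def)
qed

lemma slobodeckij_measurable:
  assumes [measurable]: "v \<in> borel_measurable I"
  shows "slobodeckij_quotient \<alpha> v \<in> borel_measurable (I \<Otimes>\<^sub>M I)"
proof -
  have [measurable]: "(\<lambda>x. x) \<in> borel_measurable I" by (rule borel_I) simp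
  show ?thesis unfolding slobodeckij_quotient_def case_prod_beta' by measurable
qed

lemma slobodeckij_nonneg: "0 \<le> slobodeckij_quotient \<alpha> v p"
  by (simp add: slobodeckij_quotient_def case_prod_beta')

lemma slobodeckij_cong:
  assumes m: "v \<in> borel_measurable I" "w \<in> borel_measurable I" and e: "AE t in I. v t = w t"
  shows "AE p in I \<Otimes>\<^sub>M I. slobodeckij_quotient \<alpha> v p = slobodeckij_quotient \<alpha> w p"
proof -
  interpret I: sigma_finite_measure I by (rule I_sigma_finite)
  interpret P: pair_sigma_finite I I ..
  note [measurable] = slobodeckij_measurable[OF m(1)] slobodeckij_measurable[OF m(2)]
  show ?thesis
  proof (rule P.AE_pair_measure)
    show "AE t in I. AE s in I. slobodeckij_quotient \<alpha> v (t, s) = slobodeckij_quotient \<alpha> w (t, s)"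
      using e
    proof eventually_elim
      case (elim t)
      show ?case using e by eventually_elim (simp add: slobodeckij_quotient_def elim)
    qed
  qed measurable
qed

lemma slobodeckij_nn_integral:
  assumes [measurable]: "v \<in> borel_measurable borel"
  shows "(\<integral>\<^sup>+p. ennreal (slobodeckij_quotient \<alpha> v p) \<partial>(I \<Otimes>\<^sub>M I)) = slob v"
proof -
  interpret I: sigma_finite_measure I by (rule I_sigma_finite)
  have [measurable]: "slobodeckij_quotient \<alpha> v \<in> borel_measurable (I \<Otimes>\<^sub>M I)"
    by (rule slobodeckij_measurable, rule borel_I) measurable
  let ?q = "\<lambda>t s. \<bar>v t - v s\<bar>\<^sup>2 / \<bar>t - s\<bar> powr (1 + 2 * \<alpha>)"
  have "(\<integral>\<^sup>+p. ennreal (slobodeckij_quotient \<alpha> v p) \<partial>(I \<Otimes>\<^sub>M I)) = (\<integral>\<^sup>+t. \<integral>\<^sup>+s. ennreal (slobodeckij_quotient \<alpha> v (t, s)) \<partial>I \<partial>I)"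
    by (rule I.nn_integral_fst[symmetric]) measurable
  also have "\<dots> = (\<integral>\<^sup>+t. \<integral>\<^sup>+s. ennreal (?q t s) \<partial>I \<partial>I)" by (simp add: slobodeckij_quotient_def)
  also have "\<dots> = (\<integral>\<^sup>+t. \<integral>\<^sup>+s. ennreal (?q t s) * indicator {0<..<T} s \<partial>lborel \<partial>I)"
    by (rule nn_integral_cong, rule nn_integral_I) measurable
  also have "\<dots> = (\<integral>\<^sup>+t. (\<integral>\<^sup>+s. ennreal (?q t s) * indicator {0<..<T} s \<partial>lborel) * indicator {0<..<T} t \<partial>lborel)"
    by (rule nn_integral_I) measurable
  also have "\<dots> = (\<integral>\<^sup>+t. \<integral>\<^sup>+s. ennreal (?q t s) * indicator {0<..<T} s * indicator {0<..<T} t \<partial>lborel \<partial>lborel)"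
    by (rule nn_integral_cong, rule nn_integral_multc[symmetric]) measurable
  also have "\<dots> = slob v"
    unfolding slob_def by (intro nn_integral_cong) (auto simp: indicator_def)
  finally show ?thesis .
qed

lemma sobolev_S:
  assumes v: "S v"
  shows "v \<in> sobolev_H \<alpha> T \<longleftrightarrow> slob v < \<infinity>"
    and "(sobolev_norm \<alpha> T v)\<^sup>2 = (norm2R v)\<^sup>2 + enn2real (slob v)"
proof -
  have b: "v \<in> borel_measurable borel" using v by (rule S_borel)
  note q = nonneg_integrable_iff[OF slobodeckij_measurable[OF borel_I[OF b]] slobodeckij_nonneg]
  show "v \<in> sobolev_H \<alpha> T \<longleftrightarrow> slob v < \<infinity>"
    using q(1) S_I[OF v] by (simp add: sobolev_H_def L2_sq_integrable slobodeckij_nn_integral[OF b])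
  show "(sobolev_norm \<alpha> T v)\<^sup>2 = (norm2R v)\<^sup>2 + enn2real (slob v)"
    unfolding sobolev_norm_def using q(2) S_I[OF v]
    by (simp add: L2_norm_norm2 slobodeckij_nn_integral[OF b])
qed

lemma weight_S:
  assumes v: "S v" and a: "\<alpha> = 1/2"
  shows "integrable I (\<lambda>t. \<bar>v t\<bar>\<^sup>2 / (T - t)) \<longleftrightarrow> end_weight v < \<infinity>"
    and "(LINT t|I. \<bar>v t\<bar>\<^sup>2 / (T - t)) = enn2real (end_weight v)"
proof -
  have [measurable]: "v \<in> borel_measurable borel" using v by (rule S_borel)
  have m: "(\<lambda>t. \<bar>v t\<bar>\<^sup>2 / (T - t)) \<in> borel_measurable I" by (rule borel_I) measurable
  have nn: "0 \<le> \<bar>v t\<bar>\<^sup>2 / (T - t)" if "t \<in> space I" for t using that by (simp add: space_I)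
  have "(\<integral>\<^sup>+t. ennreal (\<bar>v t\<bar>\<^sup>2 / (T - t)) \<partial>I) = (\<integral>\<^sup>+t. ennreal (\<bar>v t\<bar>\<^sup>2 / (T - t)) * indicator {0<..<T} t \<partial>lborel)"
    by (rule nn_integral_I) measurable
  also have "\<dots> = end_weight v"
    unfolding end_weight_def
  proof (rule nn_integral_cong)
    fix t :: real
    have "(T - t) powr (- (2 * \<alpha>)) = inverse (T - t)" if "t < T"
    proof -
      have "2 * \<alpha> = 1" using a by simp
      then have "(T - t) powr (- (2 * \<alpha>)) = (T - t) powr (- 1)" by (simp only:)
      also have "\<dots> = inverse ((T - t) powr 1)" by (rule powr_minus)
      finally show ?thesis using that by simp
    qed
    then show "ennreal (\<bar>v t\<bar>\<^sup>2 / (T - t)) * indicator {0<..<T} t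
        = ennreal (indicator {0<..<T} t * (v t)\<^sup>2 * (T - t) powr (- (2 * \<alpha>)))"
      by (cases "t \<in> {0<..<T}") (simp_all add: divide_inverse)
  qed
  finally have e: "(\<integral>\<^sup>+t. ennreal (\<bar>v t\<bar>\<^sup>2 / (T - t)) \<partial>I) = end_weight v" .
  show "integrable I (\<lambda>t. \<bar>v t\<bar>\<^sup>2 / (T - t)) \<longleftrightarrow> end_weight v < \<infinity>"
    and "(LINT t|I. \<bar>v t\<bar>\<^sup>2 / (T - t)) = enn2real (end_weight v)"
    using nonneg_integrable_iff[OF m nn] e by simp_all
qed

lemma end_H_L2: "v \<in> end_H \<alpha> T \<Longrightarrow> sq_integrable I v"
  by (auto simp: end_H_def sobolev_H_def L2_sq_integrable split: if_splits)

text \<open>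
  Membership and norm only depend on the class of functions equal almost everywhere, which permits to
  pass to representatives in \<open>S\<close>.
\<close>

lemma end_H_cong:
  assumes v: "v \<in> end_H \<alpha> T" and w: "w \<in> borel_measurable I" and e: "AE t in I. v t = w t"
  shows "w \<in> end_H \<alpha> T" "end_H_norm \<alpha> T w = end_H_norm \<alpha> T v"
proof -
  have sv: "sq_integrable I v" by (rule end_H_L2[OF v])
  have mv: "v \<in> borel_measurable I" using sv by (simp add: sq_integrable_def)
  have sw: "sq_integrable I w" by (rule sq_integrable_cong_AE[OF sv w e])
  note q = slobodeckij_cong[OF mv w e]
  note mq = slobodeckij_measurable[OF mv] slobodeckij_measurable[OF w]
  have T1: "(\<lambda>x. x) \<in> borel_measurable I" by (rule borel_I) simp
  have m1: "(\<lambda>t. \<bar>v t\<bar>\<^sup>2 / (T - t)) \<in> borel_measurable I" "(\<lambda>t. \<bar>w t\<bar>\<^sup>2 / (T - t)) \<in> borel_measurable I"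
    using mv w T1 by measurable
  have e1: "AE t in I. \<bar>v t\<bar>\<^sup>2 / (T - t) = \<bar>w t\<bar>\<^sup>2 / (T - t)" using e by eventually_elim simp
  have sob: "w \<in> sobolev_H \<alpha> T" if "v \<in> sobolev_H \<alpha> T"
    using that sw integrable_cong_AE[OF mq q] by (simp add: sobolev_H_def L2_sq_integrable)
  have "w \<in> sobolev_H \<alpha> T" using v by (intro sob) (auto simp: end_H_def split: if_splits)
  moreover have "integrable I (\<lambda>t. \<bar>w t\<bar>\<^sup>2 / (T - t)) \<longleftrightarrow> integrable I (\<lambda>t. \<bar>v t\<bar>\<^sup>2 / (T - t))"
    using integrable_cong_AE[OF m1 e1] by simp
  moreover have "L2_eq T w u" if "L2_eq T v u" for u
    using that e unfolding L2_eq_def by eventually_elim simp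
  ultimately show "w \<in> end_H \<alpha> T" using v by (auto simp: end_H_def split: if_splits)
  have "sobolev_norm \<alpha> T w = sobolev_norm \<alpha> T v"
    unfolding sobolev_norm_def L2_norm_norm2 norm2_cong_AE[OF mv w e] integral_cong_AE[OF mq q] ..
  then show "end_H_norm \<alpha> T w = end_H_norm \<alpha> T v"
    unfolding end_H_norm_def integral_cong_AE[OF m1 e1] by simp
qed

lemma end_H_norm_nonneg: "0 \<le> end_H_norm \<alpha> T v"
proof -
  have "0 \<le> (LINT t|I. \<bar>v t\<bar>\<^sup>2 / (T - t))"
    by (rule integral_nonneg_AE, rule AE_I2) (simp add: space_I)
  moreover have "0 \<le> sobolev_norm \<alpha> T v"
    unfolding sobolev_norm_def
    by (intro real_sqrt_ge_zero add_nonneg_nonneg integral_nonneg_AE AE_I2 slobodeckij_nonneg) simp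
  ultimately show ?thesis by (auto simp: end_H_norm_def)
qed

lemma end_H_norm_scale: "end_H_norm \<alpha> T (\<lambda>t. c * v t) = \<bar>c\<bar> * end_H_norm \<alpha> T v"
proof -
  have q: "slobodeckij_quotient \<alpha> (\<lambda>t. c * v t) p = c\<^sup>2 * slobodeckij_quotient \<alpha> v p" for p
  proof -
    have "(c * v (fst p) - c * v (snd p))\<^sup>2 = c\<^sup>2 * (v (fst p) - v (snd p))\<^sup>2"
      by (simp only: right_diff_distrib[symmetric] power_mult_distrib)
    then show ?thesis by (simp add: slobodeckij_quotient_def case_prod_beta')
  qed
  have s: "sobolev_norm \<alpha> T (\<lambda>t. c * v t) = \<bar>c\<bar> * sobolev_norm \<alpha> T v"
  proof -
    have "sobolev_norm \<alpha> T (\<lambda>t. c * v t) = sqrt (c\<^sup>2 * ((norm2 I v)\<^sup>2 + (LINT p|(I \<Otimes>\<^sub>M I). slobodeckij_quotient \<alpha> v p)))"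
      unfolding sobolev_norm_def L2_norm_norm2 norm2_scale q integral_mult_right_zero
      by (simp add: power_mult_distrib distrib_left)
    then show ?thesis by (simp add: real_sqrt_mult sobolev_norm_def L2_norm_norm2)
  qed
  have w: "(LINT t|I. \<bar>c * v t\<bar>\<^sup>2 / (T - t)) = c\<^sup>2 * (LINT t|I. \<bar>v t\<bar>\<^sup>2 / (T - t))"
    by (subst integral_mult_right_zero[symmetric]) (simp add: abs_mult power_mult_distrib)
  have "sqrt ((\<bar>c\<bar> * sobolev_norm \<alpha> T v)\<^sup>2 + c\<^sup>2 * (LINT t|I. \<bar>v t\<bar>\<^sup>2 / (T - t)))
      = sqrt (c\<^sup>2 * ((sobolev_norm \<alpha> T v)\<^sup>2 + (LINT t|I. \<bar>v t\<bar>\<^sup>2 / (T - t))))"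
    by (simp add: power_mult_distrib distrib_left)
  then show ?thesis unfolding end_H_norm_def s w by (simp add: real_sqrt_mult)
qed

text \<open>
  By \<open>shift_energy_JT\<close> and \<open>shift_energy_eq\<close> both the double integral and the weighted integral are bounded;
  by \<open>back_int_continuous\<close> the function has the boundary value zero at \<open>T\<close> if \<open>\<alpha> > 1/2\<close>.
\<close>

lemma JT_into_end_H:
  obtains C where "0 \<le> C" "\<And>\<psi>. S \<psi> \<Longrightarrow> JT \<psi> \<in> end_H \<alpha> T \<and> end_H_norm \<alpha> T (JT \<psi>) \<le> C * norm2R \<psi>"
proof -
  define k where "k = (LINT x|lborel. \<bar>indicator {..T} x * pow_ker x\<bar>)"
  define C where "C = sqrt (k\<^sup>2 + 2 * square_const + 2 * square_const)"
  have C0: "0 \<le> C" using square_const_nonneg by (simp add: C_def)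
  have "JT \<psi> \<in> end_H \<alpha> T \<and> end_H_norm \<alpha> T (JT \<psi>) \<le> C * norm2R \<psi>" if \<psi>: "S \<psi>" for \<psi>
  proof -
    let ?v = "JT \<psi>"
    have v: "S ?v" by (rule JT_S[OF \<psi>])
    have [measurable]: "?v \<in> borel_measurable borel" using v by (rule S_borel)
    let ?X = "square_const * (norm2R \<psi>)\<^sup>2"
    have X0: "0 \<le> ?X" using square_const_nonneg by simp
    have N: "half_slob ?v + ennreal (1 / (2 * \<alpha>)) * end_weight ?v \<le> ennreal ?X"
      using shift_energy_JT[OF \<psi>] unfolding shift_energy_eq[OF v] .
    have "half_slob ?v \<le> ennreal ?X"
      by (rule order_trans[OF _ N]) simp
    then have sl: "slob ?v \<le> ennreal (2 * ?X)"
      unfolding slob_half[OF S_borel[OF v]] using X0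
      by (metis ennreal_mult'' ennreal_numeral mult_left_mono zero_le)
    have "ennreal (1 / (2 * \<alpha>)) * end_weight ?v \<le> ennreal ?X"
      by (rule order_trans[OF _ N]) simp
    then have "ennreal (2 * \<alpha>) * (ennreal (1 / (2 * \<alpha>)) * end_weight ?v) \<le> ennreal (2 * \<alpha>) * ennreal ?X"
      by (rule mult_left_mono) simp
    moreover have "ennreal (2 * \<alpha>) * ennreal (1 / (2 * \<alpha>)) = 1"
      using alpha by (simp add: ennreal_mult[symmetric])
    ultimately have w: "end_weight ?v \<le> ennreal (2 * \<alpha> * ?X)"
      using alpha X0 by (simp add: mult.assoc[symmetric] ennreal_mult[symmetric])
    have sob: "?v \<in> sobolev_H \<alpha> T"
      using sobolev_S(1)[OF v] le_less_trans[OF sl] by simp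
    have slr: "enn2real (slob ?v) \<le> 2 * ?X" using enn2real_mono[OF sl] X0 by simp
    have "?v \<in> end_H \<alpha> T"
    proof -
      consider "\<alpha> < 1/2" | "\<alpha> = 1/2" | "1/2 < \<alpha>" by linarith
      then show ?thesis
      proof cases
        case 1 then show ?thesis using sob by (simp add: end_H_def)
      next
        case 2 then show ?thesis using sob weight_S(1)[OF v 2] le_less_trans[OF w] by (simp add: end_H_def)
      next
        case 3
        have "AE t in I. ?v t = back_int \<psi> t"
          by (rule AE_I) (simp add: JT_pos[OF \<psi>])
        then have "\<exists>w. continuous_on {0..T} w \<and> L2_eq T ?v w \<and> w T = 0"
          using back_int_continuous[OF 3 \<psi>] back_int_zero[OF \<psi>, of T] by (auto simp: L2_eq_def)
        then show ?thesis using sob 3 by (simp add: end_H_def)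
      qed
    qed
    moreover have "end_H_norm \<alpha> T ?v \<le> C * norm2R \<psi>"
    proof (rule power2_le_imp_le)
      have kb: "(norm2R ?v)\<^sup>2 \<le> (k * norm2R \<psi>)\<^sup>2"
        using JT_bound[OF \<psi>] by (intro power_mono) (auto simp: k_def)
      have s: "(sobolev_norm \<alpha> T ?v)\<^sup>2 \<le> (k\<^sup>2 + 2 * square_const) * (norm2R \<psi>)\<^sup>2"
        unfolding sobolev_S(2)[OF v] using kb slr by (simp add: power_mult_distrib distrib_right)
      have C2: "(C * norm2R \<psi>)\<^sup>2 = (k\<^sup>2 + 2 * square_const) * (norm2R \<psi>)\<^sup>2 + 2 * ?X"
        using square_const_nonneg by (simp add: C_def power_mult_distrib distrib_right)
      show "(end_H_norm \<alpha> T ?v)\<^sup>2 \<le> (C * norm2R \<psi>)\<^sup>2"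
      proof (cases "\<alpha> = 1/2")
        case True
        have "enn2real (end_weight ?v) \<le> 2 * \<alpha> * ?X" using enn2real_mono[OF w] X0 alpha by simp
        moreover have "2 * \<alpha> * ?X \<le> 2 * ?X" using alpha X0 by (intro mult_right_mono) auto
        ultimately have "enn2real (end_weight ?v) \<le> 2 * ?X" by linarith
        moreover have "(end_H_norm \<alpha> T ?v)\<^sup>2 = (sobolev_norm \<alpha> T ?v)\<^sup>2 + enn2real (end_weight ?v)"
          using True weight_S(2)[OF v True] by (simp add: end_H_norm_def)
        ultimately show ?thesis using s C2 by linarith
      next
        case False
        then show ?thesis using s C2 X0 by (simp add: end_H_norm_def)
      qed
    qed (use C0 in simp)
    ultimately show ?thesis by simp
  qed
  then show ?thesis using that C0 by blast
qed

text \<open>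
  The weighted integral is controlled by the norm: for \<open>\<alpha> = 1/2\<close> by definition of the norm, for the other
  orders by \<open>end_weight_bound\<close>. If \<open>\<alpha> > 1/2\<close> the representative must be the continuous one, since the
  boundary value zero has to be attained as a limit.
\<close>

lemma end_H_representative:
  obtains C where "0 \<le> C" "\<And>v. v \<in> end_H \<alpha> T \<Longrightarrow> \<exists>v'. S v' \<and> (AE t in I. v t = v' t) \<and>
     slob v' < \<infinity> \<and> end_weight v' \<le> ennreal (C * (end_H_norm \<alpha> T v)\<^sup>2) \<and> slob v' \<le> ennreal ((end_H_norm \<alpha> T v)\<^sup>2)"
proof -
  have nrm: "(sobolev_norm \<alpha> T v)\<^sup>2 \<le> (end_H_norm \<alpha> T v)\<^sup>2" for v
  proof -
    have "0 \<le> (LINT t|I. \<bar>v t\<bar>\<^sup>2 / (T - t))"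
      by (rule integral_nonneg_AE, rule AE_I2) (simp add: space_I)
    then have "0 \<le> (sobolev_norm \<alpha> T v)\<^sup>2 + (LINT t|I. \<bar>v t\<bar>\<^sup>2 / (T - t))"
      and "(sobolev_norm \<alpha> T v)\<^sup>2 \<le> (sobolev_norm \<alpha> T v)\<^sup>2 + (LINT t|I. \<bar>v t\<bar>\<^sup>2 / (T - t))"
      by auto
    then show ?thesis unfolding end_H_norm_def by (simp only: real_sqrt_pow2 split: if_split) simp
  qed
  have rep: "slob v' < \<infinity> \<and> slob v' \<le> ennreal ((end_H_norm \<alpha> T v)\<^sup>2) \<and>
      slob v' + (\<integral>\<^sup>+s. ennreal ((v' s)\<^sup>2) \<partial>lborel) \<le> ennreal ((end_H_norm \<alpha> T v)\<^sup>2)"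
    if v: "v \<in> end_H \<alpha> T" and v': "S v'" and e: "AE t in I. v t = v' t" for v v'
  proof -
    have b: "v' \<in> borel_measurable borel" using v' by (rule S_borel)
    have E: "v' \<in> end_H \<alpha> T" "end_H_norm \<alpha> T v' = end_H_norm \<alpha> T v" by (rule end_H_cong[OF v borel_I[OF b] e])+
    have fin: "slob v' < \<infinity>"
      using E(1) sobolev_S(1)[OF v'] by (auto simp: end_H_def split: if_splits)
    have "ennreal (enn2real (slob v')) = slob v'" using fin by simp
    moreover have "(\<integral>\<^sup>+s. ennreal ((v' s)\<^sup>2) \<partial>lborel) = ennreal ((norm2R v')\<^sup>2)"
      by (rule nn_integral_power2_sq_integrable[OF S_sqR[OF v']])
    ultimately have "slob v' + (\<integral>\<^sup>+s. ennreal ((v' s)\<^sup>2) \<partial>lborel) = ennreal ((sobolev_norm \<alpha> T v')\<^sup>2)"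
      unfolding sobolev_S(2)[OF v'] by (simp add: ennreal_plus add.commute)
    also have "\<dots> \<le> ennreal ((end_H_norm \<alpha> T v)\<^sup>2)" using nrm[of v'] E(2) by (intro ennreal_leI) simp
    finally have "slob v' + (\<integral>\<^sup>+s. ennreal ((v' s)\<^sup>2) \<partial>lborel) \<le> ennreal ((end_H_norm \<alpha> T v)\<^sup>2)" .
    moreover from this have "slob v' \<le> ennreal ((end_H_norm \<alpha> T v)\<^sup>2)"
      by (rule order_trans[rotated]) simp
    ultimately show ?thesis using fin by blast
  qed
  show ?thesis
  proof (cases "\<alpha> = 1/2")
    case True
    have "\<exists>v'. S v' \<and> (AE t in I. v t = v' t) \<and> slob v' < \<infinity> \<and>
        end_weight v' \<le> ennreal (1 * (end_H_norm \<alpha> T v)\<^sup>2) \<and> slob v' \<le> ennreal ((end_H_norm \<alpha> T v)\<^sup>2)"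
      if v: "v \<in> end_H \<alpha> T" for v
    proof -
      obtain v' where v': "S v'" "AE t in I. v t = v' t" using L2_rep[OF end_H_L2[OF v]] by blast
      have b: "v' \<in> borel_measurable borel" using v'(1) by (rule S_borel)
      have E: "v' \<in> end_H \<alpha> T" "end_H_norm \<alpha> T v' = end_H_norm \<alpha> T v"
        by (rule end_H_cong[OF v borel_I[OF b] v'(2)])+
      have fin: "end_weight v' < \<infinity>"
        by (rule iffD1[OF weight_S(1)[OF v'(1) True]]) (use E(1) True in \<open>simp add: end_H_def\<close>)
      have "(end_H_norm \<alpha> T v')\<^sup>2 = (sobolev_norm \<alpha> T v')\<^sup>2 + enn2real (end_weight v')"
        using True weight_S(2)[OF v'(1) True] by (simp add: end_H_norm_def)
      then have "enn2real (end_weight v') \<le> (end_H_norm \<alpha> T v)\<^sup>2" using E(2) by simp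
      then have "ennreal (enn2real (end_weight v')) \<le> ennreal ((end_H_norm \<alpha> T v)\<^sup>2)" by (rule ennreal_leI)
      moreover have "ennreal (enn2real (end_weight v')) = end_weight v'" using fin by simp
      ultimately have "end_weight v' \<le> ennreal (1 * (end_H_norm \<alpha> T v)\<^sup>2)" by (simp only: mult_1)
      then show ?thesis using v' rep[OF v v'] by blast
    qed
    from that[OF zero_le_one this] show ?thesis .
  next
    case False
    obtain C where C: "0 \<le> C" and H: "\<And>v. S v \<Longrightarrow> (1/2 < \<alpha> \<Longrightarrow> (v \<longlongrightarrow> 0) (at_left T)) \<Longrightarrow>
      end_weight v \<le> ennreal C * (slob v + (\<integral>\<^sup>+s. ennreal ((v s)\<^sup>2) \<partial>lborel))"
      using end_weight_bound[OF False] by blast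
    have "\<exists>v'. S v' \<and> (AE t in I. v t = v' t) \<and> slob v' < \<infinity> \<and>
        end_weight v' \<le> ennreal (C * (end_H_norm \<alpha> T v)\<^sup>2) \<and> slob v' \<le> ennreal ((end_H_norm \<alpha> T v)\<^sup>2)"
      if v: "v \<in> end_H \<alpha> T" for v
    proof -
      obtain v' where v': "S v'" "AE t in I. v t = v' t" and l: "1/2 < \<alpha> \<Longrightarrow> (v' \<longlongrightarrow> 0) (at_left T)"
      proof (cases "\<alpha> < 1/2")
        case True
        then show ?thesis using L2_rep[OF end_H_L2[OF v]] that by force
      next
        case F2: False
        obtain w where w: "continuous_on {0..T} w" "L2_eq T v w" "w T = 0"
          using v F2 False by (auto simp: end_H_def)
        have "(\<lambda>t. indicator {0..T} t *\<^sub>R w t) \<in> borel_measurable borel"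
          by (rule borel_measurable_continuous_on_indicator[OF _ w(1)]) simp
        moreover have "cut w = cut (\<lambda>t. indicator {0..T} t *\<^sub>R w t)"
          by (auto simp: cut_def indicator_def fun_eq_iff)
        ultimately have cb: "cut w \<in> borel_measurable borel" by simp
        have e: "AE t in I. v t = cut w t"
          using w(2) AE_space[of I] unfolding L2_eq_def by eventually_elim (simp add: space_I cut_def)
        obtain u where u: "S u" "AE t in I. v t = u t" using L2_rep[OF end_H_L2[OF v]] by blast
        have "AE t in I. u t = cut w t" using e u(2) by eventually_elim simp
        then have "AE t in lborel. t \<in> {0<..<T} \<longrightarrow> u t = cut w t" by (rule AE_I_lborel)
        then have "AE t in lborel. u t = cut w t"
        proof eventually_elim
          case (elim t)
          then show ?case using S_zero[OF u(1), of t] by (cases "t \<in> {0<..<T}") (auto simp: cut_def)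
        qed
        then have "sqR (cut w)" using cb by (intro sq_integrable_cong_AE[OF S_sqR[OF u(1)]]) auto
        then have "S (cut w)" by (auto simp: S_def cut_def)
        moreover have "(cut w \<longlongrightarrow> 0) (at_left T)"
        proof -
          have "(w \<longlongrightarrow> w T) (at T within {0..T})" using w(1) T by (auto simp: continuous_on_def)
          then have "(w \<longlongrightarrow> 0) (at_left T)"
            using w(3) T at_within_Icc_at_left[of 0 T] by simp
          then show ?thesis
          proof (rule tendsto_cong[THEN iffD1, rotated])
            show "\<forall>\<^sub>F t in at_left T. w t = cut w t"
              using eventually_at_left_real[OF T] by eventually_elim (simp add: cut_def)
          qed
        qed
        ultimately show ?thesis using e that by blast
      qed
      have "end_weight v' \<le> ennreal C * (slob v' + (\<integral>\<^sup>+s. ennreal ((v' s)\<^sup>2) \<partial>lborel))" by (rule H[OF v'(1) l])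
      also have "\<dots> \<le> ennreal C * ennreal ((end_H_norm \<alpha> T v)\<^sup>2)"
        using rep[OF v v'] by (intro mult_left_mono) auto
      also have "\<dots> = ennreal (C * (end_H_norm \<alpha> T v)\<^sup>2)" using C by (simp add: ennreal_mult)
      finally show ?thesis using v' rep[OF v v'] by blast
    qed
    then show ?thesis using that C by blast
  qed
qed

text \<open>
  The two bounds of \<open>end_H_representative\<close> make the energy finite, and \<open>JT_surjective\<close> applies.
\<close>

lemma JT_onto_end_H:
  obtains C where "0 \<le> C" "\<And>v. v \<in> end_H \<alpha> T \<Longrightarrow> \<exists>\<psi>. S \<psi> \<and> (AE t in I. v t = JT \<psi> t) \<and> norm2R \<psi> \<le> C * end_H_norm \<alpha> T v"
proof -
  obtain C where C: "0 \<le> C" and H: "\<And>v. v \<in> end_H \<alpha> T \<Longrightarrow> \<exists>v'. S v' \<and> (AE t in I. v t = v' t) \<and>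
     slob v' < \<infinity> \<and> end_weight v' \<le> ennreal (C * (end_H_norm \<alpha> T v)\<^sup>2) \<and> slob v' \<le> ennreal ((end_H_norm \<alpha> T v)\<^sup>2)"
    using end_H_representative by blast
  define D where "D = sqrt (1 + 1 / (2 * \<alpha>) * C)"
  have D0: "0 \<le> 1 + 1 / (2 * \<alpha>) * C" using C alpha by simp
  have "\<exists>\<psi>. S \<psi> \<and> (AE t in I. v t = JT \<psi> t) \<and> norm2R \<psi> \<le> (D * sqrt square_const / repro_const) * end_H_norm \<alpha> T v"
    if v: "v \<in> end_H \<alpha> T" for v
  proof -
    let ?n = "end_H_norm \<alpha> T v"
    obtain v' where v': "S v'" "AE t in I. v t = v' t" and w: "end_weight v' \<le> ennreal (C * ?n\<^sup>2)" and s: "slob v' \<le> ennreal (?n\<^sup>2)"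
      using H[OF v] by blast
    have [measurable]: "v' \<in> borel_measurable borel" using v'(1) by (rule S_borel)
    have "half_slob v' \<le> slob v'" unfolding slob_half[OF S_borel[OF v'(1)]] by (simp add: mult_2)
    then have "shift_energy v' \<le> ennreal (?n\<^sup>2) + ennreal (1 / (2 * \<alpha>)) * ennreal (C * ?n\<^sup>2)"
      unfolding shift_energy_eq[OF v'(1)] using s w by (intro add_mono mult_left_mono) auto
    also have "\<dots> = ennreal (?n\<^sup>2 + 1 / (2 * \<alpha>) * (C * ?n\<^sup>2))"
      using C alpha by (subst ennreal_plus) (auto simp: ennreal_mult[symmetric])
    also have "?n\<^sup>2 + 1 / (2 * \<alpha>) * (C * ?n\<^sup>2) = (D * ?n)\<^sup>2"
      unfolding D_def power_mult_distrib real_sqrt_pow2[OF D0] by (simp add: distrib_right)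
    finally have N: "shift_energy v' \<le> ennreal ((D * ?n)\<^sup>2)" .
    have "0 \<le> D * ?n" using D0 end_H_norm_nonneg by (simp add: D_def)
    from JT_surjective[OF v'(1) N this] obtain \<psi> where \<psi>: "S \<psi>" "AE t in lborel. JT \<psi> t = v' t" "norm2R \<psi> \<le> D * ?n * sqrt square_const / repro_const"
      by blast
    have "AE t in I. JT \<psi> t = v' t" by (rule AE_I) (use \<psi>(2) in auto)
    with v'(2) have "AE t in I. v t = JT \<psi> t" by eventually_elim simp
    then show ?thesis using \<psi>(1,3) by (auto simp: mult_ac)
  qed
  moreover have "0 \<le> D * sqrt square_const / repro_const" using D0 repro_const_pos square_const_nonneg by (simp add: D_def)
  ultimately show ?thesis using that by blast
qed

end

section \<open>The dual space and the fractional derivative\<close>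

lemma L2_eq_if_inner_eq:
  assumes f: "sq_integrable M f" and g: "sq_integrable M g"
    and e: "\<And>h. sq_integrable M h \<Longrightarrow> (LINT x|M. f x * h x) = (LINT x|M. g x * h x)"
  shows "AE x in M. f x = g x"
proof -
  let ?d = "\<lambda>x. f x - g x"
  have d: "sq_integrable M ?d" by (rule sq_integrable_diff[OF f g])
  have "(norm2 M ?d)\<^sup>2 = (LINT x|M. f x * ?d x - g x * ?d x)"
    unfolding norm2_power2 by (simp add: power2_eq_square left_diff_distrib)
  also have "\<dots> = 0"
    using sq_integrable_mult_integrable[OF f d] sq_integrable_mult_integrable[OF g d] e[OF d] by simp
  finally have "AE x in M. ?d x = 0" using norm2_eq_0_iff[OF d] by simp
  then show ?thesis by eventually_elim simp
qed

lemma norm2_zero: "norm2 M (\<lambda>x. 0) = 0"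
  by (simp add: norm2_def)

context frac_interval
begin

abbreviation J :: "(real \<Rightarrow> real) \<Rightarrow> real \<Rightarrow> real" where "J \<equiv> J_op \<alpha> T"
abbreviation E :: "(real \<Rightarrow> real) set" where "E \<equiv> end_H \<alpha> T"
abbreviation nE :: "(real \<Rightarrow> real) \<Rightarrow> real" where "nE \<equiv> end_H_norm \<alpha> T"

lemma Gamma_pos: "0 < Gamma \<alpha>"
  using alpha by (intro Gamma_real_pos)

lemma J_rep:
  assumes \<psi>: "sq_integrable I \<psi>"
  obtains \<psi>' where "S \<psi>'" "AE t in I. \<psi> t = \<psi>' t" "norm2 I \<psi> = norm2R \<psi>'"
    "\<And>t. t \<in> {0<..<T} \<Longrightarrow> J \<psi> t = 1 / Gamma \<alpha> * JT \<psi>' t"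
proof -
  obtain \<psi>' where p: "S \<psi>'" "AE t in I. \<psi> t = \<psi>' t" "norm2 I \<psi> = norm2R \<psi>'" using L2_rep[OF \<psi>] by blast
  then show ?thesis using that J_op_JT[OF p(1,2)] \<psi> by (auto simp: sq_integrable_def)
qed

lemma J_JT_scaled:
  assumes "\<And>t. t \<in> {0<..<T} \<Longrightarrow> J \<psi> t = 1 / Gamma \<alpha> * JT \<psi>' t"
  shows "AE t in I. JT (\<lambda>x. (1 / Gamma \<alpha>) * \<psi>' x) t = J \<psi> t"
  using AE_space[of I] by eventually_elim (use assms in \<open>simp only: JT_scale space_I\<close>)

lemma J_measurable:
  assumes \<psi>: "sq_integrable I \<psi>" shows "J \<psi> \<in> borel_measurable I"
proof -
  obtain \<psi>' where p: "S \<psi>'" "\<And>t. t \<in> {0<..<T} \<Longrightarrow> J \<psi> t = 1 / Gamma \<alpha> * JT \<psi>' t"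
    using J_rep[OF \<psi>] by blast
  have "(\<lambda>t. 1 / Gamma \<alpha> * JT \<psi>' t) \<in> borel_measurable I"
    using S_borel[OF JT_S[OF p(1)]] by (intro borel_I) measurable
  then show ?thesis by (subst measurable_cong[of I _ "\<lambda>t. 1 / Gamma \<alpha> * JT \<psi>' t"]) (use p(2) in \<open>auto simp: space_I\<close>)
qed

lemma J_cong_AE:
  assumes "sq_integrable I \<psi>" "sq_integrable I \<phi>" "AE t in I. \<psi> t = \<phi> t"
  shows "AE t in I. J \<psi> t = J \<phi> t"
proof -
  obtain \<phi>' where p: "S \<phi>'" "AE t in I. \<phi> t = \<phi>' t" "\<And>t. t \<in> {0<..<T} \<Longrightarrow> J \<phi> t = 1 / Gamma \<alpha> * JT \<phi>' t"
    using J_rep[OF assms(2)] by blast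
  have "AE t in I. \<psi> t = \<phi>' t" using assms(3) p(2) by eventually_elim simp
  then have "J \<psi> t = 1 / Gamma \<alpha> * JT \<phi>' t" if "t \<in> {0<..<T}" for t
    using J_op_JT[OF p(1) _ _ that] assms(1) by (auto simp: sq_integrable_def)
  then show ?thesis using AE_space[of I] p(3) by (auto simp: space_I)
qed

lemma J_linear:
  assumes \<psi>: "sq_integrable I \<psi>" and \<phi>: "sq_integrable I \<phi>"
  shows "AE t in I. J (\<lambda>t. \<psi> t + c * \<phi> t) t = J \<psi> t + c * J \<phi> t"
proof -
  obtain \<psi>' where p: "S \<psi>'" "AE t in I. \<psi> t = \<psi>' t" "\<And>t. t \<in> {0<..<T} \<Longrightarrow> J \<psi> t = 1 / Gamma \<alpha> * JT \<psi>' t"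
    using J_rep[OF \<psi>] by blast
  obtain \<phi>' where q: "S \<phi>'" "AE t in I. \<phi> t = \<phi>' t" "\<And>t. t \<in> {0<..<T} \<Longrightarrow> J \<phi> t = 1 / Gamma \<alpha> * JT \<phi>' t"
    using J_rep[OF \<phi>] by blast
  have S: "S (\<lambda>t. \<psi>' t + c * \<phi>' t)" by (intro S_add S_scale p q)
  have e: "AE t in I. \<psi> t + c * \<phi> t = \<psi>' t + c * \<phi>' t" using p(2) q(2) by eventually_elim simp
  have m: "(\<lambda>t. \<psi> t + c * \<phi> t) \<in> borel_measurable I" using \<psi> \<phi> by (auto simp: sq_integrable_def)
  have "AE t in I. JT (\<lambda>t. \<psi>' t + c * \<phi>' t) t = JT \<psi>' t + JT (\<lambda>t. c * \<phi>' t) t"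
    by (rule AE_I) (use JT_add[OF p(1) S_scale[OF q(1)], of c] in auto)
  then show ?thesis using AE_space[of I]
  proof eventually_elim
    case (elim t)
    then have t: "t \<in> {0<..<T}" by (simp add: space_I)
    have "J (\<lambda>t. \<psi> t + c * \<phi> t) t = 1 / Gamma \<alpha> * JT (\<lambda>t. \<psi>' t + c * \<phi>' t) t"
      by (rule J_op_JT[OF S e m t])
    also have "\<dots> = 1 / Gamma \<alpha> * (JT \<psi>' t + c * JT \<phi>' t)" unfolding elim(1) JT_scale ..
    finally show ?case unfolding p(3)[OF t] q(3)[OF t] by (simp add: distrib_left mult_ac)
  qed
qed

lemma J_bounded:
  obtains C where "0 \<le> C" "\<And>\<psi>. sq_integrable I \<psi> \<Longrightarrow> J \<psi> \<in> E \<and> nE (J \<psi>) \<le> C * norm2 I \<psi>"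
proof -
  obtain C where C: "0 \<le> C" and H: "\<And>\<psi>. S \<psi> \<Longrightarrow> JT \<psi> \<in> E \<and> nE (JT \<psi>) \<le> C * norm2R \<psi>"
    using JT_into_end_H by blast
  have "J \<psi> \<in> E \<and> nE (J \<psi>) \<le> (C * (1 / Gamma \<alpha>)) * norm2 I \<psi>" if \<psi>: "sq_integrable I \<psi>" for \<psi>
  proof -
    obtain \<psi>' where p: "S \<psi>'" "norm2 I \<psi> = norm2R \<psi>'" "\<And>t. t \<in> {0<..<T} \<Longrightarrow> J \<psi> t = 1 / Gamma \<alpha> * JT \<psi>' t"
      using J_rep[OF \<psi>] by blast
    let ?\<phi> = "\<lambda>x. (1 / Gamma \<alpha>) * \<psi>' x"
    have S: "S ?\<phi>" by (intro S_scale p)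
    note c = end_H_cong[OF H[OF S, THEN conjunct1] J_measurable[OF \<psi>] J_JT_scaled[OF p(3)]]
    have "nE (J \<psi>) \<le> C * norm2R ?\<phi>" using c(2) H[OF S] by simp
    also have "\<dots> = (C * (1 / Gamma \<alpha>)) * norm2 I \<psi>" unfolding norm2_scale p(2) using Gamma_pos by simp
    finally show ?thesis using c(1) by simp
  qed
  moreover have "0 \<le> C * (1 / Gamma \<alpha>)" using C Gamma_pos by simp
  ultimately show ?thesis using that by blast
qed

lemma J_onto:
  obtains C where "0 \<le> C" "\<And>v. v \<in> E \<Longrightarrow> \<exists>\<psi>. sq_integrable I \<psi> \<and> (AE t in I. v t = J \<psi> t) \<and> norm2 I \<psi> \<le> C * nE v"
proof -
  obtain C where C: "0 \<le> C" and H: "\<And>v. v \<in> E \<Longrightarrow> \<exists>\<psi>. S \<psi> \<and> (AE t in I. v t = JT \<psi> t) \<and> norm2R \<psi> \<le> C * nE v"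
    using JT_onto_end_H by blast
  have "\<exists>\<psi>. sq_integrable I \<psi> \<and> (AE t in I. v t = J \<psi> t) \<and> norm2 I \<psi> \<le> (Gamma \<alpha> * C) * nE v" if v: "v \<in> E" for v
  proof -
    obtain \<psi> where p: "S \<psi>" "AE t in I. v t = JT \<psi> t" "norm2R \<psi> \<le> C * nE v" using H[OF v] by blast
    let ?\<phi> = "\<lambda>x. Gamma \<alpha> * \<psi> x"
    have S: "S ?\<phi>" by (intro S_scale p)
    have m: "?\<phi> \<in> borel_measurable I" using S_I(1)[OF S] by (simp add: sq_integrable_def)
    have "AE t in I. v t = J ?\<phi> t"
      using p(2) AE_space[of I]
    proof eventually_elim
      case (elim t)
      then have "J ?\<phi> t = 1 / Gamma \<alpha> * JT ?\<phi> t" using J_op_JT[OF S _ m, of t] by (simp add: space_I)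
      also have "\<dots> = JT \<psi> t" unfolding JT_scale using Gamma_pos by simp
      finally show ?case using elim by simp
    qed
    moreover have "norm2 I ?\<phi> \<le> (Gamma \<alpha> * C) * nE v"
      unfolding norm2_scale S_I(2)[OF p(1)] using Gamma_pos p(3) by (simp add: mult.assoc)
    ultimately show ?thesis using S_I(1)[OF S] by blast
  qed
  moreover have "0 \<le> Gamma \<alpha> * C" using C Gamma_pos by simp
  ultimately show ?thesis using that by blast
qed

lemma J_inj:
  assumes \<psi>: "sq_integrable I \<psi>" and \<phi>: "sq_integrable I \<phi>" and e: "AE t in I. J \<psi> t = J \<phi> t"
  shows "AE t in I. \<psi> t = \<phi> t"
proof -
  have s: "sq_integrable I (\<lambda>t. \<psi> t + (-1) * \<phi> t)" by (intro sq_integrable_add sq_integrable_scale \<psi> \<phi>)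
  obtain u where u: "S u" "AE t in I. \<psi> t + (-1) * \<phi> t = u t"
    "\<And>t. t \<in> {0<..<T} \<Longrightarrow> J (\<lambda>t. \<psi> t + (-1) * \<phi> t) t = 1 / Gamma \<alpha> * JT u t"
    using J_rep[OF s] by blast
  have "AE t in I. JT u t = 0"
    using e J_linear[OF \<psi> \<phi>, of "-1"] AE_space[of I]
  proof eventually_elim
    case (elim t)
    then have "1 / Gamma \<alpha> * JT u t = 0" using u(3)[of t] by (simp add: space_I)
    then show ?case using Gamma_pos by simp
  qed
  then have "AE t in lborel. t \<in> {0<..<T} \<longrightarrow> JT u t = 0" by (rule AE_I_lborel)
  then have "AE t in lborel. JT u t = 0"
    by eventually_elim (use S_zero[OF JT_S[OF u(1)]] in blast)
  then have "AE t in lborel. u t = 0" by (rule JT_injective[OF u(1)])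
  then have "AE t in I. u t = 0" by (intro AE_I) auto
  with u(2) show ?thesis by eventually_elim simp
qed

lemma J_Volterra:
  obtains C where "0 \<le> C"
    "\<And>x. sq_integrable I x \<Longrightarrow> \<exists>\<psi>. sq_integrable I \<psi> \<and> (AE t in I. \<psi> t + l * J \<psi> t = x t)"
    "\<And>x \<psi>. sq_integrable I x \<Longrightarrow> sq_integrable I \<psi> \<Longrightarrow> (AE t in I. \<psi> t + l * J \<psi> t = x t) \<Longrightarrow> norm2 I \<psi> \<le> C * norm2 I x"
proof -
  let ?l = "l * (1 / Gamma \<alpha>)"
  obtain C where C: "0 \<le> C"
    "\<And>x. S x \<Longrightarrow> \<exists>\<psi>. S \<psi> \<and> (AE t in lborel. \<psi> t + ?l * JT \<psi> t = x t)"
    "\<And>x \<psi>. S x \<Longrightarrow> S \<psi> \<Longrightarrow> (AE t in lborel. \<psi> t + ?l * JT \<psi> t = x t) \<Longrightarrow> norm2R \<psi> \<le> C * norm2R x"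
    using JT_Volterra[of ?l] by blast
  have "\<exists>\<psi>. sq_integrable I \<psi> \<and> (AE t in I. \<psi> t + l * J \<psi> t = x t)" if x: "sq_integrable I x" for x
  proof -
    obtain x' where x': "S x'" "AE t in I. x t = x' t" using L2_rep[OF x] by blast
    obtain \<psi> where p: "S \<psi>" "AE t in lborel. \<psi> t + ?l * JT \<psi> t = x' t" using C(2)[OF x'(1)] by blast
    have s: "sq_integrable I \<psi>" by (rule S_I(1)[OF p(1)])
    have "AE t in I. \<psi> t + ?l * JT \<psi> t = x' t" by (rule AE_I) (use p(2) in auto)
    then have "AE t in I. \<psi> t + l * J \<psi> t = x t"
      using x'(2) AE_space[of I]
    proof eventually_elim
      case (elim t)
      then have "J \<psi> t = 1 / Gamma \<alpha> * JT \<psi> t"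
        using J_op_JT[OF p(1), of \<psi> t] s by (simp add: space_I sq_integrable_def)
      then show ?case using elim by simp
    qed
    then show ?thesis using s by blast
  qed
  moreover have "norm2 I \<psi> \<le> C * norm2 I x"
    if x: "sq_integrable I x" and \<psi>: "sq_integrable I \<psi>" and e: "AE t in I. \<psi> t + l * J \<psi> t = x t" for x \<psi>
  proof -
    obtain x' where x': "S x'" "AE t in I. x t = x' t" "norm2 I x = norm2R x'" using L2_rep[OF x] by blast
    obtain \<psi>' where p: "S \<psi>'" "AE t in I. \<psi> t = \<psi>' t" "norm2 I \<psi> = norm2R \<psi>'"
      "\<And>t. t \<in> {0<..<T} \<Longrightarrow> J \<psi> t = 1 / Gamma \<alpha> * JT \<psi>' t" using J_rep[OF \<psi>] by blast
    have "AE t in I. \<psi>' t + ?l * JT \<psi>' t = x' t"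
      using e p(2) x'(2) AE_space[of I] by eventually_elim (use p(4) in \<open>simp add: space_I\<close>)
    then have "AE t in lborel. t \<in> {0<..<T} \<longrightarrow> \<psi>' t + ?l * JT \<psi>' t = x' t" by (rule AE_I_lborel)
    then have "AE t in lborel. \<psi>' t + ?l * JT \<psi>' t = x' t"
    proof eventually_elim
      case (elim t)
      show ?case
        using elim S_zero[OF p(1), of t] S_zero[OF x'(1), of t] S_zero[OF JT_S[OF p(1)], of t]
        by (cases "t \<in> {0<..<T}") auto
    qed
    then show ?thesis using C(3)[OF x'(1) p(1)] p(3) x'(3) by simp
  qed
  ultimately show ?thesis using that C(1) by blast
qed

text \<open>
  Sums of functions in the range of \<open>J\<close> are in the range of \<open>J\<close>, so the three cases in the definition of
  \<open>end_H\<close> need not be distinguished.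
\<close>

lemma E_add:
  assumes v: "v \<in> E" and w: "w \<in> E" shows "(\<lambda>t. v t + w t) \<in> E"
proof -
  obtain C where C: "\<And>v. v \<in> E \<Longrightarrow> \<exists>\<psi>. sq_integrable I \<psi> \<and> (AE t in I. v t = J \<psi> t) \<and> norm2 I \<psi> \<le> C * nE v" using J_onto by blast
  obtain D where D: "\<And>\<psi>. sq_integrable I \<psi> \<Longrightarrow> J \<psi> \<in> E \<and> nE (J \<psi>) \<le> D * norm2 I \<psi>" using J_bounded by blast
  obtain \<psi> \<phi> where p: "sq_integrable I \<psi>" "AE t in I. v t = J \<psi> t" "sq_integrable I \<phi>" "AE t in I. w t = J \<phi> t"
    using C[OF v] C[OF w] by blast
  have "J (\<lambda>t. \<psi> t + 1 * \<phi> t) \<in> E" using D sq_integrable_add[OF p(1) sq_integrable_scale[OF p(3)]] by blast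
  then show ?thesis
  proof (rule end_H_cong(1))
    show "(\<lambda>t. v t + w t) \<in> borel_measurable I" using end_H_L2[OF v] end_H_L2[OF w] by (auto simp: sq_integrable_def)
    show "AE t in I. J (\<lambda>t. \<psi> t + 1 * \<phi> t) t = v t + w t"
      using J_linear[OF p(1,3), of 1] p(2,4) by eventually_elim simp
  qed
qed

lemma E_scale:
  assumes v: "v \<in> E" shows "(\<lambda>t. c * v t) \<in> E"
proof -
  obtain C where C: "\<And>v. v \<in> E \<Longrightarrow> \<exists>\<psi>. sq_integrable I \<psi> \<and> (AE t in I. v t = J \<psi> t) \<and> norm2 I \<psi> \<le> C * nE v" using J_onto by blast
  obtain D where D: "\<And>\<psi>. sq_integrable I \<psi> \<Longrightarrow> J \<psi> \<in> E \<and> nE (J \<psi>) \<le> D * norm2 I \<psi>" using J_bounded by blast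
  obtain \<psi> where p: "sq_integrable I \<psi>" "AE t in I. v t = J \<psi> t" using C[OF v] by blast
  have "J (\<lambda>t. \<psi> t + (c - 1) * \<psi> t) \<in> E" using D sq_integrable_add[OF p(1) sq_integrable_scale[OF p(1)]] by blast
  then show ?thesis
  proof (rule end_H_cong(1))
    show "(\<lambda>t. c * v t) \<in> borel_measurable I" using end_H_L2[OF v] by (auto simp: sq_integrable_def)
    show "AE t in I. J (\<lambda>t. \<psi> t + (c - 1) * \<psi> t) t = c * v t"
      using J_linear[OF p(1) p(1), of "c - 1"] p(2) by eventually_elim (simp add: algebra_simps)
  qed
qed

lemma norm2_le_nE: "norm2 I v \<le> nE v"
proof (rule power2_le_imp_le[OF _ end_H_norm_nonneg])
  have a: "0 \<le> (LINT t|I. \<bar>v t\<bar>\<^sup>2 / (T - t))"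
    by (rule integral_nonneg_AE, rule AE_I2) (simp add: space_I)
  have b: "0 \<le> (LINT p|(I \<Otimes>\<^sub>M I). slobodeckij_quotient \<alpha> v p)"
    by (intro integral_nonneg_AE AE_I2 slobodeckij_nonneg)
  have s: "(norm2 I v)\<^sup>2 \<le> (sobolev_norm \<alpha> T v)\<^sup>2"
    unfolding sobolev_norm_def L2_norm_norm2 using b by simp
  have "(nE v)\<^sup>2 = (sobolev_norm \<alpha> T v)\<^sup>2 + (if \<alpha> = 1/2 then LINT t|I. \<bar>v t\<bar>\<^sup>2 / (T - t) else 0)"
    unfolding end_H_norm_def using real_sqrt_pow2[of "(sobolev_norm \<alpha> T v)\<^sup>2 + (LINT t|I. \<bar>v t\<bar>\<^sup>2 / (T - t))"] a
    by (simp split: if_split)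
  then show "(norm2 I v)\<^sup>2 \<le> (nE v)\<^sup>2" using s a by (simp split: if_splits)
qed

abbreviation D where "D \<equiv> dual_H \<alpha> T"

lemma dual_add: "F \<in> D \<Longrightarrow> v \<in> E \<Longrightarrow> w \<in> E \<Longrightarrow> F (\<lambda>t. v t + w t) = F v + F w"
  and dual_scale: "F \<in> D \<Longrightarrow> v \<in> E \<Longrightarrow> F (\<lambda>t. c * v t) = c * F v"
  by (simp_all add: dual_H_def)

text \<open>
  The difference agrees almost everywhere with zero, so its norm is zero and the functional, being
  bounded, vanishes on it.
\<close>

lemma dual_cong:
  assumes F: "F \<in> D" and v: "v \<in> E" and w: "w \<in> E" and e: "AE t in I. v t = w t"
  shows "F v = F w"
proof -
  let ?d = "\<lambda>t. v t + (-1) * w t"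
  have d: "?d \<in> E" by (intro E_add v E_scale[OF w])
  have z: "AE t in I. ?d t = 0" using e by eventually_elim simp
  have "nE ?d = nE (\<lambda>t. 0 * ?d t)"
    by (rule end_H_cong(2)[OF E_scale[OF d]]) (use end_H_L2[OF d] z in \<open>auto simp: sq_integrable_def\<close>)
  then have "nE ?d = 0" unfolding end_H_norm_scale by simp
  moreover obtain K where "\<bar>F ?d\<bar> \<le> K * nE ?d" using F d by (auto simp: dual_H_def)
  ultimately have "F ?d = 0" by simp
  then show ?thesis using dual_add[OF F v E_scale[OF w, of "-1"]] dual_scale[OF F w, of "-1"] by simp
qed

lemma dual_norm_bound:
  assumes F: "F \<in> D" and v: "v \<in> E"
  shows "\<bar>F v\<bar> \<le> dual_norm \<alpha> T F * nE v" and "0 \<le> dual_norm \<alpha> T F"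
proof -
  let ?B = "{v \<in> E. nE v \<le> 1}"
  obtain K where K: "\<And>v. v \<in> E \<Longrightarrow> \<bar>F v\<bar> \<le> K * nE v" using F unfolding dual_H_def by blast
  have bdd: "bdd_above ((\<lambda>v. \<bar>F v\<bar>) ` ?B)"
  proof (rule bdd_aboveI2)
    fix v assume v: "v \<in> ?B"
    have "\<bar>F v\<bar> \<le> K * nE v" using K v by simp
    also have "\<dots> \<le> \<bar>K\<bar> * 1" using v end_H_norm_nonneg[of v] by (intro mult_mono) auto
    finally show "\<bar>F v\<bar> \<le> \<bar>K\<bar> * 1" .
  qed
  have le: "\<bar>F u\<bar> \<le> dual_norm \<alpha> T F" if "u \<in> ?B" for u
    unfolding dual_norm_def by (rule cSUP_upper[OF that bdd])
  have z: "(\<lambda>t. 0 * v t) \<in> ?B" using E_scale[OF v, of 0] end_H_norm_scale[of 0 v] by simp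
  show "0 \<le> dual_norm \<alpha> T F" using order_trans[OF abs_ge_zero le[OF z]] .
  show "\<bar>F v\<bar> \<le> dual_norm \<alpha> T F * nE v"
  proof (cases "nE v = 0")
    case True then show ?thesis using K[OF v] by simp
  next
    case False
    then have p: "0 < nE v" using end_H_norm_nonneg[of v] by simp
    have "(\<lambda>t. (1 / nE v) * v t) \<in> ?B"
      using E_scale[OF v, of "1 / nE v"] p end_H_norm_scale[of "1 / nE v" v] by simp
    from le[OF this] have "\<bar>1 / nE v * F v\<bar> \<le> dual_norm \<alpha> T F" unfolding dual_scale[OF F v] .
    then show ?thesis using p by (simp add: abs_mult field_simps)
  qed
qed

lemma dual_J_linear:
  assumes F: "F \<in> D" and \<psi>: "sq_integrable I \<psi>" and \<phi>: "sq_integrable I \<phi>"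
  shows "F (J (\<lambda>t. \<psi> t + c * \<phi> t)) = F (J \<psi>) + c * F (J \<phi>)"
proof -
  obtain B where B: "\<And>\<psi>. sq_integrable I \<psi> \<Longrightarrow> J \<psi> \<in> E \<and> nE (J \<psi>) \<le> B * norm2 I \<psi>" using J_bounded by blast
  have e: "J \<psi> \<in> E" "J \<phi> \<in> E" "J (\<lambda>t. \<psi> t + c * \<phi> t) \<in> E"
    using B \<psi> \<phi> sq_integrable_add[OF \<psi> sq_integrable_scale[OF \<phi>]] by blast+
  have "F (J (\<lambda>t. \<psi> t + c * \<phi> t)) = F (\<lambda>t. J \<psi> t + c * J \<phi> t)"
    by (rule dual_cong[OF F e(3) E_add[OF e(1) E_scale[OF e(2)]] J_linear[OF \<psi> \<phi>]])
  then show ?thesis using dual_add[OF F e(1) E_scale[OF e(2)]] dual_scale[OF F e(2)] by simp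
qed

text \<open>
  The composition of \<open>F\<close> with \<open>J\<close> is a bounded functional, so \<open>L2_Riesz\<close> provides a function for the choice
  in the definition of \<open>J_dual\<close>.
\<close>

lemma J_dual_spec:
  assumes F: "F \<in> D"
  shows "sq_integrable I (J_dual \<alpha> T F)" "\<And>\<psi>. sq_integrable I \<psi> \<Longrightarrow> L2_inner T (J_dual \<alpha> T F) \<psi> = F (J \<psi>)"
proof -
  obtain B where B0: "0 \<le> B" and B: "\<And>\<psi>. sq_integrable I \<psi> \<Longrightarrow> J \<psi> \<in> E \<and> nE (J \<psi>) \<le> B * norm2 I \<psi>" using J_bounded by blast
  have bd: "\<bar>F (J \<psi>)\<bar> \<le> (dual_norm \<alpha> T F * B) * norm2 I \<psi>" if "sq_integrable I \<psi>" for \<psi>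
  proof -
    have "\<bar>F (J \<psi>)\<bar> \<le> dual_norm \<alpha> T F * nE (J \<psi>)" using dual_norm_bound(1)[OF F] B[OF that] by blast
    also have "\<dots> \<le> dual_norm \<alpha> T F * (B * norm2 I \<psi>)"
      using dual_norm_bound(2)[OF F] B[OF that] by (intro mult_left_mono) blast+
    finally show ?thesis by (simp add: mult.assoc)
  qed
  have sc: "F (J (\<lambda>x. c * f x)) = c * F (J f)" if "sq_integrable I f" for c f
    using dual_J_linear[OF F sq_integrable_scale[OF that, of 0] that, of c] dual_J_linear[OF F that that, of "-1"] by simp
  obtain g where g: "sq_integrable I g" "\<And>f. sq_integrable I f \<Longrightarrow> (LINT x|I. g x * f x) = F (J f)"
    by (rule L2_Riesz[of I "\<lambda>\<psi>. F (J \<psi>)" "dual_norm \<alpha> T F * B"])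
       (use dual_J_linear[OF F, of _ _ 1] sc bd in auto)
  then have "\<exists>g. g \<in> L2 T \<and> (\<forall>\<psi>\<in>L2 T. L2_inner T g \<psi> = F (J \<psi>))"
    by (intro exI[of _ g]) (auto simp: L2_sq_integrable L2_inner_def)
  from someI_ex[OF this]
  have "J_dual \<alpha> T F \<in> L2 T \<and> (\<forall>\<psi>\<in>L2 T. L2_inner T (J_dual \<alpha> T F) \<psi> = F (J \<psi>))" unfolding J_dual_def .
  then show "sq_integrable I (J_dual \<alpha> T F)" "\<And>\<psi>. sq_integrable I \<psi> \<Longrightarrow> L2_inner T (J_dual \<alpha> T F) \<psi> = F (J \<psi>)"
    by (auto simp: L2_sq_integrable)
qed

lemma J_dual_eq_iff:
  assumes F: "F \<in> D" and w: "sq_integrable I w"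
  shows "L2_eq T (J_dual \<alpha> T F) w \<longleftrightarrow> (\<forall>\<psi>. sq_integrable I \<psi> \<longrightarrow> F (J \<psi>) = L2_inner T w \<psi>)"
proof
  assume e: "L2_eq T (J_dual \<alpha> T F) w"
  show "\<forall>\<psi>. sq_integrable I \<psi> \<longrightarrow> F (J \<psi>) = L2_inner T w \<psi>"
  proof (intro allI impI)
    fix \<psi> assume \<psi>: "sq_integrable I \<psi>"
    have "F (J \<psi>) = L2_inner T (J_dual \<alpha> T F) \<psi>" using J_dual_spec(2)[OF F \<psi>] by simp
    also have "\<dots> = L2_inner T w \<psi>"
      unfolding L2_inner_def
    proof (rule integral_cong_AE)
      show "AE x in I. J_dual \<alpha> T F x * \<psi> x = w x * \<psi> x"
        using e unfolding L2_eq_def by eventually_elim simp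
    qed (use J_dual_spec(1)[OF F] w \<psi> in \<open>auto simp: sq_integrable_def\<close>)
    finally show "F (J \<psi>) = L2_inner T w \<psi>" .
  qed
next
  assume "\<forall>\<psi>. sq_integrable I \<psi> \<longrightarrow> F (J \<psi>) = L2_inner T w \<psi>"
  then show "L2_eq T (J_dual \<alpha> T F) w"
    unfolding L2_eq_def using J_dual_spec(2)[OF F]
    by (intro L2_eq_if_inner_eq J_dual_spec(1)[OF F] w) (simp add: L2_inner_def)
qed

text \<open>
  \<open>J\<close> is onto up to null sets, and functionals respect null sets; outside of \<open>end_H\<close> extensionality
  decides.
\<close>

lemma dual_unique:
  assumes F: "F \<in> D" and G: "G \<in> D" and e: "\<And>\<psi>. sq_integrable I \<psi> \<Longrightarrow> F (J \<psi>) = G (J \<psi>)"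
  shows "F = G"
proof (rule ext)
  fix v
  obtain C where C: "\<And>v. v \<in> E \<Longrightarrow> \<exists>\<psi>. sq_integrable I \<psi> \<and> (AE t in I. v t = J \<psi> t) \<and> norm2 I \<psi> \<le> C * nE v" using J_onto by blast
  obtain B where B: "\<And>\<psi>. sq_integrable I \<psi> \<Longrightarrow> J \<psi> \<in> E \<and> nE (J \<psi>) \<le> B * norm2 I \<psi>" using J_bounded by blast
  show "F v = G v"
  proof (cases "v \<in> E")
    case True
    obtain \<psi> where p: "sq_integrable I \<psi>" "AE t in I. v t = J \<psi> t" using C[OF True] by blast
    then show ?thesis using dual_cong[OF F True _ p(2)] dual_cong[OF G True _ p(2)] B[OF p(1)] e[OF p(1)] by simp
  next
    case False
    then show ?thesis using F G by (auto simp: dual_H_def extensional_def)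
  qed
qed

text \<open>
  The functional maps \<open>v\<close> to the inner product of \<open>w\<close> with the preimage of \<open>v\<close> under \<open>J\<close>. The preimage is unique
  by \<open>J_inj\<close>, hence depends linearly on \<open>v\<close>, and it is bounded by the norm of \<open>v\<close> by \<open>J_onto\<close>.
\<close>

lemma dual_of_L2:
  assumes w: "sq_integrable I w"
  shows "\<exists>F\<in>D. \<forall>\<psi>. sq_integrable I \<psi> \<longrightarrow> F (J \<psi>) = L2_inner T w \<psi>"
proof -
  obtain C where C0: "0 \<le> C" and C: "\<And>v. v \<in> E \<Longrightarrow> \<exists>\<psi>. sq_integrable I \<psi> \<and> (AE t in I. v t = J \<psi> t) \<and> norm2 I \<psi> \<le> C * nE v" using J_onto by blast
  obtain B where B: "\<And>\<psi>. sq_integrable I \<psi> \<Longrightarrow> J \<psi> \<in> E \<and> nE (J \<psi>) \<le> B * norm2 I \<psi>" using J_bounded by blast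
  define p where "p v = (SOME \<psi>. sq_integrable I \<psi> \<and> (AE t in I. v t = J \<psi> t) \<and> norm2 I \<psi> \<le> C * nE v)" for v
  have p: "sq_integrable I (p v)" "AE t in I. v t = J (p v) t" "norm2 I (p v) \<le> C * nE v" if "v \<in> E" for v
    using someI_ex[OF C[OF that]] unfolding p_def by blast+
  define F where "F = (\<lambda>v\<in>E. L2_inner T w (p v))"
  have inner_lin: "L2_inner T w (\<lambda>t. \<psi> t + c * \<phi> t) = L2_inner T w \<psi> + c * L2_inner T w \<phi>"
    if "sq_integrable I \<psi>" "sq_integrable I \<phi>" for c \<psi> \<phi>
  proof -
    have "L2_inner T w (\<lambda>t. \<psi> t + c * \<phi> t) = (LINT t|I. w t * \<psi> t + c * (w t * \<phi> t))"
      unfolding L2_inner_def by (simp add: distrib_left mult_ac)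
    then show ?thesis unfolding L2_inner_def
      using sq_integrable_mult_integrable[OF w that(1)] sq_integrable_mult_integrable[OF w that(2)] by simp
  qed
  have inner_cong: "L2_inner T w \<psi> = L2_inner T w \<phi>" if "sq_integrable I \<psi>" "sq_integrable I \<phi>" "AE t in I. \<psi> t = \<phi> t" for \<psi> \<phi>
    unfolding L2_inner_def
  proof (rule integral_cong_AE)
    show "AE t in I. w t * \<psi> t = w t * \<phi> t" using that(3) by eventually_elim simp
  qed (use w that in \<open>auto simp: sq_integrable_def\<close>)
  have Fv: "F v = L2_inner T w \<psi>" if v: "v \<in> E" and \<psi>: "sq_integrable I \<psi>" and e: "AE t in I. v t = J \<psi> t" for v \<psi>
  proof -
    have "AE t in I. J (p v) t = J \<psi> t" using e p(2)[OF v] by eventually_elim simp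
    then have "AE t in I. p v t = \<psi> t" by (rule J_inj[OF p(1)[OF v] \<psi>])
    then show ?thesis using v inner_cong[OF p(1)[OF v] \<psi>] by (simp add: F_def)
  qed
  have "F \<in> D"
    unfolding dual_H_def
  proof (intro CollectI conjI ballI allI)
    show "F \<in> extensional E" by (simp add: F_def)
    fix v w' assume v: "v \<in> E" and w': "w' \<in> E"
    have "AE t in I. v t + w' t = J (\<lambda>t. p v t + 1 * p w' t) t"
      using J_linear[OF p(1)[OF v] p(1)[OF w'], of 1] p(2)[OF v] p(2)[OF w'] by eventually_elim simp
    then have "F (\<lambda>t. v t + w' t) = L2_inner T w (\<lambda>t. p v t + 1 * p w' t)"
      by (intro Fv E_add v w' sq_integrable_add sq_integrable_scale p(1))
    also have "\<dots> = F v + F w'"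
      unfolding inner_lin[OF p(1)[OF v] p(1)[OF w']] using v w' by (simp add: F_def)
    finally show "F (\<lambda>t. v t + w' t) = F v + F w'" .
  next
    fix c v assume v: "v \<in> E"
    have "AE t in I. c * v t = J (\<lambda>t. p v t + (c - 1) * p v t) t"
      using J_linear[OF p(1)[OF v] p(1)[OF v], of "c - 1"] p(2)[OF v]
      by eventually_elim (simp add: algebra_simps)
    then have "F (\<lambda>t. c * v t) = L2_inner T w (\<lambda>t. p v t + (c - 1) * p v t)"
      by (intro Fv E_scale v sq_integrable_add sq_integrable_scale p(1))
    also have "\<dots> = c * F v"
      unfolding inner_lin[OF p(1)[OF v] p(1)[OF v]] using v by (simp add: F_def algebra_simps)
    finally show "F (\<lambda>t. c * v t) = c * F v" .
  next
    show "\<exists>K. \<forall>v\<in>E. \<bar>F v\<bar> \<le> K * nE v"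
    proof (intro exI ballI)
      fix v assume v: "v \<in> E"
      have "\<bar>F v\<bar> \<le> norm2 I w * norm2 I (p v)"
        using L2_Cauchy_Schwarz[OF w p(1)[OF v]] v by (simp add: F_def L2_inner_def)
      also have "\<dots> \<le> norm2 I w * (C * nE v)" by (intro mult_left_mono p(3)[OF v]) simp
      finally show "\<bar>F v\<bar> \<le> (norm2 I w * C) * nE v" by (simp add: mult.assoc)
    qed
  qed
  moreover have "F (J \<psi>) = L2_inner T w \<psi>" if "sq_integrable I \<psi>" for \<psi>
    using Fv[OF _ that] B[OF that] by simp
  ultimately show ?thesis by blast
qed

text \<open>
  The fractional derivative of \<open>w\<close> is the functional with the values \<open>L2_inner T w \<psi>\<close> at \<open>J \<psi>\<close>. Existence
  and uniqueness, as required by the definite description, are \<open>dual_of_L2\<close> and \<open>dual_unique\<close>.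
\<close>

lemma frac_deriv_eq_iff:
  assumes w: "sq_integrable I w" and G: "G \<in> D"
  shows "frac_deriv \<alpha> T w = G \<longleftrightarrow> (\<forall>\<psi>. sq_integrable I \<psi> \<longrightarrow> G (J \<psi>) = L2_inner T w \<psi>)"
proof -
  obtain F where F: "F \<in> D" "\<And>\<psi>. sq_integrable I \<psi> \<Longrightarrow> F (J \<psi>) = L2_inner T w \<psi>" using dual_of_L2[OF w] by blast
  have "frac_deriv \<alpha> T w = F"
    unfolding frac_deriv_def
  proof (rule the_equality)
    show "F \<in> D \<and> L2_eq T (J_dual \<alpha> T F) w" using F J_dual_eq_iff[OF F(1) w] by blast
    fix H assume "H \<in> D \<and> L2_eq T (J_dual \<alpha> T H) w"
    then show "H = F" using F J_dual_eq_iff[of H, OF _ w] by (intro dual_unique) auto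
  qed
  then show ?thesis using F dual_unique[OF F(1) G] by auto
qed

section \<open>Well-posedness of the initial value problem\<close>

lemma const_sq_integrable: "sq_integrable I (\<lambda>t. c)"
proof -
  have "integrable I (\<lambda>t. c\<^sup>2)" by (intro finite_measure.integrable_const finite_measure_lebesgue_on) auto
  then show ?thesis by (simp add: sq_integrable_def)
qed

text \<open>
  The equation tested with \<open>J \<psi>\<close>, with \<open>u = (u - a) + a\<close> on its right-hand side: all terms with the unknown
  \<open>u - a\<close> are collected in the inner product with \<open>\<psi> + lam * J \<psi>\<close>.
\<close>

lemma is_solution_iff:
  assumes f: "f \<in> D"
  shows "is_solution \<alpha> T lam a f u \<longleftrightarrow> sq_integrable I (\<lambda>t. u t - a) \<and>
    (\<forall>\<psi>. sq_integrable I \<psi> \<longrightarrow> L2_inner T (\<lambda>t. u t - a) (\<lambda>t. \<psi> t + lam * J \<psi> t) = f (J \<psi>) - lam * a * (LINT t|I. J \<psi> t))"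
proof (cases "sq_integrable I (\<lambda>t. u t - a)")
  case w: True
  obtain B where B: "\<And>\<psi>. sq_integrable I \<psi> \<Longrightarrow> J \<psi> \<in> E \<and> nE (J \<psi>) \<le> B * norm2 I \<psi>" using J_bounded by blast
  have u: "sq_integrable I u" using sq_integrable_add[OF w const_sq_integrable[of a]] by simp
  let ?R = "\<lambda>v\<in>E. - lam * L2_embed \<alpha> T u v + f v"
  have Rv: "?R v = - lam * L2_inner T u v + f v" if "v \<in> E" for v using that by (simp add: L2_embed_def)
  have add: "L2_inner T u (\<lambda>t. v t + w t) = L2_inner T u v + L2_inner T u w" if "v \<in> E" "w \<in> E" for v w
    unfolding L2_inner_def using sq_integrable_mult_integrable[OF u end_H_L2] that by (simp add: distrib_left)
  have scale: "L2_inner T u (\<lambda>t. c * v t) = c * L2_inner T u v" for c v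
    unfolding L2_inner_def by (subst integral_mult_right_zero[symmetric]) (simp add: mult_ac)
  \<comment> \<open>The right-hand side of the equation belongs to the dual space, so \<open>frac_deriv_eq_iff\<close> applies to it.\<close>
  have R: "?R \<in> D"
    unfolding dual_H_def
  proof (intro CollectI conjI ballI allI)
    show "?R \<in> extensional E" by simp
    fix v w assume v: "v \<in> E" and w: "w \<in> E"
    show "?R (\<lambda>t. v t + w t) = ?R v + ?R w"
      unfolding Rv[OF v] Rv[OF w] Rv[OF E_add[OF v w]] add[OF v w] dual_add[OF f v w] by (simp add: algebra_simps)
  next
    fix c v assume v: "v \<in> E"
    show "?R (\<lambda>t. c * v t) = c * ?R v"
      unfolding Rv[OF v] Rv[OF E_scale[OF v]] scale dual_scale[OF f v] by (simp add: algebra_simps)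
  next
    show "\<exists>K. \<forall>v\<in>E. \<bar>?R v\<bar> \<le> K * nE v"
    proof (intro exI ballI)
      fix v assume v: "v \<in> E"
      have "\<bar>L2_inner T u v\<bar> \<le> norm2 I u * norm2 I v" unfolding L2_inner_def by (rule L2_Cauchy_Schwarz[OF u end_H_L2[OF v]])
      also have "\<dots> \<le> norm2 I u * nE v" by (intro mult_left_mono norm2_le_nE) simp
      finally have "\<bar>lam\<bar> * \<bar>L2_inner T u v\<bar> \<le> \<bar>lam\<bar> * (norm2 I u * nE v)" by (intro mult_left_mono) auto
      moreover have "\<bar>?R v\<bar> \<le> \<bar>lam\<bar> * \<bar>L2_inner T u v\<bar> + \<bar>f v\<bar>"
        unfolding Rv[OF v] using abs_triangle_ineq[of "- lam * L2_inner T u v" "f v"] by (simp add: abs_mult)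
      ultimately show "\<bar>?R v\<bar> \<le> (\<bar>lam\<bar> * norm2 I u + dual_norm \<alpha> T f) * nE v"
        using dual_norm_bound(1)[OF f v] by (simp add: distrib_right mult.assoc)
    qed
  qed
  have key: "?R (J \<psi>) = L2_inner T (\<lambda>t. u t - a) \<psi> \<longleftrightarrow>
      L2_inner T (\<lambda>t. u t - a) (\<lambda>t. \<psi> t + lam * J \<psi> t) = f (J \<psi>) - lam * a * (LINT t|I. J \<psi> t)"
    if \<psi>: "sq_integrable I \<psi>" for \<psi>
  proof -
    have e: "J \<psi> \<in> E" using B[OF \<psi>] by blast
    have s: "sq_integrable I (J \<psi>)" by (rule end_H_L2[OF e])
    have i: "integrable I (\<lambda>t. (u t - a) * \<psi> t)" "integrable I (\<lambda>t. (u t - a) * J \<psi> t)" "integrable I (\<lambda>t. u t * J \<psi> t)"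
      using sq_integrable_mult_integrable[OF w \<psi>] sq_integrable_mult_integrable[OF w s] sq_integrable_mult_integrable[OF u s] by auto
    have i1: "integrable I (J \<psi>)" using sq_integrable_mult_integrable[OF const_sq_integrable[of 1] s] by simp
    have "L2_inner T (\<lambda>t. u t - a) (\<lambda>t. \<psi> t + lam * J \<psi> t)
        = (LINT t|I. (u t - a) * \<psi> t + lam * (u t * J \<psi> t) - lam * a * J \<psi> t)"
      unfolding L2_inner_def by (intro Bochner_Integration.integral_cong) (auto simp: algebra_simps)
    also have "\<dots> = L2_inner T (\<lambda>t. u t - a) \<psi> + lam * L2_inner T u (J \<psi>) - lam * a * (LINT t|I. J \<psi> t)"
      unfolding L2_inner_def using i i1 by simp
    finally show ?thesis unfolding Rv[OF e] by auto
  qed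
  have "is_solution \<alpha> T lam a f u \<longleftrightarrow> frac_deriv \<alpha> T (\<lambda>t. u t - a) = ?R"
    using w by (simp add: is_solution_def L2_sq_integrable)
  also have "\<dots> \<longleftrightarrow> (\<forall>\<psi>. sq_integrable I \<psi> \<longrightarrow> ?R (J \<psi>) = L2_inner T (\<lambda>t. u t - a) \<psi>)"
    by (rule frac_deriv_eq_iff[OF w R])
  finally show ?thesis using w key by blast
qed (simp add: is_solution_def L2_sq_integrable)

text \<open>
  Every square integrable \<open>x\<close> is \<open>\<psi> + lam * J \<psi>\<close> for exactly one \<open>\<psi> = p x\<close>, of norm at most a multiple of that
  of \<open>x\<close>. So \<open>is_solution_iff\<close> prescribes the inner product of \<open>u - a\<close> with every \<open>x\<close>, as a bounded linear
  functional of \<open>x\<close>, and \<open>L2_Riesz\<close> yields the solution.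
\<close>

lemma solvability:
  obtains C where "0 < C"
    "\<And>a f. f \<in> D \<Longrightarrow> \<exists>u. is_solution \<alpha> T lam a f u"
    "\<And>a f u w. f \<in> D \<Longrightarrow> is_solution \<alpha> T lam a f u \<Longrightarrow> is_solution \<alpha> T lam a f w \<Longrightarrow> L2_eq T w u"
    "\<And>a f u. f \<in> D \<Longrightarrow> is_solution \<alpha> T lam a f u \<Longrightarrow> L2_norm T (\<lambda>t. u t - a) \<le> C * (\<bar>a\<bar> + dual_norm \<alpha> T f)"
proof -
  obtain B where B0: "0 \<le> B" and B: "\<And>\<psi>. sq_integrable I \<psi> \<Longrightarrow> J \<psi> \<in> E \<and> nE (J \<psi>) \<le> B * norm2 I \<psi>" using J_bounded by blast
  obtain V where V0: "0 \<le> V"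
    and Vex: "\<And>x. sq_integrable I x \<Longrightarrow> \<exists>\<psi>. sq_integrable I \<psi> \<and> (AE t in I. \<psi> t + lam * J \<psi> t = x t)"
    and Vb: "\<And>x \<psi>. sq_integrable I x \<Longrightarrow> sq_integrable I \<psi> \<Longrightarrow> (AE t in I. \<psi> t + lam * J \<psi> t = x t) \<Longrightarrow> norm2 I \<psi> \<le> V * norm2 I x"
    using J_Volterra[of lam] by blast
  define p where "p x = (SOME \<psi>. sq_integrable I \<psi> \<and> (AE t in I. \<psi> t + lam * J \<psi> t = x t))" for x
  have p: "sq_integrable I (p x)" "AE t in I. p x t + lam * J (p x) t = x t" if "sq_integrable I x" for x
    using someI_ex[OF Vex[OF that]] unfolding p_def by blast+
  have zero: "AE t in I. d t = 0" if d: "sq_integrable I d" and e: "AE t in I. d t + lam * J d t = 0" for d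
  proof -
    have "norm2 I d \<le> V * norm2 I (\<lambda>t. 0)" by (rule Vb[OF sq_integrable_zero d e])
    then have "norm2 I d \<le> 0" by (simp only: norm2_zero mult_zero_right)
    then have "norm2 I d = 0" using norm2_nonneg by (rule antisym)
    then show ?thesis using norm2_eq_0_iff[OF d] by simp
  qed
  define k where "k = norm2 I (\<lambda>t. 1)"
  have k0: "0 \<le> k" by (simp add: k_def)
  let ?l = "\<lambda>a f \<psi>. f (J \<psi>) - lam * a * (LINT t|I. J \<psi> t)"
  \<comment> \<open>The summand \<open>1\<close> makes the constant positive.\<close>
  define M where "M = V * (B * (1 + \<bar>lam\<bar> * k)) + 1"
  have M: "0 < M" using V0 B0 k0 by (simp add: M_def add_nonneg_pos)
  have JS: "sq_integrable I (J \<psi>)" if "sq_integrable I \<psi>" for \<psi> using B[OF that] end_H_L2 by blast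
  have JI: "integrable I (J \<psi>)" if "sq_integrable I \<psi>" for \<psi>
    using sq_integrable_mult_integrable[OF const_sq_integrable[of 1] JS[OF that]] by simp
  have lin: "?l a f (\<lambda>t. \<psi> t + c * \<phi> t) = ?l a f \<psi> + c * ?l a f \<phi>"
    if "f \<in> D" "sq_integrable I \<psi>" "sq_integrable I \<phi>" for a f c \<psi> \<phi>
  proof -
    have "(LINT t|I. J (\<lambda>t. \<psi> t + c * \<phi> t) t) = (LINT t|I. J \<psi> t + c * J \<phi> t)"
      using J_linear[OF that(2,3), of c] J_measurable[OF that(2)] J_measurable[OF that(3)]
        J_measurable[OF sq_integrable_add[OF that(2) sq_integrable_scale[OF that(3)], of c]]
      by (intro integral_cong_AE) auto
    also have "\<dots> = (LINT t|I. J \<psi> t) + c * (LINT t|I. J \<phi> t)" using JI that by simp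
    finally show ?thesis unfolding dual_J_linear[OF that] by (simp add: algebra_simps)
  qed
  have cong: "?l a f \<psi> = ?l a f \<phi>" if f: "f \<in> D" and \<psi>: "sq_integrable I \<psi>" and \<phi>: "sq_integrable I \<phi>" and e: "AE t in I. \<psi> t = \<phi> t" for a f \<psi> \<phi>
  proof -
    note j = J_cong_AE[OF \<psi> \<phi> e]
    have "f (J \<psi>) = f (J \<phi>)" using dual_cong[OF f _ _ j] B \<psi> \<phi> by blast
    moreover have "(LINT t|I. J \<psi> t) = (LINT t|I. J \<phi> t)"
      by (rule integral_cong_AE[OF J_measurable[OF \<psi>] J_measurable[OF \<phi>] j])
    ultimately show ?thesis by simp
  qed
  have lb: "\<bar>?l a f \<psi>\<bar> \<le> (B * (1 + \<bar>lam\<bar> * k) * (\<bar>a\<bar> + dual_norm \<alpha> T f)) * norm2 I \<psi>"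
    if f: "f \<in> D" and \<psi>: "sq_integrable I \<psi>" for a f \<psi>
  proof -
    have e: "J \<psi> \<in> E" "nE (J \<psi>) \<le> B * norm2 I \<psi>" using B[OF \<psi>] by auto
    note dn = dual_norm_bound[OF f e(1)]
    have "\<bar>f (J \<psi>)\<bar> \<le> dual_norm \<alpha> T f * (B * norm2 I \<psi>)"
      using dn(1) mult_left_mono[OF e(2) dn(2)] by linarith
    moreover have "\<bar>LINT t|I. J \<psi> t\<bar> \<le> k * (B * norm2 I \<psi>)"
    proof -
      have "\<bar>LINT t|I. J \<psi> t\<bar> \<le> k * norm2 I (J \<psi>)"
        using L2_Cauchy_Schwarz[OF const_sq_integrable[of 1] JS[OF \<psi>]] by (simp add: k_def)
      also have "\<dots> \<le> k * (B * norm2 I \<psi>)"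
        using order_trans[OF norm2_le_nE e(2)] k0 by (rule mult_left_mono)
      finally show ?thesis .
    qed
    then have "\<bar>lam * a\<bar> * \<bar>LINT t|I. J \<psi> t\<bar> \<le> \<bar>lam * a\<bar> * (k * (B * norm2 I \<psi>))" by (intro mult_left_mono) auto
    moreover have "\<bar>?l a f \<psi>\<bar> \<le> \<bar>f (J \<psi>)\<bar> + \<bar>lam * a\<bar> * \<bar>LINT t|I. J \<psi> t\<bar>"
      using abs_triangle_ineq4[of "f (J \<psi>)" "lam * a * (LINT t|I. J \<psi> t)"] by (simp add: abs_mult)
    ultimately have "\<bar>?l a f \<psi>\<bar> \<le> dual_norm \<alpha> T f * (B * norm2 I \<psi>) + \<bar>lam * a\<bar> * (k * (B * norm2 I \<psi>))" by linarith
    also have "\<dots> = (dual_norm \<alpha> T f + \<bar>lam\<bar> * k * \<bar>a\<bar>) * (B * norm2 I \<psi>)"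
      by (simp add: abs_mult algebra_simps)
    also have "\<dots> \<le> ((1 + \<bar>lam\<bar> * k) * (\<bar>a\<bar> + dual_norm \<alpha> T f)) * (B * norm2 I \<psi>)"
    proof (rule mult_right_mono)
      have "0 \<le> \<bar>lam\<bar> * k * dual_norm \<alpha> T f" using k0 dn(2) by simp
      then show "dual_norm \<alpha> T f + \<bar>lam\<bar> * k * \<bar>a\<bar> \<le> (1 + \<bar>lam\<bar> * k) * (\<bar>a\<bar> + dual_norm \<alpha> T f)"
        by (simp add: algebra_simps)
    qed (use B0 in simp)
    finally show ?thesis by (simp add: mult_ac)
  qed
  have val: "L2_inner T (\<lambda>t. u t - a) x = ?l a f (p x)"
    if f: "f \<in> D" and s: "is_solution \<alpha> T lam a f u" and x: "sq_integrable I x" for a f u x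
  proof -
    have w: "sq_integrable I (\<lambda>t. u t - a)" using s by (simp add: is_solution_iff[OF f])
    have "L2_inner T (\<lambda>t. u t - a) x = L2_inner T (\<lambda>t. u t - a) (\<lambda>t. p x t + lam * J (p x) t)"
      unfolding L2_inner_def
    proof (rule integral_cong_AE)
      show "AE t in I. (u t - a) * x t = (u t - a) * (p x t + lam * J (p x) t)"
        using p(2)[OF x] by eventually_elim simp
      have "sq_integrable I (\<lambda>t. p x t + lam * J (p x) t)" by (intro sq_integrable_add sq_integrable_scale JS p(1) x)
      then show "(\<lambda>t. (u t - a) * (p x t + lam * J (p x) t)) \<in> borel_measurable I"
        using w by (auto simp: sq_integrable_def)
    qed (use w x in \<open>auto simp: sq_integrable_def\<close>)
    also have "\<dots> = ?l a f (p x)" using s p(1)[OF x] by (simp add: is_solution_iff[OF f])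
    finally show ?thesis .
  qed
  have plin: "AE t in I. p (\<lambda>t. x t + c * y t) t = p x t + c * p y t" if x: "sq_integrable I x" and y: "sq_integrable I y" for x y c
  proof -
    let ?z = "\<lambda>t. x t + c * y t"
    have z: "sq_integrable I ?z" by (intro sq_integrable_add sq_integrable_scale x y)
    let ?q = "\<lambda>t. p x t + c * p y t"
    have q: "sq_integrable I ?q" by (intro sq_integrable_add sq_integrable_scale p(1) x y)
    let ?d = "\<lambda>t. p ?z t + (-1) * ?q t"
    have d: "sq_integrable I ?d" by (intro sq_integrable_add sq_integrable_scale p(1) z q)
    have "AE t in I. ?d t + lam * J ?d t = 0"
      using p(2)[OF x] p(2)[OF y] p(2)[OF z] J_linear[OF p(1)[OF z] q, of "-1"] J_linear[OF p(1)[OF x] p(1)[OF y], of c]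
    proof eventually_elim
      case (elim t)
      have "?d t + lam * J ?d t = (p ?z t + lam * J (p ?z) t) - (p x t + lam * J (p x) t) - c * (p y t + lam * J (p y) t)"
        unfolding elim(4,5) by (simp add: algebra_simps)
      then show ?case unfolding elim(1-3) by simp
    qed
    then have "AE t in I. ?d t = 0" by (rule zero[OF d])
    then show ?thesis by eventually_elim simp
  qed
  have bound: "norm2 I (\<lambda>t. u t - a) \<le> M * (\<bar>a\<bar> + dual_norm \<alpha> T f)"
    if f: "f \<in> D" and s: "is_solution \<alpha> T lam a f u" for a f u
  proof -
    let ?w = "\<lambda>t. u t - a"
    let ?c = "\<bar>a\<bar> + dual_norm \<alpha> T f"
    have w: "sq_integrable I ?w" using s by (simp add: is_solution_iff[OF f])
    have e0: "(\<lambda>t. 0 * ?w t) \<in> E"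
    proof -
      have "J (\<lambda>t. 0) \<in> E" using B[of "\<lambda>t. 0"] by simp
      from E_scale[OF this, of 0] show ?thesis by simp
    qed
    have c0: "0 \<le> ?c" using dual_norm_bound(2)[OF f e0] by simp
    have "(norm2 I ?w)\<^sup>2 = L2_inner T ?w ?w" unfolding norm2_power2 L2_inner_def by (simp add: power2_eq_square)
    also have "\<dots> = ?l a f (p ?w)" by (rule val[OF f s w])
    also have "\<dots> \<le> (B * (1 + \<bar>lam\<bar> * k) * ?c) * norm2 I (p ?w)" using lb[OF f p(1)[OF w], of a] by linarith
    also have "\<dots> \<le> (B * (1 + \<bar>lam\<bar> * k) * ?c) * (V * norm2 I ?w)"
      using B0 k0 c0 by (intro mult_left_mono Vb w p) auto
    also have "\<dots> = (V * (B * (1 + \<bar>lam\<bar> * k))) * ?c * norm2 I ?w" by (simp add: mult_ac)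
    also have "\<dots> \<le> M * ?c * norm2 I ?w"
      using c0 by (intro mult_right_mono) (auto simp: M_def)
    finally have "norm2 I ?w * norm2 I ?w \<le> (M * ?c) * norm2 I ?w" by (simp add: power2_eq_square)
    then show ?thesis
    proof (cases "norm2 I ?w = 0")
      case True then show ?thesis using M c0 by simp
    next
      case False
      then have "0 < norm2 I ?w" using norm2_nonneg[of I ?w] by linarith
      then show ?thesis using \<open>norm2 I ?w * norm2 I ?w \<le> (M * ?c) * norm2 I ?w\<close> by (simp only: mult_le_cancel_right_pos)
    qed
  qed
  have ex: "\<exists>u. is_solution \<alpha> T lam a f u" if f: "f \<in> D" for a f
  proof -
    let ?L = "\<lambda>x. ?l a f (p x)"
    let ?K = "(B * (1 + \<bar>lam\<bar> * k) * (\<bar>a\<bar> + dual_norm \<alpha> T f)) * V"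
    have Llin: "?L (\<lambda>t. x t + c * y t) = ?L x + c * ?L y" if x: "sq_integrable I x" and y: "sq_integrable I y" for x y c
    proof -
      have "?L (\<lambda>t. x t + c * y t) = ?l a f (\<lambda>t. p x t + c * p y t)"
        by (rule cong[OF f _ _ plin[OF x y]]) (intro p(1) sq_integrable_add sq_integrable_scale x y)+
      also have "\<dots> = ?L x + c * ?L y" by (rule lin[OF f p(1)[OF x] p(1)[OF y]])
      finally show ?thesis .
    qed
    have e0: "J (\<lambda>t. 0) \<in> E" using B[of "\<lambda>t. 0"] by simp
    have Lb: "\<bar>?L x\<bar> \<le> ?K * norm2 I x" if x: "sq_integrable I x" for x
    proof -
      have "\<bar>?L x\<bar> \<le> (B * (1 + \<bar>lam\<bar> * k) * (\<bar>a\<bar> + dual_norm \<alpha> T f)) * norm2 I (p x)" by (rule lb[OF f p(1)[OF x]])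
      also have "\<dots> \<le> (B * (1 + \<bar>lam\<bar> * k) * (\<bar>a\<bar> + dual_norm \<alpha> T f)) * (V * norm2 I x)"
        using B0 k0 dual_norm_bound(2)[OF f e0] by (intro mult_left_mono Vb x p) auto
      finally show ?thesis by (simp add: mult.assoc)
    qed
    have Lsc: "?L (\<lambda>t. c * x t) = c * ?L x" if x: "sq_integrable I x" for x c
    proof -
      have "?L (\<lambda>t. c * x t) = ?L (\<lambda>t. x t + (c - 1) * x t)" by (simp add: algebra_simps)
      also have "\<dots> = ?L x + (c - 1) * ?L x" by (rule Llin[OF x x])
      finally show ?thesis by (simp add: algebra_simps)
    qed
    obtain w where w: "sq_integrable I w" and rep: "\<And>x. sq_integrable I x \<Longrightarrow> (LINT t|I. w t * x t) = ?L x"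
    proof (rule L2_Riesz[of I ?L ?K])
      fix g h assume "sq_integrable I g" "sq_integrable I h"
      then show "?L (\<lambda>x. g x + h x) = ?L g + ?L h" using Llin[of g h 1] by simp
    qed (use Lsc Lb in auto)
    have "is_solution \<alpha> T lam a f (\<lambda>t. w t + a)"
      unfolding is_solution_iff[OF f]
    proof (intro conjI allI impI)
      show "sq_integrable I (\<lambda>t. w t + a - a)" using w by simp
      fix \<psi> assume \<psi>: "sq_integrable I \<psi>"
      let ?x = "\<lambda>t. \<psi> t + lam * J \<psi> t"
      have x: "sq_integrable I ?x" by (intro sq_integrable_add sq_integrable_scale JS \<psi>)
      let ?d = "\<lambda>t. p ?x t + (-1) * \<psi> t"
      have d: "sq_integrable I ?d" by (intro sq_integrable_add sq_integrable_scale p(1) x \<psi>)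
      have "AE t in I. ?d t + lam * J ?d t = 0"
        using p(2)[OF x] J_linear[OF p(1)[OF x] \<psi>, of "-1"]
      proof eventually_elim
        case (elim t)
        have "?d t + lam * J ?d t = (p ?x t + lam * J (p ?x) t) - ?x t" unfolding elim(2) by (simp add: algebra_simps)
        then show ?case unfolding elim(1) by simp
      qed
      then have "AE t in I. ?d t = 0" by (rule zero[OF d])
      then have "AE t in I. p ?x t = \<psi> t" by eventually_elim simp
      then have "?L ?x = ?l a f \<psi>" by (rule cong[OF f p(1)[OF x] \<psi>])
      then show "L2_inner T (\<lambda>t. w t + a - a) ?x = ?l a f \<psi>"
        using rep[OF x] by (simp add: L2_inner_def)
    qed
    then show ?thesis by blast
  qed
  have uniq: "L2_eq T w u" if f: "f \<in> D" and s: "is_solution \<alpha> T lam a f u" "is_solution \<alpha> T lam a f w" for a f u w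
  proof -
    have "sq_integrable I (\<lambda>t. w t - a)" "sq_integrable I (\<lambda>t. u t - a)" using s by (auto simp: is_solution_iff[OF f])
    moreover have "(LINT t|I. (w t - a) * x t) = (LINT t|I. (u t - a) * x t)" if "sq_integrable I x" for x
      using val[OF f s(1) that] val[OF f s(2) that] by (simp add: L2_inner_def)
    ultimately have "AE t in I. w t - a = u t - a" by (rule L2_eq_if_inner_eq)
    then show ?thesis unfolding L2_eq_def by eventually_elim simp
  qed
  show ?thesis using that[OF M ex uniq] bound by (simp add: L2_norm_norm2)
qed

end

theorem theorem5p2:
  fixes T \<alpha> lam :: real
  assumes "0 < T" and "0 < \<alpha>" and "\<alpha> < 1"
  shows "(\<forall>a. \<forall>f\<in>dual_H \<alpha> T.
            \<exists>u. is_solution \<alpha> T lam a f u \<and>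
                (\<forall>w. is_solution \<alpha> T lam a f w \<longrightarrow> L2_eq T w u)) \<and>
         (\<exists>C>0. \<forall>a. \<forall>f\<in>dual_H \<alpha> T. \<forall>u. is_solution \<alpha> T lam a f u \<longrightarrow>
            L2_norm T (\<lambda>t. u t - a) \<le> C * (\<bar>a\<bar> + dual_norm \<alpha> T f))"
proof -
  interpret frac_interval \<alpha> T using assms by unfold_locales
  obtain C where "0 < C"
    "\<And>a f. f \<in> dual_H \<alpha> T \<Longrightarrow> \<exists>u. is_solution \<alpha> T lam a f u"
    "\<And>a f u w. f \<in> dual_H \<alpha> T \<Longrightarrow> is_solution \<alpha> T lam a f u \<Longrightarrow> is_solution \<alpha> T lam a f w \<Longrightarrow> L2_eq T w u"
    "\<And>a f u. f \<in> dual_H \<alpha> T \<Longrightarrow> is_solution \<alpha> T lam a f u \<Longrightarrow> L2_norm T (\<lambda>t. u t - a) \<le> C * (\<bar>a\<bar> + dual_norm \<alpha> T f)"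
    using solvability[of lam] by blast
  then show ?thesis by blast
qed

end
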